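(* Let $K$ be a CM number field of unit rank at least $3$. Then $\operatorname{Spec}(\overline K)=\operatorname{Spec}(K)$. Moreover, $\operatorname{Spec}(K)$ is a countable subset of $\mathbb Q$ and can be decomposed as a disjoint union $\{0\}\sqcup\bigl(\bigsqcup_{n=1}^\infty S_n\bigr)$, where: (1) For all $n\ge1$, $S_n$ can be written as $\{\nu_n,\mu_{n,1},\mu_{n,2},\dots\}$ such that - $\mu_{n,1}>\mu_{n,2}>\cdots$, - $\lim_{k\to\infty}\mu_{n,k}=\nu_n$, - $\lim_{n\to\infty}\nu_n=0$, - $\nu_n>\mu_{n+1,1}$. (2) For each $\mu_{n,k}$, the set $\{z\in\overline K/\mathcal O_K: m_{\overline K/\mathcal O_K}(z)=\mu_{n,k}\}$ is a finite subset of rational points. For each $\nu_n$, the set $\{z\in K/\mathcal O_K: m_{\overline K/\mathcal O_K}(z)=\nu_n\}$ is finite and non-empty, and the set $\{z\in\overline K/\mathcal O_K: z\text{ is irrational},\ m_{\overline K/\mathcal O_K}(z)=\nu_n\}$ is the set of all irrational points in a certain finite union of $s$-dimensional affine subtori of $\overline K/\mathcal O_K$, where $s=\frac12\deg K$.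
   Context: A number field $K$ is CM if it is a totally complex quadratic extension of a totally real number field. $\mathcal O_K$ is the ring of integers, and the unit rank is the rank of $\mathcal O_K^*$. Since $K$ is CM it has no real embeddings; let $\sigma_1,\dots,\sigma_s$ be representatives of its $s=\frac12\deg K$ pairs of conjugate complex embeddings. Put $\overline K=K\otimes_{\mathbb Q}\mathbb R$, identified with $\mathbb C^s$ via $\theta\otimes t\mapsto(t\sigma_i(\theta))_{i}$; $K\subset\overline K$ via $x\mapsto x\otimes1$. $N_{\overline K}(x)=\prod_{i=1}^s|x_i|^2$, which extends the field norm of $K$. $\mathcal O_K$ is a cocompact lattice in $\overline K$, so $\overline K/\mathcal O_K$ is a torus of dimension $2s$. For $z\in\overline K/\mathcal O_K$ let $m_{\overline K/\mathcal O_K}(z)=\inf|N_{\overline K}(x)|$, the infimum being over all $x\in\overline K$ projecting to $z$. The inhomogeneous and Euclidean spectra are $\operatorname{Spec}(\overline K)=\{m_{\overline K/\mathcal O_K}(z):z\in\overline K/\mathcal O_K\}$ and $\operatorname{Spec}(K)=\{m_{\overline K/\mathcal O_K}(z):z\in K/\mathcal O_K\}$. A point of $\overline K/\mathcal O_K$ is rational if it lies in $K/\mathcal O_K$ (equivalently, is a torsion point), and irrational otherwise. An affine subtorus is a translate of a subtorus. *)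

theory Defs
  imports "HOL-Analysis.Analysis"
begin

text \<open>
  Number fields are subfields of an arbitrary ambient field of characteristic zero, so that
  a field and its subfields can be treated uniformly.
\<close>

definition subfield_set :: "'a::field_char_0 set \<Rightarrow> bool" where
  "subfield_set K \<longleftrightarrow> 1 \<in> K \<and> (\<forall>x\<in>K. \<forall>y\<in>K. x - y \<in> K \<and> x * y \<in> K) \<and> (\<forall>x\<in>K. inverse x \<in> K)"

definition field_basis :: "'a::field_char_0 set \<Rightarrow> 'a set \<Rightarrow> 'a set \<Rightarrow> bool" where
  "field_basis F K B \<longleftrightarrow> finite B \<and> B \<subseteq> K \<and>
     (\<forall>x\<in>K. \<exists>!c. c \<in> B \<rightarrow>\<^sub>E F \<and> x = (\<Sum>b\<in>B. c b * b))"

text \<open>The degree \<open>[K : F]\<close>; only meaningful if \<open>F \<subseteq> K\<close> is a finite extension.\<close>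

definition field_degree :: "'a::field_char_0 set \<Rightarrow> 'a set \<Rightarrow> nat" where
  "field_degree F K = (THE n. \<exists>B. field_basis F K B \<and> card B = n)"

definition number_field :: "'a::field_char_0 set \<Rightarrow> bool" where
  "number_field K \<longleftrightarrow> subfield_set K \<and> (\<exists>B. field_basis \<rat> K B)"

text \<open>Complex embeddings; only the values on \<open>K\<close> matter.\<close>

definition complex_embedding :: "'a::field_char_0 set \<Rightarrow> ('a \<Rightarrow> complex) \<Rightarrow> bool" where
  "complex_embedding K \<tau> \<longleftrightarrow> \<tau> 1 = 1 \<and>
     (\<forall>x\<in>K. \<forall>y\<in>K. \<tau> (x + y) = \<tau> x + \<tau> y \<and> \<tau> (x * y) = \<tau> x * \<tau> y)"

definition totally_real :: "'a::field_char_0 set \<Rightarrow> bool" where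
  "totally_real K \<longleftrightarrow> (\<forall>\<tau>. complex_embedding K \<tau> \<longrightarrow> \<tau> ` K \<subseteq> \<real>)"

definition totally_complex :: "'a::field_char_0 set \<Rightarrow> bool" where
  "totally_complex K \<longleftrightarrow> (\<forall>\<tau>. complex_embedding K \<tau> \<longrightarrow> \<not> \<tau> ` K \<subseteq> \<real>)"

definition CM_field :: "'a::field_char_0 set \<Rightarrow> bool" where
  "CM_field K \<longleftrightarrow> number_field K \<and> totally_complex K \<and>
     (\<exists>F. number_field F \<and> totally_real F \<and> F \<subseteq> K \<and> (\<exists>B. field_basis F K B \<and> card B = 2))"

definition ring_of_integers :: "'a::field_char_0 set \<Rightarrow> 'a set" where
  "ring_of_integers K = {x \<in> K. algebraic_int x}"

definition integer_units :: "'a::field_char_0 set \<Rightarrow> 'a set" where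
  "integer_units K = {u \<in> ring_of_integers K. \<exists>v \<in> ring_of_integers K. u * v = 1}"

definition mult_independent :: "'a::field_char_0 set \<Rightarrow> bool" where
  "mult_independent B \<longleftrightarrow>
     (\<forall>e :: 'a \<Rightarrow> int. (\<Prod>b\<in>B. b powi e b) = 1 \<longrightarrow> (\<forall>b\<in>B. e b = 0))"

text \<open>
  The rank of the abelian group of units, as the largest size of an independent set.
  The values are extended naturals so that the supremum is never a junk value.
\<close>

definition unit_rank :: "'a::field_char_0 set \<Rightarrow> enat" where
  "unit_rank K = (SUP B \<in> {B. finite B \<and> B \<subseteq> integer_units K \<and> mult_independent B}. enat (card B))"

text \<open>
  \<open>\<sigma>\<close> picks exactly one embedding out of each pair of conjugate complex embeddings. For a
  totally complex \<open>K\<close> this forces \<open>CARD('s) = s\<close>, half the degree of \<open>K\<close>, and the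
  algebra obtained from \<open>K\<close> by extending scalars to the reals is \<open>complex ^ 's\<close>.
\<close>

definition embedding_representatives ::
    "'a::field_char_0 set \<Rightarrow> ('s::finite \<Rightarrow> 'a \<Rightarrow> complex) \<Rightarrow> bool" where
  "embedding_representatives K \<sigma> \<longleftrightarrow> (\<forall>i. complex_embedding K (\<sigma> i)) \<and>
     (\<forall>\<tau>. complex_embedding K \<tau> \<longrightarrow>
        (\<exists>!i. (\<forall>x\<in>K. \<tau> x = \<sigma> i x) \<or> (\<forall>x\<in>K. \<tau> x = cnj (\<sigma> i x))))"

definition canonical_embedding :: "('s::finite \<Rightarrow> 'a \<Rightarrow> complex) \<Rightarrow> 'a \<Rightarrow> complex ^ 's" where
  "canonical_embedding \<sigma> x = (\<chi> i. \<sigma> i x)"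

definition norm_Kbar :: "complex ^ 's::finite \<Rightarrow> real" where
  "norm_Kbar x = (\<Prod>i\<in>UNIV. (cmod (x $ i))\<^sup>2)"

text \<open>
  Points of the torus are the cosets of the lattice, that is, the classes of \<open>lattice_rel\<close>;
  the elements of \<open>complex ^ 's\<close> projecting to a point \<open>z\<close> are thus the elements of \<open>z\<close>.
\<close>

definition lattice_rel ::
    "'a::field_char_0 set \<Rightarrow> ('s::finite \<Rightarrow> 'a \<Rightarrow> complex) \<Rightarrow> ((complex ^ 's) \<times> (complex ^ 's)) set" where
  "lattice_rel K \<sigma> = {(x, y). x - y \<in> canonical_embedding \<sigma> ` ring_of_integers K}"

definition torus ::
    "'a::field_char_0 set \<Rightarrow> ('s::finite \<Rightarrow> 'a \<Rightarrow> complex) \<Rightarrow> (complex ^ 's) set set" where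
  "torus K \<sigma> = UNIV // lattice_rel K \<sigma>"

definition rational_points ::
    "'a::field_char_0 set \<Rightarrow> ('s::finite \<Rightarrow> 'a \<Rightarrow> complex) \<Rightarrow> (complex ^ 's) set set" where
  "rational_points K \<sigma> = (canonical_embedding \<sigma> ` K) // lattice_rel K \<sigma>"

definition irrational_points ::
    "'a::field_char_0 set \<Rightarrow> ('s::finite \<Rightarrow> 'a \<Rightarrow> complex) \<Rightarrow> (complex ^ 's) set set" where
  "irrational_points K \<sigma> = torus K \<sigma> - rational_points K \<sigma>"

definition euclidean_min :: "(complex ^ 's::finite) set \<Rightarrow> real" where
  "euclidean_min z = (INF x\<in>z. \<bar>norm_Kbar x\<bar>)"

definition inhomogeneous_spectrum ::
    "'a::field_char_0 set \<Rightarrow> ('s::finite \<Rightarrow> 'a \<Rightarrow> complex) \<Rightarrow> real set" where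
  "inhomogeneous_spectrum K \<sigma> = euclidean_min ` torus K \<sigma>"

definition euclidean_spectrum ::
    "'a::field_char_0 set \<Rightarrow> ('s::finite \<Rightarrow> 'a \<Rightarrow> complex) \<Rightarrow> real set" where
  "euclidean_spectrum K \<sigma> = euclidean_min ` rational_points K \<sigma>"

text \<open>
  A subtorus is a closed connected subgroup, i.e. a closed subgroup that is the image of a real
  linear subspace \<open>W\<close>; its dimension is that of \<open>W\<close>. Closedness in the quotient topology
  means that the preimage \<open>\<Union>A\<close> in \<open>complex ^ 's\<close> is closed.
\<close>

definition subtorus ::
    "'a::field_char_0 set \<Rightarrow> ('s::finite \<Rightarrow> 'a \<Rightarrow> complex) \<Rightarrow> nat \<Rightarrow> (complex ^ 's) set set \<Rightarrow> bool" where
  "subtorus K \<sigma> d A \<longleftrightarrow>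
     (\<exists>W. subspace W \<and> dim W = d \<and> A = W // lattice_rel K \<sigma> \<and> closed (\<Union>A))"

definition affine_subtorus ::
    "'a::field_char_0 set \<Rightarrow> ('s::finite \<Rightarrow> 'a \<Rightarrow> complex) \<Rightarrow> nat \<Rightarrow> (complex ^ 's) set set \<Rightarrow> bool" where
  "affine_subtorus K \<sigma> d T \<longleftrightarrow>
     (\<exists>A a. subtorus K \<sigma> d A \<and> T = (\<lambda>z. (+) a ` z) ` A)"

end

theory Submission
  imports Defs "HOL-Computational_Algebra.Fundamental_Theorem_Algebra"
    "HOL-Computational_Algebra.Polynomial_Factorial" "HOL-Computational_Algebra.Field_as_Ring"
begin

text \<open>
  The lattice \<open>\<Lambda>\<close> of integers is acted on by the group \<open>\<Gamma>\<close> of the vectors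
  \<open>(\<bar>\<sigma>\<^sub>i a\<bar>\<^sup>2)\<^sub>i\<close>, \<open>a\<close> a unit, because \<open>K\<close> is stable under complex conjugation. These
  vectors are real, so \<open>\<Gamma>\<close> preserves the image in the torus of the real span
  \<open>v \<real>\<^sup>s\<close> of any lattice vector \<open>v\<close>, which is an \<open>s\<close>-dimensional subtorus.
  The norm minimum \<open>m\<close> is upper semicontinuous and \<open>\<Gamma>\<close>-invariant, so the sets
  \<open>{m \<ge> e}\<close> with \<open>e > 0\<close> are closed, invariant and proper.

  Whenever points of a closed invariant set accumulate, their differences can be expanded by units
  in one coordinate direction. Since there are at least four places, units bounded in two
  coordinates abound, and the limits sweep out real lines, whose closures contain translates of the
  above subtori. It follows that \<open>{m \<ge> e}\<close> consists of finitely many torsion translates of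
  such subtori (flats) and of finitely many torsion points.

  On a flat, minimizing the part of the norm transversal to \<open>v \<real>\<^sup>s\<close> gives the least
  value \<open>\<nu>\<close> of \<open>m\<close>; it is attained at a torsion point, because real parts of
  elements of \<open>K\<close> lie in \<open>K\<close>, and at all points that are not torsion. Only finitely
  many points of the flat have \<open>m \<ge> \<nu> + d\<close>, but the values approach \<open>\<nu>\<close>. So the
  spectrum consists of the values \<open>\<nu>\<close> of flats, which tend to \<open>0\<close>, and of sequences
  of isolated values decreasing to each of them. At a torsion point, \<open>m\<close> is a minimum of norms
  of elements of \<open>K\<close>, hence rational.
\<close>


section \<open>Lattices\<close>

text \<open>With respect to the real basis v, iv given by a lattice vector v, a real unit acts on
  both coordinates by the same diagonal matrix. So the torus is an extension of one real torus of
  dimension s by another, and each of the two is rigid: its proper closed invariant subsets are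
  finite. Flats are what the extension allows in addition.

  The obstacle is that logarithms of units at two places need not be dense in the plane; only a line
  in their closure is available. So the growth at one place i is kept as an extra coordinate, a
  height, and the dynamics happens on torus times line. There a Furstenberg type argument applies:
  away from exceptional points, differences inside a minimal set fill a slice, hence the set is
  invariant under all translations of order q, and q is arbitrary.

  Torsion points are the base points of all local arguments because N-th powers of units fix them,
  and passing to N-th powers preserves all assumptions on the group.

  That {m >= e} contains finitely many flats is a matter of size: if the real span of v contains
  only long lattice vectors, the transversal lattice is so fine that the flat has points of small
  norm.\<close>

lemma nat_pigeonhole_index:
  fixes f :: "nat \<Rightarrow> 'b::finite"
  shows "\<exists>j. \<exists>r::nat \<Rightarrow> nat. strict_mono r \<and> (\<forall>n. f (r n) = j)"
proof -
  have "\<exists>j. infinite {n. f n = j}"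
  proof (rule ccontr)
    assume "\<not> ?thesis"
    then have "finite (\<Union>j. {n. f n = j})" by auto
    moreover have "(\<Union>j. {n. f n = j}) = (UNIV::nat set)" by auto
    ultimately show False by simp
  qed
  then obtain j where j: "infinite {n. f n = j}" by blast
  show ?thesis
    using infinite_enumerate[OF j] by (intro exI[of _ j]) simp
qed

lemma bounded_subsequence:
  fixes f :: "nat \<Rightarrow> 'v::euclidean_space"
  assumes "\<And>n. norm (f n) \<le> C"
  obtains r l where "strict_mono r" "(\<lambda>n. f (r n)) \<longlonglongrightarrow> l"
proof -
  have "bounded (range f)" using assms by (intro boundedI[of _ C]) auto
  from bounded_imp_convergent_subsequence[OF this] show ?thesis
    using that by (auto simp: o_def)
qed

text \<open>Cocompactness is given by a covering radius and discreteness by an isolation radius of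
  0, so both are checked and used on vectors, without forming the quotient torus. The locale serves
  for the complex lattice as well as for the real lattices along and transversal to a flat.\<close>

locale lattice_in =
  fixes L :: "'v::euclidean_space set"
  assumes zero: "0 \<in> L"
    and diff: "a \<in> L \<Longrightarrow> b \<in> L \<Longrightarrow> a - b \<in> L"
    and cocompact: "\<exists>C. \<forall>x. \<exists>a\<in>L. norm (x - a) \<le> C"
    and discrete: "\<exists>e>0. \<forall>a\<in>L. norm a < e \<longrightarrow> a = 0"
begin

lemma uminus: "a \<in> L \<Longrightarrow> - a \<in> L"
  using diff[OF zero, of a] by simp

lemma add: "a \<in> L \<Longrightarrow> b \<in> L \<Longrightarrow> a + b \<in> L"
  using diff[OF _ uminus, of a b] by simp

lemma scaleR_nat: "a \<in> L \<Longrightarrow> real n *\<^sub>R a \<in> L"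
  by (induction n) (auto simp: zero scaleR_left_distrib intro: add)

lemma scaleR_int: "a \<in> L \<Longrightarrow> real_of_int k *\<^sub>R a \<in> L"
  using scaleR_nat[of a "nat k"] uminus[OF scaleR_nat, of a "nat (-k)"]
  by (cases "k \<ge> 0") auto

lemma sum_mem: "(\<And>x. x \<in> S \<Longrightarrow> f x \<in> L) \<Longrightarrow> sum f S \<in> L"
  by (induction S rule: infinite_finite_induct) (auto intro: zero add)

lemma radius:
  obtains C where "C > 0" "\<And>x. \<exists>a\<in>L. norm (x - a) \<le> C"
proof -
  obtain C where C: "\<forall>x. \<exists>a\<in>L. norm (x - a) \<le> C" using cocompact by blast
  have "max C 1 > 0" by simp
  moreover have "\<exists>a\<in>L. norm (x - a) \<le> max C 1" for x
    using C by (meson max.coboundedI1)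
  ultimately show ?thesis using that by blast
qed

lemma finite_bounded: "finite {a\<in>L. norm (a - x) \<le> B}"
proof (rule ccontr)
  let ?S = "{a\<in>L. norm (a - x) \<le> B}"
  assume inf: "infinite ?S"
  have "?S \<subseteq> cball x B" by (auto simp: dist_norm norm_minus_commute)
  then obtain l where l: "l islimpt ?S"
    using inf compact_cball[of x B] unfolding compact_eq_Bolzano_Weierstrass by blast
  obtain e where e: "e > 0" "\<forall>a\<in>L. norm a < e \<longrightarrow> a = 0" using discrete by blast
  obtain a where a: "a \<in> ?S" "a \<noteq> l" "dist a l < e / 2"
    using l e(1) unfolding islimpt_approachable by (metis half_gt_zero)
  \<comment> \<open>\<open>b\<close> is taken closer to \<open>l\<close> than \<open>a\<close>,
    which makes the two different; otherwise their small difference could be 0.\<close>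
  obtain b where b: "b \<in> ?S" "b \<noteq> l" "dist b l < min (e / 2) (dist a l)"
    using l e(1) a(2) unfolding islimpt_approachable
    by (metis (no_types, lifting) half_gt_zero min_less_iff_conj zero_less_dist_iff)
  have "dist a b < e"
    using a(3) b(3) dist_triangle2[of a b l] by simp
  moreover have "a - b \<in> L" using a(1) b(1) diff by simp
  ultimately have "a - b = 0" using e(2) unfolding dist_norm by blast
  then show False using b(3) by simp
qed

lemma finite_bounded0: "finite {a\<in>L. norm a \<le> B}"
  using finite_bounded[of 0 B] by simp

lemma closed: "closed L"
proof -
  obtain e where e: "e > 0" "\<forall>a\<in>L. norm a < e \<longrightarrow> a = 0" using discrete by blast
  show ?thesis
  proof (rule discrete_imp_closed[OF e(1)], intro ballI impI)
    fix x y assume "x \<in> L" "y \<in> L" "dist y x < e"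
    then show "y = x" using e(2) diff[of y x] by (auto simp: dist_norm)
  qed
qed

lemma countable: "countable L"
proof -
  have "L = (\<Union>n::nat. {a\<in>L. norm a \<le> real n})"
    using real_arch_simple by auto
  moreover have "countable (\<Union>n::nat. {a\<in>L. norm a \<le> real n})"
    using finite_bounded0 by (intro countable_UN) (auto intro: countable_finite)
  ultimately show ?thesis by metis
qed

text \<open>Sequential compactness of the torus. The translations are indexed along the subsequence
  already: \<open>a n\<close> belongs to \<open>x (r n)\<close>.\<close>

lemma reduce_seq:
  fixes x :: "nat \<Rightarrow> 'v"
  obtains a r z where "\<And>n. a n \<in> L" "strict_mono r" "(\<lambda>n. x (r n) - a n) \<longlonglongrightarrow> z"
proof -
  obtain C where C: "C > 0" "\<And>x. \<exists>a\<in>L. norm (x - a) \<le> C" using radius by metis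
  then have "\<forall>n. \<exists>b. b \<in> L \<and> norm (x n - b) \<le> C" by blast
  then obtain b where b: "\<And>n. b n \<in> L" "\<And>n. norm (x n - b n) \<le> C" by metis
  obtain r z where "strict_mono r" "(\<lambda>n. x (r n) - b (r n)) \<longlonglongrightarrow> z"
    using bounded_subsequence[of "\<lambda>n. x n - b n" C] b(2) by blast
  then show ?thesis using that[of "\<lambda>n. b (r n)" r z] b by simp
qed

lemma periodic_minus:
  assumes "\<And>x a. x \<in> X \<Longrightarrow> a \<in> L \<Longrightarrow> x + a \<in> X"
  shows "x \<in> X \<Longrightarrow> a \<in> L \<Longrightarrow> x - a \<in> X"
  using assms[of x "-a"] uminus[of a] by simp

text \<open>The preimage of the torsion subgroup of the torus. For the lattice of integers these are
  the elements of K, see \<open>torsion_iff\<close>.\<close>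

definition torsion :: "'v \<Rightarrow> bool" where
  "torsion x \<longleftrightarrow> (\<exists>n::nat. n > 0 \<and> real n *\<^sub>R x \<in> L)"

lemma torsion_lattice: "a \<in> L \<Longrightarrow> torsion a"
  unfolding torsion_def by (intro exI[of _ 1]) auto

lemma torsion_add: "torsion x \<Longrightarrow> torsion y \<Longrightarrow> torsion (x + y)"
proof -
  assume "torsion x" "torsion y"
  then obtain n m :: nat where nm: "n > 0" "m > 0" "real n *\<^sub>R x \<in> L" "real m *\<^sub>R y \<in> L"
    unfolding torsion_def by blast
  have "real (n * m) *\<^sub>R (x + y) = real m *\<^sub>R (real n *\<^sub>R x) + real n *\<^sub>R (real m *\<^sub>R y)"
    by (simp add: scaleR_right_distrib mult.commute)
  then show ?thesis using nm scaleR_nat add unfolding torsion_def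
    by (metis nat_0_less_mult_iff)
qed

lemma torsion_minus: "torsion x \<Longrightarrow> torsion (- x)"
  unfolding torsion_def using uminus by fastforce

lemma torsion_diff: "torsion x \<Longrightarrow> torsion y \<Longrightarrow> torsion (x - y)"
  using torsion_add[OF _ torsion_minus, of x y] by simp

lemma torsion_add_iff: "a \<in> L \<Longrightarrow> torsion (x + a) \<longleftrightarrow> torsion x"
  using torsion_add[of x a] torsion_diff[of "x + a" a] torsion_lattice by auto

lemma countable_torsion: "countable {x. torsion x}"
proof -
  have "{x. torsion x} \<subseteq> (\<Union>n\<in>{0<..}. (\<lambda>a. a /\<^sub>R real n) ` L)"
  proof
    fix x assume "x \<in> {x. torsion x}"
    then obtain n :: nat where n: "n > 0" "real n *\<^sub>R x \<in> L" unfolding torsion_def by blast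
    then have "x = (real n *\<^sub>R x) /\<^sub>R real n" by simp
    then show "x \<in> (\<Union>n\<in>{0<..}. (\<lambda>a. a /\<^sub>R real n) ` L)" using n by blast
  qed
  moreover have "countable (\<Union>n\<in>{0::nat<..}. (\<lambda>a. a /\<^sub>R real n) ` L)"
    using countable by (intro countable_UN) auto
  ultimately show ?thesis using countable_subset by blast
qed

text \<open>The remainders of the multiples of \<open>x\<close> modulo \<open>L'\<close> are bounded
  points of \<open>L\<close>, so two of them agree, and the difference of their indices is the
  multiplier.\<close>

lemma torsion_sublattice:
  assumes sub: "\<And>a b. a \<in> L' \<Longrightarrow> b \<in> L' \<Longrightarrow> a - b \<in> L'" and L': "L' \<subseteq> L"
    and coc: "\<And>x. \<exists>a\<in>L'. norm (x - a) \<le> C" and x: "x \<in> L"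
  shows "\<exists>n::nat. n > 0 \<and> real n *\<^sub>R x \<in> L'"
proof -
  have "\<forall>k::nat. \<exists>a. a \<in> L' \<and> norm (real k *\<^sub>R x - a) \<le> C" using coc by blast
  then obtain a where a: "\<And>k::nat. a k \<in> L'" "\<And>k. norm (real k *\<^sub>R x - a k) \<le> C"
    by metis
  let ?f = "\<lambda>k::nat. real k *\<^sub>R x - a k"
  have "range ?f \<subseteq> {a\<in>L. norm a \<le> C}"
    using a L' x diff[OF scaleR_nat] by blast
  then have "finite (range ?f)" using finite_bounded0 finite_subset by blast
  then have "\<not> inj ?f" using finite_imageD by blast
  then obtain k l where kl: "k \<noteq> l" "?f k = ?f l" unfolding inj_def by blast
  have "\<exists>k l. k < l \<and> ?f k = ?f l"
    using kl by (metis linorder_neqE_nat)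
  then obtain k l where kl: "k < l" "?f k = ?f l" by blast
  have "real (l - k) *\<^sub>R x = real l *\<^sub>R x - real k *\<^sub>R x"
    using kl(1) by (simp add: of_nat_diff scaleR_left_diff_distrib)
  also have "\<dots> = a l - a k" using kl(2) by (simp add: algebra_simps)
  finally have "real (l - k) *\<^sub>R x \<in> L'" using sub a by simp
  then show ?thesis using kl(1) by (intro exI[of _ "l - k"]) auto
qed

lemma finite_torsion_classes:
  fixes q :: nat
  assumes "q > 0"
  shows "\<exists>S. finite S \<and> (\<forall>x. real q *\<^sub>R x \<in> L \<longrightarrow> (\<exists>s\<in>S. real q *\<^sub>R s \<in> L \<and> x - s \<in> L))"
proof -
  obtain C where C: "C > 0" "\<And>x. \<exists>a\<in>L. norm (x - a) \<le> C" using radius by metis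
  let ?S = "(\<lambda>a. a /\<^sub>R real q) ` {a\<in>L. norm a \<le> real q * C}"
  have "finite ?S" using finite_bounded0 by blast
  moreover have "\<exists>s\<in>?S. real q *\<^sub>R s \<in> L \<and> x - s \<in> L" if x: "real q *\<^sub>R x \<in> L" for x
  proof -
    obtain a where a: "a \<in> L" "norm (x - a) \<le> C" using C by blast
    let ?b = "real q *\<^sub>R (x - a)"
    have "?b \<in> L" using x a(1) diff scaleR_nat by (simp add: scaleR_right_diff_distrib)
    moreover have "norm ?b \<le> real q * C" using a(2) by (simp add: mult_left_mono)
    moreover have "x - a = ?b /\<^sub>R real q" using assms by simp
    ultimately have "x - a \<in> ?S" by blast
    moreover have "x - (x - a) \<in> L" using a(1) by simp
    ultimately show ?thesis using \<open>?b \<in> L\<close> by blast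
  qed
  ultimately show ?thesis by blast
qed

text \<open>An automorphism of the lattice permutes the finitely many classes killed by
  \<open>q\<close>. Two of the first iterates of a point share a class, so a power with exponent at
  most the number \<open>m\<close> of classes fixes it, and \<open>fact m\<close> is a multiple of
  all such exponents. The exponent has to be uniform in \<open>f\<close>, which will be
  multiplication by an arbitrary unit.\<close>

lemma torsion_fixed:
  fixes q :: nat
  assumes "q > 0"
  shows "\<exists>N>0. \<forall>f x. (\<forall>x y. f (x - y) = f x - f y) \<longrightarrow> (\<forall>x c. f (c *\<^sub>R x) = c *\<^sub>R f x) \<longrightarrow>
    (\<forall>x. f x \<in> L \<longleftrightarrow> x \<in> L) \<longrightarrow> real q *\<^sub>R x \<in> L \<longrightarrow> (f ^^ N) x - x \<in> L"
proof -
  obtain S where S: "finite S" "\<And>x. real q *\<^sub>R x \<in> L \<Longrightarrow> \<exists>s\<in>S. real q *\<^sub>R s \<in> L \<and> x - s \<in> L"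
    using finite_torsion_classes[OF assms] by blast
  define m where "m = card S"
  have "(f ^^ fact m) x - x \<in> L" if ad: "\<forall>x y. f (x - y) = f x - f y" and sc: "\<forall>x c. f (c *\<^sub>R x) = c *\<^sub>R f x"
    and f_iff: "\<forall>x. f x \<in> L \<longleftrightarrow> x \<in> L" and x: "real q *\<^sub>R x \<in> L" for f x
  proof -
    have add_pow: "(f ^^ k) (y - z) = (f ^^ k) y - (f ^^ k) z" for k y z
      by (induction k arbitrary: y z) (auto simp: ad)
    have pow_iff: "(f ^^ k) y \<in> L \<longleftrightarrow> y \<in> L" for k y
      by (induction k) (auto simp: f_iff)
    have tors: "real q *\<^sub>R (f ^^ k) x \<in> L" for k
      using x by (induction k) (auto simp: f_iff sc[rule_format, symmetric])
    obtain s where s: "\<And>k. s k \<in> S" "\<And>k. (f ^^ k) x - s k \<in> L" using S(2)[OF tors] by metis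
    have "\<not> inj_on s {0..m}"
    proof
      assume "inj_on s {0..m}"
      then have "card {0..m} \<le> card S" using s(1) S(1) by (intro card_inj_on_le) auto
      then show False by (simp add: m_def)
    qed
    then have "\<exists>k l. k < l \<and> l \<le> m \<and> s k = s l"
      unfolding inj_on_def by (metis atLeastAtMost_iff linorder_neqE_nat)
    then obtain k l where kl: "k < l" "l \<le> m" "s k = s l" by blast
    have "(f ^^ l) x - (f ^^ k) x \<in> L"
      using diff[OF s(2)[of l] s(2)[of k]] kl(3) by simp
    then have "(f ^^ k) ((f ^^ (l - k)) x - x) \<in> L"
      using kl(1) by (simp add: add_pow funpow_add[symmetric, THEN fun_cong, unfolded o_def])
    then have base: "(f ^^ (l - k)) x - x \<in> L" by (simp add: pow_iff)
    have iter: "(f ^^ (j * (l - k))) x - x \<in> L" for j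
    proof (induction j)
      case 0 then show ?case by (simp add: zero)
    next
      case (Suc j)
      have "(f ^^ (l - k)) ((f ^^ (j * (l - k))) x - x) + ((f ^^ (l - k)) x - x) \<in> L"
        using Suc base by (intro add) (auto simp: pow_iff)
      then show ?case
        by (simp add: add_pow funpow_add)
    qed
    have "l - k dvd fact m" using kl by (intro dvd_fact) auto
    then obtain j where "fact m = j * (l - k)" by (metis dvd_def mult.commute)
    then show ?thesis using iter[of j] by simp
  qed
  then show ?thesis by (intro exI[of _ "fact m"]) auto
qed

lemma periodic_limpt:
  assumes "x islimpt X" "\<And>x a. x \<in> X \<Longrightarrow> a \<in> L \<Longrightarrow> x + a \<in> X" "a \<in> L"
  shows "x + a islimpt X"
proof -
  obtain f where f: "\<And>n. f n \<in> X - {x}" "f \<longlonglongrightarrow> x"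
    using assms(1) unfolding islimpt_sequential by auto
  have "(\<lambda>n. f n + a) \<longlonglongrightarrow> x + a" using f(2) by (intro tendsto_intros)
  moreover have "f n + a \<in> X - {x + a}" for n using f(1)[of n] assms by auto
  ultimately show ?thesis unfolding islimpt_sequential by (intro exI[of _ "\<lambda>n. f n + a"] conjI allI) auto
qed

lemma finite_mod:
  assumes "\<not> (\<exists>x. x islimpt X)" "\<And>x a. x \<in> X \<Longrightarrow> a \<in> L \<Longrightarrow> x + a \<in> X"
  shows "\<exists>F. finite F \<and> F \<subseteq> X \<and> (\<forall>x\<in>X. \<exists>y\<in>F. x - y \<in> L)"
proof -
  obtain C where C: "C > 0" "\<And>x. \<exists>a\<in>L. norm (x - a) \<le> C" using radius by metis
  let ?F = "X \<inter> cball 0 C"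
  have "finite ?F"
  proof (rule ccontr)
    assume "infinite ?F"
    then obtain l where "l islimpt ?F"
      using compact_cball[of 0 C] unfolding compact_eq_Bolzano_Weierstrass by blast
    then have "l islimpt X" by (rule islimpt_subset) auto
    then show False using assms(1) by blast
  qed
  moreover have "\<exists>y\<in>?F. x - y \<in> L" if "x \<in> X" for x
  proof -
    obtain a where a: "a \<in> L" "norm (x - a) \<le> C" using C by blast
    have "x - a \<in> X" using periodic_minus[of X x a] assms(2) that a by blast
    then show ?thesis using a by (intro bexI[of _ "x - a"]) auto
  qed
  ultimately show ?thesis by (intro exI[of _ ?F]) auto
qed

end


section \<open>Groups of positive diagonal matrices with cocompact logarithms\<close>

definition cvec :: "real ^ 's \<Rightarrow> complex ^ 's" where
  "cvec p = (\<chi> i. complex_of_real (p $ i))"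

definition vinv :: "real ^ 's \<Rightarrow> real ^ 's" where
  "vinv u = (\<chi> i. inverse (u $ i))"

lemma cvec_nth [simp]: "cvec p $ i = complex_of_real (p $ i)" by (simp add: cvec_def)
lemma vinv_nth [simp]: "vinv p $ i = inverse (p $ i)" by (simp add: vinv_def)

lemma cvec_simps: "cvec (p + q) = cvec p + cvec q" "cvec (p - q) = cvec p - cvec q"
  "cvec (p * q) = cvec p * cvec q" "cvec 0 = 0" "cvec 1 = 1" "cvec (- p) = - cvec p"
  "cvec (c *\<^sub>R p) = c *\<^sub>R cvec p"
  by (simp_all add: vec_eq_iff) (simp_all add: scaleR_conv_of_real)

lemma power_nth [simp]: "((u :: 'a::monoid_mult ^ 's) ^ n) $ i = (u $ i) ^ n"
  by (induction n) simp_all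

lemma tendsto_mult_vec [tendsto_intros]:
  fixes f g :: "'x \<Rightarrow> ('a::real_normed_algebra) ^ 's"
  assumes "(f \<longlongrightarrow> a) F" "(g \<longlongrightarrow> b) F"
  shows "((\<lambda>x. f x * g x) \<longlongrightarrow> a * b) F"
  by (rule vec_tendstoI) (auto intro!: tendsto_intros tendsto_vec_nth assms)

lemma tendsto_cvec [tendsto_intros]:
  "(f \<longlongrightarrow> a) F \<Longrightarrow> ((\<lambda>x. cvec (f x)) \<longlongrightarrow> cvec a) F"
  by (rule vec_tendstoI) (auto intro!: tendsto_intros)

lemma axis_mult: "x * axis i a = axis i ((x $ i) * (a::'a::semiring_0))"
  by (auto simp: vec_eq_iff axis_def)

lemma norm_cvec: "norm (cvec p) = norm p"
  by (simp add: norm_vec_def)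

text \<open>\<open>log_cocompact\<close> is the half of Dirichlet's unit theorem that provides
  units: their logarithms are coarsely dense in the hyperplane of sum 0. \<open>inj\<close> reflects
  that embeddings of a field are injective, and \<open>card4\<close> is the hypothesis on the rank,
  which is one less than the number of places.\<close>

locale unit_group =
  fixes G :: "(real ^ 's::finite) set"
  assumes one: "1 \<in> G"
    and mult: "u \<in> G \<Longrightarrow> w \<in> G \<Longrightarrow> u * w \<in> G"
    and inv: "u \<in> G \<Longrightarrow> vinv u \<in> G"
    and pos: "u \<in> G \<Longrightarrow> u $ i > 0"
    and prod1: "u \<in> G \<Longrightarrow> (\<Prod>i\<in>UNIV. u $ i) = 1"
    and inj: "u \<in> G \<Longrightarrow> u $ i = 1 \<Longrightarrow> u = 1"
    and log_cocompact: "\<exists>R. \<forall>h::real^'s. (\<Sum>i\<in>UNIV. h $ i) = 0 \<longrightarrow> (\<exists>u\<in>G. \<forall>i. \<bar>ln (u $ i) - h $ i\<bar> \<le> R)"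
    and card4: "CARD('s) \<ge> 4"
begin

lemma nonzero: "u \<in> G \<Longrightarrow> u $ i \<noteq> 0"
  using pos[of u i] by simp

lemma ln_mult: "u \<in> G \<Longrightarrow> w \<in> G \<Longrightarrow> ln ((u * w) $ i) = ln (u $ i) + ln (w $ i)"
  using pos[of u i] pos[of w i] by (simp add: ln_mult_pos)

lemma ln_inv: "u \<in> G \<Longrightarrow> ln (vinv u $ i) = - ln (u $ i)"
  using pos[of u i] by (simp add: ln_inverse)

lemma mult_vinv: "u \<in> G \<Longrightarrow> u * vinv u = 1" "u \<in> G \<Longrightarrow> vinv u * u = 1"
  using nonzero[of u] by (simp_all add: vec_eq_iff)

lemma power: "u \<in> G \<Longrightarrow> u ^ n \<in> G"
  by (induction n) (auto intro: one mult)

lemma ln_power: "u \<in> G \<Longrightarrow> ln ((u ^ n) $ i) = real n * ln (u $ i)"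
  using pos[of u i] by (simp add: ln_realpow)

lemma inj2: "u \<in> G \<Longrightarrow> w \<in> G \<Longrightarrow> u $ i = w $ i \<Longrightarrow> u = w"
proof -
  assume a: "u \<in> G" "w \<in> G" "u $ i = w $ i"
  have "u * vinv w = 1"
    using a nonzero[of w i] by (intro inj[of _ i] mult inv) auto
  then have "u * (vinv w * w) = w" by (simp add: mult.assoc[symmetric])
  then show "u = w" using mult_vinv[OF a(2)] by simp
qed

lemma zpower:
  assumes "u \<in> G"
  shows "\<exists>w\<in>G. \<forall>i. ln (w $ i) = real_of_int k * ln (u $ i)"
proof (cases "k \<ge> 0")
  case True
  then show ?thesis using power[OF assms, of "nat k"] ln_power[OF assms, of "nat k"]
    by (intro bexI[of _ "u ^ nat k"]) auto
next
  case False
  have "ln (vinv (u ^ nat (-k)) $ i) = real_of_int k * ln (u $ i)" for i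
    using ln_inv[OF power[OF assms]] ln_power[OF assms] False by simp
  then show ?thesis using inv[OF power[OF assms]] by blast
qed

lemma log_radius:
  obtains R where "R > 0" "\<And>h::real^'s. (\<Sum>i\<in>UNIV. h $ i) = 0 \<Longrightarrow> \<exists>u\<in>G. \<forall>i. \<bar>ln (u $ i) - h $ i\<bar> \<le> R"
proof -
  obtain R where R: "\<forall>h::real^'s. (\<Sum>i\<in>UNIV. h $ i) = 0 \<longrightarrow> (\<exists>u\<in>G. \<forall>i. \<bar>ln (u $ i) - h $ i\<bar> \<le> R)"
    using log_cocompact by blast
  have "\<exists>u\<in>G. \<forall>i. \<bar>ln (u $ i) - h $ i\<bar> \<le> max R 1" if h: "(\<Sum>i\<in>UNIV. h $ i) = 0" for h :: "real^'s"
  proof -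
    obtain u where "u \<in> G" "\<forall>i. \<bar>ln (u $ i) - h $ i\<bar> \<le> R" using R h by blast
    then show ?thesis by (meson max.coboundedI1)
  qed
  moreover have "max R 1 > 0" by simp
  ultimately show ?thesis using that by blast
qed

lemma third_index: "\<exists>k::'s. k \<noteq> a \<and> k \<noteq> b \<and> k \<noteq> c"
proof (rule ccontr)
  assume "\<not> ?thesis"
  then have "(UNIV::'s set) = {a, b, c}" by auto
  moreover have "card {a, b, c} \<le> 3" by (simp add: card_insert_le_m1)
  ultimately show False using card4 by simp
qed

text \<open>The vector with entries \<open>T\<close> and \<open>-T\<close> at \<open>p\<close> and
  \<open>q\<close> has sum 0, so it is within \<open>R\<close> of the logarithms of a unit. This is
  the tool for moving growth between two places while the others stay under control.\<close>

lemma two_point: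
  obtains R where "R > 0"
    "\<And>p q T. p \<noteq> q \<Longrightarrow> \<exists>g\<in>G. \<bar>ln (g $ p) - T\<bar> \<le> R \<and> \<bar>ln (g $ q) + T\<bar> \<le> R \<and> (\<forall>k. k \<noteq> p \<longrightarrow> k \<noteq> q \<longrightarrow> \<bar>ln (g $ k)\<bar> \<le> R)"
proof -
  obtain R where R: "R > 0" "\<And>h::real^'s. (\<Sum>i\<in>UNIV. h $ i) = 0 \<Longrightarrow> \<exists>u\<in>G. \<forall>i. \<bar>ln (u $ i) - h $ i\<bar> \<le> R"
    using log_radius by metis
  have "\<exists>g\<in>G. \<bar>ln (g $ p) - T\<bar> \<le> R \<and> \<bar>ln (g $ q) + T\<bar> \<le> R \<and> (\<forall>k. k \<noteq> p \<longrightarrow> k \<noteq> q \<longrightarrow> \<bar>ln (g $ k)\<bar> \<le> R)"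
    if "p \<noteq> q" for p q T
  proof -
    let ?h = "axis p T - axis q T :: real^'s"
    have "(\<Sum>i\<in>UNIV. ?h $ i) = 0"
      by (simp add: axis_def sum_subtractf)
    from R(2)[OF this] obtain u where u: "u \<in> G" "\<And>i. \<bar>ln (u $ i) - ?h $ i\<bar> \<le> R" by blast
    show ?thesis
      using u(1) u(2)[of p] u(2)[of q] u(2) that
      by (intro bexI[of _ u]) (auto simp: axis_def split: if_splits, smt (verit, best))
  qed
  then show ?thesis using that R(1) by blast
qed

lemma contraction:
  assumes "\<eta> > 0"
  shows "\<exists>g\<in>G. \<forall>k. k \<noteq> i \<longrightarrow> g $ k \<le> \<eta>"
proof -
  obtain R where R: "R > 0" "\<And>h::real^'s. (\<Sum>i\<in>UNIV. h $ i) = 0 \<Longrightarrow> \<exists>u\<in>G. \<forall>i. \<bar>ln (u $ i) - h $ i\<bar> \<le> R"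
    using log_radius by metis
  \<comment> \<open>Off \<open>i\<close> every entry is \<open>ln \<eta>\<close> with a margin
    \<open>R\<close> for the rounding; the additional term at \<open>i\<close> makes the sum
    0.\<close>
  let ?h = "(\<chi> k. ln \<eta> - R) + axis i (real CARD('s) * (R - ln \<eta>)) :: real^'s"
  have "(\<Sum>i\<in>UNIV. ?h $ i) = 0"
    by (simp add: axis_def sum.distrib sum_subtractf) (simp add: algebra_simps)
  from R(2)[OF this] obtain u where u: "u \<in> G" "\<And>i. \<bar>ln (u $ i) - ?h $ i\<bar> \<le> R" by blast
  have "u $ k \<le> \<eta>" if "k \<noteq> i" for k
  proof -
    have "ln (u $ k) \<le> ln \<eta>" using u(2)[of k] that by (simp add: axis_def)
    then show ?thesis using pos[OF u(1), of k] assms by simp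
  qed
  then show ?thesis using u(1) by blast
qed

lemma norm_contraction:
  fixes a :: "complex^'s"
  assumes a: "a $ i = 0" and e: "e > 0"
  shows "\<exists>g\<in>G. norm (cvec g * a) < e"
proof -
  define \<eta> where "\<eta> = e / (2 * (norm a + 1))"
  have p: "norm a + 1 > 0" by (simp add: add_nonneg_pos)
  have \<eta>: "\<eta> > 0" using e p by (simp add: \<eta>_def)
  obtain g where g: "g \<in> G" "\<And>k. k \<noteq> i \<Longrightarrow> g $ k \<le> \<eta>" using contraction[OF \<eta>] by blast
  have "norm (cvec g * a) \<le> norm (\<eta> *\<^sub>R a)"
  proof (rule norm_le_componentwise_cart)
    fix k show "norm ((cvec g * a) $ k) \<le> norm ((\<eta> *\<^sub>R a) $ k)"
      using g(2)[of k] pos[OF g(1), of k] \<eta> a by (cases "k = i") (simp_all add: norm_mult mult_right_mono)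
  qed
  also have "\<dots> \<le> \<eta> * (norm a + 1)" using \<eta> by simp
  also have "\<dots> = e / 2" using p by (simp add: \<eta>_def field_simps)
  also have "\<dots> < e" using e by simp
  finally show ?thesis using g(1) by blast
qed

text \<open>Growth is shuttled between two further places \<open>k\<close> and \<open>l\<close>, so
  four places are needed. Consecutive targets at \<open>k\<close> are \<open>3 * R\<close> apart,
  more than two rounding errors, which makes the units distinct.\<close>

lemma bounded_pair_seq:
  assumes "i \<noteq> j"
  obtains w :: "nat \<Rightarrow> real^'s" and x where "inj w" "\<And>n. w n \<in> G"
    "(\<lambda>n. (ln (w n $ i), ln (w n $ j))) \<longlonglongrightarrow> x"
proof -
  obtain R where R: "R > 0" "\<And>p q T. p \<noteq> q \<Longrightarrow> \<exists>g\<in>G. \<bar>ln (g $ p) - T\<bar> \<le> R \<and> \<bar>ln (g $ q) + T\<bar> \<le> R \<and> (\<forall>k. k \<noteq> p \<longrightarrow> k \<noteq> q \<longrightarrow> \<bar>ln (g $ k)\<bar> \<le> R)"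
    using two_point by metis
  obtain k where k: "k \<noteq> i" "k \<noteq> j" using third_index[of i j i] by blast
  obtain l where l: "l \<noteq> i" "l \<noteq> j" "l \<noteq> k" using third_index[of i j k] by blast
  have "\<forall>n::nat. \<exists>g. g \<in> G \<and> \<bar>ln (g $ k) - real n * (3 * R)\<bar> \<le> R \<and> \<bar>ln (g $ i)\<bar> \<le> R \<and> \<bar>ln (g $ j)\<bar> \<le> R"
    using R(2)[OF l(3)[symmetric]] k l by (metis (no_types, lifting))
  then obtain g where g: "\<And>n. g n \<in> G" "\<And>n::nat. \<bar>ln (g n $ k) - real n * (3 * R)\<bar> \<le> R"
     "\<And>n. \<bar>ln (g n $ i)\<bar> \<le> R" "\<And>n. \<bar>ln (g n $ j)\<bar> \<le> R" by metis
  have "norm (ln (g n $ i), ln (g n $ j)) \<le> R + R" for n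
    using norm_Pair_le[of "ln (g n $ i)" "ln (g n $ j)"] g(3)[of n] g(4)[of n] by simp
  then obtain r x where r: "strict_mono r" "(\<lambda>n. (ln (g (r n) $ i), ln (g (r n) $ j))) \<longlonglongrightarrow> x"
    by (rule bounded_subsequence[of "\<lambda>n. (ln (g n $ i), ln (g n $ j))"])
  have "inj (\<lambda>n. g (r n))"
  proof (rule injI)
    fix m n assume eq: "g (r m) = g (r n)"
    have "\<bar>real (r m) * (3 * R) - real (r n) * (3 * R)\<bar> \<le> 2 * R"
      using g(2)[of "r m"] g(2)[of "r n"] eq by simp
    also have "real (r m) * (3 * R) - real (r n) * (3 * R) = (real (r m) - real (r n)) * (3 * R)" by (simp add: algebra_simps)
    finally have "\<bar>real (r m) - real (r n)\<bar> * (3 * R) \<le> (2/3) * (3 * R)" using R(1) by (simp add: abs_mult)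
    then have "\<bar>real (r m) - real (r n)\<bar> \<le> 2/3" using R(1) by (simp only: mult_le_cancel_right)
    then have "r m = r n" by linarith
    then show "m = n" using r(1) by (simp add: strict_mono_eq)
  qed
  then show ?thesis using that[of "\<lambda>n. g (r n)" x] r(2) g(1) by blast
qed

text \<open>Quotients of consecutive terms of a sequence with convergent logarithms. Distinct units
  differ at every place, so no logarithm of a quotient vanishes.\<close>

lemma small_pair_seq:
  assumes "i \<noteq> j"
  obtains d :: "nat \<Rightarrow> real^'s" where "\<And>n. d n \<in> G" "\<And>n k. ln (d n $ k) \<noteq> 0"
    "(\<lambda>n. ln (d n $ i)) \<longlonglongrightarrow> 0" "(\<lambda>n. ln (d n $ j)) \<longlonglongrightarrow> 0"
proof -
  obtain w :: "nat \<Rightarrow> real^'s" and x where w: "inj w" "\<And>n. w n \<in> G"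
    "(\<lambda>n. (ln (w n $ i), ln (w n $ j))) \<longlonglongrightarrow> x"
    by (rule bounded_pair_seq[OF assms]) blast
  have 1: "(\<lambda>n. ln (w n $ i)) \<longlonglongrightarrow> fst x" "(\<lambda>n. ln (w n $ j)) \<longlonglongrightarrow> snd x"
    using tendsto_fst[OF w(3)] tendsto_snd[OF w(3)] by auto
  let ?d = "\<lambda>n. w (Suc n) * vinv (w n)"
  have eq: "ln (?d n $ k) = ln (w (Suc n) $ k) - ln (w n $ k)" for n k
    using w(2) inv by (simp only: ln_mult ln_inv)
  have "(\<lambda>n. ln (?d n $ i)) \<longlonglongrightarrow> fst x - fst x" "(\<lambda>n. ln (?d n $ j)) \<longlonglongrightarrow> snd x - snd x"
    unfolding eq by (intro tendsto_diff LIMSEQ_Suc 1)+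
  moreover have "ln (?d n $ k) \<noteq> 0" for n k
  proof
    assume "ln (?d n $ k) = 0"
    then have "w (Suc n) $ k = w n $ k" using eq[of n k] pos[OF w(2)] by simp
    then have "w (Suc n) = w n" using inj2[OF w(2) w(2)] by blast
    then show False using w(1) by (metis injD n_not_Suc_n)
  qed
  moreover have "?d n \<in> G" for n using w(2) inv mult by blast
  ultimately show ?thesis using that[of ?d] by simp
qed

text \<open>Integer multiples of the small vectors of logarithms at \<open>p\<close> and
  \<open>q\<close> approximate a line. Its slope \<open>c\<close> is a limit of their slopes, which
  the last assumption bounds by 1, and the multiple used is the integer part of \<open>t\<close>
  divided by the small logarithm at \<open>p\<close>.\<close>

lemma log_line:
  fixes d :: "nat \<Rightarrow> real^'s"
  assumes d: "\<And>n. d n \<in> G" "\<And>n. ln (d n $ p) \<noteq> 0" "(\<lambda>n. ln (d n $ p)) \<longlonglongrightarrow> 0"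
    and le: "\<And>n. \<bar>ln (d n $ q)\<bar> \<le> \<bar>ln (d n $ p)\<bar>"
  shows "\<exists>c. \<forall>t e. e > 0 \<longrightarrow> (\<exists>u\<in>G. \<bar>ln (u $ p) - t\<bar> < e \<and> \<bar>ln (u $ q) - c * t\<bar> < e)"
proof -
  let ?x = "\<lambda>n. ln (d n $ p)" let ?y = "\<lambda>n. ln (d n $ q)"
  have "norm (?y n / ?x n) \<le> 1" for n using le[of n] d(2)[of n] by simp
  then obtain r c where r: "strict_mono r" "(\<lambda>n. ?y (r n) / ?x (r n)) \<longlonglongrightarrow> c"
    by (rule bounded_subsequence[of "\<lambda>n. ?y n / ?x n"])
  have xr: "(\<lambda>n. ?x (r n)) \<longlonglongrightarrow> 0"
    using LIMSEQ_subseq_LIMSEQ[OF d(3) r(1)] by (simp add: o_def)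
  have "\<exists>u\<in>G. \<bar>ln (u $ p) - t\<bar> < e \<and> \<bar>ln (u $ q) - c * t\<bar> < e" if e: "e > 0" for t e
  proof -
    let ?k = "\<lambda>n. real_of_int \<lfloor>t / ?x (r n)\<rfloor>"
    have kx: "\<bar>?k n * ?x (r n) - t\<bar> \<le> \<bar>?x (r n)\<bar>" for n
    proof -
      have "\<bar>?k n - t / ?x (r n)\<bar> \<le> 1" by linarith
      then have "\<bar>?k n - t / ?x (r n)\<bar> * \<bar>?x (r n)\<bar> \<le> \<bar>?x (r n)\<bar>" by (simp add: mult_left_le_one_le)
      then have "\<bar>(?k n - t / ?x (r n)) * ?x (r n)\<bar> \<le> \<bar>?x (r n)\<bar>" by (simp only: abs_mult)
      then show ?thesis using d(2)[of "r n"] by (simp add: left_diff_distrib)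
    qed
    have l1: "(\<lambda>n. ?k n * ?x (r n) - t) \<longlonglongrightarrow> 0"
      by (rule Lim_null_comparison[OF _ tendsto_rabs_zero[OF xr]]) (use kx in auto)
    have l1': "(\<lambda>n. ?k n * ?x (r n)) \<longlonglongrightarrow> t" using l1 by (simp add: LIM_zero_iff)
    have "(\<lambda>n. (?y (r n) / ?x (r n)) * (?k n * ?x (r n))) \<longlonglongrightarrow> c * t"
      by (intro tendsto_intros r(2) l1')
    then have l2: "(\<lambda>n. ?k n * ?y (r n)) \<longlonglongrightarrow> c * t" using d(2) by (simp add: mult.commute)
    have "\<forall>\<^sub>F n in sequentially. \<bar>?k n * ?x (r n) - t\<bar> < e \<and> \<bar>?k n * ?y (r n) - c * t\<bar> < e"
      using tendstoD[OF l1' e] tendstoD[OF l2 e] by eventually_elim (simp add: dist_real_def)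
    then obtain n where n: "\<bar>?k n * ?x (r n) - t\<bar> < e" "\<bar>?k n * ?y (r n) - c * t\<bar> < e"
      unfolding eventually_sequentially by blast
    obtain w where "w \<in> G" "\<forall>k. ln (w $ k) = ?k n * ln (d (r n) $ k)"
      using zpower[OF d(1)] by blast
    then show ?thesis using n by (intro bexI[of _ w]) auto
  qed
  then show ?thesis by blast
qed

lemma log_dense:
  assumes "e > 0"
  shows "\<exists>u\<in>G. \<bar>ln (u $ i) - t\<bar> < e"
proof -
  obtain j where "j \<noteq> i" using third_index by blast
  then obtain d :: "nat \<Rightarrow> real^'s" where d: "\<And>n. d n \<in> G" "\<And>n k. ln (d n $ k) \<noteq> 0"
    "(\<lambda>n. ln (d n $ i)) \<longlonglongrightarrow> 0" using small_pair_seq[of i j] by metis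
  \<comment> \<open>The case \<open>p = q\<close> of \<open>log_line\<close>, in which the
    comparison of the logarithms is trivial.\<close>
  from log_line[OF d(1,2,3) order_refl] assms show ?thesis by blast
qed

text \<open>
  The closure of the projection of the logarithms to two coordinates contains a line that is not
  horizontal; here \<open>CARD('s) \<ge> 4\<close> is needed. It need not be the whole plane: if the
  units have norm 1 down to a quadratic subfield, some projections are not dense.
\<close>

lemma two_coordinate_line:
  assumes ij: "i \<noteq> j"
  shows "\<exists>\<alpha>. \<forall>t e. e > 0 \<longrightarrow> (\<exists>u\<in>G. \<bar>ln (u $ i) - \<alpha> * t\<bar> < e \<and> \<bar>ln (u $ j) - t\<bar> < e)"
proof -
  obtain d :: "nat \<Rightarrow> real^'s" where d: "\<And>n. d n \<in> G" "\<And>n k. ln (d n $ k) \<noteq> 0"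
    "(\<lambda>n. ln (d n $ i)) \<longlonglongrightarrow> 0" "(\<lambda>n. ln (d n $ j)) \<longlonglongrightarrow> 0"
    using small_pair_seq[OF ij] by metis
  obtain b r where r: "strict_mono (r::nat\<Rightarrow>nat)" "\<And>n. (\<bar>ln (d (r n) $ i)\<bar> \<le> \<bar>ln (d (r n) $ j)\<bar>) = b"
    using nat_pigeonhole_index[of "\<lambda>n. (\<bar>ln (d n $ i)\<bar> \<le> \<bar>ln (d n $ j)\<bar>)"] by metis
  have dr: "(\<lambda>n. ln (d (r n) $ i)) \<longlonglongrightarrow> 0" "(\<lambda>n. ln (d (r n) $ j)) \<longlonglongrightarrow> 0"
    using LIMSEQ_subseq_LIMSEQ[OF d(3) r(1)] LIMSEQ_subseq_LIMSEQ[OF d(4) r(1)] by (auto simp: o_def)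
  show ?thesis
  proof (cases b)
    case True
    from log_line[of "\<lambda>n. d (r n)" j i] obtain c where
      c: "\<forall>t e. e > 0 \<longrightarrow> (\<exists>u\<in>G. \<bar>ln (u $ j) - t\<bar> < e \<and> \<bar>ln (u $ i) - c * t\<bar> < e)"
      using d(1,2) dr r(2) True by auto
    show ?thesis using c by (intro exI[of _ c]) blast
  next
    case False
    from log_line[of "\<lambda>n. d (r n)" i j] obtain c where
      c: "\<And>t e. e > 0 \<Longrightarrow> (\<exists>u\<in>G. \<bar>ln (u $ i) - t\<bar> < e \<and> \<bar>ln (u $ j) - c * t\<bar> < e)"
      using d(1,2) dr r(2) False by (metis linear)
    show ?thesis
    proof (cases "c = 0")
      case False
      have "\<exists>u\<in>G. \<bar>ln (u $ i) - (1 / c) * t\<bar> < e \<and> \<bar>ln (u $ j) - t\<bar> < e" if "e > 0" for t e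
        using c[OF that, of "t / c"] False by simp
      then show ?thesis by blast
    next
      case True
      \<comment> \<open>The closure contains the horizontal line, so a unit \<open>v\<close> with
        the right logarithm at \<open>j\<close> can be corrected at \<open>i\<close> by a unit
        \<open>w\<close> that is nearly 1 at \<open>j\<close>.\<close>
      have "\<exists>u\<in>G. \<bar>ln (u $ i) - 0 * t\<bar> < e \<and> \<bar>ln (u $ j) - t\<bar> < e" if e: "e > 0" for t e
      proof -
        obtain v where v: "v \<in> G" "\<bar>ln (v $ j) - t\<bar> < e / 2" using log_dense[of "e/2" j t] e by auto
        obtain w where w: "w \<in> G" "\<bar>ln (w $ i) - (- ln (v $ i))\<bar> < e / 2" "\<bar>ln (w $ j)\<bar> < e / 2"
          using c[of "e/2" "- ln (v $ i)"] e True by auto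
        have "\<bar>ln ((v * w) $ i) - 0 * t\<bar> < e" "\<bar>ln ((v * w) $ j) - t\<bar> < e"
          unfolding ln_mult[OF v(1) w(1)] using v(2) w(2,3) by linarith+
        then show ?thesis using mult[OF v(1) w(1)] by blast
      qed
      then show ?thesis by blast
    qed
  qed
qed

text \<open>At \<open>j\<close> the unit \<open>g n\<close> is about the inverse of the entry of
  \<open>\<delta>\<close>, which brings that entry to size 1. The compensating small factor is put
  at a place other than \<open>i\<close> and \<open>j\<close>; all remaining factors are bounded, so
  the other entries still tend to 0. The convergence of \<open>ln (g n $ i)\<close> and the bound
  off \<open>j\<close> serve to carry heights and transversal coordinates along.\<close>

lemma expand_seq:
  fixes \<delta> :: "nat \<Rightarrow> complex ^ 's"
  assumes ij: "i \<noteq> j" and lim: "\<delta> \<longlonglongrightarrow> 0" and nz: "\<And>n. \<delta> n $ j \<noteq> 0"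
  obtains g r a l C where "\<And>n. g n \<in> G" "strict_mono r" "a \<noteq> 0"
    "(\<lambda>n. cvec (g n) * \<delta> (r n)) \<longlonglongrightarrow> axis j a" "(\<lambda>n. ln (g n $ i)) \<longlonglongrightarrow> l"
    "\<And>n k. k \<noteq> j \<Longrightarrow> g n $ k \<le> C" "C > 0"
proof -
  obtain R where R: "R > 0" "\<And>p q T. p \<noteq> q \<Longrightarrow> \<exists>g\<in>G. \<bar>ln (g $ p) - T\<bar> \<le> R \<and> \<bar>ln (g $ q) + T\<bar> \<le> R \<and> (\<forall>k. k \<noteq> p \<longrightarrow> k \<noteq> q \<longrightarrow> \<bar>ln (g $ k)\<bar> \<le> R)"
    using two_point by metis
  obtain q where q: "q \<noteq> i" "q \<noteq> j" using third_index[of i j i] by blast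
  have lim_nth: "(\<lambda>n. \<delta> n $ k) \<longlonglongrightarrow> 0" for k using tendsto_vec_nth[OF lim, of k] by simp
  \<comment> \<open>Beyond \<open>n0\<close> the entry at \<open>j\<close> is less than 1, so the
    compensating factor at \<open>q\<close> is bounded above like the others.\<close>
  obtain n0 where n0: "\<And>n. n \<ge> n0 \<Longrightarrow> cmod (\<delta> n $ j) < 1"
    using LIMSEQ_D[OF lim_nth, of 1 j] by auto
  have "\<exists>g. g \<in> G \<and> \<bar>ln (g $ j) + ln (cmod (\<delta> n $ j))\<bar> \<le> R \<and> \<bar>ln (g $ q) - ln (cmod (\<delta> n $ j))\<bar> \<le> R
     \<and> (\<forall>k. k \<noteq> j \<longrightarrow> k \<noteq> q \<longrightarrow> \<bar>ln (g $ k)\<bar> \<le> R)" for n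
    using R(2)[of j q "- ln (cmod (\<delta> n $ j))"] q by auto
  then obtain g where g: "\<And>n. g n \<in> G" "\<And>n. \<bar>ln (g n $ j) + ln (cmod (\<delta> n $ j))\<bar> \<le> R"
     "\<And>n. \<bar>ln (g n $ q) - ln (cmod (\<delta> n $ j))\<bar> \<le> R"
     "\<And>n k. k \<noteq> j \<Longrightarrow> k \<noteq> q \<Longrightarrow> \<bar>ln (g n $ k)\<bar> \<le> R" by metis
  have gq: "ln (g n $ k) \<le> R" if "n \<ge> n0" "k \<noteq> j" for n k
  proof (cases "k = q")
    case True
    have "ln (cmod (\<delta> n $ j)) \<le> 0" using n0[OF that(1)] nz[of n] by simp
    then show ?thesis using g(3)[of n] True by simp
  next
    case False
    then show ?thesis using g(4)[of k n] that by simp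
  qed
  have gC: "g n $ k \<le> exp R" if "n \<ge> n0" "k \<noteq> j" for n k
    using gq[OF that] pos[OF g(1), of n k] by (metis exp_le_cancel_iff exp_ln)
  let ?z = "\<lambda>n. complex_of_real (g n $ j) * \<delta> n $ j"
  have lnz: "\<bar>ln (cmod (?z n))\<bar> \<le> R" for n
    using g(2)[of n] pos[OF g(1), of n j] nz[of n] by (simp add: norm_mult ln_mult_pos)
  have zb: "cmod (?z n) \<le> exp R" "cmod (?z n) \<ge> exp (- R)" for n
  proof -
    have p: "cmod (?z n) > 0" using nz[of n] nonzero[OF g(1), of n j] by simp
    have "ln (cmod (?z n)) \<le> R" "- R \<le> ln (cmod (?z n))" using lnz[of n] by linarith+
    then have "exp (ln (cmod (?z n))) \<le> exp R" "exp (- R) \<le> exp (ln (cmod (?z n)))" by simp_all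
    then show "cmod (?z n) \<le> exp R" "cmod (?z n) \<ge> exp (- R)" by (simp_all only: exp_ln[OF p])
  qed
  let ?f = "\<lambda>n. (?z (n + n0), ln (g (n + n0) $ i))"
  have "norm (?f n) \<le> exp R + R" for n
    using norm_Pair_le[of "?z (n + n0)" "ln (g (n + n0) $ i)"] zb(1)[of "n + n0"] g(4)[of i "n + n0"] ij q(1)
    by (smt (verit) real_norm_def)
  then obtain r x where r: "strict_mono r" "(\<lambda>n. ?f (r n)) \<longlonglongrightarrow> x"
    by (rule bounded_subsequence[of ?f])
  have l1: "(\<lambda>n. ?z (r n + n0)) \<longlonglongrightarrow> fst x" and l2: "(\<lambda>n. ln (g (r n + n0) $ i)) \<longlonglongrightarrow> snd x"
    using tendsto_fst[OF r(2)] tendsto_snd[OF r(2)] by auto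
  have "exp (- R) \<le> cmod (fst x)"
    by (rule LIMSEQ_le_const[OF tendsto_norm[OF l1]]) (use zb(2) in blast)
  then have x0: "fst x \<noteq> 0" by auto
  have "(\<lambda>n. cvec (g (r n + n0)) * \<delta> (r n + n0)) \<longlonglongrightarrow> axis j (fst x)"
  proof (rule vec_tendstoI)
    fix k
    show "(\<lambda>n. (cvec (g (r n + n0)) * \<delta> (r n + n0)) $ k) \<longlonglongrightarrow> axis j (fst x) $ k"
    proof (cases "k = j")
      case True then show ?thesis using l1 by (simp add: axis_def)
    next
      case False
      have "strict_mono (\<lambda>n. r n + n0)" using r(1) by (simp add: strict_mono_def)
      from LIMSEQ_subseq_LIMSEQ[OF lim_nth this]
      have "(\<lambda>n. \<delta> (r n + n0) $ k) \<longlonglongrightarrow> 0" by (simp add: o_def)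
      then have "(\<lambda>n. exp R * norm (\<delta> (r n + n0) $ k)) \<longlonglongrightarrow> 0"
        by (intro tendsto_mult_right_zero tendsto_norm_zero)
      moreover have "norm ((cvec (g (r n + n0)) * \<delta> (r n + n0)) $ k) \<le> exp R * norm (\<delta> (r n + n0) $ k)" for n
        using gC[of "r n + n0" k] False pos[OF g(1), of "r n + n0" k]
        by (simp add: norm_mult mult_right_mono)
      ultimately have "(\<lambda>n. (cvec (g (r n + n0)) * \<delta> (r n + n0)) $ k) \<longlonglongrightarrow> 0"
        by (rule Lim_null_comparison[OF always_eventually, OF allI, rotated])
      then show ?thesis using False by (simp add: axis_def)
    qed
  qed
  moreover have "strict_mono (\<lambda>n. r n + n0)" using r(1) by (simp add: strict_mono_def)
  ultimately show ?thesis
    using that[of "\<lambda>n. g (r n + n0)" "\<lambda>n. r n + n0" "fst x" "snd x" "exp R"] g(1) x0 l2 gC by simp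
qed

text \<open>Powers multiply the logarithms by \<open>N\<close>, so only the covering radius changes.
  This allows passing to units that fix a given torsion point.\<close>

lemma powers:
  assumes "N > 0"
  shows "unit_group ((\<lambda>u. u ^ N) ` G)"
proof (rule unit_group.intro, goal_cases)
  case 1
  have "1 = (1::real^'s) ^ N" by simp
  then show ?case using one by blast
next
  case (2 u w)
  then obtain a b where "a \<in> G" "b \<in> G" "u = a ^ N" "w = b ^ N" by auto
  then show ?case using mult[of a b] by (auto simp: power_mult_distrib[symmetric])
next
  case (3 u)
  then obtain a where a: "a \<in> G" "u = a ^ N" by auto
  then have "vinv u = (vinv a) ^ N" by (simp add: vec_eq_iff power_inverse)
  then show ?case using inv a(1) by blast
next
  case (4 u i)
  then show ?case using pos by auto
next
  case (5 u)
  then show ?case using prod1 by (auto simp: prod_power_distrib[symmetric])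
next
  case (6 u i)
  then obtain a where a: "a \<in> G" "u = a ^ N" by auto
  then have "(a $ i) ^ N = 1" using 6 by simp
  then have "a $ i = 1" using pos[OF a(1), of i] assms power_eq_iff_eq_base[of N "a $ i" 1] by simp
  then show ?case using inj[OF a(1), of i] a(2) by simp
next
  case 7
  obtain R where R: "R > 0" "\<And>h::real^'s. (\<Sum>i\<in>UNIV. h $ i) = 0 \<Longrightarrow> \<exists>u\<in>G. \<forall>i. \<bar>ln (u $ i) - h $ i\<bar> \<le> R"
    using log_radius by metis
  have "\<exists>u\<in>(\<lambda>u. u ^ N) ` G. \<forall>i. \<bar>ln (u $ i) - h $ i\<bar> \<le> real N * R" if h: "(\<Sum>i\<in>UNIV. h $ i) = 0" for h :: "real^'s"
  proof -
    let ?h = "(1 / real N) *\<^sub>R h"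
    have "(\<Sum>i\<in>UNIV. ?h $ i) = 0" using h by (simp add: sum_divide_distrib[symmetric])
    from R(2)[OF this] obtain u where u: "u \<in> G" "\<And>i. \<bar>ln (u $ i) - ?h $ i\<bar> \<le> R" by blast
    have "\<bar>ln ((u ^ N) $ i) - h $ i\<bar> \<le> real N * R" for i
    proof -
      have "ln ((u ^ N) $ i) - h $ i = real N * (ln (u $ i) - ?h $ i)"
        using assms by (simp only: ln_power[OF u(1)]) (simp add: field_simps)
      then show ?thesis using u(2)[of i] by (simp add: abs_mult mult_left_mono)
    qed
    then show ?thesis using u(1) by blast
  qed
  then show ?case by blast
next
  case 8
  show ?case by (rule card4)
qed

lemma powers_subset: "(\<lambda>u. u ^ N) ` G \<subseteq> G"
  by (intro image_subsetI power)

end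


section \<open>Invariant closed sets in a solenoidal cylinder\<close>

lemma norm_vec_mult_le:
  fixes x y :: "('a::real_normed_algebra) ^ 's::finite"
  shows "norm (x * y) \<le> norm x * norm y"
proof -
  have "norm (x * y) \<le> norm (norm x *\<^sub>R y)"
  proof (rule norm_le_componentwise_cart)
    fix i
    have "norm ((x * y) $ i) \<le> norm (x $ i) * norm (y $ i)" by (simp add: norm_mult_ineq)
    also have "\<dots> \<le> norm x * norm (y $ i)" by (intro mult_right_mono Finite_Cartesian_Product.norm_nth_le) auto
    finally show "norm ((x * y) $ i) \<le> norm ((norm x *\<^sub>R y) $ i)" by simp
  qed
  then show ?thesis by simp
qed

lemma (in unit_group) expand_seq_real:
  fixes \<delta> :: "nat \<Rightarrow> real ^ 's"
  assumes ij: "i \<noteq> j" and lim: "\<delta> \<longlonglongrightarrow> 0" and nz: "\<And>n. \<delta> n $ j \<noteq> 0"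
  obtains g r a l C where "\<And>n. g n \<in> G" "strict_mono r" "a \<noteq> 0"
    "(\<lambda>n. g n * \<delta> (r n)) \<longlonglongrightarrow> axis j a" "(\<lambda>n. ln (g n $ i)) \<longlonglongrightarrow> l"
    "\<And>n k. k \<noteq> j \<Longrightarrow> g n $ k \<le> C" "C > 0"
proof -
  have 1: "(\<lambda>n. cvec (\<delta> n)) \<longlonglongrightarrow> 0" using tendsto_cvec[OF lim] by (simp add: cvec_simps)
  have 2: "cvec (\<delta> n) $ j \<noteq> 0" for n using nz by simp
  obtain g r a l C where g: "\<And>n. g n \<in> G" "strict_mono r" "a \<noteq> 0"
    "(\<lambda>n. cvec (g n) * cvec (\<delta> (r n))) \<longlonglongrightarrow> axis j a" "(\<lambda>n. ln (g n $ i)) \<longlonglongrightarrow> l"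
    "\<And>n k. k \<noteq> j \<Longrightarrow> g n $ k \<le> C" "C > 0"
    by (rule expand_seq[OF ij 1 2]) blast
  have nth: "(\<lambda>n. complex_of_real ((g n * \<delta> (r n)) $ k)) \<longlonglongrightarrow> axis j a $ k" for k
    using tendsto_vec_nth[OF g(4), of k] by simp
  have re: "(\<lambda>n. (g n * \<delta> (r n)) $ k) \<longlonglongrightarrow> Re (axis j a $ k)" for k
    using tendsto_Re[OF nth[of k]] by simp
  have "(\<lambda>n. 0) \<longlonglongrightarrow> Im a" using tendsto_Im[OF nth[of j]] by (simp add: axis_def)
  then have "Im a = 0" using LIMSEQ_unique tendsto_const by blast
  then have "Re a \<noteq> 0" using g(3) by (simp add: complex_eq_iff)
  moreover have "(\<lambda>n. g n * \<delta> (r n)) \<longlonglongrightarrow> axis j (Re a)"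
  proof (rule vec_tendstoI)
    fix k show "(\<lambda>n. (g n * \<delta> (r n)) $ k) \<longlonglongrightarrow> axis j (Re a) $ k"
      using re[of k] by (auto simp: axis_def)
  qed
  ultimately show ?thesis using that[of g r "Re a" l C] g by blast
qed

text \<open>
  The diagonal group \<open>G\<close> acts on the cylinder over the torus by acting on the torus and translating
  the second coordinate by the logarithm of the \<open>i\<close>-th entry.
\<close>

definition cylinder :: "(real^'s) set \<Rightarrow> (real^'s) set \<Rightarrow> 's::finite \<Rightarrow> ((real^'s) \<times> real) set \<Rightarrow> bool" where
  "cylinder G I i P \<longleftrightarrow> closed P \<and> (\<forall>p t a. (p, t) \<in> P \<longrightarrow> a \<in> I \<longrightarrow> (p + a, t) \<in> P) \<and>
     (\<forall>p t u. (p, t) \<in> P \<longrightarrow> u \<in> G \<longrightarrow> (u * p, t + ln (u $ i)) \<in> P)"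

lemma cylinderD:
  assumes "cylinder G I i P"
  shows "closed P" "(p, t) \<in> P \<Longrightarrow> a \<in> I \<Longrightarrow> (p + a, t) \<in> P"
    "(p, t) \<in> P \<Longrightarrow> u \<in> G \<Longrightarrow> (u * p, t + ln (u $ i)) \<in> P"
  using assms unfolding cylinder_def by blast+

locale unit_lattice = unit_group G + lattice_in I for G :: "(real ^ 's::finite) set" and I :: "(real^'s) set" +
  assumes act: "u \<in> G \<Longrightarrow> a \<in> I \<Longrightarrow> u * a \<in> I"
begin

lemma act_iff: "u \<in> G \<Longrightarrow> u * a \<in> I \<longleftrightarrow> a \<in> I"
  using act[of u a] act[OF inv, of u "u * a"] mult_vinv[of u] by (auto simp: mult.assoc[symmetric])

lemma powers_lattice: "N > 0 \<Longrightarrow> unit_lattice ((\<lambda>u. u ^ N) ` G) I"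
  using powers[of N] lattice_in_axioms act power
  by (auto simp: unit_lattice_def unit_lattice_axioms_def)

text \<open>Multiplication by a unit is a lattice automorphism, and \<open>torsion_fixed\<close> is
  uniform in it. So a group of powers fixes the class of a torsion point \<open>r\<close>, and an
  invariant set translated by \<open>r\<close> stays invariant under these powers.\<close>

lemma unit_power_fixes_torsion:
  fixes q :: nat
  assumes "q > 0"
  shows "\<exists>N>0. \<forall>u\<in>G. \<forall>x. real q *\<^sub>R x \<in> I \<longrightarrow> u ^ N * x - x \<in> I"
proof -
  obtain N where N: "N > 0" "\<And>f x. (\<forall>x y. f (x - y) = f x - f y) \<Longrightarrow> (\<forall>x c. f (c *\<^sub>R x) = c *\<^sub>R f x) \<Longrightarrow>
    (\<forall>x. f x \<in> I \<longleftrightarrow> x \<in> I) \<Longrightarrow> real q *\<^sub>R x \<in> I \<Longrightarrow> (f ^^ N) x - x \<in> I"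
    using torsion_fixed[OF assms] by blast
  have "((*) u ^^ n) y = u ^ n * y" for u y :: "real^'s" and n
    by (induction n) (auto simp: mult.assoc)
  then have "u ^ N * x - x \<in> I" if "u \<in> G" "real q *\<^sub>R x \<in> I" for u x
    using N(2)[of "(*) u" x] that by (simp add: right_diff_distrib act_iff)
  then show ?thesis using N(1) by blast
qed

text \<open>No entry of \<open>u - w\<close> is 0, so multiplication by it maps the lattice onto a
  cocompact sublattice. A multiple of \<open>(u - w) * y\<close> lies there, and the factor
  cancels.\<close>

lemma torsion_divide:
  assumes u: "u \<in> G" "w \<in> G" "u \<noteq> w" and y: "(u - w) * y \<in> I"
  shows "torsion y"
proof -
  let ?b = "u - w"
  have nz: "?b $ k \<noteq> 0" for k using inj2[OF u(1,2), of k] u(3) by auto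
  obtain C where C: "C > 0" "\<And>x. \<exists>a\<in>I. norm (x - a) \<le> C" using radius by metis
  have "\<exists>n::nat. n > 0 \<and> real n *\<^sub>R (?b * y) \<in> (\<lambda>a. ?b * a) ` I"
  proof (rule torsion_sublattice[where C = "norm ?b * C"])
    show "a - b \<in> (\<lambda>a. ?b * a) ` I" if ab: "a \<in> (\<lambda>a. ?b * a) ` I" "b \<in> (\<lambda>a. ?b * a) ` I" for a b
    proof -
      obtain a' b' where "a' \<in> I" "b' \<in> I" "a = ?b * a'" "b = ?b * b'" using ab by blast
      then show ?thesis using diff[of a' b'] by (intro image_eqI[of _ _ "a' - b'"]) (auto simp: right_diff_distrib)
    qed
    show "(\<lambda>a. ?b * a) ` I \<subseteq> I"
      using act u diff by (auto simp: left_diff_distrib)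
    show "\<exists>a\<in>(\<lambda>a. ?b * a) ` I. norm (x - a) \<le> norm ?b * C" for x
    proof -
      let ?x = "vinv ?b * x"
      obtain a where a: "a \<in> I" "norm (?x - a) \<le> C" using C(2) by blast
      have "?b * vinv ?b = 1" using nz by (simp add: vec_eq_iff)
      then have "x - ?b * a = ?b * (?x - a)" by (simp only: right_diff_distrib mult.assoc[symmetric] mult_1_left)
      then have "norm (x - ?b * a) \<le> norm ?b * norm (?x - a)" by (simp only: norm_vec_mult_le)
      also have "\<dots> \<le> norm ?b * C" using a(2) by (intro mult_left_mono) auto
      finally show ?thesis using a(1) by blast
    qed
    show "?b * y \<in> I" by (rule y)
  qed
  then obtain n :: nat and a where n: "n > 0" "a \<in> I" "real n *\<^sub>R (?b * y) = ?b * a" by blast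
  have "real n *\<^sub>R y = a"
    unfolding vec_eq_iff
  proof
    fix k
    have "(real n *\<^sub>R (?b * y)) $ k = (?b * a) $ k" using n(3) by simp
    then show "(real n *\<^sub>R y) $ k = a $ k" using nz[of k] by simp
  qed
  then show ?thesis using n unfolding torsion_def by blast
qed

text \<open>A lattice approximation of \<open>vinv g * x\<close> is multiplied by a unit
  \<open>g\<close> that contracts all directions but \<open>i\<close>. The error becomes small
  except in direction \<open>i\<close>, where it is written as a multiple of
  \<open>b\<close>.\<close>

lemma half_line_approx:
  assumes b: "b \<noteq> 0" and e: "e > 0"
  shows "\<exists>a\<in>I. \<exists>t>0. norm (x - (a + axis i (t * b))) < e"
proof -
  obtain C where C: "C > 0" "\<And>x. \<exists>a\<in>I. norm (x - a) \<le> C" using radius by metis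
  define \<eta> where "\<eta> = e / (2 * C * real CARD('s))"
  have \<eta>: "\<eta> > 0" using e C(1) by (simp add: \<eta>_def)
  obtain g where g: "g \<in> G" and gk: "\<And>k. k \<noteq> i \<Longrightarrow> g $ k \<le> \<eta>" using contraction[OF \<eta>] by blast
  \<comment> \<open>The target is displaced by \<open>2 * C\<close> towards the sign of
    \<open>b\<close>, so the error in direction \<open>i\<close> has that sign and \<open>t\<close>
    comes out positive.\<close>
  obtain m where m: "m \<in> I" "norm (vinv g * x - axis i (2 * C * sgn b) - m) \<le> C" using C(2) by blast
  let ?y = "vinv g * x - m"
  have xa: "x - g * m = g * ?y"
    using mult_vinv[OF g(1)] by (simp add: right_diff_distrib mult.assoc[symmetric])
  have yk: "\<bar>?y $ k - (axis i (2 * C * sgn b)) $ k\<bar> \<le> C" for k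
    using Finite_Cartesian_Product.norm_nth_le[of "vinv g * x - axis i (2 * C * sgn b) - m" k] m(2) by simp
  define t where "t = g $ i * ?y $ i / b"
  have "\<bar>?y $ i - 2 * C * sgn b\<bar> \<le> C" using yk[of i] by simp
  then have "?y $ i / b > 0"
    using C(1) b by (cases "b > 0") (auto simp: zero_less_divide_iff sgn_if abs_le_iff)
  then have t: "t > 0" unfolding t_def using pos[OF g(1), of i] by (metis mult_pos_pos times_divide_eq_right)
  have "norm (x - (g * m + axis i (t * b))) \<le> (\<Sum>k\<in>UNIV. \<bar>(x - (g * m + axis i (t * b))) $ k\<bar>)"
    by (rule norm_le_l1_cart)
  also have "\<dots> \<le> (\<Sum>k\<in>(UNIV::'s set). \<eta> * C)"
  proof (rule sum_mono)
    fix k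
    have "(x - (g * m + axis i (t * b))) $ k = (g * ?y) $ k - axis i (t * b) $ k"
      using xa by (metis diff_diff_eq vector_minus_component)
    also have "\<bar>\<dots>\<bar> \<le> \<eta> * C"
    proof (cases "k = i")
      case True then show ?thesis using b \<eta> C(1) by (simp add: t_def)
    next
      case False
      have "\<bar>(g * ?y) $ k\<bar> = g $ k * \<bar>?y $ k\<bar>" using pos[OF g(1), of k] by (simp add: abs_mult)
      also have "\<dots> \<le> \<eta> * C"
        using gk[OF False] yk[of k] False pos[OF g(1), of k] C(1) \<eta> by (intro mult_mono) (auto simp: axis_def)
      finally show ?thesis using False by (simp add: axis_def)
    qed
    finally show "\<bar>(x - (g * m + axis i (t * b))) $ k\<bar> \<le> \<eta> * C" .
  qed
  also have "\<dots> = e / 2" using C(1) by (simp add: \<eta>_def)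
  also have "\<dots> < e" using e by simp
  finally show ?thesis using act[OF g(1) m(1)] t by blast
qed

lemma closed_half_line:
  assumes X: "closed X" "\<And>x a. x \<in> X \<Longrightarrow> a \<in> I \<Longrightarrow> x + a \<in> X"
    and line: "\<And>t. t > 0 \<Longrightarrow> y + axis i (t * b) \<in> X" and b: "b \<noteq> 0"
  shows "x \<in> X"
proof -
  have "\<exists>z\<in>X. dist z x < e" if e: "e > 0" for e
  proof -
    obtain a t where at: "a \<in> I" "t > 0" "norm (x - y - (a + axis i (t * b))) < e"
      using half_line_approx[OF b e] by blast
    have "y + axis i (t * b) + a \<in> X" using X(2) line at by blast
    moreover have "dist (y + axis i (t * b) + a) x < e"
      using at(3) by (simp add: dist_norm norm_minus_commute algebra_simps)
    ultimately show ?thesis by blast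
  qed
  then have "x \<in> closure X" by (simp add: closure_approachable)
  then show ?thesis using X(1) by simp
qed

text \<open>
  Units with bounded \<open>i\<close>-th entry, moved a little along the line of
  \<open>two_coordinate_line\<close>, produce long segments in direction \<open>j\<close>.
\<close>

lemma cylinder_full_slice:
  assumes Q: "cylinder G I i Q" and a: "(axis j a, t0) \<in> Q" "a \<noteq> 0" and ij: "i \<noteq> j"
  shows "\<exists>t. \<forall>d. (d, t) \<in> Q"
proof -
  obtain \<alpha> where \<alpha>: "\<And>t e. e > 0 \<Longrightarrow> (\<exists>u\<in>G. \<bar>ln (u $ i) - \<alpha> * t\<bar> < e \<and> \<bar>ln (u $ j) - t\<bar> < e)"
    using two_coordinate_line[OF ij] by blast
  \<comment> \<open>Units whose logarithms approach the point \<open>(\<alpha> * t, t)\<close> of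
    the line give a curve in \<open>Q\<close> along which the height is known.\<close>
  have step1: "(axis j (exp t * a), t0 + \<alpha> * t) \<in> Q" for t
  proof -
    have "\<exists>u. u \<in> G \<and> \<bar>ln (u $ i) - \<alpha> * t\<bar> < inverse (real (Suc n)) \<and> \<bar>ln (u $ j) - t\<bar> < inverse (real (Suc n))" for n
      using \<alpha>[of "inverse (real (Suc n))" t] by auto
    then obtain u where u: "\<And>n. u n \<in> G" "\<And>n. \<bar>ln (u n $ i) - \<alpha> * t\<bar> < inverse (real (Suc n))"
      "\<And>n. \<bar>ln (u n $ j) - t\<bar> < inverse (real (Suc n))" by metis
    have "(\<lambda>n. ln (u n $ i) - \<alpha> * t) \<longlonglongrightarrow> 0" "(\<lambda>n. ln (u n $ j) - t) \<longlonglongrightarrow> 0"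
      using u(2,3) by (auto intro!: Lim_null_comparison[OF always_eventually LIMSEQ_inverse_real_of_nat] simp: less_imp_le)
    then have l: "(\<lambda>n. ln (u n $ i)) \<longlonglongrightarrow> \<alpha> * t" "(\<lambda>n. ln (u n $ j)) \<longlonglongrightarrow> t" by (simp_all add: LIM_zero_iff)
    have e: "exp (ln (u n $ j)) = u n $ j" for n using pos[OF u(1)] by simp
    have "(\<lambda>n. u n $ j) \<longlonglongrightarrow> exp t" using tendsto_exp[OF l(2)] by (simp only: e)
    then have "(\<lambda>n. (axis j (u n $ j * a), t0 + ln (u n $ i))) \<longlonglongrightarrow> (axis j (exp t * a), t0 + \<alpha> * t)"
      by (intro tendsto_Pair vec_tendstoI) (auto simp: axis_def intro!: tendsto_intros l)
    moreover have "(axis j (u n $ j * a), t0 + ln (u n $ i)) \<in> Q" for n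
      using cylinderD(3)[OF Q a(1) u(1)[of n]] by (simp only: axis_mult)
    ultimately show ?thesis by (rule closed_sequentially[OF cylinderD(1)[OF Q], rotated])
  qed
  obtain R where R: "R > 0" "\<And>p q T. p \<noteq> q \<Longrightarrow> \<exists>g\<in>G. \<bar>ln (g $ p) - T\<bar> \<le> R \<and> \<bar>ln (g $ q) + T\<bar> \<le> R \<and> (\<forall>k. k \<noteq> p \<longrightarrow> k \<noteq> q \<longrightarrow> \<bar>ln (g $ k)\<bar> \<le> R)"
    using two_point by metis
  obtain q where q: "q \<noteq> i" "q \<noteq> j" using third_index[of i j i] by blast
  \<comment> \<open>Units that grow like n at \<open>j\<close> and stay bounded at \<open>i\<close>;
    the compensation takes place at \<open>q\<close>.\<close>
  have "\<exists>g. g \<in> G \<and> \<bar>ln (g $ j) - ln (real (Suc n))\<bar> \<le> R \<and> \<bar>ln (g $ i)\<bar> \<le> R" for n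
    using R(2)[of j q "ln (real (Suc n))"] q ij by auto
  then obtain g where g: "\<And>n. g n \<in> G" "\<And>n. \<bar>ln (g n $ j) - ln (real (Suc n))\<bar> \<le> R"
    "\<And>n. \<bar>ln (g n $ i)\<bar> \<le> R" by metis
  define A where "A n = g n $ j * a" for n
  have A0: "A n \<noteq> 0" for n using a(2) nonzero[OF g(1)] by (simp add: A_def)
  have Ainv: "(\<lambda>n. x / A n) \<longlonglongrightarrow> 0" for x
  proof (rule Lim_null_comparison[OF always_eventually])
    show "\<forall>n. norm (x / A n) \<le> \<bar>x / a\<bar> * exp R * inverse (real (Suc n))"
    proof
      fix n
      have "ln (real (Suc n)) - R \<le> ln (g n $ j)" using g(2)[of n] by linarith
      then have "exp (ln (real (Suc n)) - R) \<le> g n $ j" using pos[OF g(1), of n j] by (metis exp_le_cancel_iff exp_ln)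
      then have "real (Suc n) / exp R \<le> g n $ j" by (simp add: exp_diff)
      then have "inverse (g n $ j) \<le> exp R * inverse (real (Suc n))"
        using pos[OF g(1), of n j] by (simp add: field_simps)
      then have "\<bar>x / a\<bar> * inverse (g n $ j) \<le> \<bar>x / a\<bar> * (exp R * inverse (real (Suc n)))" by (intro mult_left_mono) auto
      then show "norm (x / A n) \<le> \<bar>x / a\<bar> * exp R * inverse (real (Suc n))"
        using pos[OF g(1), of n j] by (simp add: A_def abs_mult divide_inverse mult_ac)
    qed
    show "(\<lambda>n. \<bar>x / a\<bar> * exp R * inverse (real (Suc n))) \<longlonglongrightarrow> 0"
      by (rule tendsto_mult_right_zero[OF LIMSEQ_inverse_real_of_nat])
  qed
  obtain b r y where b: "\<And>n. b n \<in> I" "strict_mono r" "(\<lambda>n. axis j (A (r n)) - b n) \<longlonglongrightarrow> y"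
    by (rule reduce_seq[of "\<lambda>n. axis j (A n)"]) blast
  have "norm (ln (g (r n) $ i)) \<le> R" for n using g(3) by simp
  then obtain r' l where r': "strict_mono r'" "(\<lambda>n. ln (g (r (r' n)) $ i)) \<longlonglongrightarrow> l"
    by (rule bounded_subsequence[of "\<lambda>n. ln (g (r n) $ i)"])
  define \<rho> where "\<rho> n = r (r' n)" for n
  have \<rho>: "strict_mono \<rho>" using b(2) r'(1) by (simp add: \<rho>_def strict_mono_def)
  have ylim: "(\<lambda>n. axis j (A (\<rho> n)) - b (r' n)) \<longlonglongrightarrow> y"
    using LIMSEQ_subseq_LIMSEQ[OF b(3) r'(1)] by (simp add: o_def \<rho>_def)
  \<comment> \<open>Moving the end point \<open>A\<close> of the long vector by \<open>x\<close>
    means multiplying it by \<open>1 + x / A\<close>, a factor tending to 1. By \<open>step1\<close>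
    this changes the height only by \<open>\<alpha> * ln (1 + x / A)\<close>, so in the limit a
    whole line lies at a single height.\<close>
  have seg: "(y + axis j x, t0 + l) \<in> Q" for x
  proof -
    have xA: "(\<lambda>n. x / A (\<rho> n)) \<longlonglongrightarrow> 0" using LIMSEQ_subseq_LIMSEQ[OF Ainv \<rho>] by (simp add: o_def)
    have ev: "\<forall>\<^sub>F n in sequentially. \<bar>x / A (\<rho> n)\<bar> < 1"
      using tendstoD[OF xA, of 1] by simp
    have l1: "(\<lambda>n. ln (1 + x / A (\<rho> n))) \<longlonglongrightarrow> 0"
      using tendsto_ln[OF tendsto_add[OF tendsto_const xA, of 1]] by simp
    have "\<forall>\<^sub>F n in sequentially. (axis j (A (\<rho> n)) - b (r' n) + axis j x, t0 + \<alpha> * ln (1 + x / A (\<rho> n)) + ln (g (\<rho> n) $ i)) \<in> Q"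
      using ev
    proof eventually_elim
      case (elim n)
      let ?t = "ln (1 + x / A (\<rho> n))"
      have "exp ?t = 1 + x / A (\<rho> n)" using elim by (intro exp_ln) linarith
      then have eq: "g (\<rho> n) $ j * (exp ?t * a) = A (\<rho> n) + x" using A0[of "\<rho> n"] by (simp add: A_def algebra_simps)
      have "(g (\<rho> n) * axis j (exp ?t * a) + (- b (r' n)), t0 + \<alpha> * ?t + ln (g (\<rho> n) $ i)) \<in> Q"
        by (intro cylinderD(2)[OF Q] cylinderD(3)[OF Q] step1 g(1) uminus b(1))
      also have "g (\<rho> n) * axis j (exp ?t * a) = axis j (A (\<rho> n)) + axis j x"
        unfolding axis_mult eq by (simp add: axis_def vec_eq_iff)
      finally show ?case by (simp add: algebra_simps)
    qed
    moreover have "(\<lambda>n. (axis j (A (\<rho> n)) - b (r' n) + axis j x, t0 + \<alpha> * ln (1 + x / A (\<rho> n)) + ln (g (\<rho> n) $ i)))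
       \<longlonglongrightarrow> (y + axis j x, t0 + \<alpha> * 0 + l)"
      by (intro tendsto_intros ylim l1 r'(2)[folded \<rho>_def])
    ultimately show ?thesis using Lim_in_closed_set[OF cylinderD(1)[OF Q]] by fastforce
  qed
  have "d \<in> {d. (d, t0 + l) \<in> Q}" for d
  proof (rule closed_half_line[where y = y and i = j and b = 1])
    have "closed ((\<lambda>d. (d, t0 + l)) -` Q)"
      by (intro closed_vimage cylinderD(1)[OF Q] continuous_intros)
    then show "closed {d. (d, t0 + l) \<in> Q}" by (simp add: vimage_def)
  qed (use cylinderD(2)[OF Q] seg in auto)
  then show ?thesis by blast
qed

text \<open>The logarithms of the \<open>i\<close>-th entries are dense, so heights can be brought
  near 0. Hence all nonempty invariant sets meet one compact set, which yields the bounds of chains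
  in \<open>cylinder_minimal\<close>.\<close>

lemma cylinder_representative:
  assumes C: "\<And>x. \<exists>a\<in>I. norm (x - a) \<le> C" and P: "cylinder G I i P" "P \<noteq> {}"
  shows "\<exists>p t. (p, t) \<in> P \<and> norm p \<le> C \<and> \<bar>t\<bar> \<le> 1"
proof -
  obtain p t where pt: "(p, t) \<in> P" using P(2) by (metis equals0I surj_pair)
  obtain u where u: "u \<in> G" "\<bar>ln (u $ i) - (- t)\<bar> < 1" using log_dense[of 1 i "-t"] by auto
  obtain a where a: "a \<in> I" "norm (u * p - a) \<le> C" using C by blast
  have "(u * p + (- a), t + ln (u $ i)) \<in> P"
    by (intro cylinderD(2)[OF P(1)] cylinderD(3)[OF P(1)] pt u uminus a)
  then show ?thesis using a(2) u(2) by (intro exI[of _ "u * p - a"] exI[of _ "t + ln (u $ i)"]) auto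
qed

lemma cylinder_minimal:
  assumes P: "cylinder G I i P" "P \<noteq> {}"
  shows "\<exists>M\<subseteq>P. M \<noteq> {} \<and> cylinder G I i M \<and> (\<forall>M'. M' \<subseteq> M \<longrightarrow> M' \<noteq> {} \<longrightarrow> cylinder G I i M' \<longrightarrow> M' = M)"
proof -
  obtain C where C: "C > 0" "\<And>x. \<exists>a\<in>I. norm (x - a) \<le> C" using radius by metis
  let ?A = "{M. M \<subseteq> P \<and> M \<noteq> {} \<and> cylinder G I i M}"
  let ?K = "cball (0::real^'s) C \<times> cball (0::real) 1"
  have "\<exists>m\<in>?A. \<forall>a\<in>?A. a \<subseteq> m \<longrightarrow> a = m"
  proof (rule predicate_Zorn)
    show "partial_order_on ?A (relation_of (\<lambda>x y. y \<subseteq> x) ?A)"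
      by (rule partial_order_on_relation_ofI) auto
  next
    fix \<C> assume "\<C> \<in> Chains (relation_of (\<lambda>x y. y \<subseteq> x) ?A)"
    then have ch: "\<And>x. x \<in> \<C> \<Longrightarrow> x \<in> ?A" "\<And>x y. x \<in> \<C> \<Longrightarrow> y \<in> \<C> \<Longrightarrow> x \<subseteq> y \<or> y \<subseteq> x"
      unfolding Chains_def relation_of_def by auto
    show "\<exists>u\<in>?A. \<forall>a\<in>\<C>. u \<subseteq> a"
    proof (cases "\<C> = {}")
      case True then show ?thesis using P by blast
    next
      case False
      have "\<Inter> ((\<lambda>M. M \<inter> ?K) ` \<C>) \<noteq> {}"
      proof (rule compact_chain)
        fix S assume "S \<in> (\<lambda>M. M \<inter> ?K) ` \<C>"
        then obtain M where M: "M \<in> \<C>" "S = M \<inter> ?K" by blast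
        have "closed M" using ch(1)[OF M(1)] cylinderD(1) by blast
        then show "compact S" unfolding M(2) by (intro closed_Int_compact compact_Times compact_cball)
      next
        show "{} \<notin> (\<lambda>M. M \<inter> ?K) ` \<C>"
        proof
          assume "{} \<in> (\<lambda>M. M \<inter> ?K) ` \<C>"
          then obtain M where M: "M \<in> \<C>" "M \<inter> ?K = {}" by blast
          then obtain p t where "(p, t) \<in> M" "norm p \<le> C" "\<bar>t\<bar> \<le> 1"
            using cylinder_representative[OF C(2), of i M] ch(1)[OF M(1)] by blast
          then show False using M(2) by auto
        qed
      next
        show "S \<subseteq> T \<or> T \<subseteq> S" if ST: "S \<in> (\<lambda>M. M \<inter> ?K) ` \<C> \<and> T \<in> (\<lambda>M. M \<inter> ?K) ` \<C>" for S T
        proof -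
          obtain M M' where "M \<in> \<C>" "M' \<in> \<C>" "S = M \<inter> ?K" "T = M' \<inter> ?K" using ST by blast
          then show ?thesis using ch(2)[of M M'] by auto
        qed
      qed
      then obtain x where "x \<in> \<Inter> ((\<lambda>M. M \<inter> ?K) ` \<C>)" by blast
      then have "x \<in> \<Inter> \<C>" by blast
      then have "\<Inter> \<C> \<noteq> {}" by blast
      moreover have "\<Inter> \<C> \<subseteq> P" using False ch(1) by blast
      moreover have "cylinder G I i (\<Inter> \<C>)"
        unfolding cylinder_def
      proof (intro conjI allI impI)
        show "closed (\<Inter> \<C>)" using ch(1) cylinderD(1) by (intro closed_Inter) blast
      next
        fix p t a assume "(p, t) \<in> \<Inter> \<C>" "a \<in> I"
        then show "(p + a, t) \<in> \<Inter> \<C>" using ch(1) cylinderD(2) by blast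
      next
        fix p t u assume "(p, t) \<in> \<Inter> \<C>" "u \<in> G"
        then show "(u * p, t + ln (u $ i)) \<in> \<Inter> \<C>" using ch(1) cylinderD(3) by blast
      qed
      ultimately show ?thesis by (intro bexI[of _ "\<Inter> \<C>"]) auto
    qed
  qed
  then obtain M where "M \<in> ?A" "\<forall>a\<in>?A. a \<subseteq> M \<longrightarrow> a = M" by blast
  then show ?thesis by (intro exI[of _ M]) blast
qed

text \<open>Differences are taken at equal heights, so that a unit moves both points to the same new
  height. Closedness holds because the base points can be reduced modulo the lattice.\<close>

lemma cylinder_differences:
  assumes M: "cylinder G I i M"
  shows "cylinder G I i {(d, t). \<exists>p. (p, t) \<in> M \<and> (p + d, t) \<in> M}" (is "cylinder G I i ?D")
  unfolding cylinder_def
proof (intro conjI allI impI)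
  show "closed ?D"
    unfolding closed_sequential_limits
  proof (intro allI impI, elim conjE)
    fix x l assume x: "\<forall>n. x n \<in> ?D" and l: "x \<longlonglongrightarrow> l"
    then have "\<forall>n. \<exists>p. (p, snd (x n)) \<in> M \<and> (p + fst (x n), snd (x n)) \<in> M" by (auto simp: case_prod_beta)
    then obtain p where p: "\<And>n. (p n, snd (x n)) \<in> M" "\<And>n. (p n + fst (x n), snd (x n)) \<in> M" by metis
    obtain b r y where b: "\<And>n. b n \<in> I" "strict_mono r" "(\<lambda>n. p (r n) - b n) \<longlonglongrightarrow> y"
      by (rule reduce_seq[of p]) blast
    have xr: "(\<lambda>n. x (r n)) \<longlonglongrightarrow> l" using LIMSEQ_subseq_LIMSEQ[OF l b(2)] by (simp add: o_def)
    note f = tendsto_fst[OF xr] and s = tendsto_snd[OF xr]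
    have "(p (r n) + (- b n), snd (x (r n))) \<in> M" for n
      by (intro cylinderD(2)[OF M] p uminus b)
    then have 1: "(p (r n) - b n, snd (x (r n))) \<in> M" for n by simp
    have "(p (r n) + fst (x (r n)) + (- b n), snd (x (r n))) \<in> M" for n
      by (intro cylinderD(2)[OF M] p uminus b)
    then have 2: "(p (r n) - b n + fst (x (r n)), snd (x (r n))) \<in> M" for n by (simp add: algebra_simps)
    have "(y, snd l) \<in> M"
      by (rule closed_sequentially[OF cylinderD(1)[OF M] 1 tendsto_Pair[OF b(3) s]])
    moreover have "(y + fst l, snd l) \<in> M"
      by (rule closed_sequentially[OF cylinderD(1)[OF M] 2 tendsto_Pair[OF tendsto_add[OF b(3) f] s]])
    ultimately show "l \<in> ?D" by (auto simp: case_prod_beta)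
  qed
next
  fix d t a assume "(d, t) \<in> ?D" "a \<in> I"
  then show "(d + a, t) \<in> ?D" using cylinderD(2)[OF M] by (auto simp: add.assoc[symmetric])
next
  fix d t u assume "(d, t) \<in> ?D" "u \<in> G"
  then obtain p where "(p, t) \<in> M" "(p + d, t) \<in> M" by blast
  then have "(u * p, t + ln (u $ i)) \<in> M" "(u * p + u * d, t + ln (u $ i)) \<in> M"
    using cylinderD(3)[OF M _ \<open>u \<in> G\<close>] by (auto simp: distrib_left[symmetric])
  then show "(u * d, t + ln (u $ i)) \<in> ?D" by blast
qed

text \<open>Units with convergent \<open>i\<close>-th logarithm bring images of one point close
  together, at heights with a common limit. A difference in direction \<open>i\<close> alone would
  lead to a torsion point excluded by \<open>H\<close>; so there is a component in another direction
  \<open>j\<close>, which is expanded while the heights still converge to one value.\<close>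

lemma cylinder_difference_limit:
  assumes M: "cylinder G I i M" "M \<noteq> {}"
    and H: "\<And>p t x. (p, t) \<in> M \<Longrightarrow> \<not> torsion (p - axis i x)"
  shows "\<exists>j a p t. j \<noteq> i \<and> a \<noteq> 0 \<and> (p, t) \<in> M \<and> (p + axis j a, t) \<in> M"
proof -
  obtain p0 t0 where p0: "(p0, t0) \<in> M" using M(2) by (metis equals0I surj_pair)
  obtain j0 where "i \<noteq> j0" using third_index[of i i i] by metis
  then obtain w x where w: "inj w" "\<And>n. w n \<in> G" "(\<lambda>n. (ln (w n $ i), ln (w n $ j0))) \<longlonglongrightarrow> x"
    by (rule bounded_pair_seq) blast
  have wl: "(\<lambda>n. ln (w n $ i)) \<longlonglongrightarrow> fst x" using tendsto_fst[OF w(3)] by simp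
  obtain b r z where b: "\<And>n. b n \<in> I" "strict_mono r" "(\<lambda>n. w (r n) * p0 - b n) \<longlonglongrightarrow> z"
    by (rule reduce_seq[of "\<lambda>n. w n * p0"]) blast
  define y where "y n = w (r n) * p0 - b n" for n
  define \<tau> where "\<tau> n = t0 + ln (w (r n) $ i)" for n
  define \<delta> where "\<delta> n = y (Suc n) - y n" for n
  have yM: "(y n, \<tau> n) \<in> M" for n
  proof -
    have "(w (r n) * p0 + (- b n), t0 + ln (w (r n) $ i)) \<in> M"
      by (intro cylinderD(2)[OF M(1)] cylinderD(3)[OF M(1)] p0 w uminus b)
    then show ?thesis by (simp add: y_def \<tau>_def)
  qed
  have ylim: "y \<longlonglongrightarrow> z" using b(3) by (simp only: y_def[symmetric])
  have \<tau>lim: "\<tau> \<longlonglongrightarrow> t0 + fst x"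
    unfolding \<tau>_def using LIMSEQ_subseq_LIMSEQ[OF wl b(2)] by (intro tendsto_intros) (simp add: o_def)
  have \<delta>lim: "\<delta> \<longlonglongrightarrow> 0"
    unfolding \<delta>_def using tendsto_diff[OF LIMSEQ_Suc[OF ylim] ylim] by simp
  have "\<exists>j. j \<noteq> i \<and> \<delta> n $ j \<noteq> 0" for n
  proof (rule ccontr)
    assume "\<not> ?thesis"
    then have \<delta>n: "\<delta> n = axis i (\<delta> n $ i)" by (auto simp: vec_eq_iff axis_def)
    let ?u = "w (r (Suc n))" and ?v = "w (r n)"
    have ne: "?u \<noteq> ?v" using w(1) b(2) by (simp add: inj_eq strict_mono_eq)
    have nz: "(?u - ?v) $ i \<noteq> 0" using inj2[OF w(2) w(2), of "r (Suc n)" i "r n"] ne by auto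
    \<comment> \<open>The shift of \<open>p0\<close> in direction \<open>i\<close> is the one that
      turns the difference of the two images into a lattice vector.\<close>
    have "(?u - ?v) * (p0 - axis i (\<delta> n $ i / (?u - ?v) $ i)) = (?u - ?v) * p0 - axis i (\<delta> n $ i)"
      using nz by (simp only: right_diff_distrib axis_mult) simp
    also have "\<dots> = (?u - ?v) * p0 - \<delta> n" using \<delta>n by simp
    also have "\<dots> = b (Suc n) - b n" by (simp add: \<delta>_def y_def algebra_simps)
    finally have "torsion (p0 - axis i (\<delta> n $ i / (?u - ?v) $ i))"
      using torsion_divide[OF w(2) w(2) ne] diff[OF b(1) b(1)] by metis
    then show False using H[OF p0] by blast
  qed
  then obtain J where J: "\<And>n. J n \<noteq> i" "\<And>n. \<delta> n $ J n \<noteq> 0" by metis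
  obtain j r' where r': "strict_mono r'" "\<And>n::nat. J (r' n) = j" using nat_pigeonhole_index[of J] by blast
  have ij: "i \<noteq> j" using J(1) r'(2) by metis
  have "(\<lambda>n. \<delta> (r' n)) \<longlonglongrightarrow> 0" using LIMSEQ_subseq_LIMSEQ[OF \<delta>lim r'(1)] by (simp add: o_def)
  moreover have "\<delta> (r' n) $ j \<noteq> 0" for n using J(2)[of "r' n"] r'(2) by simp
  ultimately obtain g s a l where g: "\<And>n. g n \<in> G" "strict_mono s" "a \<noteq> 0"
    "(\<lambda>n. g n * \<delta> (r' (s n))) \<longlonglongrightarrow> axis j a" "(\<lambda>n. ln (g n $ i)) \<longlonglongrightarrow> l"
    by (rule expand_seq_real[OF ij, of "\<lambda>n. \<delta> (r' n)"]) blast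
  define m where "m n = r' (s n)" for n
  have m: "strict_mono m" using r'(1) g(2) by (simp add: m_def strict_mono_def)
  obtain c r2 q where c: "\<And>n. c n \<in> I" "strict_mono r2" "(\<lambda>n. g (r2 n) * y (m (r2 n)) - c n) \<longlonglongrightarrow> q"
    by (rule reduce_seq[of "\<lambda>n. g n * y (m n)"]) blast
  let ?m = "\<lambda>n. m (r2 n)"
  have mm: "strict_mono ?m" using m c(2) by (simp add: strict_mono_def)
  have gl: "(\<lambda>n. ln (g (r2 n) $ i)) \<longlonglongrightarrow> l" using LIMSEQ_subseq_LIMSEQ[OF g(5) c(2)] by (simp add: o_def)
  have t1: "(\<lambda>n. \<tau> (?m n)) \<longlonglongrightarrow> t0 + fst x" using LIMSEQ_subseq_LIMSEQ[OF \<tau>lim mm] by (simp add: o_def)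
  have t2: "(\<lambda>n. \<tau> (Suc (?m n))) \<longlonglongrightarrow> t0 + fst x"
    using LIMSEQ_subseq_LIMSEQ[OF LIMSEQ_Suc[OF \<tau>lim] mm] by (simp add: o_def)
  have gd: "(\<lambda>n. g (r2 n) * \<delta> (?m n)) \<longlonglongrightarrow> axis j a"
    using LIMSEQ_subseq_LIMSEQ[OF g(4) c(2)] by (simp add: o_def m_def)
  have 1: "(g (r2 n) * y (?m n) - c n, \<tau> (?m n) + ln (g (r2 n) $ i)) \<in> M" for n
  proof -
    have "(g (r2 n) * y (?m n) + (- c n), \<tau> (?m n) + ln (g (r2 n) $ i)) \<in> M"
      by (intro cylinderD(2)[OF M(1)] cylinderD(3)[OF M(1)] yM g uminus c)
    then show ?thesis by simp
  qed
  have 2: "(g (r2 n) * y (?m n) - c n + g (r2 n) * \<delta> (?m n), \<tau> (Suc (?m n)) + ln (g (r2 n) $ i)) \<in> M" for n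
  proof -
    have "(g (r2 n) * y (Suc (?m n)) + (- c n), \<tau> (Suc (?m n)) + ln (g (r2 n) $ i)) \<in> M"
      by (intro cylinderD(2)[OF M(1)] cylinderD(3)[OF M(1)] yM g uminus c)
    moreover have "g (r2 n) * y (Suc (?m n)) + (- c n) = g (r2 n) * y (?m n) - c n + g (r2 n) * \<delta> (?m n)"
      by (simp add: \<delta>_def algebra_simps)
    ultimately show ?thesis by (simp only:)
  qed
  have "(q, t0 + fst x + l) \<in> M"
    by (rule closed_sequentially[OF cylinderD(1)[OF M(1)] 1 tendsto_Pair[OF c(3) tendsto_add[OF t1 gl]]])
  moreover have "(q + axis j a, t0 + fst x + l) \<in> M"
    by (rule closed_sequentially[OF cylinderD(1)[OF M(1)] 2 tendsto_Pair[OF tendsto_add[OF c(3) gd] tendsto_add[OF t2 gl]]])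
  ultimately show ?thesis using ij g(3)
    by (intro exI[of _ j] exI[of _ a] exI[of _ q] exI[of _ "t0 + fst x + l"]) auto
qed

text \<open>If the second alternative fails, consider a subset that is minimal for the powers of
  units fixing all points of order \<open>q\<close>. Its differences contain a full slice, so it
  meets its translate by any such point \<open>r\<close>; the intersection is invariant, and
  minimality makes the set invariant under \<open>r\<close>. These translations become dense as
  \<open>q\<close> grows, and a limit of the heights carries a full slice.\<close>

theorem cylinder_alternative:
  assumes P: "cylinder G I i P" "P \<noteq> {}"
  shows "(\<exists>t. \<forall>p. (p, t) \<in> P) \<or> (\<exists>p t x. (p, t) \<in> P \<and> torsion (p - axis i x))"
proof (rule ccontr)
  assume neg: "\<not> ?thesis"
  obtain C where C: "C > 0" "\<And>x. \<exists>a\<in>I. norm (x - a) \<le> C" using radius by metis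
  have "\<exists>p t. (p, t) \<in> P \<and> norm p \<le> C \<and> \<bar>t\<bar> \<le> 1 \<and> (\<forall>r. real q *\<^sub>R r \<in> I \<longrightarrow> (p + r, t) \<in> P)" if q: "q > 0" for q :: nat
  proof -
    obtain N where N: "N > 0" "\<And>u x. u \<in> G \<Longrightarrow> real q *\<^sub>R x \<in> I \<Longrightarrow> u ^ N * x - x \<in> I"
      using unit_power_fixes_torsion[OF q] by blast
    let ?G = "(\<lambda>u. u ^ N) ` G"
    interpret G': unit_lattice ?G I by (rule powers_lattice[OF N(1)])
    have "cylinder ?G I i P" using P(1) powers_subset[of N] unfolding cylinder_def by blast
    from G'.cylinder_minimal[OF this P(2)] obtain M where M: "M \<subseteq> P" "M \<noteq> {}" "cylinder ?G I i M"
      and min: "\<And>M'. M' \<subseteq> M \<Longrightarrow> M' \<noteq> {} \<Longrightarrow> cylinder ?G I i M' \<Longrightarrow> M' = M" by blast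
    have "\<exists>j a p t. j \<noteq> i \<and> a \<noteq> 0 \<and> (p, t) \<in> M \<and> (p + axis j a, t) \<in> M"
      by (rule G'.cylinder_difference_limit[OF M(3,2)]) (use neg M(1) in blast)
    then obtain j a p1 t1 where j: "i \<noteq> j" "a \<noteq> 0" "(p1, t1) \<in> M" "(p1 + axis j a, t1) \<in> M" by metis
    have "\<exists>t. \<forall>d. (d, t) \<in> {(d, t). \<exists>p. (p, t) \<in> M \<and> (p + d, t) \<in> M}"
      by (rule G'.cylinder_full_slice[OF G'.cylinder_differences[OF M(3)] _ j(2,1)]) (use j in blast)
    then obtain t where t: "\<And>d. \<exists>p. (p, t) \<in> M \<and> (p + d, t) \<in> M" by auto
    have inv: "(p + r, s) \<in> M" if ps: "(p, s) \<in> M" and r: "real q *\<^sub>R r \<in> I" for p s r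
    proof -
      let ?M = "{(p, t). (p, t) \<in> M \<and> (p + r, t) \<in> M}"
      have "?M = M"
      proof (rule min)
        show "?M \<noteq> {}" using t[of r] by blast
        show "cylinder ?G I i ?M"
          unfolding cylinder_def
        proof (intro conjI allI impI)
          have "closed (M \<inter> (\<lambda>x. x + (r, 0)) -` M)"
            by (intro closed_Int closed_vimage cylinderD(1)[OF M(3)] continuous_intros)
          moreover have "M \<inter> (\<lambda>x. x + (r, 0)) -` M = ?M" by auto
          ultimately show "closed ?M" by simp
        next
          fix p t a assume "(p, t) \<in> ?M" "a \<in> I"
          then have "(p + a, t) \<in> M" "(p + r + a, t) \<in> M" using cylinderD(2)[OF M(3)] by blast+
          then show "(p + a, t) \<in> ?M" by (simp add: add_ac)
        next
          fix p t u assume pt: "(p, t) \<in> ?M" and u: "u \<in> ?G"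
          obtain v where v: "v \<in> G" "u = v ^ N" using u by blast
          have "- (u * r - r) \<in> I" using uminus[OF N(2)[OF v(1) r]] v(2) by simp
          moreover have "(u * p, t + ln (u $ i)) \<in> M" "(u * (p + r), t + ln (u $ i)) \<in> M"
            using pt u by (auto intro: cylinderD(3)[OF M(3)])
          ultimately have "(u * p, t + ln (u $ i)) \<in> M" "(u * (p + r) + (- (u * r - r)), t + ln (u $ i)) \<in> M"
            by (auto intro: cylinderD(2)[OF M(3)] simp only:)
          then show "(u * p, t + ln (u $ i)) \<in> ?M" by (simp add: algebra_simps)
        qed
      qed auto
      then show ?thesis using ps by blast
    qed
    obtain p t where "(p, t) \<in> M" "norm p \<le> C" "\<bar>t\<bar> \<le> 1"
      using G'.cylinder_representative[OF C(2) M(3,2)] by blast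
    then show ?thesis using inv M(1) by blast
  qed
  then have "\<forall>n. \<exists>p t. (p, t) \<in> P \<and> norm p \<le> C \<and> \<bar>t\<bar> \<le> 1 \<and> (\<forall>r. real (Suc n) *\<^sub>R r \<in> I \<longrightarrow> (p + r, t) \<in> P)" by blast
  then obtain p t where pt: "\<And>n. norm (p n) \<le> C" "\<And>n. \<bar>t n\<bar> \<le> (1::real)"
    "\<And>n r. real (Suc n) *\<^sub>R r \<in> I \<Longrightarrow> (p n + r, t n) \<in> P" by metis
  have "norm (t n) \<le> 1" for n using pt(2) by simp
  then obtain \<rho> t' where \<rho>: "strict_mono \<rho>" "(\<lambda>n. t (\<rho> n)) \<longlonglongrightarrow> t'" by (rule bounded_subsequence[of t])
  have "(d, t') \<in> P" for d
  proof -
    have "\<exists>r. real (Suc n) *\<^sub>R r \<in> I \<and> norm (d - (p n + r)) \<le> C * inverse (real (Suc n))" for n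
    proof -
      obtain a where a: "a \<in> I" "norm (real (Suc n) *\<^sub>R (d - p n) - a) \<le> C" using C(2) by blast
      let ?r = "inverse (real (Suc n)) *\<^sub>R a"
      have "d - (p n + ?r) = inverse (real (Suc n)) *\<^sub>R (real (Suc n) *\<^sub>R (d - p n) - a)"
        by (simp add: scaleR_right_diff_distrib)
      then have "norm (d - (p n + ?r)) = inverse (real (Suc n)) * norm (real (Suc n) *\<^sub>R (d - p n) - a)"
        by (simp only: norm_scaleR) simp
      also have "\<dots> \<le> inverse (real (Suc n)) * C" using a(2) by (intro mult_left_mono) auto
      finally show ?thesis using a(1) by (intro exI[of _ ?r]) (auto simp: mult.commute)
    qed
    then obtain r where r: "\<And>n. real (Suc n) *\<^sub>R r n \<in> I" "\<And>n. norm (d - (p n + r n)) \<le> C * inverse (real (Suc n))" by metis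
    have "(\<lambda>n. d - (p n + r n)) \<longlonglongrightarrow> 0"
      by (rule Lim_null_comparison[OF always_eventually, OF allI, OF r(2)])
         (rule tendsto_mult_right_zero[OF LIMSEQ_inverse_real_of_nat])
    from tendsto_diff[OF tendsto_const this, of d] have "(\<lambda>n. p n + r n) \<longlonglongrightarrow> d" by simp
    then have "(\<lambda>n. p (\<rho> n) + r (\<rho> n)) \<longlonglongrightarrow> d" using LIMSEQ_subseq_LIMSEQ[OF _ \<rho>(1)] by (fastforce simp: o_def)
    then show ?thesis
      by (intro closed_sequentially[OF cylinderD(1)[OF P(1)] pt(3)[OF r(1)] tendsto_Pair[OF _ \<rho>(2)]])
  qed
  then show False using neg by blast
qed

end


section \<open>Closed invariant sets and the rigidity of real tori\<close>

definition real_invariant :: "(real^'s) set \<Rightarrow> (real^'s) set \<Rightarrow> (real^'s::finite) set \<Rightarrow> bool" where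
  "real_invariant G I X \<longleftrightarrow> closed X \<and> (\<forall>x\<in>X. \<forall>a\<in>I. x + a \<in> X) \<and> (\<forall>x\<in>X. \<forall>u\<in>G. u * x \<in> X)"

definition invariant :: "(real^'s) set \<Rightarrow> (complex^'s) set \<Rightarrow> (complex^'s::finite) set \<Rightarrow> bool" where
  "invariant G L X \<longleftrightarrow> closed X \<and> (\<forall>x\<in>X. \<forall>a\<in>L. x + a \<in> X) \<and> (\<forall>x\<in>X. \<forall>u\<in>G. cvec u * x \<in> X)"

lemma real_invariantD:
  assumes "real_invariant G I X"
  shows "closed X" "x \<in> X \<Longrightarrow> a \<in> I \<Longrightarrow> x + a \<in> X" "x \<in> X \<Longrightarrow> u \<in> G \<Longrightarrow> u * x \<in> X"
  using assms unfolding real_invariant_def by blast+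

lemma invariantD:
  assumes "invariant G L X"
  shows "closed X" "x \<in> X \<Longrightarrow> a \<in> L \<Longrightarrow> x + a \<in> X" "x \<in> X \<Longrightarrow> u \<in> G \<Longrightarrow> cvec u * x \<in> X"
  using assms unfolding invariant_def by blast+

lemma invariant_subset: "G' \<subseteq> G \<Longrightarrow> invariant G L X \<Longrightarrow> invariant G' L X"
  unfolding invariant_def by blast

text \<open>The \<open>j\<close>-th entries of units are dense in the positive reals. This turns
  invariance under units into invariance under positive scaling along a coordinate axis.\<close>

lemma (in unit_group) closed_coordinate_values:
  assumes S: "closed S" "\<And>u. u \<in> G \<Longrightarrow> u $ j \<in> S" and t: "t > 0"
  shows "t \<in> S"
proof -
  have "\<exists>u. u \<in> G \<and> \<bar>ln (u $ j) - ln t\<bar> < inverse (real (Suc n))" for n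
    using log_dense[of "inverse (real (Suc n))" j "ln t"] by auto
  then obtain u where u: "\<And>n. u n \<in> G" "\<And>n. \<bar>ln (u n $ j) - ln t\<bar> < inverse (real (Suc n))" by metis
  have "(\<lambda>n. ln (u n $ j) - ln t) \<longlonglongrightarrow> 0"
    using u(2) by (auto intro!: Lim_null_comparison[OF always_eventually LIMSEQ_inverse_real_of_nat] simp: less_imp_le)
  then have "(\<lambda>n. ln (u n $ j)) \<longlonglongrightarrow> ln t" by (simp add: LIM_zero_iff)
  from tendsto_exp[OF this] have "(\<lambda>n. u n $ j) \<longlonglongrightarrow> t" using pos[OF u(1)] t by simp
  then show ?thesis by (rule closed_sequentially[OF S(1) S(2)[OF u(1)]])
qed

lemma axis_tendsto [tendsto_intros]: "(f \<longlongrightarrow> a) F \<Longrightarrow> ((\<lambda>x. axis j (f x)) \<longlongrightarrow> axis j a) F"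
  by (rule vec_tendstoI) (auto simp: axis_def)

lemma axis_continuous [continuous_intros]:
  "continuous_on S f \<Longrightarrow> continuous_on S (\<lambda>x. axis j (f x))"
  unfolding continuous_on_def by (auto intro: tendsto_intros)

lemma axis_0 [simp]: "axis j 0 = 0"
  by (simp add: axis_def vec_eq_iff)

context unit_lattice
begin

text \<open>Units contract a vector vanishing at \<open>i\<close> below the isolation radius of
  0.\<close>

lemma coordinate_nonzero:
  assumes a: "a \<in> I" "a $ i = 0"
  shows "a = 0"
proof -
  obtain e where e: "e > 0" "\<forall>a\<in>I. norm a < e \<longrightarrow> a = 0" using discrete by blast
  obtain g where g: "g \<in> G" "norm (cvec g * cvec a) < e"
    using norm_contraction[of "cvec a" i, OF _ e(1)] a(2) by auto
  then have "g * a = 0" using e(2) act[OF g(1) a(1)] by (simp add: norm_cvec flip: cvec_simps(3))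
  then have "vinv g * g * a = 0" by (simp add: mult.assoc)
  then show ?thesis using mult_vinv[OF g(1)] by simp
qed

text \<open>Apply \<open>cylinder_alternative\<close> to the product of \<open>X\<close> with the
  line of heights. In the second case the point found is torsion up to a component in direction
  \<open>i\<close>; powers of units that fix the torsion part shrink this component to 0, and
  \<open>X\<close> is closed.\<close>

theorem real_invariant_torsion:
  assumes X: "real_invariant G I X" "X \<noteq> {}"
  shows "\<exists>x\<in>X. torsion x"
proof -
  obtain i :: 's where True by blast
  have "cylinder G I i (X \<times> UNIV)"
    unfolding cylinder_def using real_invariantD[OF X(1)] by (auto intro: closed_Times)
  moreover have "X \<times> (UNIV::real set) \<noteq> {}" using X(2) by auto
  ultimately consider "\<exists>t::real. \<forall>p. (p, t) \<in> X \<times> UNIV" | "\<exists>p (t::real) x. (p, t) \<in> X \<times> UNIV \<and> torsion (p - axis i x)"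
    using cylinder_alternative by blast
  then show ?thesis
  proof cases
    case 1
    then have "0 \<in> X" by auto
    then show ?thesis using torsion_lattice[OF zero] by blast
  next
    case 2
    then obtain p x where p: "p \<in> X" "torsion (p - axis i x)" by blast
    define r where "r = p - axis i x"
    obtain q :: nat where q: "q > 0" "real q *\<^sub>R r \<in> I" using p(2) unfolding torsion_def r_def by blast
    obtain N where N: "N > 0" "\<And>u x. u \<in> G \<Longrightarrow> real q *\<^sub>R x \<in> I \<Longrightarrow> u ^ N * x - x \<in> I"
      using unit_power_fixes_torsion[OF q(1)] by blast
    let ?G = "(\<lambda>u. u ^ N) ` G"
    interpret G': unit_lattice ?G I by (rule powers_lattice[OF N(1)])
    let ?S = "(\<lambda>t. r + axis i (t * x)) -` X"
    have S: "closed ?S" by (intro closed_vimage real_invariantD(1)[OF X(1)] continuous_intros)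
    have M: "u $ i \<in> ?S" if u: "u \<in> ?G" for u
    proof -
      obtain v where v: "v \<in> G" "u = v ^ N" using u by blast
      have "u * p + (- (u * r - r)) \<in> X"
        using N(2)[OF v(1) q(2)] v(2) power[OF v(1)] p(1)
        by (intro real_invariantD(2,3)[OF X(1)] uminus) auto
      moreover have "u * p + (- (u * r - r)) = r + u * axis i x" by (simp add: r_def algebra_simps)
      ultimately show ?thesis by (simp only: vimage_eq axis_mult[symmetric])
    qed
    have "inverse (real (Suc n)) \<in> ?S" for n by (rule G'.closed_coordinate_values[OF S M]) simp_all
    then have "0 \<in> ?S" by (intro closed_sequentially[OF S _ LIMSEQ_inverse_real_of_nat])
    then have "r \<in> X" by simp
    then show ?thesis using p(2) r_def by blast
  qed
qed

lemma real_invariant_limpts: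
  assumes X: "real_invariant G I X"
  shows "real_invariant G I {x. x islimpt X}"
  unfolding real_invariant_def
proof (intro conjI ballI)
  show "closed {x. x islimpt X}" by (rule closed_limpts)
next
  fix x a assume "x \<in> {x. x islimpt X}" "a \<in> I"
  then show "x + a \<in> {x. x islimpt X}" using periodic_limpt[of x X a] real_invariantD(2)[OF X] by blast
next
  fix x u assume x: "x \<in> {x. x islimpt X}" and u: "u \<in> G"
  then obtain f where f: "\<And>n. f n \<in> X - {x}" "f \<longlonglongrightarrow> x" unfolding islimpt_sequential by auto
  have "u * y = u * z \<longleftrightarrow> y = z" for y z using nonzero[OF u] by (simp add: vec_eq_iff)
  then have "u * f n \<in> X - {u * x}" for n using f(1)[of n] real_invariantD(3)[OF X] u by auto
  moreover have "(\<lambda>n. u * f n) \<longlonglongrightarrow> u * x" by (intro tendsto_intros f(2))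
  ultimately show "u * x \<in> {x. x islimpt X}" unfolding islimpt_sequential mem_Collect_eq by (intro exI[of _ "\<lambda>n. u * f n"]) auto
qed

text \<open>The limit points form an invariant set, so some torsion point \<open>r\<close> is among
  them. Around \<open>r\<close> the set is invariant under powers of units; expanding the small
  differences gives a point \<open>r + axis j a\<close>, scaling gives a half line, and half lines
  are dense modulo the lattice.\<close>

theorem real_invariant_full:
  assumes X: "real_invariant G I X" and y: "y islimpt X"
  shows "x \<in> X"
proof -
  obtain r where r: "r islimpt X" "torsion r"
    using real_invariant_torsion[OF real_invariant_limpts[OF X]] y by blast
  obtain q :: nat where q: "q > 0" "real q *\<^sub>R r \<in> I" using r(2) unfolding torsion_def by blast
  obtain N where N: "N > 0" "\<And>u x. u \<in> G \<Longrightarrow> real q *\<^sub>R x \<in> I \<Longrightarrow> u ^ N * x - x \<in> I"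
    using unit_power_fixes_torsion[OF q(1)] by blast
  let ?G = "(\<lambda>u. u ^ N) ` G"
  interpret G': unit_lattice ?G I by (rule powers_lattice[OF N(1)])
  have shift: "r + u * d \<in> X" if u: "u \<in> ?G" and d: "r + d \<in> X" for u d
  proof -
    obtain v where v: "v \<in> G" "u = v ^ N" using u by blast
    have "u * (r + d) \<in> X" using real_invariantD(3)[OF X d] power[OF v(1)] v(2) by blast
    moreover have "- (u * r - r) \<in> I" using uminus[OF N(2)[OF v(1) q(2)]] v(2) by simp
    ultimately have "u * (r + d) + (- (u * r - r)) \<in> X" by (rule real_invariantD(2)[OF X])
    then show ?thesis by (simp add: algebra_simps)
  qed
  obtain f where f: "\<And>n. f n \<in> X - {r}" "f \<longlonglongrightarrow> r" using r(1) unfolding islimpt_sequential by auto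
  define \<delta> where "\<delta> n = f n - r" for n
  have "\<delta> \<longlonglongrightarrow> 0" using tendsto_diff[OF f(2) tendsto_const[of r]] by (simp add: \<delta>_def[abs_def])
  have "\<exists>j. \<delta> n $ j \<noteq> 0" for n using f(1)[of n] by (auto simp: \<delta>_def vec_eq_iff)
  then obtain J where J: "\<And>n. \<delta> n $ J n \<noteq> 0" by metis
  obtain j r' where r': "strict_mono r'" "\<And>n::nat. J (r' n) = j" using nat_pigeonhole_index[of J] by blast
  obtain i where ij: "i \<noteq> j" using third_index[of j j j] by metis
  have "(\<lambda>n. \<delta> (r' n)) \<longlonglongrightarrow> 0" using LIMSEQ_subseq_LIMSEQ[OF \<open>\<delta> \<longlonglongrightarrow> 0\<close> r'(1)] by (simp add: o_def)
  moreover have "\<delta> (r' n) $ j \<noteq> 0" for n using J[of "r' n"] r'(2) by simp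
  ultimately obtain g s a where g: "\<And>n. g n \<in> ?G" "a \<noteq> 0" "(\<lambda>n. g n * \<delta> (r' (s n))) \<longlonglongrightarrow> axis j a"
    by (rule G'.expand_seq_real[OF ij, of "\<lambda>n. \<delta> (r' n)"]) blast
  have "r + \<delta> n \<in> X" for n using f(1)[of n] by (simp add: \<delta>_def)
  then have mem: "r + g n * \<delta> (r' (s n)) \<in> X" for n using shift[OF g(1)] by blast
  have ax: "r + axis j a \<in> X"
    by (rule closed_sequentially[OF real_invariantD(1)[OF X] mem tendsto_add[OF tendsto_const g(3)]])
  have "t \<in> {t. r + axis j (t * a) \<in> X}" if "t > 0" for t
  proof (rule G'.closed_coordinate_values[OF _ _ that])
    have "closed ((\<lambda>t. r + axis j (t * a)) -` X)"
      by (intro closed_vimage real_invariantD(1)[OF X] continuous_intros)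
    then show "closed {t. r + axis j (t * a) \<in> X}" by (simp add: vimage_def)
    show "u $ j \<in> {t. r + axis j (t * a) \<in> X}" if "u \<in> ?G" for u
      using shift[OF that ax] by (simp add: axis_mult)
  qed
  then show ?thesis
    using closed_half_line[OF real_invariantD(1,2)[OF X], of r j a x] g(2) by blast
qed

corollary real_invariant_finite:
  assumes X: "real_invariant G I X" and x: "x \<notin> X"
  shows "\<exists>F. finite F \<and> F \<subseteq> X \<and> (\<forall>x\<in>X. \<exists>y\<in>F. x - y \<in> I)"
proof (rule finite_mod)
  show "\<not> (\<exists>y. y islimpt X)" using real_invariant_full[OF X] x by blast
qed (rule real_invariantD(2)[OF X])

end

section \<open>Integer combinations of units\<close>

context unit_group
begin

text \<open>A vector \<open>d\<close> orthogonal to all units is orthogonal to one that is tiny off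
  \<open>i\<close>. As the entries of a unit have product 1, that unit is at least 1 at
  \<open>i\<close>, which forces \<open>d $ i = 0\<close>.\<close>

lemma span_units: "span G = UNIV"
proof (rule ccontr)
  assume "span G \<noteq> UNIV"
  then obtain d where d: "d \<noteq> 0" "\<And>x. x \<in> span G \<Longrightarrow> d \<bullet> x = 0"
    using span_not_UNIV_orthogonal[of G] by auto
  have "d $ i = 0" for i
  proof (rule ccontr)
    assume di: "d $ i \<noteq> 0"
    \<comment> \<open>Chosen such that the terms off \<open>i\<close> add up to less than half of
      \<open>\<bar>d $ i\<bar>\<close>.\<close>
    define \<eta> where "\<eta> = \<bar>d $ i\<bar> / (2 * (norm d * real CARD('s) + 1)) "
    have pd: "norm d * real CARD('s) + 1 > 0" by (simp add: add_nonneg_pos)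
    have \<eta>: "\<eta> > 0" using di pd by (simp add: \<eta>_def)
    define \<eta>' where "\<eta>' = min \<eta> 1"
    have \<eta>': "\<eta>' > 0" "\<eta>' \<le> 1" "\<eta>' \<le> \<eta>" using \<eta> by (auto simp: \<eta>'_def)
    obtain g where g: "g \<in> G" and gk: "\<And>k. k \<noteq> i \<Longrightarrow> g $ k \<le> \<eta>'" using contraction[OF \<eta>'(1)] by blast
    have "(\<Prod>k\<in>UNIV - {i}. g $ k) \<le> 1"
      using gk \<eta>' pos[OF g(1)] by (intro prod_le_1) (force simp: less_imp_le)
    moreover have "g $ i * (\<Prod>k\<in>UNIV - {i}. g $ k) = 1"
      using prod1[OF g(1)] by (simp add: prod.remove[of UNIV i])
    moreover have "(\<Prod>k\<in>UNIV - {i}. g $ k) > 0" using pos[OF g(1)] by (intro prod_pos) auto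
    ultimately have gi: "g $ i \<ge> 1"
      by (metis mult_le_cancel_left1 mult.commute not_less order.strict_trans1 zero_less_one mult.right_neutral mult_le_cancel_right)
    have "d \<bullet> g = 0" using d(2) span_base[OF g(1)] by blast
    then have "d $ i * g $ i = - (\<Sum>k\<in>UNIV - {i}. d $ k * g $ k)"
      by (simp add: inner_vec_def sum.remove[of UNIV i])
    then have "\<bar>d $ i\<bar> * g $ i \<le> \<bar>\<Sum>k\<in>UNIV - {i}. d $ k * g $ k\<bar>"
      using pos[OF g(1), of i] by (simp add: abs_mult[symmetric])
    also have "\<dots> \<le> (\<Sum>k\<in>UNIV - {i}. \<bar>d $ k * g $ k\<bar>)" by (rule sum_abs)
    also have "\<dots> \<le> (\<Sum>k\<in>UNIV - {i}. norm d * \<eta>)"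
    proof (rule sum_mono)
      fix k assume "k \<in> UNIV - {i}"
      then have "g $ k \<le> \<eta>" using gk \<eta>'(3) by force
      then show "\<bar>d $ k * g $ k\<bar> \<le> norm d * \<eta>"
        using pos[OF g(1), of k] component_le_norm_cart[of d k] by (simp add: abs_mult mult_mono)
    qed
    also have "\<dots> \<le> (\<Sum>k\<in>(UNIV::'s set). norm d * \<eta>)" using \<eta> by (intro sum_mono2) auto
    also have "\<dots> = norm d * real CARD('s) * \<eta>" by simp
    also have "\<dots> < (norm d * real CARD('s) + 1) * \<eta>" using \<eta> by simp
    also have "\<dots> = \<bar>d $ i\<bar> / 2" unfolding \<eta>_def using pd by (simp add: field_simps)
    finally have "\<bar>d $ i\<bar> * g $ i < \<bar>d $ i\<bar> / 2" .
    moreover have "\<bar>d $ i\<bar> * g $ i \<ge> \<bar>d $ i\<bar> * 1" using gi by (intro mult_left_mono) auto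
    ultimately show False using di by linarith
  qed
  then show False using d(1) by (simp add: vec_eq_iff)
qed

text \<open>A lattice vector times an integer combination of units is again a lattice vector. So a
  single vector provides lattice points all along its real span, with a covering constant that
  depends on the units alone.\<close>

lemma unit_rounding:
  "\<exists>B C. finite B \<and> B \<subseteq> G \<and> C > 0 \<and> (\<forall>x. \<exists>k :: real^'s \<Rightarrow> int. norm (x - (\<Sum>b\<in>B. real_of_int (k b) *\<^sub>R b)) \<le> C)"
proof -
  obtain B where B: "B \<subseteq> G" "independent B" "G \<subseteq> span B"
    using maximal_independent_subset[of G] by blast
  have fin: "finite B" using B(2) independent_imp_finite by blast
  have "span B = UNIV" using span_mono[OF B(3)] span_units by (simp add: span_span top.extremum_unique)
  then have rep: "\<exists>c. x = (\<Sum>b\<in>B. c b *\<^sub>R b)" for x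
    using span_finite[OF fin] by (metis (no_types, lifting) UNIV_I imageE)
  have "\<exists>k :: real^'s \<Rightarrow> int. norm (x - (\<Sum>b\<in>B. real_of_int (k b) *\<^sub>R b)) \<le> (\<Sum>b\<in>B. norm b) + 1" for x
  proof -
    obtain c where c: "x = (\<Sum>b\<in>B. c b *\<^sub>R b)" using rep by blast
    have "x - (\<Sum>b\<in>B. real_of_int \<lfloor>c b\<rfloor> *\<^sub>R b) = (\<Sum>b\<in>B. (c b - real_of_int \<lfloor>c b\<rfloor>) *\<^sub>R b)"
      by (simp add: c sum_subtractf scaleR_left_diff_distrib)
    also have "norm \<dots> \<le> (\<Sum>b\<in>B. norm ((c b - real_of_int \<lfloor>c b\<rfloor>) *\<^sub>R b))" by (rule norm_sum)
    also have "\<dots> \<le> (\<Sum>b\<in>B. norm b)"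
    proof (rule sum_mono)
      fix b
      have "\<bar>c b - real_of_int \<lfloor>c b\<rfloor>\<bar> \<le> 1" by linarith
      then show "norm ((c b - real_of_int \<lfloor>c b\<rfloor>) *\<^sub>R b) \<le> norm b" by (simp add: mult_left_le_one_le)
    qed
    finally show ?thesis by (intro exI[of _ "\<lambda>b. \<lfloor>c b\<rfloor>"]) simp
  qed
  moreover have "(\<Sum>b\<in>B. norm b) + 1 > 0" by (simp add: add_nonneg_pos sum_nonneg)
  ultimately show ?thesis using fin B(1) by blast
qed

end


section \<open>Lattices in complex space\<close>

text \<open>Coordinates in the real basis formed at each place by \<open>v\<close> and i times
  \<open>v\<close>, with \<open>reco\<close> and \<open>imco\<close> as the coordinate functions.
  Real units act on \<open>p\<close> and \<open>q\<close> by the same diagonal matrix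
  (\<open>frame_cvec\<close>).\<close>

definition frame :: "complex^'s \<Rightarrow> real^'s \<Rightarrow> real^'s \<Rightarrow> complex^'s" where
  "frame v p q = (\<chi> k. v $ k * Complex (p $ k) (q $ k))"

definition reco :: "complex^'s \<Rightarrow> complex^'s \<Rightarrow> real^'s" where
  "reco v x = (\<chi> k. Re (x $ k / v $ k))"

definition imco :: "complex^'s \<Rightarrow> complex^'s \<Rightarrow> real^'s" where
  "imco v x = (\<chi> k. Im (x $ k / v $ k))"

lemma frame_nth [simp]: "frame v p q $ k = v $ k * Complex (p $ k) (q $ k)" by (simp add: frame_def)
lemma reco_nth [simp]: "reco v x $ k = Re (x $ k / v $ k)" by (simp add: reco_def)
lemma imco_nth [simp]: "imco v x $ k = Im (x $ k / v $ k)" by (simp add: imco_def)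

lemma frame_add: "frame v p q + frame v p' q' = frame v (p + p') (q + q')"
  by (simp add: vec_eq_iff distrib_left[symmetric] complex_add)

lemma frame_diff: "frame v p q - frame v p' q' = frame v (p - p') (q - q')"
  by (simp add: vec_eq_iff right_diff_distrib[symmetric] complex_diff)

lemma frame_0 [simp]: "frame v 0 0 = 0"
  by (simp add: vec_eq_iff complex_eq_iff)

lemma frame_scaleR: "c *\<^sub>R frame v p q = frame v (c *\<^sub>R p) (c *\<^sub>R q)"
  by (simp add: vec_eq_iff complex_eq_iff algebra_simps)

lemma frame_cvec: "cvec u * frame v p q = frame v (u * p) (u * q)"
  by (simp add: vec_eq_iff complex_eq_iff algebra_simps)

lemma frame_unit: "frame v u 0 = cvec u * v"
  by (simp add: vec_eq_iff complex_eq_iff algebra_simps)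

lemma frame_coordinates: "(\<And>k. v $ k \<noteq> 0) \<Longrightarrow> frame v (reco v x) (imco v x) = x"
  by (simp add: vec_eq_iff)

lemma reco_frame [simp]: "(\<And>k. v $ k \<noteq> 0) \<Longrightarrow> reco v (frame v p q) = p"
  and imco_frame [simp]: "(\<And>k. v $ k \<noteq> 0) \<Longrightarrow> imco v (frame v p q) = q"
  by (simp_all add: vec_eq_iff)

lemma reco_add: "reco v (x + y) = reco v x + reco v y"
  and imco_add: "imco v (x + y) = imco v x + imco v y"
  and reco_diff: "reco v (x - y) = reco v x - reco v y"
  and imco_diff: "imco v (x - y) = imco v x - imco v y"
  by (simp_all add: vec_eq_iff add_divide_distrib diff_divide_distrib)

lemma imco_0 [simp]: "imco v 0 = 0" by (simp add: vec_eq_iff)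

lemma imco_scaleR: "imco v (c *\<^sub>R x) = c *\<^sub>R imco v x"
proof -
  have "Im (c *\<^sub>R (z::complex) / w) = c * Im (z / w)" for z w
    by (simp only: divide_inverse mult_scaleR_left scaleR_complex.sel)
  then show ?thesis by (simp add: vec_eq_iff)
qed

lemma imco_cvec: "imco v (cvec u * x) = u * imco v x"
proof -
  have "Im (complex_of_real c * z / w) = c * Im (z / w)" for c z w
    by (simp only: times_divide_eq_right[symmetric] times_complex.sel Re_complex_of_real Im_complex_of_real)
  then show ?thesis by (simp add: vec_eq_iff)
qed

lemma tendsto_frame [tendsto_intros]:
  "(p \<longlongrightarrow> p') F \<Longrightarrow> (q \<longlongrightarrow> q') F \<Longrightarrow> ((\<lambda>n. frame v (p n) (q n)) \<longlongrightarrow> frame v p' q') F"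
  by (rule vec_tendstoI) (auto intro!: tendsto_intros)

lemma tendsto_reco [tendsto_intros]:
  "(\<And>k. v $ k \<noteq> 0) \<Longrightarrow> (x \<longlongrightarrow> x') F \<Longrightarrow> ((\<lambda>n. reco v (x n)) \<longlongrightarrow> reco v x') F"
  by (rule vec_tendstoI) (auto intro!: tendsto_intros)

lemma tendsto_imco [tendsto_intros]:
  "(\<And>k. v $ k \<noteq> 0) \<Longrightarrow> (x \<longlongrightarrow> x') F \<Longrightarrow> ((\<lambda>n. imco v (x n)) \<longlongrightarrow> imco v x') F"
  by (rule vec_tendstoI) (auto intro!: tendsto_intros)

lemma continuous_frame [continuous_intros]:
  "continuous_on S p \<Longrightarrow> continuous_on S q \<Longrightarrow> continuous_on S (\<lambda>n. frame v (p n) (q n))"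
  unfolding continuous_on_def by (auto intro: tendsto_intros)

lemma norm_frame_le:
  fixes v :: "complex^'s::finite"
  shows "norm (frame v p q) \<le> norm v * (norm p + norm q)"
proof -
  have "norm (frame v p q) \<le> norm ((norm p + norm q) *\<^sub>R v)"
  proof (rule norm_le_componentwise_cart)
    fix k
    have "cmod (Complex (p $ k) (q $ k)) \<le> norm p + norm q"
      using cmod_le[of "Complex (p $ k) (q $ k)"] component_le_norm_cart[of p k] component_le_norm_cart[of q k] by simp
    then have "cmod (v $ k) * cmod (Complex (p $ k) (q $ k)) \<le> cmod (v $ k) * (norm p + norm q)"
      by (intro mult_left_mono) auto
    then show "norm (frame v p q $ k) \<le> norm (((norm p + norm q) *\<^sub>R v) $ k)"
      by (simp add: norm_mult mult.commute)
  qed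
  then show ?thesis by (simp add: mult.commute)
qed

lemma norm_imco_le:
  fixes v :: "complex^'s::finite"
  shows "norm (imco v x) \<le> norm x * norm (\<chi> k. inverse (v $ k))"
proof -
  have "norm (imco v x) \<le> norm (x * (\<chi> k. inverse (v $ k)))"
  proof (rule norm_le_componentwise_cart)
    fix k show "norm (imco v x $ k) \<le> norm ((x * (\<chi> k. inverse (v $ k))) $ k)"
      using abs_Im_le_cmod[of "x $ k / v $ k"] by (simp add: divide_inverse)
  qed
  also have "\<dots> \<le> norm x * norm (\<chi> k. inverse (v $ k))" by (rule norm_vec_mult_le)
  finally show ?thesis .
qed

locale complex_lattice = unit_group G + lattice_in L for G :: "(real ^ 's::finite) set" and L :: "(complex^'s) set" +
  assumes act: "u \<in> G \<Longrightarrow> a \<in> L \<Longrightarrow> cvec u * a \<in> L"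
begin

lemma powers_lattice: "N > 0 \<Longrightarrow> complex_lattice ((\<lambda>u. u ^ N) ` G) L"
  using powers[of N] lattice_in_axioms act power
  by (auto simp: complex_lattice_def complex_lattice_axioms_def)

lemma cvec_vinv: "u \<in> G \<Longrightarrow> cvec u * (cvec (vinv u) * x) = x" "u \<in> G \<Longrightarrow> cvec (vinv u) * (cvec u * x) = x"
  by (simp_all add: mult.assoc[symmetric] cvec_simps(3)[symmetric] mult_vinv cvec_simps)

lemma unit_power_fixes_torsion:
  fixes q :: nat
  assumes "q > 0"
  shows "\<exists>N>0. \<forall>u\<in>G. \<forall>x. real q *\<^sub>R x \<in> L \<longrightarrow> cvec (u ^ N) * x - x \<in> L"
proof -
  obtain N where N: "N > 0" "\<And>f x. (\<forall>x y. f (x - y) = f x - f y) \<Longrightarrow> (\<forall>x c. f (c *\<^sub>R x) = c *\<^sub>R f x) \<Longrightarrow>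
    (\<forall>x. f x \<in> L \<longleftrightarrow> x \<in> L) \<Longrightarrow> real q *\<^sub>R x \<in> L \<Longrightarrow> (f ^^ N) x - x \<in> L"
    using torsion_fixed[OF assms] by blast
  have pow: "((*) (cvec u) ^^ n) y = cvec (u ^ n) * y" for u y n
    by (induction n) (auto simp: mult.assoc cvec_simps)
  have "cvec u * x \<in> L \<longleftrightarrow> x \<in> L" if u: "u \<in> G" for u x
    using act[OF u, of x] act[OF inv[OF u], of "cvec u * x"] cvec_vinv[OF u] by auto
  then have "cvec (u ^ N) * x - x \<in> L" if "u \<in> G" "real q *\<^sub>R x \<in> L" for u x
    using N(2)[of "(*) (cvec u)" x] that by (simp add: pow right_diff_distrib)
  then show ?thesis using N(1) by blast
qed

lemma coordinate_nonzero:
  assumes a: "a \<in> L" "a \<noteq> 0"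
  shows "a $ i \<noteq> 0"
proof
  assume ai: "a $ i = 0"
  obtain e where e: "e > 0" "\<forall>a\<in>L. norm a < e \<longrightarrow> a = 0" using discrete by blast
  obtain g where g: "g \<in> G" "norm (cvec g * a) < e" using norm_contraction[OF ai e(1)] by blast
  then have "cvec g * a = 0" using e(2) act[OF g(1) a(1)] by blast
  then have "cvec (vinv g) * (cvec g * a) = 0" by simp
  then show False using cvec_vinv[OF g(1)] a(2) by simp
qed

lemma nonzero_element: "\<exists>v\<in>L. v \<noteq> 0"
proof -
  obtain C where C: "C > 0" "\<And>x. \<exists>a\<in>L. norm (x - a) \<le> C" using radius by metis
  obtain b :: "complex^'s" where b: "b \<in> Basis" using nonempty_Basis by blast
  obtain a where a: "a \<in> L" "norm ((C + 1) *\<^sub>R b - a) \<le> C" using C(2) by blast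
  have "norm ((C + 1) *\<^sub>R b) = C + 1" using b C(1) by simp
  then have "a \<noteq> 0" using a(2) by auto
  then show ?thesis using a(1) by blast
qed

text \<open>\<open>flat v\<close> consists of the parameters of the lattice points on the real span
  of \<open>v\<close>, and \<open>quotient v\<close> is the image of the lattice in the transversal
  coordinates: the two real lattices of the extension.\<close>

definition flat :: "complex^'s \<Rightarrow> (real^'s) set" where
  "flat v = {p. frame v p 0 \<in> L}"

definition quotient :: "complex^'s \<Rightarrow> (real^'s) set" where
  "quotient v = imco v ` L"

lemma flat_iff: "p \<in> flat v \<longleftrightarrow> frame v p 0 \<in> L" by (simp add: flat_def)

text \<open>Integer combinations of units, applied to \<open>v\<close>, are lattice points on the
  span, so \<open>unit_rounding\<close> provides the covering radius. Discreteness is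
  inherited.\<close>

lemma flat_lattice:
  assumes v: "v \<in> L" "v \<noteq> 0"
  shows "unit_lattice G (flat v)"
proof -
  note nz = coordinate_nonzero[OF v]
  have "lattice_in (flat v)"
  proof
    show "0 \<in> flat v" by (simp add: flat_iff zero)
  next
    fix a b assume "a \<in> flat v" "b \<in> flat v"
    then show "a - b \<in> flat v" using diff[of "frame v a 0" "frame v b 0"] by (simp add: flat_iff frame_diff)
  next
    obtain B C where B: "finite B" "B \<subseteq> G" "\<And>x. \<exists>k :: real^'s \<Rightarrow> int. norm (x - (\<Sum>b\<in>B. real_of_int (k b) *\<^sub>R b)) \<le> C"
      using unit_rounding by blast
    have "\<exists>a\<in>flat v. norm (x - a) \<le> C" for x
    proof -
      obtain k :: "real^'s \<Rightarrow> int" where k: "norm (x - (\<Sum>b\<in>B. real_of_int (k b) *\<^sub>R b)) \<le> C" using B(3) by blast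
      have "(\<Sum>b\<in>A. real_of_int (k b) *\<^sub>R b) \<in> flat v" if "finite A" "A \<subseteq> B" for A
        using that
      proof (induction A rule: finite_induct)
        case empty then show ?case by (simp add: flat_iff zero)
      next
        case (insert b A)
        have "frame v b 0 \<in> L" using act[of b v] insert.prems B(2) v(1) by (auto simp: frame_unit)
        then have "frame v (real_of_int (k b) *\<^sub>R b) 0 \<in> L" using scaleR_int[of "frame v b 0" "k b"] by (simp add: frame_scaleR)
        then show ?case
          using insert add[of "frame v (real_of_int (k b) *\<^sub>R b) 0" "frame v (\<Sum>b\<in>A. real_of_int (k b) *\<^sub>R b) 0"] by (simp add: flat_iff frame_add)
      qed
      then show ?thesis using k B(1) by blast
    qed
    then show "\<exists>C. \<forall>x. \<exists>a\<in>flat v. norm (x - a) \<le> C" by blast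
  next
    obtain e where e: "e > 0" "\<forall>a\<in>L. norm a < e \<longrightarrow> a = 0" using discrete by blast
    have "a = 0" if a: "a \<in> flat v" "norm a < e / norm v" for a
    proof -
      have "norm (frame v a 0) \<le> norm v * norm a" using norm_frame_le[of v a 0] by simp
      also have "\<dots> < e" using a(2) v(2) by (simp add: field_simps)
      finally have "frame v a 0 = 0" using e(2) a(1) by (simp add: flat_iff)
      then have "reco v (frame v a 0) = reco v (frame v 0 0)" by simp
      then show ?thesis by (simp only: reco_frame[OF nz])
    qed
    then show "\<exists>e>0. \<forall>a\<in>flat v. norm a < e \<longrightarrow> a = 0" using e(1) v(2) by (intro exI[of _ "e / norm v"]) auto
  qed
  moreover have "u * a \<in> flat v" if "u \<in> G" "a \<in> flat v" for u a
    using act[of u "frame v a 0"] that by (simp add: flat_iff frame_cvec)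
  ultimately show ?thesis
    using unit_group_axioms by (auto simp: unit_lattice_def unit_lattice_axioms_def)
qed

text \<open>A short transversal vector has a lift whose component along \<open>v\<close> is reduced
  modulo the cocompact lattice \<open>flat v\<close>. Such lifts are bounded, so there are finitely
  many short vectors, which gives discreteness.\<close>

lemma quotient_lattice:
  assumes v: "v \<in> L" "v \<noteq> 0"
  shows "unit_lattice G (quotient v)"
proof -
  note nz = coordinate_nonzero[OF v]
  interpret flat: unit_lattice G "flat v" by (rule flat_lattice[OF v])
  obtain C where C: "C > 0" "\<And>x. \<exists>a\<in>L. norm (x - a) \<le> C" using radius by metis
  have "lattice_in (quotient v)"
  proof
    show "0 \<in> quotient v" using zero by (auto simp: quotient_def intro!: image_eqI[of _ _ 0])
  next
    fix a b assume "a \<in> quotient v" "b \<in> quotient v"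
    then obtain x y where "x \<in> L" "y \<in> L" "a = imco v x" "b = imco v y" by (auto simp: quotient_def)
    then show "a - b \<in> quotient v" using diff[of x y] by (auto simp: quotient_def imco_diff[symmetric])
  next
    have "\<exists>a\<in>quotient v. norm (y - a) \<le> C * norm (\<chi> k. inverse (v $ k))" for y
    proof -
      obtain a where a: "a \<in> L" "norm (frame v 0 y - a) \<le> C" using C(2) by blast
      have "y - imco v a = imco v (frame v 0 y - a)" using nz by (simp add: imco_diff)
      also have "norm \<dots> \<le> norm (frame v 0 y - a) * norm (\<chi> k. inverse (v $ k))" by (rule norm_imco_le)
      also have "\<dots> \<le> C * norm (\<chi> k. inverse (v $ k))" using a(2) by (intro mult_right_mono) auto
      finally show ?thesis using a(1) by (auto simp: quotient_def)
    qed
    then show "\<exists>C. \<forall>x. \<exists>a\<in>quotient v. norm (x - a) \<le> C" by blast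
  next
    obtain C' where C': "C' > 0" "\<And>x. \<exists>a\<in>flat v. norm (x - a) \<le> C'" using flat.radius by metis
    let ?F = "imco v ` {a\<in>L. norm a \<le> norm v * (C' + 1)}"
    have "finite ?F" using finite_bounded0 by blast
    then obtain e where e: "e > 0" "\<And>y. y \<in> ?F \<Longrightarrow> y \<noteq> 0 \<Longrightarrow> e \<le> dist 0 y"
      using finite_set_avoid[of ?F 0] by blast
    have "y = 0" if y: "y \<in> quotient v" "norm y < min e 1" for y
    proof -
      obtain a where a: "a \<in> L" "y = imco v a" using y(1) by (auto simp: quotient_def)
      obtain b where b: "b \<in> flat v" "norm (reco v a - b) \<le> C'" using C'(2) by blast
      let ?a = "a - frame v b 0"
      have "?a = frame v (reco v a - b) y"
        using frame_coordinates[of v a] nz a(2) frame_diff[of v "reco v a" "imco v a" b 0] by simp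
      then have "norm ?a \<le> norm v * (norm (reco v a - b) + norm y)" using norm_frame_le by metis
      also have "\<dots> \<le> norm v * (C' + 1)" using b(2) y(2) by (intro mult_left_mono) auto
      finally have "norm ?a \<le> norm v * (C' + 1)" .
      moreover have "?a \<in> L" using a(1) b(1) diff by (simp add: flat_iff)
      moreover have "imco v ?a = y" using nz a(2) by (simp add: imco_diff)
      ultimately have "y \<in> ?F" by blast
      then show ?thesis using e(2)[of y] y(2) by force
    qed
    then show "\<exists>e>0. \<forall>a\<in>quotient v. norm a < e \<longrightarrow> a = 0" using e(1) by (intro exI[of _ "min e 1"]) auto
  qed
  moreover have "u * a \<in> quotient v" if "u \<in> G" "a \<in> quotient v" for u a
    using that act by (auto simp: quotient_def imco_cvec[symmetric])
  ultimately show ?thesis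
    using unit_group_axioms by (auto simp: unit_lattice_def unit_lattice_axioms_def)
qed

lemma flat_torsion:
  "lattice_in.torsion (flat v) p \<longleftrightarrow> torsion (frame v p 0)" if v: "v \<in> L" "v \<noteq> 0"
proof -
  interpret flat: unit_lattice G "flat v" by (rule flat_lattice[OF v])
  show ?thesis by (simp add: flat.torsion_def torsion_def flat_iff frame_scaleR)
qed

text \<open>Two steps along the extension: the projection to the transversal torus contains a
  torsion point, and over a torsion lift \<open>r\<close> of it the set restricts to a closed subset
  of the flat torus, invariant under the powers of units that fix \<open>r\<close>.\<close>

theorem invariant_torsion:
  assumes X: "invariant G L X" "X \<noteq> {}"
  shows "\<exists>x\<in>X. torsion x"
proof -
  obtain v where v: "v \<in> L" "v \<noteq> 0" using nonzero_element by blast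
  note nz = coordinate_nonzero[OF v]
  interpret flat: unit_lattice G "flat v" by (rule flat_lattice[OF v])
  interpret quot: unit_lattice G "quotient v" by (rule quotient_lattice[OF v])
  have "real_invariant G (quotient v) (imco v ` X)"
    unfolding real_invariant_def
  proof (intro conjI ballI)
    show "closed (imco v ` X)"
      unfolding closed_sequential_limits
    proof (intro allI impI, elim conjE)
      fix f l assume f: "\<forall>n. f n \<in> imco v ` X" and l: "f \<longlonglongrightarrow> l"
      then have "\<forall>n. \<exists>x. x \<in> X \<and> f n = imco v x" by blast
      then obtain x where x: "\<And>n. x n \<in> X" "\<And>n. f n = imco v (x n)" by metis
      \<comment> \<open>The fibre torus is compact, so preimages can be chosen with a convergent
        subsequence; this makes the projection closed.\<close>
      obtain b r y where b: "\<And>n. b n \<in> flat v" "strict_mono r" "(\<lambda>n. reco v (x (r n)) - b n) \<longlonglongrightarrow> y"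
        by (rule flat.reduce_seq[of "\<lambda>n. reco v (x n)"]) blast
      have "x (r n) + (- frame v (b n) 0) \<in> X" for n
        using b(1) by (intro invariantD(2)[OF X(1)] x uminus) (simp add: flat_iff)
      moreover have "x (r n) + (- frame v (b n) 0) = frame v (reco v (x (r n)) - b n) (f (r n))" for n
        using frame_coordinates[of v "x (r n)"] nz x(2) frame_diff[of v "reco v (x (r n))" "imco v (x (r n))" "b n" 0] by simp
      ultimately have mem: "frame v (reco v (x (r n)) - b n) (f (r n)) \<in> X" for n by simp
      have "(\<lambda>n. f (r n)) \<longlonglongrightarrow> l" using LIMSEQ_subseq_LIMSEQ[OF l b(2)] by (simp add: o_def)
      from closed_sequentially[OF invariantD(1)[OF X(1)] mem tendsto_frame[OF b(3) this]]
      have "frame v y l \<in> X" .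
      then show "l \<in> imco v ` X" using nz by (intro image_eqI[of _ _ "frame v y l"]) auto
    qed
  next
    fix y a assume "y \<in> imco v ` X" "a \<in> quotient v"
    then obtain x b where "x \<in> X" "y = imco v x" "b \<in> L" "a = imco v b" by (auto simp: quotient_def)
    then show "y + a \<in> imco v ` X" using invariantD(2)[OF X(1), of x b] by (auto simp: imco_add[symmetric])
  next
    fix y u assume "y \<in> imco v ` X" "u \<in> G"
    then show "u * y \<in> imco v ` X" using invariantD(3)[OF X(1)] by (auto simp: imco_cvec[symmetric])
  qed
  then obtain x where x: "x \<in> X" "quot.torsion (imco v x)"
    using quot.real_invariant_torsion X(2) by blast
  obtain n :: nat where n: "n > 0" "real n *\<^sub>R imco v x \<in> quotient v" using x(2) unfolding quot.torsion_def by blast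
  then obtain a where a: "a \<in> L" "real n *\<^sub>R imco v x = imco v a" by (auto simp: quotient_def)
  \<comment> \<open>A torsion lift of the transversal torsion point; it differs from
    \<open>x\<close> by a vector along the flat.\<close>
  define r where "r = a /\<^sub>R real n"
  have r: "real n *\<^sub>R r \<in> L" using a(1) n(1) by (simp add: r_def)
  have "imco v r = imco v x" using a(2) n(1) by (simp add: r_def imco_scaleR field_simps) (metis inverse_eq_divide scaleR_one scaleR_scaleR left_inverse of_nat_0_eq_iff a(2) not_gr_zero)
  then have xr: "x = r + frame v (reco v (x - r)) 0"
    using frame_coordinates[of v "x - r"] nz by (simp add: imco_diff)
  obtain N where N: "N > 0" "\<And>u x. u \<in> G \<Longrightarrow> real n *\<^sub>R x \<in> L \<Longrightarrow> cvec (u ^ N) * x - x \<in> L"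
    using unit_power_fixes_torsion[OF n(1)] by blast
  let ?G = "(\<lambda>u. u ^ N) ` G"
  interpret flat': unit_lattice ?G "flat v" by (rule flat.powers_lattice[OF N(1)])
  have "real_invariant ?G (flat v) {p. r + frame v p 0 \<in> X}"
    unfolding real_invariant_def
  proof (intro conjI ballI)
    have "closed ((\<lambda>p. r + frame v p 0) -` X)" by (intro closed_vimage invariantD(1)[OF X(1)] continuous_intros)
    then show "closed {p. r + frame v p 0 \<in> X}" by (simp add: vimage_def)
  next
    fix p a assume "p \<in> {p. r + frame v p 0 \<in> X}" "a \<in> flat v"
    then have "r + frame v p 0 + frame v a 0 \<in> X" using invariantD(2)[OF X(1)] by (simp add: flat_iff)
    then show "p + a \<in> {p. r + frame v p 0 \<in> X}" by (simp add: add.assoc frame_add)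
  next
    fix p u assume p: "p \<in> {p. r + frame v p 0 \<in> X}" and "u \<in> ?G"
    then obtain w where w: "w \<in> G" "u = w ^ N" by blast
    have "cvec u * (r + frame v p 0) \<in> X" using invariantD(3)[OF X(1)] p power[OF w(1)] w(2) by simp
    moreover have "- (cvec u * r - r) \<in> L" using uminus[OF N(2)[OF w(1) r]] w(2) by simp
    ultimately have "cvec u * (r + frame v p 0) + (- (cvec u * r - r)) \<in> X" by (rule invariantD(2)[OF X(1)])
    then show "u * p \<in> {p. r + frame v p 0 \<in> X}" by (simp add: algebra_simps frame_cvec)
  qed
  moreover have "reco v (x - r) \<in> {p. r + frame v p 0 \<in> X}" using x(1) xr by simp
  ultimately obtain p where p: "r + frame v p 0 \<in> X" "flat.torsion p"
    using flat'.real_invariant_torsion by blast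
  have "torsion r" using r n(1) unfolding torsion_def by blast
  then have "torsion (r + frame v p 0)" using torsion_add p(2) flat_torsion[OF v] by blast
  then show ?thesis using p(1) by blast
qed

lemma invariant_limpts:
  assumes X: "\<And>x a. x \<in> X \<Longrightarrow> a \<in> L \<Longrightarrow> x + a \<in> X" "\<And>x u. x \<in> X \<Longrightarrow> u \<in> G \<Longrightarrow> cvec u * x \<in> X"
  shows "invariant G L {x. x islimpt X}"
  unfolding invariant_def
proof (intro conjI ballI)
  show "closed {x. x islimpt X}" by (rule closed_limpts)
next
  fix x a assume "x \<in> {x. x islimpt X}" "a \<in> L"
  then show "x + a \<in> {x. x islimpt X}" using periodic_limpt[of x X a] X by blast
next
  fix x u assume x: "x \<in> {x. x islimpt X}" and u: "u \<in> G"
  then obtain f where f: "\<And>n. f n \<in> X - {x}" "f \<longlonglongrightarrow> x" unfolding islimpt_sequential by auto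
  have "cvec u * y = cvec u * z \<longleftrightarrow> y = z" for y z using nonzero[OF u] by (simp add: vec_eq_iff)
  then have "cvec u * f n \<in> X - {cvec u * x}" for n using f(1)[of n] X(2) u by auto
  moreover have "(\<lambda>n. cvec u * f n) \<longlonglongrightarrow> cvec u * x" by (intro tendsto_intros f(2))
  ultimately show "cvec u * x \<in> {x. x islimpt X}" unfolding islimpt_sequential mem_Collect_eq by (intro exI[of _ "\<lambda>n. cvec u * f n"]) auto
qed

end


section \<open>Flats generated by lines\<close>

context complex_lattice
begin

lemma invariant_closure:
  assumes Z: "\<And>x a. x \<in> Z \<Longrightarrow> a \<in> L \<Longrightarrow> x + a \<in> Z" "\<And>x u. x \<in> Z \<Longrightarrow> u \<in> G \<Longrightarrow> cvec u * x \<in> Z"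
  shows "invariant G L (closure Z)"
  unfolding invariant_def
proof (intro conjI ballI)
  fix x a assume x: "x \<in> closure Z" and a: "a \<in> L"
  have "(\<lambda>x. x + a) ` closure Z \<subseteq> closure Z"
    using Z(1)[OF _ a] closure_subset[of Z] by (intro image_closure_subset continuous_intros closed_closure) blast
  then show "x + a \<in> closure Z" using x by blast
next
  fix x u assume x: "x \<in> closure Z" and u: "u \<in> G"
  have "(\<lambda>x. cvec u * x) ` closure Z \<subseteq> closure Z"
    using Z(2)[OF _ u] closure_subset[of Z] by (intro image_closure_subset closed_closure)
      (auto simp: continuous_on_def intro!: tendsto_intros)
  then show "cvec u * x \<in> closure Z" using x by blast
qed simp

text \<open>The contraction argument of \<open>half_line_approx\<close>; with a whole complex line
  at hand no sign has to be arranged.\<close>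

lemma complex_line_dense:
  assumes X: "closed X" "\<And>x a. x \<in> X \<Longrightarrow> a \<in> L \<Longrightarrow> x + a \<in> X"
    and line: "\<And>w. axis k w \<in> X"
  shows "x \<in> X"
proof -
  have "\<exists>z\<in>X. dist z x < e" if e: "e > 0" for e
  proof -
    obtain C where C: "C > 0" "\<And>x. \<exists>a\<in>L. norm (x - a) \<le> C" using radius by metis
    define \<eta> where "\<eta> = e / (2 * C)"
    have \<eta>: "\<eta> > 0" using e C(1) by (simp add: \<eta>_def)
    obtain g where g: "g \<in> G" "\<And>i. i \<noteq> k \<Longrightarrow> g $ i \<le> \<eta>" using contraction[OF \<eta>] by blast
    obtain m where m: "m \<in> L" "norm (cvec (vinv g) * x - m) \<le> C" using C(2) by blast
    let ?y = "cvec (vinv g) * x - m"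
    have eq: "x - cvec g * m = cvec g * ?y" using cvec_vinv[OF g(1)] by (simp add: right_diff_distrib)
    let ?z = "axis k ((cvec g * ?y) $ k) + cvec g * m"
    have "?z \<in> X" by (rule X(2)[OF line act[OF g(1) m(1)]])
    moreover have "dist ?z x < e"
    proof -
      have "norm (cvec g * ?y - axis k ((cvec g * ?y) $ k)) \<le> norm (\<eta> *\<^sub>R ?y)"
      proof (rule norm_le_componentwise_cart)
        fix i
        show "norm ((cvec g * ?y - axis k ((cvec g * ?y) $ k)) $ i) \<le> norm ((\<eta> *\<^sub>R ?y) $ i)"
        proof (cases "i = k")
          case True then show ?thesis by (simp add: axis_def)
        next
          case False
          have "g $ i * cmod (?y $ i) \<le> \<eta> * cmod (?y $ i)" using g(2)[OF False] by (intro mult_right_mono) auto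
          then show ?thesis using pos[OF g(1), of i] \<eta> False by (simp add: axis_def norm_mult)
        qed
      qed
      also have "\<dots> \<le> \<eta> * C" using m(2) \<eta> by simp
      also have "\<dots> = e / 2" using C(1) by (simp add: \<eta>_def)
      also have "\<dots> < e" using e by simp
      finally have "norm (x - cvec g * m - axis k ((cvec g * ?y) $ k)) < e" by (simp only: eq)
      then show ?thesis unfolding dist_norm by (metis diff_diff_eq add.commute norm_minus_commute)
    qed
    ultimately show ?thesis by blast
  qed
  then have "x \<in> closure X" by (simp add: closure_approachable)
  then show ?thesis using X(1) by simp
qed

text \<open>
  The closure of the image of a line in the direction of a coordinate contains an
  \<open>s\<close>-dimensional subtorus. Recurrence of the line gives lattice points close to it; expanding the
  error terms yields real lines in all coordinate directions, spanning some \<open>W\<close>. Either a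
  lattice point lies in \<open>W\<close>, or the components transversal to \<open>W\<close> can be expanded as well.
\<close>

lemma half_line_contains_flat:
  assumes X: "closed X" "\<And>x a. x \<in> X \<Longrightarrow> a \<in> L \<Longrightarrow> x + a \<in> X"
    and line: "\<And>t. t > 0 \<Longrightarrow> z + axis i (complex_of_real t * a) \<in> X" and a: "a \<noteq> 0"
  shows "\<exists>v\<in>L. v \<noteq> 0 \<and> (\<forall>p. z + frame v p 0 \<in> X)"
proof -
  let ?\<alpha> = "\<lambda>x. axis i (complex_of_real x * a)"
  obtain b r y where b: "\<And>n. b n \<in> L" "strict_mono r" "(\<lambda>n. axis i (of_nat (r n) * a) - b n) \<longlonglongrightarrow> y"
    by (rule reduce_seq[of "\<lambda>n. axis i (of_nat n * a)"]) blast
  \<comment> \<open>Lattice points near the line. The indices \<open>2 * n + 1\<close> and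
    \<open>n\<close> are so far apart that the parameters \<open>t n\<close> tend to
    infinity.\<close>
  define c where "c n = b (2 * n + 1) - b n" for n
  define t where "t n = real (r (2 * n + 1)) - real (r n)" for n
  have cL: "c n \<in> L" for n by (simp add: c_def diff b(1))
  have tn: "t n \<ge> real n + 1" for n
  proof -
    have "r m + k \<le> r (m + k)" for m k
      using b(2) by (induction k) (auto simp: strict_mono_Suc_iff Suc_le_eq order.strict_trans1)
    from this[of n "n + 1"] show ?thesis unfolding t_def by (simp add: mult_2)
  qed
  define \<tau> where "\<tau> n = c n - ?\<alpha> (t n)" for n
  have \<tau>lim: "\<tau> \<longlonglongrightarrow> 0"
  proof -
    have "strict_mono (\<lambda>n::nat. 2 * n + 1)" by (simp add: strict_mono_def)
    from LIMSEQ_subseq_LIMSEQ[OF b(3) this]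
    have "(\<lambda>n. axis i (of_nat (r (2 * n + 1)) * a) - b (2 * n + 1)) \<longlonglongrightarrow> y" by (simp add: o_def)
    from tendsto_diff[OF b(3) this]
    have "(\<lambda>n. (axis i (of_nat (r n) * a) - b n) - (axis i (of_nat (r (2 * n + 1)) * a) - b (2 * n + 1))) \<longlonglongrightarrow> 0" by simp
    moreover have "(axis i (of_nat (r n) * a) - b n) - (axis i (of_nat (r (2 * n + 1)) * a) - b (2 * n + 1)) = \<tau> n" for n
      by (simp add: \<tau>_def c_def t_def axis_def vec_eq_iff algebra_simps)
    ultimately show ?thesis by (simp only:)
  qed
  \<comment> \<open>Subtracting \<open>c n\<close> moves the ray back by \<open>t n\<close>, up to
    the small error \<open>\<tau> n\<close>; in the limit the whole line is covered.\<close>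
  have line': "z + ?\<alpha> x \<in> X" for x
  proof -
    have ev: "\<forall>\<^sub>F n in sequentially. z + ?\<alpha> x - \<tau> n \<in> X"
      using eventually_ge_at_top[of "nat \<lceil>\<bar>x\<bar>\<rceil>"]
    proof eventually_elim
      case (elim n)
      then have "x + t n > 0" using tn[of n] by linarith
      have eq: "?\<alpha> (x + t n) = ?\<alpha> x + ?\<alpha> (t n)"
        by (simp add: axis_def vec_eq_iff algebra_simps)
      from X(2)[OF line[OF \<open>x + t n > 0\<close>] uminus[OF cL[of n]]]
      show ?case unfolding eq by (simp add: \<tau>_def algebra_simps)
    qed
    have "(\<lambda>n. z + ?\<alpha> x - \<tau> n) \<longlonglongrightarrow> z + ?\<alpha> x - 0"
      by (intro tendsto_intros \<tau>lim)
    with Lim_in_closed_set[OF X(1) ev] show ?thesis by simp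
  qed
  define S where "S = {?\<alpha> x + m |x m. m \<in> L}"
  \<comment> \<open>\<open>H\<close> is a closed subgroup that is invariant under units, although no
    such invariance is assumed of \<open>X\<close>. As \<open>z + H\<close> lies in
    \<open>X\<close>, everything can be done inside \<open>H\<close>.\<close>
  define H where "H = closure S"
  have SI: "?\<alpha> x + m \<in> S" if "m \<in> L" for x m using that by (auto simp: S_def)
  have S_diff: "x - y \<in> S" if "x \<in> S" "y \<in> S" for x y
  proof -
    obtain x1 m1 x2 m2 where "m1 \<in> L" "m2 \<in> L" "x = ?\<alpha> x1 + m1" "y = ?\<alpha> x2 + m2"
      using \<open>x \<in> S\<close> \<open>y \<in> S\<close> unfolding S_def by blast
    then have "x - y = ?\<alpha> (x1 - x2) + (m1 - m2)" "m1 - m2 \<in> L"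
      by (auto simp: axis_def vec_eq_iff algebra_simps intro: diff)
    then show ?thesis using SI by metis
  qed
  have H_inv: "invariant G L H"
    unfolding H_def
  proof (rule invariant_closure)
    fix x m assume "x \<in> S" and m: "m \<in> L"
    then obtain x1 m1 where "m1 \<in> L" "x = ?\<alpha> x1 + m1" by (auto simp: S_def)
    then show "x + m \<in> S" using SI[OF add[OF _ m], of m1 x1] by (simp add: add.assoc)
  next
    fix x u assume "x \<in> S" and u: "u \<in> G"
    then obtain x1 m where m: "m \<in> L" "x = ?\<alpha> x1 + m" by (auto simp: S_def)
    have "cvec u * x = ?\<alpha> (u $ i * x1) + cvec u * m"
      by (simp add: m(2) distrib_left axis_mult mult.assoc)
    then show "cvec u * x \<in> S" using SI[OF act[OF u m(1)]] by metis
  qed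
  have H_closed: "closed H" by (simp add: H_def)
  have H_diff: "x - y \<in> H" if "x \<in> H" "y \<in> H" for x y
  proof -
    obtain f g where "\<And>n. f n \<in> S" "f \<longlonglongrightarrow> x" "\<And>n. g n \<in> S" "g \<longlonglongrightarrow> y"
      using \<open>x \<in> H\<close> \<open>y \<in> H\<close> unfolding H_def closure_sequential by auto
    then show ?thesis unfolding H_def closure_sequential using S_diff
      by (intro exI[of _ "\<lambda>n. f n - g n"] conjI allI tendsto_diff) auto
  qed
  have S_H: "S \<subseteq> H" by (simp add: H_def closure_subset)
  have H_axis: "?\<alpha> x \<in> H" for x using SI[OF zero, of x] S_H by auto
  have H_L: "m \<in> H" if "m \<in> L" for m using SI[OF that, of 0] S_H by auto
  have H_0: "0 \<in> H" by (rule H_L[OF zero])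
  have H_add: "x + y \<in> H" if "x \<in> H" "y \<in> H" for x y
    using H_diff[OF that(1) H_diff[OF H_0 that(2)]] by simp
  have H_X: "z + h \<in> X" if "h \<in> H" for h
  proof -
    have "S \<subseteq> (\<lambda>h. z + h) -` X" using X(2)[OF line'] by (auto simp: S_def add.assoc)
    moreover have "closed ((\<lambda>h. z + h) -` X)" by (intro closed_vimage X(1) continuous_intros)
    ultimately have "H \<subseteq> (\<lambda>h. z + h) -` X" unfolding H_def by (rule closure_minimal)
    then show ?thesis using that by blast
  qed
  have H_line: "axis j (complex_of_real x * w) \<in> H" if w: "axis j w \<in> H" for j w x
  proof -
    have p: "x \<in> {x. axis j (complex_of_real x * w) \<in> H}" if "x > 0" for x
    proof (rule closed_coordinate_values[OF _ _ that])
      have "closed ((\<lambda>x. axis j (complex_of_real x * w)) -` H)"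
        by (intro closed_vimage H_closed continuous_intros)
      then show "closed {x. axis j (complex_of_real x * w) \<in> H}" by (simp add: vimage_def)
      show "u $ j \<in> {x. axis j (complex_of_real x * w) \<in> H}" if "u \<in> G" for u
        using invariantD(3)[OF H_inv w that] by (simp add: axis_mult)
    qed
    consider "x > 0" | "x = 0" | "- x > 0" by linarith
    then show ?thesis
    proof cases
      case 1 then show ?thesis using p by blast
    next
      case 2 then show ?thesis using H_0 by simp
    next
      case 3
      have "axis j (complex_of_real x * w) = 0 - axis j (complex_of_real (- x) * w)"
        by (simp add: axis_def vec_eq_iff)
      then show ?thesis using H_diff[OF H_0, of "axis j (complex_of_real (- x) * w)"] p[OF 3] by (simp only: mem_Collect_eq)
    qed
  qed
  have \<tau>H: "\<tau> n \<in> H" for n unfolding \<tau>_def by (intro H_diff H_L cL H_axis)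
  have "\<forall>\<^sub>F n in sequentially. c n \<noteq> 0"
  proof -
    have "(\<lambda>n. \<tau> n $ i) \<longlonglongrightarrow> 0" using tendsto_vec_nth[OF \<tau>lim, of i] by simp
    from tendstoD[OF this, of "cmod a"] have "\<forall>\<^sub>F n in sequentially. cmod (\<tau> n $ i) < cmod a" using a by simp
    then show ?thesis
    proof eventually_elim
      case (elim n)
      show ?case
      proof
        assume "c n = 0"
        then have "cmod (\<tau> n $ i) = t n * cmod a" using tn[of n] by (simp add: \<tau>_def norm_mult)
        moreover have "1 * cmod a \<le> t n * cmod a" using tn[of n] by (intro mult_right_mono) auto
        ultimately show False using elim by simp
      qed
    qed
  qed
  then obtain n0 where n0: "\<And>n. n \<ge> n0 \<Longrightarrow> c n \<noteq> 0" unfolding eventually_sequentially by blast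
  have \<tau>lim': "(\<lambda>n. \<tau> (n + n0)) \<longlonglongrightarrow> 0" by (rule LIMSEQ_ignore_initial_segment[OF \<tau>lim])
  \<comment> \<open>Off \<open>i\<close> the entries of \<open>\<tau>\<close> are those of the
    lattice vector \<open>c\<close>, hence nonzero, so \<open>\<tau>\<close> can be expanded in
    every direction \<open>j\<close>.\<close>
  have "\<exists>w. w \<noteq> 0 \<and> axis j w \<in> H \<and> (j = i \<longrightarrow> w = a)" for j
  proof (cases "j = i")
    case True
    then show ?thesis using a H_axis[of 1] by auto
  next
    case False
    have nz: "\<tau> (n + n0) $ j \<noteq> 0" for n
      using coordinate_nonzero[OF cL n0, of "n + n0" j] False by (simp add: \<tau>_def axis_def)
    obtain g \<rho> w where g: "\<And>n. g n \<in> G" "w \<noteq> 0" "(\<lambda>n. cvec (g n) * \<tau> (\<rho> n + n0)) \<longlonglongrightarrow> axis j w"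
      by (rule expand_seq[OF False[symmetric] \<tau>lim' nz]) blast
    have "axis j w \<in> H"
      by (rule closed_sequentially[OF H_closed invariantD(3)[OF H_inv \<tau>H g(1)] g(3)])
    then show ?thesis using g(2) False by blast
  qed
  then obtain A' where A': "\<And>j. A' j \<noteq> 0" "\<And>j. axis j (A' j) \<in> H" "A' i = a" by metis
  define A :: "complex^'s" where "A = (\<chi> j. A' j)"
  have nz: "A $ j \<noteq> 0" for j using A'(1) by (simp add: A_def)
  have W: "frame A p 0 \<in> H" for p
  proof -
    have "(\<Sum>j\<in>F. axis j (complex_of_real (p $ j) * A' j)) \<in> H" if "finite F" for F
      using that by (induction F rule: finite_induct) (auto intro: H_0 H_add H_line A'(2))
    from this[of UNIV] have "(\<Sum>j\<in>UNIV. axis j (complex_of_real (p $ j) * A' j)) \<in> H" by simp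
    moreover have "(\<Sum>j\<in>UNIV. axis j (complex_of_real (p $ j) * A' j)) = frame A p 0"
      by (simp add: vec_eq_iff axis_def A_def complex_eq_iff)
    ultimately show ?thesis by simp
  qed
  define y' where "y' n = imco A (c (n + n0))" for n
  have cf: "c (n + n0) = frame A (reco A (c (n + n0))) (y' n)" for n
    unfolding y'_def using frame_coordinates[of A] nz by simp
  have y'\<tau>: "y' n = imco A (\<tau> (n + n0))" for n
  proof -
    have "imco A (?\<alpha> x) = 0" for x
      using A'(1)[of i] by (auto simp: vec_eq_iff axis_def A_def A'(3)[symmetric])
    then show ?thesis by (simp add: y'_def \<tau>_def imco_diff)
  qed
  have y'lim: "y' \<longlonglongrightarrow> 0"
    using tendsto_imco[OF nz \<tau>lim'] by (simp add: y'\<tau>[abs_def])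
  have y'H: "frame A 0 (y' n) \<in> H" for n
  proof -
    have "frame A 0 (y' n) = c (n + n0) - frame A (reco A (c (n + n0))) 0"
      by (subst (1) cf) (simp add: frame_diff)
    then show ?thesis using H_diff[OF H_L[OF cL] W] by metis
  qed
  show ?thesis
  proof (cases "\<exists>n. y' n = 0")
    case True
    \<comment> \<open>A nonzero lattice vector lies in the real span of \<open>A\<close>, and this
      span contains the real span of that lattice vector.\<close>
    then obtain n where n: "y' n = 0" by blast
    let ?v = "c (n + n0)"
    have "frame ?v p 0 = frame A (p * reco A ?v) 0" for p
      using cf[of n, unfolded n] by (simp add: vec_eq_iff complex_eq_iff)
    then have "z + frame ?v p 0 \<in> X" for p using H_X[OF W] by metis
    then show ?thesis using cL n0[of "n + n0"] by (intro bexI[of _ ?v]) auto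
  next
    case False
    then have "\<exists>k. y' n $ k \<noteq> 0" for n by (metis vec_eq_iff zero_index)
    then obtain J where J: "\<And>n. y' n $ J n \<noteq> 0" by metis
    obtain k r' where r': "strict_mono r'" "\<And>n::nat. J (r' n) = k" using nat_pigeonhole_index[of J] by blast
    obtain k' where k': "k' \<noteq> k" using third_index[of k k k] by metis
    define \<delta> where "\<delta> n = frame A 0 (y' (r' n))" for n
    have "(\<lambda>n. y' (r' n)) \<longlonglongrightarrow> 0" using LIMSEQ_subseq_LIMSEQ[OF y'lim r'(1)] by (simp add: o_def)
    from tendsto_frame[OF tendsto_const this, of A 0] have \<delta>lim: "\<delta> \<longlonglongrightarrow> 0" by (simp add: \<delta>_def[abs_def])
    have \<delta>nz: "\<delta> n $ k \<noteq> 0" for n 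
    proof -
      have "Complex 0 (y' (r' n) $ k) \<noteq> 0" using J[of "r' n"] r'(2) by (simp add: complex_eq_iff)
      then show ?thesis using nz[of k] by (simp add: \<delta>_def)
    qed
    obtain g \<rho> w where g: "\<And>n. g n \<in> G" "w \<noteq> 0" "(\<lambda>n. cvec (g n) * \<delta> (\<rho> n)) \<longlonglongrightarrow> axis k w"
      by (rule expand_seq[OF k' \<delta>lim \<delta>nz]) blast
    have wH: "axis k w \<in> H"
      by (rule closed_sequentially[OF H_closed invariantD(3)[OF H_inv _ g(1)] g(3)]) (simp add: \<delta>_def y'H)
    have "reco A (cvec (g n) * \<delta> (\<rho> n)) = 0" for n
      using reco_frame[of A 0 "g n * y' (r' (\<rho> n))"] nz by (simp add: \<delta>_def frame_cvec)
    with tendsto_reco[OF nz g(3)] have "(\<lambda>n. 0) \<longlonglongrightarrow> reco A (axis k w)" by simp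
    then have "reco A (axis k w) = 0" using LIMSEQ_unique tendsto_const by blast
    then have "reco A (axis k w) $ k = 0" by simp
    \<comment> \<open>The expanded errors have no real part relative to \<open>A\<close>. So
      \<open>w\<close> and \<open>A' k\<close> are independent over the reals, they span a complex
      line in \<open>H\<close>, and \<open>H\<close> is everything by
      \<open>complex_line_dense\<close>.\<close>
    then have re: "Re (w / A' k) = 0" by (simp add: A_def)
    then have im: "Im (w / A' k) \<noteq> 0" using g(2) A'(1)[of k] by (metis complex_eq_iff divide_eq_0_iff zero_complex.simps)
    have real_basis: "h = complex_of_real (Re h) + complex_of_real (Im h / Im w) * w"
      if "Re w = 0" "Im w \<noteq> 0" for h w :: complex
      using that by (simp add: complex_eq_iff)
    have "axis k h \<in> H" for h
    proof -
      let ?h = "h / A' k" and ?w = "w / A' k"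
      have "?h = complex_of_real (Re ?h) + complex_of_real (Im ?h / Im ?w) * ?w"
        by (rule real_basis[OF re im])
      then have "h = complex_of_real (Re ?h) * A' k + complex_of_real (Im ?h / Im ?w) * w"
        using A'(1)[of k] by (metis (no_types, lifting) distrib_right nonzero_divide_eq_eq times_divide_eq_right)
      then have "axis k h = axis k (complex_of_real (Re ?h) * A' k) + axis k (complex_of_real (Im ?h / Im ?w) * w)"
        by (simp add: axis_def vec_eq_iff)
      then show ?thesis using H_add[OF H_line[OF A'(2)] H_line[OF wH]] by metis
    qed
    then have "h \<in> H" for h using complex_line_dense[OF H_closed invariantD(2)[OF H_inv]] by blast
    then have "z + h \<in> X" for h using H_X by blast
    then show ?thesis using nonzero_element by blast
  qed
qed

end


lemma null_comparison:
  fixes f :: "nat \<Rightarrow> 'v::real_normed_vector"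
  assumes "\<And>n. norm (f n) \<le> g n" "g \<longlonglongrightarrow> 0"
  shows "f \<longlonglongrightarrow> 0"
  by (rule Lim_null_comparison[OF always_eventually assms(2)]) (use assms(1) in blast)

section \<open>Accumulation of an invariant set at a flat\<close>

context complex_lattice
begin

text \<open>The transversal coordinates over which the whole flat lies in \<open>X\<close> form a
  closed set with periods \<open>quotient v\<close>. Scaling by units puts a half line into it, and
  half lines are dense modulo that lattice.\<close>

lemma transversal_full:
  assumes X: "invariant G L X" and v: "v \<in> L" "v \<noteq> 0"
    and shift: "\<And>p q u. r + frame v p q \<in> X \<Longrightarrow> u \<in> G \<Longrightarrow> r + frame v (u * p) (u * q) \<in> X"
    and full: "\<And>p. r + frame v p (axis i b) \<in> X" and b: "b \<noteq> 0"
  shows "w \<in> X"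
proof -
  note nz = coordinate_nonzero[OF v]
  interpret quot: unit_lattice G "quotient v" by (rule quotient_lattice[OF v])
  define Y where "Y = {y. \<forall>p. r + frame v p y \<in> X}"
  have Yc: "closed Y"
  proof -
    have "Y = (\<Inter>p. (\<lambda>y. r + frame v p y) -` X)" by (auto simp: Y_def)
    moreover have "closed ((\<lambda>y. r + frame v p y) -` X)" for p
      by (intro closed_vimage invariantD(1)[OF X] continuous_intros)
    ultimately show ?thesis by auto
  qed
  have Yp: "y + a \<in> Y" if "y \<in> Y" "a \<in> quotient v" for y a
  proof -
    obtain m where m: "m \<in> L" "a = imco v m" using \<open>a \<in> quotient v\<close> by (auto simp: quotient_def)
    have "r + frame v p (y + a) \<in> X" for p
    proof -
      have "r + frame v (p - reco v m) y \<in> X" using \<open>y \<in> Y\<close> by (simp add: Y_def)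
      from invariantD(2)[OF X this m(1)] have "r + frame v (p - reco v m) y + m \<in> X" .
      moreover have "frame v (p - reco v m) y + m = frame v p (y + a)"
        using frame_coordinates[of v m] nz frame_add[of v "p - reco v m" y "reco v m" "imco v m"] m(2) by simp
      ultimately show ?thesis by (simp add: add.assoc)
    qed
    then show ?thesis by (simp add: Y_def)
  qed
  have "0 + axis i (t * b) \<in> Y" if "t > 0" for t
  proof -
    have "t \<in> {t. axis i (t * b) \<in> Y}"
    proof (rule closed_coordinate_values[OF _ _ that])
      have "closed ((\<lambda>t. axis i (t * b)) -` Y)" by (intro closed_vimage Yc continuous_intros)
      then show "closed {t. axis i (t * b) \<in> Y}" by (simp add: vimage_def)
    next
      fix u assume u: "u \<in> G"
      have "r + frame v p (axis i (u $ i * b)) \<in> X" for p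
        using shift[OF full u, of "vinv u * p"] mult_vinv[OF u] by (simp add: axis_mult mult.assoc[symmetric])
      then show "u $ i \<in> {t. axis i (t * b) \<in> Y}" by (simp add: Y_def)
    qed
    then show ?thesis by simp
  qed
  from quot.closed_half_line[OF Yc Yp this b] have "imco v (w - r) \<in> Y" .
  then have "r + frame v (reco v (w - r)) (imco v (w - r)) \<in> X" by (simp add: Y_def)
  then show ?thesis using frame_coordinates[of v "w - r"] nz by simp
qed

lemma closures_sequence:
  fixes x :: "'b::metric_space"
  assumes "\<And>k. x \<in> closure (Z k)"
  shows "\<exists>y. (\<forall>k::nat. y k \<in> Z k) \<and> y \<longlonglongrightarrow> x"
proof -
  have "\<forall>k. \<exists>y\<in>Z k. dist y x < inverse (real (Suc k))" using assms by (simp add: closure_approachable)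
  then obtain y where y: "\<And>k. y k \<in> Z k" "\<And>k. dist (y k) x < inverse (real (Suc k))" by metis
  have "(\<lambda>k. dist (y k) x) \<longlonglongrightarrow> 0"
    by (rule null_comparison[OF _ LIMSEQ_inverse_real_of_nat]) (use y(2) in \<open>simp add: less_imp_le\<close>)
  then show ?thesis using y(1) tendsto_dist_iff by blast
qed

text \<open>
  Points accumulating at an \<open>s\<close>-dimensional flat can be expanded until they leave it in a coordinate
  direction. The limits form an invariant set in a cylinder over the flat, to which
  \<open>cylinder_alternative\<close> applies; going back in time, the points must have accumulated at a
  torsion point.
\<close>

lemma flat_accumulation_aux:
  fixes p q :: "nat \<Rightarrow> real^'s"
  assumes X: "invariant G L X" and w: "w \<notin> X" and r: "torsion r" and v: "v \<in> L" "v \<noteq> 0"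
    and p: "p \<longlonglongrightarrow> p'" and q: "q \<longlonglongrightarrow> 0" and s: "s \<noteq> 0" "\<And>n. s * q n $ i > 0"
    and mem: "\<And>n. r + frame v (p n) (q n) \<in> X"
  shows "torsion (r + frame v p' 0)"
proof -
  note nz = coordinate_nonzero[OF v]
  interpret flat: unit_lattice G "flat v" by (rule flat_lattice[OF v])
  obtain n0 :: nat where n0: "n0 > 0" "real n0 *\<^sub>R r \<in> L" using r unfolding torsion_def by blast
  obtain N where N: "N > 0" "\<And>u x. u \<in> G \<Longrightarrow> real n0 *\<^sub>R x \<in> L \<Longrightarrow> cvec (u ^ N) * x - x \<in> L"
    using unit_power_fixes_torsion[OF n0(1)] by blast
  let ?G = "(\<lambda>u. u ^ N) ` G"
  interpret C': complex_lattice ?G L by (rule powers_lattice[OF N(1)])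
  interpret F': unit_lattice ?G "flat v" by (rule flat.powers_lattice[OF N(1)])
  have X': "invariant ?G L X" by (rule invariant_subset[OF powers_subset X])
  have shift: "r + frame v (u * p) (u * q) \<in> X" if x: "r + frame v p q \<in> X" and u: "u \<in> ?G" for p q u
  proof -
    obtain w where w: "w \<in> G" "u = w ^ N" using u by blast
    have "cvec u * (r + frame v p q) \<in> X" by (rule invariantD(3)[OF X' x u])
    moreover have "- (cvec u * r - r) \<in> L" using uminus[OF N(2)[OF w(1) n0(2)]] w(2) by simp
    ultimately have "cvec u * (r + frame v p q) + (- (cvec u * r - r)) \<in> X" by (rule invariantD(2)[OF X])
    then show ?thesis by (simp add: algebra_simps frame_cvec)
  qed
  have period: "r + frame v (p + a) q \<in> X" if x: "r + frame v p q \<in> X" and a: "a \<in> flat v" for p q a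
  proof -
    have "r + frame v p q + frame v a 0 \<in> X" using a by (intro invariantD(2)[OF X] x) (simp add: flat_iff)
    then show ?thesis by (simp add: add.assoc frame_add)
  qed
  \<comment> \<open>By \<open>transversal_full\<close> a slice of this kind would make
    \<open>X\<close> everything. Each full slice found below is refuted by this fact.\<close>
  have notfull: "\<not> (\<forall>p. r + frame v p (axis i (s * exp t)) \<in> X)" for t
    using C'.transversal_full[OF X' v shift, of i "s * exp t" w] w s(1) by auto
  \<comment> \<open>Unit translates of the tails of the sequence. \<open>P\<close> collects their
    limits whose transversal part lies on the axis \<open>i\<close>, on the side given by
    \<open>s\<close>, with \<open>t\<close> as its logarithmic position. Because of the tails,
    points of \<open>P\<close> are limits along indices tending to infinity.\<close>
  define Z where "Z m = {(u * p n + b, u * q n) |n u b. n \<ge> m \<and> u \<in> ?G \<and> b \<in> flat v}" for m :: nat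
  define P where "P = {(x, t). \<forall>m. (x, axis i (s * exp t)) \<in> closure (Z m)}"
  have PX: "r + frame v x (axis i (s * exp t)) \<in> X" if xt: "(x, t) \<in> P" for x t
  proof -
    have "closed ((\<lambda>y. r + frame v (fst y) (snd y)) -` X)"
      by (intro closed_vimage invariantD(1)[OF X] continuous_intros)
    moreover have "Z 0 \<subseteq> (\<lambda>y. r + frame v (fst y) (snd y)) -` X"
      unfolding Z_def using period[OF shift[OF mem]] by fastforce
    ultimately have "closure (Z 0) \<subseteq> (\<lambda>y. r + frame v (fst y) (snd y)) -` X" by (rule closure_minimal[rotated])
    then show ?thesis using xt by (fastforce simp: P_def)
  qed
  have cyl: "cylinder ?G (flat v) i P"
    unfolding cylinder_def
  proof (intro conjI allI impI)
    have "closed (\<Inter>m. (\<lambda>y. (fst y, axis i (s * exp (snd y)))) -` closure (Z m))"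
      by (intro closed_INT ballI closed_vimage closed_closure continuous_intros)
    moreover have "P = (\<Inter>m. (\<lambda>y. (fst y, axis i (s * exp (snd y)))) -` closure (Z m))" by (auto simp: P_def)
    ultimately show "closed P" by simp
  next
    fix x t a assume xt: "(x, t) \<in> P" and a: "a \<in> flat v"
    have "(x + a, axis i (s * exp t)) \<in> closure (Z m)" for m
    proof -
      have "(\<lambda>y. (fst y + a, snd y)) ` Z m \<subseteq> Z m" unfolding Z_def using flat.add[OF _ a] by (fastforce simp: add.assoc)
      then have "(\<lambda>y. (fst y + a, snd y)) ` closure (Z m) \<subseteq> closure (Z m)"
        using closure_subset by (intro image_closure_subset continuous_intros closed_closure) blast
      then show ?thesis using xt by (fastforce simp: P_def)
    qed
    then show "(x + a, t) \<in> P" by (simp add: P_def)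
  next
    fix x t g assume xt: "(x, t) \<in> P" and g: "g \<in> ?G"
    have ax: "g * axis i (s * exp t) = axis i (s * exp (t + ln (g $ i)))"
      using C'.pos[OF g, of i] by (simp add: axis_mult exp_add mult_ac)
    have "(g * x, g * axis i (s * exp t)) \<in> closure (Z m)" for m
    proof -
      have "(\<lambda>y. (g * fst y, g * snd y)) ` Z m \<subseteq> Z m"
      proof safe
        fix x c assume "(x, c) \<in> Z m"
        then obtain n u b where "n \<ge> m" "u \<in> ?G" "b \<in> flat v" "x = u * p n + b" "c = u * q n" unfolding Z_def by blast
        moreover from this have "(g * fst (x, c), g * snd (x, c)) = ((g * u) * p n + g * b, (g * u) * q n)"
          by (simp add: distrib_left mult.assoc)
        ultimately show "(g * fst (x, c), g * snd (x, c)) \<in> Z m" unfolding Z_def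
          using C'.mult[OF g] F'.act[OF g] by blast
      qed
      then have "(\<lambda>y. (g * fst y, g * snd y)) ` closure (Z m) \<subseteq> closure (Z m)"
        using closure_subset
        by (intro image_closure_subset closed_closure) (auto simp: continuous_on_def intro!: tendsto_intros)
      then show ?thesis using xt by (fastforce simp: P_def)
    qed
    then show "(g * x, t + ln (g $ i)) \<in> P" by (simp add: P_def ax)
  qed
  \<comment> \<open>Such limits exist: the transversal coordinates tend to 0 and can be expanded
    until the \<open>i\<close>-th one has size 1.\<close>
  have "P \<noteq> {}"
  proof -
    obtain i0 where "i0 \<noteq> i" using third_index[of i i i] by metis
    moreover have "q n $ i \<noteq> 0" for n using s(2)[of n] by auto
    ultimately obtain g \<rho> a where g: "\<And>n. g n \<in> ?G" "strict_mono \<rho>" "a \<noteq> 0" "(\<lambda>n. g n * q (\<rho> n)) \<longlonglongrightarrow> axis i a"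
      by (rule C'.expand_seq_real[OF _ q]) blast
    have sl: "(\<lambda>n. s * (g n * q (\<rho> n)) $ i) \<longlonglongrightarrow> s * a"
      using tendsto_mult[OF tendsto_const tendsto_vec_nth[OF g(4), of i]] by simp
    have "0 \<le> s * (g n * q (\<rho> n)) $ i" for n
      using mult_pos_pos[OF C'.pos[OF g(1), of n i] s(2)[of "\<rho> n"]] by (simp add: mult.left_commute)
    then have "0 \<le> s * a" using LIMSEQ_le_const[OF sl, of 0] by blast
    then have sa: "a / s > 0" using s(1) g(3) by (simp add: zero_less_divide_iff zero_le_mult_iff) linarith
    define t where "t = ln (a / s)"
    have at: "s * exp t = a" using sa s(1) by (simp add: t_def)
    obtain b r' z where b: "\<And>n. b n \<in> flat v" "strict_mono r'" "(\<lambda>n. g (r' n) * p (\<rho> (r' n)) - b n) \<longlonglongrightarrow> z"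
      by (rule flat.reduce_seq[of "\<lambda>n. g n * p (\<rho> n)"]) blast
    have gq: "(\<lambda>n. g (r' n) * q (\<rho> (r' n))) \<longlonglongrightarrow> axis i a" using LIMSEQ_subseq_LIMSEQ[OF g(4) b(2)] by (simp add: o_def)
    let ?y = "\<lambda>n. (g (r' n) * p (\<rho> (r' n)) + (- b n), g (r' n) * q (\<rho> (r' n)))"
    have "?y \<longlonglongrightarrow> (z, axis i a)" using tendsto_Pair[OF b(3) gq] by simp
    moreover have "?y n \<in> closure (Z m)" if "n \<ge> m" for n m
    proof -
      have "\<rho> (r' n) \<ge> m" using seq_suble[OF g(2), of "r' n"] seq_suble[OF b(2), of n] that by linarith
      then have "?y n \<in> Z m" unfolding Z_def using g(1) flat.uminus[OF b(1)] by blast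
      then show ?thesis using closure_subset by blast
    qed
    then have "\<forall>\<^sub>F n in sequentially. ?y n \<in> closure (Z m)" for m
      unfolding eventually_sequentially by blast
    ultimately have "(z, axis i a) \<in> closure (Z m)" for m
      by (intro Lim_in_closed_set[of "closure (Z m)" ?y sequentially]) auto
    then have "(z, t) \<in> P" by (simp add: P_def at)
    then show ?thesis by blast
  qed
  from F'.cylinder_alternative[OF cyl this] notfull PX
  obtain p0 t0 x where p0: "(p0, t0) \<in> P" "flat.torsion (p0 - axis i x)" by blast
  define r0 where "r0 = p0 - axis i x"
  obtain q0 :: nat where q0: "q0 > 0" "real q0 *\<^sub>R r0 \<in> flat v" using p0(2) unfolding flat.torsion_def r0_def by blast
  obtain M where M: "M > 0" "\<And>u x. u \<in> ?G \<Longrightarrow> real q0 *\<^sub>R x \<in> flat v \<Longrightarrow> u ^ M * x - x \<in> flat v"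
    using F'.unit_power_fixes_torsion[OF q0(1)] by blast
  let ?H = "(\<lambda>u. u ^ M) ` ?G"
  interpret F'': unit_lattice ?H "flat v" by (rule F'.powers_lattice[OF M(1)])
  have HG: "u \<in> ?G" if "u \<in> ?H" for u using C'.powers_subset[of M] that by blast
  have Hr0: "u * r0 - r0 \<in> flat v" if "u \<in> ?H" for u using M(2)[OF _ q0(2)] that by blast
  have "\<exists>y. (\<forall>k. y k \<in> Z k) \<and> y \<longlonglongrightarrow> (p0, axis i (s * exp t0))"
    using p0(1) by (intro closures_sequence) (simp add: P_def)
  then obtain y where y: "\<And>k. y k \<in> Z k" "y \<longlonglongrightarrow> (p0, axis i (s * exp t0))" by blast
  have "\<exists>n u b. n \<ge> k \<and> u \<in> ?G \<and> b \<in> flat v \<and> y k = (u * p n + b, u * q n)" for k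
    using y(1)[of k] unfolding Z_def by blast
  then obtain n u b where nub: "\<And>k. n k \<ge> k" "\<And>k. u k \<in> ?G" "\<And>k. b k \<in> flat v"
     "\<And>k. y k = (u k * p (n k) + b k, u k * q (n k))" by metis
  define \<delta> where "\<delta> k = u k * p (n k) + b k - p0" for k
  have \<delta>lim: "\<delta> \<longlonglongrightarrow> 0" and uq: "(\<lambda>k. u k * q (n k)) \<longlonglongrightarrow> axis i (s * exp t0)"
    using LIM_zero[OF tendsto_fst[OF y(2)]] tendsto_snd[OF y(2)] by (simp_all add: \<delta>_def[abs_def] nub(4))
  have nlim: "filterlim n sequentially sequentially"
    by (rule filterlim_at_top_mono[OF filterlim_ident]) (use nub(1) in auto)
  have pn: "(\<lambda>k. p (n k)) \<longlonglongrightarrow> p'" and qn: "(\<lambda>k. q (n k)) \<longlonglongrightarrow> 0"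
    using filterlim_compose[OF p nlim] filterlim_compose[OF q nlim] by auto
  \<comment> \<open>Going back by \<open>vinv (u k)\<close>: the original point
    \<open>p (n k)\<close> is the sum of \<open>\<sigma> k\<close>, whose order divides
    \<open>q0\<close>, and of \<open>\<xi> k\<close>, which stems from the component
    \<open>axis i x\<close> and the error \<open>\<delta>\<close>.\<close>
  define \<xi> where "\<xi> k = vinv (u k) * (axis i x + \<delta> k)" for k
  define \<sigma> where "\<sigma> k = p (n k) - \<xi> k" for k
  have uxi: "u k * \<xi> k = axis i x + \<delta> k" for k
    using C'.mult_vinv[OF nub(2)] by (simp add: \<xi>_def mult.assoc[symmetric])
  have \<sigma>tors: "real q0 *\<^sub>R \<sigma> k \<in> flat v" for k
  proof -
    have "u k * \<sigma> k = u k * p (n k) - u k * \<xi> k" by (simp add: \<sigma>_def right_diff_distrib)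
    also have "\<dots> = r0 - b k" by (simp only: uxi) (simp add: \<delta>_def r0_def)
    finally have "u k * \<sigma> k = r0 - b k" .
    then have "u k * (real q0 *\<^sub>R \<sigma> k) = real q0 *\<^sub>R r0 - real q0 *\<^sub>R b k" by (simp add: scaleR_right_diff_distrib)
    then have "u k * (real q0 *\<^sub>R \<sigma> k) \<in> flat v" using flat.diff[OF q0(2) flat.scaleR_nat[OF nub(3)]] by metis
    then show ?thesis using F'.act_iff[OF nub(2)] by blast
  qed
  show ?thesis
  proof (rule ccontr)
    assume "\<not> torsion (r + frame v p' 0)"
    then have notors: "\<not> flat.torsion p'" using torsion_add r flat_torsion[OF v] by blast
    \<comment> \<open>If \<open>\<xi>\<close> came arbitrarily close to 0 along large indices,
      \<open>p'\<close> would be a limit of points of order dividing \<open>q0\<close>, and these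
      form a closed set.\<close>
    have "\<exists>\<eta>>0. \<exists>k0. \<forall>k\<ge>k0. norm (\<xi> k) \<ge> \<eta>"
    proof (rule ccontr)
      assume neg: "\<not> ?thesis"
      have "p' \<in> closure {y. real q0 *\<^sub>R y \<in> flat v}"
        unfolding closure_approachable
      proof (intro allI impI)
        fix e :: real assume e: "e > 0"
        from tendstoD[OF pn, of "e / 2"] e obtain k0 where k0: "\<And>k. k \<ge> k0 \<Longrightarrow> dist (p (n k)) p' < e / 2"
          unfolding eventually_sequentially by auto
        obtain k where k: "k \<ge> k0" "norm (\<xi> k) < e / 2" using neg e by (metis half_gt_zero not_le)
        have "norm (p (n k) - p' - \<xi> k) \<le> norm (p (n k) - p') + norm (\<xi> k)" by (rule norm_triangle_ineq4)
        moreover have "p (n k) - p' - \<xi> k = \<sigma> k - p'" by (simp add: \<sigma>_def)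
        ultimately have "dist (\<sigma> k) p' < e" using k0[OF k(1)] k(2) by (simp add: dist_norm)
        then show "\<exists>y\<in>{y. real q0 *\<^sub>R y \<in> flat v}. dist y p' < e" using \<sigma>tors by blast
      qed
      moreover have "closed {y. real q0 *\<^sub>R y \<in> flat v}"
      proof -
        have "closed ((\<lambda>y. real q0 *\<^sub>R y) -` flat v)" by (intro closed_vimage flat.closed continuous_intros)
        then show ?thesis by (simp add: vimage_def)
      qed
      ultimately have "real q0 *\<^sub>R p' \<in> flat v" by simp
      then show False using notors q0(1) unfolding flat.torsion_def by blast
    qed
    then obtain \<eta> k0 where \<eta>: "\<eta> > 0" "\<And>k. k \<ge> k0 \<Longrightarrow> norm (\<xi> k) \<ge> \<eta>" by blast
    define \<eta>' where "\<eta>' = \<eta> / (2 * real CARD('s))"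
    have \<eta>': "\<eta>' > 0" using \<eta>(1) by (simp add: \<eta>'_def)
    have uqi: "(\<lambda>k. (u k * q (n k)) $ i) \<longlonglongrightarrow> s * exp t0" using tendsto_vec_nth[OF uq, of i] by simp
    \<comment> \<open>At \<open>i\<close> the units expand coordinates of \<open>q\<close> that tend
      to 0 to a nonzero limit, so they are unbounded there and \<open>\<xi>\<close> is contracted.
      Hence \<open>\<xi>\<close> has to stay away from 0 in another direction
      \<open>j\<close>.\<close>
    have \<xi>i: "(\<lambda>k. \<xi> k $ i) \<longlonglongrightarrow> 0"
    proof -
      have "(\<lambda>k. (x + \<delta> k $ i) * q (n k) $ i / (u k * q (n k)) $ i) \<longlonglongrightarrow> (x + 0) * 0 / (s * exp t0)"
        using s(1) tendsto_vec_nth[OF \<delta>lim, of i] tendsto_vec_nth[OF qn, of i]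
        by (intro tendsto_divide tendsto_mult tendsto_add tendsto_const uqi) auto
      moreover have "(x + \<delta> k $ i) * q (n k) $ i / (u k * q (n k)) $ i = \<xi> k $ i" for k

      proof -
        have "q (n k) $ i \<noteq> 0" using s(2)[of "n k"] by auto
        then show ?thesis using C'.nonzero[OF nub(2), of k i] by (simp add: \<xi>_def field_simps)
      qed
      ultimately show ?thesis by simp
    qed
    from tendstoD[OF \<xi>i \<eta>'] obtain k1 where k1: "\<And>k. k \<ge> k1 \<Longrightarrow> \<bar>\<xi> k $ i\<bar> < \<eta>'"
      unfolding eventually_sequentially by auto
    define K where "K = k0 + k1"
    have "\<exists>j. j \<noteq> i \<and> \<bar>\<xi> (k + K) $ j\<bar> \<ge> \<eta>'" for k
    proof (rule ccontr)
      assume "\<not> ?thesis"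
      then have "\<bar>\<xi> (k + K) $ j\<bar> \<le> \<eta>'" for j
        using k1[of "k + K"] by (cases "j = i") (auto simp: K_def not_le less_imp_le)
      then have "(\<Sum>j\<in>UNIV. \<bar>\<xi> (k + K) $ j\<bar>) \<le> (\<Sum>j\<in>(UNIV::'s set). \<eta>')" by (rule sum_mono)
      also have "\<dots> = \<eta> / 2" by (simp add: \<eta>'_def)
      finally have "norm (\<xi> (k + K)) \<le> \<eta> / 2" using norm_le_l1_cart[of "\<xi> (k + K)"] by linarith
      then show False using \<eta>(2)[of "k + K"] \<eta>(1) by (simp add: K_def)
    qed
    then obtain J where J: "\<And>k. J k \<noteq> i" "\<And>k. \<bar>\<xi> (k + K) $ J k\<bar> \<ge> \<eta>'" by metis
    obtain j \<kappa>' where \<kappa>': "strict_mono \<kappa>'" "\<And>n::nat. J (\<kappa>' n) = j" using nat_pigeonhole_index[of J] by blast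
    define \<kappa> where "\<kappa> m = \<kappa>' m + K" for m
    have \<kappa>: "strict_mono \<kappa>" using \<kappa>'(1) by (simp add: \<kappa>_def strict_mono_def)
    have ij: "i \<noteq> j" using J(1) \<kappa>'(2) by metis
    have \<xi>j: "\<bar>\<xi> (\<kappa> m) $ j\<bar> \<ge> \<eta>'" for m using J(2)[of "\<kappa>' m"] \<kappa>'(2) by (simp add: \<kappa>_def)
    have \<delta>j: "\<delta> (\<kappa> m) $ j = u (\<kappa> m) $ j * \<xi> (\<kappa> m) $ j" for m
      using arg_cong[OF uxi[of "\<kappa> m"], of "\<lambda>x. x $ j"] ij by (simp add: axis_def)
    have \<delta>nz: "\<delta> (\<kappa> m) $ j \<noteq> 0" for m
      using \<delta>j[of m] \<xi>j[of m] \<eta>' C'.nonzero[OF nub(2), of "\<kappa> m" j] by auto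
    have \<delta>\<kappa>: "(\<lambda>m. \<delta> (\<kappa> m)) \<longlonglongrightarrow> 0" using LIMSEQ_subseq_LIMSEQ[OF \<delta>lim \<kappa>] by (simp add: o_def)
    \<comment> \<open>Now \<open>\<delta>\<close> is expanded in direction \<open>j\<close>. The
      transversal coordinates stay under control: at \<open>j\<close> because \<open>u\<close> is at
      most \<open>\<bar>\<delta>\<bar> / \<eta>'\<close> there while \<open>q\<close> tends to 0,
      elsewhere because \<open>g\<close> is bounded off \<open>j\<close>.\<close>
    obtain g \<rho> a l C where g: "\<And>m. g m \<in> ?H" "strict_mono \<rho>" "a \<noteq> 0" "(\<lambda>m. g m * \<delta> (\<kappa> (\<rho> m))) \<longlonglongrightarrow> axis j a"
      "(\<lambda>m. ln (g m $ i)) \<longlonglongrightarrow> l" "\<And>m k. k \<noteq> j \<Longrightarrow> g m $ k \<le> C" "C > 0"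
      by (rule F''.expand_seq_real[OF ij \<delta>\<kappa> \<delta>nz]) blast
    define k where "k m = \<kappa> (\<rho> m)" for m
    have k: "strict_mono k" using \<kappa> g(2) by (simp add: k_def strict_mono_def)
    have gi: "(\<lambda>m. g m $ i) \<longlonglongrightarrow> exp l"
      using tendsto_exp[OF g(5)] F''.pos[OF g(1)] by simp
    let ?y = "\<lambda>m. r0 + axis i (g m $ i * x) + g m * \<delta> (k m)"
    let ?z = "\<lambda>m. g m * (u (k m) * q (n (k m)))"
    have ylim: "?y \<longlonglongrightarrow> r0 + axis i (exp l * x) + axis j a"
      unfolding k_def by (intro tendsto_intros gi g(4))
    have zlim: "?z \<longlonglongrightarrow> axis i (exp l * (s * exp t0))"
    proof (rule vec_tendstoI)
      fix h
      have uqk: "(\<lambda>m. (u (k m) * q (n (k m))) $ h) \<longlonglongrightarrow> axis i (s * exp t0) $ h"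
        using tendsto_vec_nth[OF LIMSEQ_subseq_LIMSEQ[OF uq k], of h] by (simp add: o_def)
      consider "h = i" | "h = j" | "h \<noteq> i" "h \<noteq> j" by blast
      then show "(\<lambda>m. ?z m $ h) \<longlonglongrightarrow> axis i (exp l * (s * exp t0)) $ h"
      proof cases
        case 1
        then show ?thesis using tendsto_mult[OF gi uqk] by (simp add: axis_def)
      next
        case 2
        have "norm (?z m $ h) \<le> \<bar>(g m * \<delta> (k m)) $ j\<bar> * \<bar>q (n (k m)) $ j\<bar> * inverse \<eta>'" for m
        proof -
          have up: "u (k m) $ j > 0" by (rule C'.pos[OF nub(2)])
          have "u (k m) $ j * \<eta>' \<le> u (k m) $ j * \<bar>\<xi> (k m) $ j\<bar>" using up \<xi>j by (intro mult_left_mono) (auto simp: k_def)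
          also have "\<dots> = \<bar>\<delta> (k m) $ j\<bar>" using up \<delta>j[of "\<rho> m"] by (simp add: k_def abs_mult)
          finally have "u (k m) $ j \<le> \<bar>\<delta> (k m) $ j\<bar> * inverse \<eta>'" using \<eta>' by (simp add: field_simps)
          then have "(g m $ j * \<bar>q (n (k m)) $ j\<bar>) * u (k m) $ j \<le> (g m $ j * \<bar>q (n (k m)) $ j\<bar>) * (\<bar>\<delta> (k m) $ j\<bar> * inverse \<eta>')"
            using F''.pos[OF g(1), of m j] by (intro mult_left_mono) auto
          then show ?thesis using 2 up F''.pos[OF g(1), of m j] by (simp add: abs_mult mult_ac)
        qed
        moreover have "(\<lambda>m. \<bar>(g m * \<delta> (k m)) $ j\<bar> * \<bar>q (n (k m)) $ j\<bar> * inverse \<eta>') \<longlonglongrightarrow> 0"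
        proof -
          have "(\<lambda>m. (g m * \<delta> (k m)) $ j) \<longlonglongrightarrow> a" using tendsto_vec_nth[OF g(4), of j] by (simp add: k_def)
          moreover have "(\<lambda>m. q (n (k m)) $ j) \<longlonglongrightarrow> 0"
            using tendsto_vec_nth[OF LIMSEQ_subseq_LIMSEQ[OF qn k], of j] by (simp add: o_def)
          ultimately have "(\<lambda>m. \<bar>(g m * \<delta> (k m)) $ j\<bar> * \<bar>q (n (k m)) $ j\<bar> * inverse \<eta>') \<longlonglongrightarrow> \<bar>a\<bar> * \<bar>0\<bar> * inverse \<eta>'"
            by (intro tendsto_intros)
          then show ?thesis by simp
        qed
        ultimately have "(\<lambda>m. ?z m $ h) \<longlonglongrightarrow> 0"
          by (rule null_comparison)
        then show ?thesis using 2 ij by (simp add: axis_def)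
      next
        case 3
        have "norm (?z m $ h) \<le> C * \<bar>(u (k m) * q (n (k m))) $ h\<bar>" for m
          using g(6)[OF 3(2), of m] F''.pos[OF g(1), of m h] by (simp add: abs_mult mult_right_mono)
        moreover have "(\<lambda>m. C * \<bar>(u (k m) * q (n (k m))) $ h\<bar>) \<longlonglongrightarrow> 0"
          using uqk 3(1) by (intro tendsto_mult_right_zero tendsto_rabs_zero) (simp add: axis_def)
        ultimately have "(\<lambda>m. ?z m $ h) \<longlonglongrightarrow> 0"
          by (rule null_comparison)
        then show ?thesis using 3 by (simp add: axis_def)
      qed
    qed
    have yz: "r + frame v (?y m) (?z m) \<in> X" for m
    proof -
      have "r + frame v (u (k m) * p (n (k m)) + b (k m)) (u (k m) * q (n (k m))) \<in> X"
        by (intro period shift mem nub)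
      then have "r + frame v (r0 + axis i x + \<delta> (k m)) (u (k m) * q (n (k m))) \<in> X"
        by (simp add: \<delta>_def r0_def)
      from shift[OF this HG[OF g(1)[of m]]]
      have "r + frame v (g m * (r0 + axis i x + \<delta> (k m)) + (- (g m * r0 - r0))) (?z m) \<in> X"
        by (intro period flat.uminus Hr0 g(1))
      then show ?thesis by (simp add: algebra_simps axis_mult)
    qed
    have limX: "r + frame v (r0 + axis i (exp l * x) + axis j a) (axis i (exp l * (s * exp t0))) \<in> X"
      by (rule closed_sequentially[OF invariantD(1)[OF X] yz tendsto_add[OF tendsto_const tendsto_frame[OF ylim zlim]]])
    \<comment> \<open>Displacements \<open>d\<close> from a base point that moves with the action:
      its components in direction \<open>i\<close> scale with the height \<open>t\<close>, while
      \<open>r0\<close> is fixed modulo the lattice by the units in \<open>?H\<close>.\<close>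
    define Q where "Q = {(d, t). r + frame v (r0 + axis i (x * exp (t - t0)) + d) (axis i (s * exp t)) \<in> X}"
    have "cylinder ?H (flat v) i Q"
      unfolding cylinder_def
    proof (intro conjI allI impI)
      have "closed ((\<lambda>y. r + frame v (r0 + axis i (x * exp (snd y - t0)) + fst y) (axis i (s * exp (snd y)))) -` X)"
        by (intro closed_vimage invariantD(1)[OF X] continuous_intros)
      also have "((\<lambda>y. r + frame v (r0 + axis i (x * exp (snd y - t0)) + fst y) (axis i (s * exp (snd y)))) -` X) = Q"
        by (auto simp: Q_def)
      finally show "closed Q" .
    next
      fix d t a assume "(d, t) \<in> Q" "a \<in> flat v"
      then show "(d + a, t) \<in> Q" using period by (simp add: Q_def add.assoc[symmetric])
    next
      fix d t h assume d: "(d, t) \<in> Q" and h: "h \<in> ?H"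
      have "r + frame v (r0 + axis i (x * exp (t - t0)) + d) (axis i (s * exp t)) \<in> X" using d by (simp add: Q_def)
      from shift[OF this HG[OF h]]
      have mem: "r + frame v (h * (r0 + axis i (x * exp (t - t0)) + d) + (- (h * r0 - r0))) (h * axis i (s * exp t)) \<in> X"
        by (intro period flat.uminus Hr0 h)
      have eq1: "h * (r0 + axis i (x * exp (t - t0)) + d) + (- (h * r0 - r0)) = r0 + axis i (h $ i * (x * exp (t - t0))) + h * d"
        by (simp add: algebra_simps axis_mult)
      have eq2: "h $ i * (x * exp (t - t0)) = x * exp (t + ln (h $ i) - t0)" "h $ i * (s * exp t) = s * exp (t + ln (h $ i))"
        using F''.pos[OF h, of i] by (simp_all add: exp_add exp_diff)
      from mem show "(h * d, t + ln (h $ i)) \<in> Q" unfolding eq1 axis_mult eq2 by (simp add: Q_def)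
    qed
    moreover have "(axis j a, t0 + l) \<in> Q"
      using limX by (simp add: Q_def exp_add mult_ac)
    ultimately have "\<exists>t. \<forall>d. (d, t) \<in> Q" using g(3) ij by (rule F''.cylinder_full_slice)
    then obtain t where t: "\<And>d. (d, t) \<in> Q" by blast
    have "r + frame v y (axis i (s * exp t)) \<in> X" for y
      using t[of "y - (r0 + axis i (x * exp (t - t0)))"] by (simp add: Q_def)
    then show False using notfull by blast
  qed
qed

lemma flat_accumulation:
  assumes X: "invariant G L X" and w: "w \<notin> X" and r: "torsion r" and v: "v \<in> L" "v \<noteq> 0"
    and x: "\<And>n. x n \<in> X" "\<And>n p. x n \<noteq> r + frame v p 0" "x \<longlonglongrightarrow> r + frame v p' 0"
  shows "torsion (r + frame v p' 0)"
proof -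
  note nz = coordinate_nonzero[OF v]
  define p where "p n = reco v (x n - r)" for n
  define q where "q n = imco v (x n - r)" for n
  have xpq: "x n = r + frame v (p n) (q n)" for n
    using frame_coordinates[of v "x n - r"] nz by (simp add: p_def q_def)
  have xr: "(\<lambda>n. x n - r) \<longlonglongrightarrow> frame v p' 0" using tendsto_diff[OF x(3) tendsto_const, of r] by simp
  have p: "p \<longlonglongrightarrow> p'" and q: "q \<longlonglongrightarrow> 0"
    unfolding p_def q_def using tendsto_reco[OF nz xr] tendsto_imco[OF nz xr] nz by simp_all
  have "q n \<noteq> 0" for n using x(2)[of n "p n"] xpq[of n] by auto
  then have "\<exists>k. q n $ k \<noteq> 0" for n by (metis vec_eq_iff zero_index)
  then obtain J where J: "\<And>n. q n $ J n \<noteq> 0" by metis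
  obtain js \<rho> where \<rho>: "strict_mono \<rho>" "\<And>n::nat. (J (\<rho> n), q (\<rho> n) $ J (\<rho> n) > 0) = js"
    using nat_pigeonhole_index[of "\<lambda>n. (J n, q n $ J n > 0)"] by blast
  define s :: real where "s = (if snd js then 1 else - 1)"
  have s: "s * q (\<rho> n) $ fst js > 0" for n
    using J[of "\<rho> n"] \<rho>(2)[of n] by (auto simp: s_def linorder_not_less)
  have "(\<lambda>n. p (\<rho> n)) \<longlonglongrightarrow> p'" "(\<lambda>n. q (\<rho> n)) \<longlonglongrightarrow> 0"
    using LIMSEQ_subseq_LIMSEQ[OF p \<rho>(1)] LIMSEQ_subseq_LIMSEQ[OF q \<rho>(1)] by (simp_all add: o_def)
  then show ?thesis
    by (rule flat_accumulation_aux[where i = "fst js" and s = s, OF X w r v]) (use s x(1) xpq in \<open>auto simp: s_def split: if_splits\<close>)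
qed

definition flat_points :: "(complex^'s) set \<Rightarrow> (complex^'s) set" where
  "flat_points X = {x. \<exists>r v p. torsion r \<and> v \<in> L \<and> v \<noteq> 0 \<and> x = r + frame v p 0 \<and> (\<forall>p. r + frame v p 0 \<in> X)}"

lemma flat_points_periodic: "x \<in> flat_points X \<Longrightarrow> a \<in> L \<Longrightarrow> x + a \<in> flat_points X" if X: "invariant G L X"
proof -
  assume "x \<in> flat_points X" and a: "a \<in> L"
  then obtain r v p where r: "torsion r" "v \<in> L" "v \<noteq> 0" "x = r + frame v p 0" "\<And>p. r + frame v p 0 \<in> X"
    unfolding flat_points_def by blast
  have "r + a + frame v p 0 \<in> X" for p using invariantD(2)[OF X r(5) a] by (simp add: add_ac)
  then show ?thesis unfolding flat_points_def using r a torsion_add_iff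
    by (intro CollectI exI[of _ "r + a"] exI[of _ v] exI[of _ p]) (auto simp: add_ac)
qed

lemma torsion_cvec: "u \<in> G \<Longrightarrow> torsion (cvec u * r)" if "torsion r"
proof -
  assume u: "u \<in> G"
  obtain n :: nat where "n > 0" "real n *\<^sub>R r \<in> L" using \<open>torsion r\<close> unfolding torsion_def by blast
  then show ?thesis unfolding torsion_def using act[OF u] by (intro exI[of _ n]) (simp flip: mult_scaleR_right)
qed

lemma flat_points_act: "x \<in> flat_points X \<Longrightarrow> u \<in> G \<Longrightarrow> cvec u * x \<in> flat_points X" if X: "invariant G L X"
proof -
  assume "x \<in> flat_points X" and u: "u \<in> G"
  then obtain r v p where r: "torsion r" "v \<in> L" "v \<noteq> 0" "x = r + frame v p 0" "\<And>p. r + frame v p 0 \<in> X"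
    unfolding flat_points_def by blast
  have "cvec u * r + frame v p 0 \<in> X" for p
    using invariantD(3)[OF X r(5) u, of "vinv u * p"] mult_vinv[OF u]
    by (simp add: distrib_left frame_cvec mult.assoc[symmetric])
  then show ?thesis unfolding flat_points_def using r torsion_cvec[OF r(1) u]
    by (intro CollectI exI[of _ "cvec u * r"] exI[of _ v] exI[of _ "u * p"]) (auto simp: distrib_left frame_cvec)
qed

text \<open>A flat is uncountable, whereas torsion points are countable.\<close>

lemma flat_nontorsion:
  assumes v: "v \<in> L" "v \<noteq> 0"
  shows "\<exists>p. \<not> torsion (r + frame v p 0)"
proof (rule ccontr)
  assume neg: "\<not> ?thesis"
  note nz = coordinate_nonzero[OF v]
  obtain i :: 's where True by blast
  let ?f = "\<lambda>t::real. r + frame v (axis i t) 0"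
  have "inj ?f"
  proof (rule injI)
    fix s t assume "?f s = ?f t"
    then have "reco v (frame v (axis i s) 0) = reco v (frame v (axis i t) 0)" by simp
    then have "axis i s $ i = axis i t $ i" by (simp only: reco_frame[OF nz])
    then show "s = t" by simp
  qed
  moreover have "countable (range ?f)"
    by (rule countable_subset[OF _ countable_torsion]) (use neg in auto)
  ultimately have "countable (UNIV :: real set)" using countable_image_inj_on by blast
  then show False using uncountable_UNIV_real by blast
qed

text \<open>The limit points of the remainder \<open>?Z\<close> include a torsion point
  \<open>r\<close>. Expanding differences gives a ray from \<open>r\<close> in the closure of
  \<open>?Z\<close>, hence a flat through \<open>r\<close> there. This flat lies in
  \<open>X\<close>, so \<open>?Z\<close> avoids it and yet accumulates at each of its points; by
  \<open>flat_accumulation\<close> all of them would be torsion.\<close>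

theorem isolated_outside_flats:
  assumes X: "invariant G L X" and w: "w \<notin> X"
  shows "\<not> (\<exists>y. y islimpt (X - flat_points X))"
proof
  let ?Z = "X - flat_points X"
  have Zp: "x + a \<in> ?Z" if "x \<in> ?Z" "a \<in> L" for x a
    using that invariantD(2)[OF X] flat_points_periodic[OF X, of "x + a" "- a"] uminus by auto
  have Zu: "cvec u * x \<in> ?Z" if "x \<in> ?Z" "u \<in> G" for x u
    using that invariantD(3)[OF X] flat_points_act[OF X, of "cvec u * x" "vinv u"] inv cvec_vinv(2)[of u x] by auto
  have cZ: "invariant G L (closure ?Z)" by (rule invariant_closure[OF Zp Zu])
  assume "\<exists>y. y islimpt ?Z"
  then obtain r where r: "r islimpt ?Z" "torsion r"
    using invariant_torsion[OF invariant_limpts[OF Zp Zu]] by blast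
  obtain n0 :: nat where n0: "n0 > 0" "real n0 *\<^sub>R r \<in> L" using r(2) unfolding torsion_def by blast
  obtain N where N: "N > 0" "\<And>u x. u \<in> G \<Longrightarrow> real n0 *\<^sub>R x \<in> L \<Longrightarrow> cvec (u ^ N) * x - x \<in> L"
    using unit_power_fixes_torsion[OF n0(1)] by blast
  let ?G = "(\<lambda>u. u ^ N) ` G"
  interpret C': complex_lattice ?G L by (rule powers_lattice[OF N(1)])
  have shift: "r + cvec u * d \<in> closure ?Z" if u: "u \<in> ?G" and d: "r + d \<in> closure ?Z" for u d
  proof -
    obtain v where v: "v \<in> G" "u = v ^ N" using u by blast
    have "cvec u * (r + d) \<in> closure ?Z" using invariantD(3)[OF cZ d] power[OF v(1)] v(2) by blast
    moreover have "- (cvec u * r - r) \<in> L" using uminus[OF N(2)[OF v(1) n0(2)]] v(2) by simp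
    ultimately have "cvec u * (r + d) + (- (cvec u * r - r)) \<in> closure ?Z" by (rule invariantD(2)[OF cZ])
    then show ?thesis by (simp add: algebra_simps)
  qed
  obtain f where f: "\<And>n. f n \<in> ?Z - {r}" "f \<longlonglongrightarrow> r" using r(1) unfolding islimpt_sequential by auto
  define \<delta> where "\<delta> n = f n - r" for n
  have \<delta>lim: "\<delta> \<longlonglongrightarrow> 0" using tendsto_diff[OF f(2) tendsto_const[of r]] by (simp add: \<delta>_def[abs_def])
  have "\<exists>j. \<delta> n $ j \<noteq> 0" for n using f(1)[of n] by (auto simp: \<delta>_def vec_eq_iff)
  then obtain J where J: "\<And>n. \<delta> n $ J n \<noteq> 0" by metis
  obtain j r' where r': "strict_mono r'" "\<And>n::nat. J (r' n) = j" using nat_pigeonhole_index[of J] by blast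
  obtain i where ij: "i \<noteq> j" using third_index[of j j j] by metis
  have 1: "(\<lambda>n. \<delta> (r' n)) \<longlonglongrightarrow> 0" using LIMSEQ_subseq_LIMSEQ[OF \<delta>lim r'(1)] by (simp add: o_def)
  have 2: "\<delta> (r' n) $ j \<noteq> 0" for n using J[of "r' n"] r'(2) by simp
  obtain g s a where g: "\<And>n. g n \<in> ?G" "a \<noteq> 0" "(\<lambda>n. cvec (g n) * \<delta> (r' (s n))) \<longlonglongrightarrow> axis j a"
    by (rule C'.expand_seq[OF ij 1 2]) blast
  have "r + \<delta> n \<in> closure ?Z" for n
  proof -
    have "f n \<in> closure ?Z" using f(1)[of n] closure_subset[of ?Z] by blast
    then show ?thesis by (simp add: \<delta>_def)
  qed
  then have mem: "r + cvec (g n) * \<delta> (r' (s n)) \<in> closure ?Z" for n using shift[OF g(1)] by blast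
  have ax: "r + axis j a \<in> closure ?Z"
    by (rule closed_sequentially[OF closed_closure mem tendsto_add[OF tendsto_const g(3)]])
  have "r + axis j (complex_of_real t * a) \<in> closure ?Z" if "t > 0" for t
  proof -
    have "t \<in> {t. r + axis j (complex_of_real t * a) \<in> closure ?Z}"
    proof (rule C'.closed_coordinate_values[OF _ _ that])
      have "closed ((\<lambda>t. r + axis j (complex_of_real t * a)) -` closure ?Z)"
        by (intro closed_vimage closed_closure continuous_intros)
      then show "closed {t. r + axis j (complex_of_real t * a) \<in> closure ?Z}" by (simp add: vimage_def)
      show "u $ j \<in> {t. r + axis j (complex_of_real t * a) \<in> closure ?Z}" if "u \<in> ?G" for u
        using shift[OF that ax] by (simp add: axis_mult)
    qed
    then show ?thesis by simp
  qed
  from half_line_contains_flat[OF closed_closure invariantD(2)[OF cZ] this g(2)]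
  obtain v where v: "v \<in> L" "v \<noteq> 0" "\<And>p. r + frame v p 0 \<in> closure ?Z" by blast
  have "closure ?Z \<subseteq> X" using invariantD(1)[OF X] by (intro closure_minimal) auto
  then have vX: "r + frame v p 0 \<in> X" for p using v(3) by blast
  obtain p where p: "\<not> torsion (r + frame v p 0)" using flat_nontorsion[OF v(1,2)] by blast
  obtain x where x: "\<And>n. x n \<in> ?Z" "x \<longlonglongrightarrow> r + frame v p 0"
    using v(3)[of p] unfolding closure_sequential by blast
  have "x n \<noteq> r + frame v p 0" for n p
    using x(1)[of n] r(2) v(1,2) vX unfolding flat_points_def by blast
  then have "torsion (r + frame v p 0)"
    using flat_accumulation[OF X w r(2) v(1,2) _ _ x(2)] x(1) by blast
  then show False using p by blast
qed

text \<open>There are infinitely many units and finitely many classes, so some difference of two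
  units maps \<open>x\<close> into the lattice; this difference is cancelled as in
  \<open>torsion_divide\<close>.\<close>

lemma finite_orbit_torsion:
  assumes F: "finite F" "\<And>u. u \<in> G \<Longrightarrow> \<exists>y\<in>F. cvec u * x - y \<in> L"
  shows "torsion x"
proof -
  obtain i j :: 's where ij: "i \<noteq> j" using third_index by metis
  obtain w :: "nat \<Rightarrow> real^'s" where w: "inj w" "\<And>n. w n \<in> G"
    by (rule bounded_pair_seq[OF ij]) blast
  obtain y where y: "\<And>n. y n \<in> F" "\<And>n. cvec (w n) * x - y n \<in> L" using F(2)[OF w(2)] by metis
  have "\<not> inj y"
  proof
    assume "inj y"
    moreover have "finite (range y)" by (rule finite_subset[OF _ F(1)]) (use y(1) in auto)
    ultimately show False using finite_imageD by blast
  qed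
  then obtain m n where mn: "m \<noteq> n" "y m = y n" unfolding inj_def by blast
  let ?u = "w m" and ?v = "w n"
  have ne: "?u \<noteq> ?v" using w(1) mn(1) by (simp add: inj_eq)
  have uvx: "cvec (?u - ?v) * x \<in> L"
    using diff[OF y(2)[of m] y(2)[of n]] mn(2) by (simp add: cvec_simps left_diff_distrib)
  have nz: "(?u - ?v) $ k \<noteq> 0" for k using inj2[OF w(2) w(2), of m k n] ne by auto
  let ?b = "cvec (?u - ?v)"
  obtain C where C: "C > 0" "\<And>x. \<exists>a\<in>L. norm (x - a) \<le> C" using radius by metis
  have "\<exists>n::nat. n > 0 \<and> real n *\<^sub>R (?b * x) \<in> (\<lambda>a. ?b * a) ` L"
  proof (rule torsion_sublattice[where C = "norm ?b * C"])
    show "a - b \<in> (\<lambda>a. ?b * a) ` L" if ab: "a \<in> (\<lambda>a. ?b * a) ` L" "b \<in> (\<lambda>a. ?b * a) ` L" for a b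
    proof -
      obtain a' b' where "a' \<in> L" "b' \<in> L" "a = ?b * a'" "b = ?b * b'" using ab by blast
      then show ?thesis using diff[of a' b'] by (intro image_eqI[of _ _ "a' - b'"]) (auto simp: right_diff_distrib)
    qed
    show "(\<lambda>a. ?b * a) ` L \<subseteq> L"
      using act[OF w(2)] diff by (auto simp: left_diff_distrib cvec_simps)
    show "\<exists>a\<in>(\<lambda>a. ?b * a) ` L. norm (x - a) \<le> norm ?b * C" for x
    proof -
      let ?x = "cvec (vinv (?u - ?v)) * x"
      obtain a where a: "a \<in> L" "norm (?x - a) \<le> C" using C(2) by blast
      have "(?u - ?v) * vinv (?u - ?v) = 1" using nz by (simp add: vec_eq_iff)
      then have "?b * cvec (vinv (?u - ?v)) = 1" by (simp only: cvec_simps(3)[symmetric] cvec_simps(5))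
      then have "x - ?b * a = ?b * (?x - a)" by (simp only: right_diff_distrib mult.assoc[symmetric] mult_1_left)
      then have "norm (x - ?b * a) \<le> norm ?b * norm (?x - a)" by (simp only: norm_vec_mult_le)
      also have "\<dots> \<le> norm ?b * C" using a(2) by (intro mult_left_mono) auto
      finally show ?thesis using a(1) by blast
    qed
    show "?b * x \<in> L" by (rule uvx)
  qed
  then obtain n :: nat and a where n: "n > 0" "a \<in> L" "real n *\<^sub>R (?b * x) = ?b * a" by blast
  have "real n *\<^sub>R x = a"
    unfolding vec_eq_iff
  proof
    fix k
    have "(real n *\<^sub>R (?b * x)) $ k = (?b * a) $ k" using n(3) by simp
    then have "complex_of_real ((?u - ?v) $ k) * (real n *\<^sub>R x) $ k = complex_of_real ((?u - ?v) $ k) * a $ k"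
      by (simp add: scaleR_conv_of_real mult_ac)
    then show "(real n *\<^sub>R x) $ k = a $ k" using nz[of k] by (simp only: mult_cancel_left of_real_eq_0_iff) simp
  qed
  then show ?thesis using n unfolding torsion_def by blast
qed

corollary finite_outside_flats:
  assumes X: "invariant G L X" and w: "w \<notin> X"
  shows "\<exists>F. finite F \<and> (\<forall>x\<in>X - flat_points X. torsion x \<and> (\<exists>y\<in>F. x - y \<in> L))"
proof -
  let ?Z = "X - flat_points X"
  have Zp: "x + a \<in> ?Z" if "x \<in> ?Z" "a \<in> L" for x a
    using that invariantD(2)[OF X] flat_points_periodic[OF X, of "x + a" "- a"] uminus by auto
  have Zu: "cvec u * x \<in> ?Z" if "x \<in> ?Z" "u \<in> G" for x u
    using that invariantD(3)[OF X] flat_points_act[OF X, of "cvec u * x" "vinv u"] inv cvec_vinv(2)[of u x] by auto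
  obtain F where F: "finite F" "F \<subseteq> ?Z" "\<And>x. x \<in> ?Z \<Longrightarrow> \<exists>y\<in>F. x - y \<in> L"
    using finite_mod[OF isolated_outside_flats[OF X w] Zp] by blast
  have "torsion x" if "x \<in> ?Z" for x
    using finite_orbit_torsion[OF F(1) F(3)[OF Zu[OF that]]] .
  then show ?thesis using F by blast
qed

end


section \<open>Level sets of the norm\<close>

lemma norm_Kbar_nonneg: "norm_Kbar x \<ge> 0"
  by (simp add: norm_Kbar_def prod_nonneg)

lemma norm_Kbar_eq_0_iff: "norm_Kbar x = 0 \<longleftrightarrow> (\<exists>i. x $ i = 0)"
  by (simp add: norm_Kbar_def)

lemma norm_Kbar_mult: "norm_Kbar (x * y) = norm_Kbar x * norm_Kbar y"
  by (simp add: norm_Kbar_def norm_mult power_mult_distrib prod.distrib)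

lemma norm_Kbar_1 [simp]: "norm_Kbar 1 = 1"
  by (simp add: norm_Kbar_def)

lemma norm_Kbar_0 [simp]: "norm_Kbar 0 = 0"
  by (simp add: norm_Kbar_eq_0_iff)

lemma tendsto_norm_Kbar [tendsto_intros]:
  "(f \<longlongrightarrow> a) F \<Longrightarrow> ((\<lambda>x. norm_Kbar (f x)) \<longlongrightarrow> norm_Kbar a) F"
  unfolding norm_Kbar_def by (intro tendsto_intros)

lemma norm_Kbar_frame_le: "norm_Kbar (frame v 0 q) \<le> norm_Kbar (frame v p q)"
  unfolding norm_Kbar_def
proof (intro prod_mono conjI power_mono)
  fix i
  have "cmod (Complex 0 (q $ i)) \<le> cmod (Complex (p $ i) (q $ i))"
    by (simp add: cmod_def)
  then show "cmod (frame v 0 q $ i) \<le> cmod (frame v p q $ i)"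
    by (simp add: norm_mult mult_left_mono)
qed auto

lemma cInf_attained:
  fixes S :: "real set"
  assumes S: "S \<noteq> {}" "\<And>B. finite {x\<in>S. x \<le> B}"
  shows "Inf S \<in> S" "\<And>x. x \<in> S \<Longrightarrow> Inf S \<le> x"
proof -
  obtain b where b: "b \<in> S" using S(1) by blast
  let ?T = "{x\<in>S. x \<le> b}"
  have T: "Min ?T \<in> ?T" using S(2)[of b] b by (intro Min_in) auto
  have le: "Min ?T \<le> x" if "x \<in> S" for x
    using Min_le[OF S(2)[of b], of x] that T by (cases "x \<le> b") auto
  have "Inf S = Min ?T" using T le by (intro cInf_eq_minimum) auto
  then show "Inf S \<in> S" "\<And>x. x \<in> S \<Longrightarrow> Inf S \<le> x" using T le by auto
qed

context unit_group
begin

lemma norm_Kbar_unit: "u \<in> G \<Longrightarrow> norm_Kbar (cvec u * x) = norm_Kbar x"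
proof -
  assume u: "u \<in> G"
  have "norm_Kbar (cvec u) = (\<Prod>i\<in>UNIV. u $ i)\<^sup>2"
    using pos[OF u] by (simp add: norm_Kbar_def prod_power_distrib)
  then show ?thesis using prod1[OF u] by (simp add: norm_Kbar_mult)
qed

text \<open>The deviations of the logarithms from their mean have sum 0, so a unit removes them up
  to the covering radius. The mean has the denominator \<open>2 * CARD('s)\<close> because every
  place enters the norm squared.\<close>

lemma balance:
  "\<exists>R>0. \<forall>x::complex^'s. (\<forall>i. x $ i \<noteq> 0) \<longrightarrow>
     (\<exists>u\<in>G. \<forall>i. \<bar>ln (cmod ((cvec u * x) $ i)) - ln (norm_Kbar x) / (2 * real CARD('s))\<bar> \<le> R)"
proof -
  obtain R where R: "R > 0" "\<And>h::real^'s. (\<Sum>i\<in>UNIV. h $ i) = 0 \<Longrightarrow> \<exists>u\<in>G. \<forall>i. \<bar>ln (u $ i) - h $ i\<bar> \<le> R"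
    using log_radius by metis
  have "\<exists>u\<in>G. \<forall>i. \<bar>ln (cmod ((cvec u * x) $ i)) - ln (norm_Kbar x) / (2 * real CARD('s))\<bar> \<le> R"
    if x: "\<forall>i. x $ i \<noteq> 0" for x :: "complex^'s"
  proof -
    define h :: "real^'s" where "h = (\<chi> i. ln (norm_Kbar x) / (2 * real CARD('s)) - ln (cmod (x $ i)))"
    have "ln (norm_Kbar x) = (\<Sum>i\<in>UNIV. ln ((cmod (x $ i))\<^sup>2))"
      unfolding norm_Kbar_def using x by (intro ln_prod) auto
    also have "\<dots> = 2 * (\<Sum>i\<in>UNIV. ln (cmod (x $ i)))"
      using x by (simp add: ln_realpow sum_distrib_left)
    finally have "(\<Sum>i\<in>UNIV. h $ i) = 0" by (simp add: h_def sum_subtractf)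
    from R(2)[OF this] obtain u where u: "u \<in> G" "\<And>i. \<bar>ln (u $ i) - h $ i\<bar> \<le> R" by blast
    have "ln (cmod ((cvec u * x) $ i)) = ln (u $ i) + ln (cmod (x $ i))" for i
      using pos[OF u(1), of i] x by (simp add: norm_mult ln_mult_pos)
    then show ?thesis using u by (intro bexI[of _ u] allI) (auto simp: h_def algebra_simps)
  qed
  then show ?thesis using R(1) by blast
qed

lemma bounded_representative:
  "\<exists>K>0. \<forall>x::complex^'s. norm_Kbar x \<le> B \<longrightarrow> (\<forall>i. x $ i \<noteq> 0) \<longrightarrow> (\<exists>u\<in>G. norm (cvec u * x) \<le> K)"
proof -
  obtain R where R: "R > 0" "\<And>x::complex^'s. (\<forall>i. x $ i \<noteq> 0) \<Longrightarrow>
     (\<exists>u\<in>G. \<forall>i. \<bar>ln (cmod ((cvec u * x) $ i)) - ln (norm_Kbar x) / (2 * real CARD('s))\<bar> \<le> R)"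
    using balance by blast
  define K where "K = real CARD('s) * exp (R + ln (max B 1) / (2 * real CARD('s)))"
  have "\<exists>u\<in>G. norm (cvec u * x) \<le> K" if x: "norm_Kbar x \<le> B" "\<forall>i. x $ i \<noteq> 0" for x :: "complex^'s"
  proof -
    obtain u where u: "u \<in> G" "\<And>i. \<bar>ln (cmod ((cvec u * x) $ i)) - ln (norm_Kbar x) / (2 * real CARD('s))\<bar> \<le> R"
      using R(2)[OF x(2)] by blast
    have "norm_Kbar x > 0" using x(2) norm_Kbar_eq_0_iff[of x] norm_Kbar_nonneg[of x] by force
    then have "ln (norm_Kbar x) \<le> ln (max B 1)" using x(1) by (simp add: le_max_iff_disj)
    then have le: "ln (norm_Kbar x) / (2 * real CARD('s)) \<le> ln (max B 1) / (2 * real CARD('s))"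
      by (intro divide_right_mono) auto
    have "norm ((cvec u * x) $ i) \<le> exp (R + ln (max B 1) / (2 * real CARD('s)))" for i
    proof -
      have "cmod ((cvec u * x) $ i) > 0" using x(2) nonzero[OF u(1), of i] by simp
      moreover have "ln (cmod ((cvec u * x) $ i)) \<le> R + ln (max B 1) / (2 * real CARD('s))"
        using u(2)[of i] le by linarith
      ultimately show ?thesis by (metis exp_le_cancel_iff exp_ln)
    qed
    then have "(\<Sum>i\<in>UNIV. norm ((cvec u * x) $ i)) \<le> K"
      unfolding K_def by (intro order.trans[OF sum_bounded_above]) auto
    moreover have "norm (cvec u * x) \<le> (\<Sum>i\<in>UNIV. norm ((cvec u * x) $ i))"
      unfolding norm_vec_def by (intro L2_set_le_sum) auto
    ultimately show ?thesis using u(1) by (intro bexI[of _ u]) linarith+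
  qed
  moreover have "K > 0" by (simp add: K_def)
  ultimately show ?thesis by blast
qed

end

lemma norm_Kbar_frame_imag: "norm_Kbar (frame v 0 y) = norm_Kbar v * norm_Kbar (cvec y)"
proof -
  have "cmod (Complex 0 t) = \<bar>t\<bar>" for t by (simp add: cmod_def)
  then show ?thesis by (simp add: norm_Kbar_def norm_mult power_mult_distrib prod.distrib)
qed

context unit_lattice
begin

text \<open>Units preserve the norm and bring points of bounded nonzero norm into a ball, which
  contains finitely many points of denominator \<open>q\<close>. The value 0 is added separately
  because balancing requires nonzero entries.\<close>

lemma finite_real_values:
  fixes q :: nat
  assumes q: "q > 0"
  shows "finite {norm_Kbar (cvec y) |y. real q *\<^sub>R y \<in> I \<and> norm_Kbar (cvec y) \<le> B}"
proof -
  obtain K where K: "K > 0" "\<And>x::complex^'s. norm_Kbar x \<le> B \<Longrightarrow> (\<forall>i. x $ i \<noteq> 0) \<Longrightarrow> (\<exists>u\<in>G. norm (cvec u * x) \<le> K)"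
    using bounded_representative[of B] by blast
  let ?F = "insert 0 ((\<lambda>y. norm_Kbar (cvec (y /\<^sub>R real q))) ` {y\<in>I. norm y \<le> real q * K})"
  have "{norm_Kbar (cvec y) |y. real q *\<^sub>R y \<in> I \<and> norm_Kbar (cvec y) \<le> B} \<subseteq> ?F"
  proof safe
    fix y assume y: "real q *\<^sub>R y \<in> I" "norm_Kbar (cvec y) \<le> B"
      "norm_Kbar (cvec y) \<notin> (\<lambda>y. norm_Kbar (cvec (y /\<^sub>R real q))) ` {y\<in>I. norm y \<le> real q * K}"
    show "norm_Kbar (cvec y) = 0"
    proof (rule ccontr)
      assume "norm_Kbar (cvec y) \<noteq> 0"
      then have "\<forall>i. cvec y $ i \<noteq> 0" using norm_Kbar_eq_0_iff by blast
      from K(2)[OF y(2) this] obtain u where u: "u \<in> G" "norm (cvec u * cvec y) \<le> K" by blast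
      have n: "norm (u * y) \<le> K" using u(2) by (simp add: cvec_simps(3)[symmetric] norm_cvec)
      have "real q *\<^sub>R (u * y) \<in> I" using act[OF u(1) y(1)] by simp
      moreover have "norm (real q *\<^sub>R (u * y)) \<le> real q * K" using n by (simp add: mult_left_mono)
      moreover have "norm_Kbar (cvec y) = norm_Kbar (cvec ((real q *\<^sub>R (u * y)) /\<^sub>R real q))"
        using q norm_Kbar_unit[OF u(1), of "cvec y"] by (simp add: cvec_simps)
      ultimately show False using y(3) by blast
    qed
  qed
  moreover have "finite ?F" using finite_bounded0 by blast
  ultimately show ?thesis by (rule finite_subset)
qed

end

context complex_lattice
begin

lemma finite_values:
  fixes q :: nat
  assumes q: "q > 0"
  shows "finite {norm_Kbar x |x. real q *\<^sub>R x \<in> L \<and> norm_Kbar x \<le> B}"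
proof -
  obtain K where K: "K > 0" "\<And>x::complex^'s. norm_Kbar x \<le> B \<Longrightarrow> (\<forall>i. x $ i \<noteq> 0) \<Longrightarrow> (\<exists>u\<in>G. norm (cvec u * x) \<le> K)"
    using bounded_representative[of B] by blast
  let ?F = "insert 0 ((\<lambda>y. norm_Kbar (y /\<^sub>R real q)) ` {y\<in>L. norm y \<le> real q * K})"
  have "{norm_Kbar x |x. real q *\<^sub>R x \<in> L \<and> norm_Kbar x \<le> B} \<subseteq> ?F"
  proof safe
    fix y assume y: "real q *\<^sub>R y \<in> L" "norm_Kbar y \<le> B"
      "norm_Kbar y \<notin> (\<lambda>y. norm_Kbar (y /\<^sub>R real q)) ` {y\<in>L. norm y \<le> real q * K}"
    show "norm_Kbar y = 0"
    proof (rule ccontr)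
      assume "norm_Kbar y \<noteq> 0"
      then have "\<forall>i. y $ i \<noteq> 0" using norm_Kbar_eq_0_iff by blast
      from K(2)[OF y(2) this] obtain u where u: "u \<in> G" "norm (cvec u * y) \<le> K" by blast
      have "real q *\<^sub>R (cvec u * y) \<in> L" using act[OF u(1) y(1)] by simp
      moreover have "norm (real q *\<^sub>R (cvec u * y)) \<le> real q * K" using u(2) by (simp add: mult_left_mono)
      moreover have "norm_Kbar y = norm_Kbar ((real q *\<^sub>R (cvec u * y)) /\<^sub>R real q)"
        using q norm_Kbar_unit[OF u(1), of y] by simp
      ultimately show False using y(3) by blast
    qed
  qed
  moreover have "finite ?F" using finite_bounded0 by blast
  ultimately show ?thesis by (rule finite_subset)
qed

text \<open>One inequality for each lattice vector, so closedness is immediate; this is the upper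
  semicontinuity of \<open>emin\<close>, which \<open>level_iff\<close> connects with it.\<close>

definition level :: "real \<Rightarrow> (complex^'s) set" where
  "level e = {x. \<forall>a\<in>L. e \<le> norm_Kbar (x + a)}"

definition emin :: "complex^'s \<Rightarrow> real" where
  "emin x = (INF a\<in>L. norm_Kbar (x + a))"

lemma emin_le: "a \<in> L \<Longrightarrow> emin x \<le> norm_Kbar (x + a)"
  unfolding emin_def by (rule cINF_lower) (auto intro!: bdd_belowI[of _ 0] simp: norm_Kbar_nonneg)

lemma level_iff: "x \<in> level e \<longleftrightarrow> e \<le> emin x"
proof
  assume "x \<in> level e"
  then show "e \<le> emin x" unfolding emin_def level_def using zero by (intro cINF_greatest) auto
next
  assume "e \<le> emin x"
  then show "x \<in> level e" unfolding level_def using emin_le order.trans by blast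
qed

lemma emin_nonneg: "emin x \<ge> 0"
  using level_iff[of x 0] by (simp add: level_def norm_Kbar_nonneg)

lemma emin_periodic: "a \<in> L \<Longrightarrow> emin (x + a) = emin x"
proof -
  have le: "emin x \<le> emin (x + a)" if "a \<in> L" for x a
  proof -
    have "x + a \<in> level (emin x)" unfolding level_def using that add emin_le by (auto simp: add.assoc)
    then show ?thesis by (simp add: level_iff)
  qed
  assume a: "a \<in> L"
  show ?thesis using le[OF a, of x] le[OF uminus[OF a], of "x + a"] by simp
qed

lemma emin_0: "emin 0 = 0"
  using emin_le[OF zero, of 0] emin_nonneg[of 0] by simp

lemma zero_notin_level: "e > 0 \<Longrightarrow> 0 \<notin> level e"
  by (simp add: level_iff emin_0)

lemma level_invariant: "invariant G L (level e)"
  unfolding invariant_def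
proof (intro conjI ballI)
  show "closed (level e)"
    unfolding closed_sequential_limits
  proof (intro allI impI, elim conjE)
    fix f l assume f: "\<forall>n. f n \<in> level e" "f \<longlonglongrightarrow> l"
    show "l \<in> level e"
      unfolding level_def
    proof (intro CollectI ballI)
      fix a assume a: "a \<in> L"
      have "(\<lambda>n. norm_Kbar (f n + a)) \<longlonglongrightarrow> norm_Kbar (l + a)" by (intro tendsto_intros f)
      then show "e \<le> norm_Kbar (l + a)" by (rule LIMSEQ_le_const) (use f(1) a in \<open>auto simp: level_def\<close>)
    qed
  qed
next
  fix x a assume "x \<in> level e" "a \<in> L"
  then show "x + a \<in> level e" by (simp add: level_iff emin_periodic)
next
  fix x u assume x: "x \<in> level e" and u: "u \<in> G"
  show "cvec u * x \<in> level e"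
    unfolding level_def
  proof (intro CollectI ballI)
    fix a assume a: "a \<in> L"
    have "cvec u * x + a = cvec u * (x + cvec (vinv u) * a)" using cvec_vinv(1)[OF u] by (simp add: distrib_left)
    then have "norm_Kbar (cvec u * x + a) = norm_Kbar (x + cvec (vinv u) * a)" using norm_Kbar_unit[OF u] by simp
    then show "e \<le> norm_Kbar (cvec u * x + a)" using x act[OF inv[OF u] a] by (simp add: level_def)
  qed
qed

lemma emin_attained:
  assumes "torsion x"
  shows "\<exists>a\<in>L. emin x = norm_Kbar (x + a)"
proof -
  obtain q :: nat where q: "q > 0" "real q *\<^sub>R x \<in> L" using assms unfolding torsion_def by blast
  let ?S = "(\<lambda>a. norm_Kbar (x + a)) ` L"
  have "finite {t\<in>?S. t \<le> B}" for B
  proof (rule finite_subset[OF _ finite_values[OF q(1), of B]])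
    show "{t\<in>?S. t \<le> B} \<subseteq> {norm_Kbar x |x. real q *\<^sub>R x \<in> L \<and> norm_Kbar x \<le> B}"
      using add[OF q(2) scaleR_nat] by (force simp: scaleR_right_distrib)
  qed
  then have "Inf ?S \<in> ?S" using zero by (intro cInf_attained) auto
  then show ?thesis unfolding emin_def by auto
qed

end


lemma norm_Kbar_frame_real: "norm_Kbar (frame v p 0) = norm_Kbar v * norm_Kbar (cvec p)"
proof -
  have "cmod (Complex t 0) = \<bar>t\<bar>" for t by (simp add: cmod_def)
  then show ?thesis by (simp add: norm_Kbar_def norm_mult power_mult_distrib prod.distrib)
qed

context complex_lattice
begin

definition flatset :: "complex^'s \<Rightarrow> complex^'s \<Rightarrow> (complex^'s) set" where
  "flatset v r = {r + frame v p 0 + a |p a. a \<in> L}"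

text \<open>Minimality refers to the norm and not to length, because the norm is invariant under
  units: a minimal vector stays minimal when it is balanced (\<open>minimal_act\<close>).\<close>

definition minimal :: "complex^'s \<Rightarrow> bool" where
  "minimal v \<longleftrightarrow> v \<in> L \<and> v \<noteq> 0 \<and> (\<forall>p. frame v p 0 \<in> L \<longrightarrow> p \<noteq> 0 \<longrightarrow> norm_Kbar v \<le> norm_Kbar (frame v p 0))"

lemma frame_frame: "frame (frame v w 0) p q = frame v (w * p) (w * q)"
  by (simp add: vec_eq_iff complex_eq_iff algebra_simps)

lemma minimal_generator:
  assumes v: "v \<in> L" "v \<noteq> 0"
  shows "\<exists>w. (\<forall>k. w $ k \<noteq> 0) \<and> minimal (frame v w 0)"
proof -
  note nz = coordinate_nonzero[OF v]
  let ?S = "{norm_Kbar (frame v p 0) |p. frame v p 0 \<in> L \<and> p \<noteq> 0}"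
  have "frame v 1 0 = v" by (simp add: vec_eq_iff complex_eq_iff)
  then have "norm_Kbar (frame v 1 0) \<in> ?S" using v by (intro CollectI exI[of _ 1]) auto
  then have "?S \<noteq> {}" by blast
  moreover have "finite {x\<in>?S. x \<le> B}" for B
    by (rule finite_subset[OF _ finite_values[of 1 B]]) auto
  ultimately have S: "Inf ?S \<in> ?S" "\<And>x. x \<in> ?S \<Longrightarrow> Inf ?S \<le> x" by (rule cInf_attained)+
  then obtain w where w: "frame v w 0 \<in> L" "w \<noteq> 0" "Inf ?S = norm_Kbar (frame v w 0)" by blast
  have fw: "frame v w 0 \<noteq> 0"
  proof
    assume "frame v w 0 = 0"
    then have "reco v (frame v w 0) = reco v (frame v 0 0)" by simp
    then show False using w(2) by (simp only: reco_frame[OF nz])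
  qed
  have wk: "w $ k \<noteq> 0" for k
    using coordinate_nonzero[OF w(1) fw, of k] by (auto simp: complex_eq_iff)
  have "minimal (frame v w 0)"
    unfolding minimal_def
  proof (intro conjI allI impI)
    fix p assume p: "frame (frame v w 0) p 0 \<in> L" "p \<noteq> 0"
    have "w * p \<noteq> 0" using p(2) wk by (simp add: vec_eq_iff)
    then have "norm_Kbar (frame v (w * p) 0) \<in> ?S" using p(1) by (auto simp: frame_frame)
    then show "norm_Kbar (frame v w 0) \<le> norm_Kbar (frame (frame v w 0) p 0)"
      using S(2) w(3) by (simp add: frame_frame)
  qed (use w(1) fw in auto)
  then show ?thesis using wk by blast
qed

lemma minimal_act:
  assumes v: "minimal v" and u: "u \<in> G"
  shows "minimal (cvec u * v)"
  unfolding minimal_def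
proof (intro conjI allI impI)
  show "cvec u * v \<in> L" using v act[OF u] by (simp add: minimal_def)
  show "cvec u * v \<noteq> 0"
  proof
    assume "cvec u * v = 0"
    then have "cvec (vinv u) * (cvec u * v) = 0" by simp
    then show False using cvec_vinv[OF u] v by (simp add: minimal_def)
  qed
next
  fix p assume p: "frame (cvec u * v) p 0 \<in> L" "p \<noteq> 0"
  have eq: "frame (cvec u * v) p 0 = frame v (u * p) 0"
    using frame_frame[of v u p 0] by (simp add: frame_unit)
  have "u * p \<noteq> 0" using p(2) nonzero[OF u] by (simp add: vec_eq_iff)
  then show "norm_Kbar (cvec u * v) \<le> norm_Kbar (frame (cvec u * v) p 0)"
    using v p(1) norm_Kbar_unit[OF u] by (simp add: minimal_def eq)
qed

text \<open>
  A pigeonhole argument: many lattice points lie close to a parallelotope in the flat spanned by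
  \<open>v\<close> in which, by minimality of \<open>v\<close>, no two of them can have the same transversal coordinates.
\<close>

lemma short_transversal:
  assumes C0: "C0 > 0" "\<And>x. \<exists>a\<in>L. norm (x - a) \<le> C0" and v: "minimal v"
    and \<beta>: "0 < \<beta>" "\<beta> \<le> 1/16" "\<And>k. C0 \<le> \<beta> * cmod (v $ k)"
  shows "\<exists>y\<in>quotient v. y \<noteq> 0 \<and> (\<forall>k. \<bar>y $ k\<bar> \<le> 32 * \<beta>\<^sup>2)"
proof -
  have vL: "v \<in> L" "v \<noteq> 0" using v by (auto simp: minimal_def)
  note nz = coordinate_nonzero[OF vL]
  \<comment> \<open>\<open>m\<close> will be the largest integer strictly below
    \<open>1 / (4 * \<beta>)\<close>, so the grid spacing \<open>1 / (2 * m)\<close> exceeds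
    \<open>2 * \<beta>\<close>, twice the error of the lattice approximation.\<close>
  define M where "M = 1 / (4 * \<beta>)"
  have M: "M \<ge> 4" using \<beta>(1,2) by (simp add: M_def field_simps)
  define m where "m = nat (\<lceil>M\<rceil> - 1)"
  have m: "real m < M" "real m \<ge> M - 1" "m \<ge> 3" using M unfolding m_def by linarith+
  define pt :: "('s \<Rightarrow> nat) \<Rightarrow> real^'s" where "pt g = (\<chi> k. real (g k) / (2 * real m))" for g
  have "\<forall>g. \<exists>a. a \<in> L \<and> norm (frame v (pt g) 0 - a) \<le> C0" using C0(2) by blast
  then obtain l where l: "\<And>g. l g \<in> L" "\<And>g. norm (frame v (pt g) 0 - l g) \<le> C0" by metis
  have close: "cmod ((frame v (pt g) 0 - l g) $ k / v $ k) \<le> \<beta>" for g k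
  proof -
    have "cmod ((frame v (pt g) 0 - l g) $ k) \<le> C0"
      using Finite_Cartesian_Product.norm_nth_le[of "frame v (pt g) 0 - l g" k] l(2)[of g] by linarith
    also have "\<dots> \<le> \<beta> * cmod (v $ k)" by (rule \<beta>(3))
    finally show ?thesis using nz[of k] by (simp add: norm_divide divide_le_eq)
  qed
  have re: "\<bar>pt g $ k - reco v (l g) $ k\<bar> \<le> \<beta>" for g k
  proof -
    have "pt g $ k - reco v (l g) $ k = reco v (frame v (pt g) 0 - l g) $ k" using nz by (simp only: reco_diff reco_frame[OF nz] vector_minus_component)
    then show ?thesis using abs_Re_le_cmod[of "(frame v (pt g) 0 - l g) $ k / v $ k"] close[of g k] by (simp only: reco_nth)
  qed
  have im: "\<bar>imco v (l g) $ k\<bar> \<le> \<beta>" for g k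
  proof -
    have "- imco v (l g) $ k = imco v (frame v (pt g) 0 - l g) $ k" using nz by (simp only: imco_diff imco_frame[OF nz] vector_minus_component vector_uminus_component zero_index diff_0)
    then show ?thesis using abs_Im_le_cmod[of "(frame v (pt g) 0 - l g) $ k / v $ k"] close[of g k] by (simp only: imco_nth)
  qed
  \<comment> \<open>A window of width \<open>4 * \<beta>\<close> around 0 contains all transversal
    coordinates. It is cut into \<open>m - 1\<close> cells in each direction, one fewer than the
    \<open>m\<close> grid points.\<close>
  let ?c = "\<lambda>g k. (imco v (l g) $ k + 2 * \<beta>) * (real m - 1) / (4 * \<beta>)"
  define Gr where "Gr = PiE (UNIV::'s set) (\<lambda>_. {..<m})"
  define cell where "cell g = (\<lambda>k. nat \<lfloor>?c g k\<rfloor>)" for g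
  have bound: "0 \<le> ?c g k" "?c g k < real m - 1" for g k
  proof -
    have a: "imco v (l g) $ k + 2 * \<beta> \<ge> 0" "imco v (l g) $ k + 2 * \<beta> < 4 * \<beta>" using im[of g k] \<beta>(1) by linarith+
    show "0 \<le> ?c g k" using a(1) m(3) \<beta>(1) by simp
    have "(imco v (l g) $ k + 2 * \<beta>) * (real m - 1) < (4 * \<beta>) * (real m - 1)"
      using a(2) m(3) by (intro mult_strict_right_mono) auto
    then show "?c g k < real m - 1" using \<beta>(1) by (simp add: divide_less_eq mult.commute)
  qed
  have "\<not> inj_on cell Gr"
  proof
    assume inj: "inj_on cell Gr"
    have "cell ` Gr \<subseteq> PiE (UNIV::'s set) (\<lambda>_. {..<m - 1})"
    proof
      fix c assume "c \<in> cell ` Gr"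
      then obtain g where g: "c = cell g" by blast
      have "cell g k < m - 1" for k
        using bound[of g k] m(3) unfolding cell_def by linarith
      then show "c \<in> PiE (UNIV::'s set) (\<lambda>_. {..<m - 1})" unfolding g by (intro PiE_I) auto
    qed
    then have "card Gr \<le> card (PiE (UNIV::'s set) (\<lambda>_. {..<m - 1}))"
      by (intro card_inj_on_le[OF inj]) (auto intro: finite_PiE)
    then have "m ^ CARD('s) \<le> (m - 1) ^ CARD('s)" by (simp add: Gr_def card_PiE)
    moreover have "(m - 1) ^ CARD('s) < m ^ CARD('s)" using m(3) by (intro power_strict_mono) auto
    ultimately show False by linarith
  qed
  then obtain g h where gh: "g \<in> Gr" "h \<in> Gr" "g \<noteq> h" "cell g = cell h" unfolding inj_on_def by blast
  define d where "d = l g - l h"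
  have dL: "d \<in> L" unfolding d_def by (rule diff[OF l(1) l(1)])
  have gm: "g k < m" "h k < m" for k using gh(1,2) by (auto simp: Gr_def PiE_def)
  have ptd: "\<bar>pt g $ k - pt h $ k\<bar> \<le> 1/2" for k
  proof -
    have "\<bar>real (g k) - real (h k)\<bar> \<le> real m" using gm[of k] by linarith
    moreover have "pt g $ k - pt h $ k = (real (g k) - real (h k)) / (2 * real m)" by (simp add: pt_def diff_divide_distrib)
    ultimately show ?thesis using m(3) by (simp add: divide_le_eq)
  qed
  have "d \<noteq> 0"
  proof
    assume "d = 0"
    then have eq: "l g = l h" by (simp add: d_def)
    obtain k where k: "g k \<noteq> h k" using gh(3) by blast
    have "\<bar>pt g $ k - pt h $ k\<bar> \<le> 2 * \<beta>" using re[of g k] re[of h k] unfolding eq by linarith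
    moreover have "\<bar>pt g $ k - pt h $ k\<bar> \<ge> 1 / (2 * real m)"
    proof -
      have "\<bar>real (g k) - real (h k)\<bar> \<ge> 1" using k by linarith
      moreover have "pt g $ k - pt h $ k = (real (g k) - real (h k)) / (2 * real m)" by (simp add: pt_def diff_divide_distrib)
      ultimately show ?thesis using m(3) by (simp add: divide_right_mono)
    qed
    moreover have "1 / (2 * real m) > 2 * \<beta>"
      using m(1,3) \<beta>(1) by (simp add: M_def field_simps)
    ultimately show False by linarith
  qed
  have "imco v d \<noteq> 0"
  proof
    assume "imco v d = 0"
    then have dr: "d = frame v (reco v d) 0" using frame_coordinates[of v d] nz by simp
    then have "reco v d \<noteq> 0" using \<open>d \<noteq> 0\<close> by auto
    moreover have "frame v (reco v d) 0 \<in> L" using dL by (subst (asm) dr)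
    ultimately have "norm_Kbar v \<le> norm_Kbar (frame v (reco v d) 0)" using v unfolding minimal_def by blast
    also have "\<dots> = norm_Kbar v * norm_Kbar (cvec (reco v d))" by (rule norm_Kbar_frame_real)
    finally have 1: "norm_Kbar (cvec (reco v d)) \<ge> 1"
      using nz norm_Kbar_eq_0_iff[of v] norm_Kbar_nonneg[of v] by (metis mult_le_cancel_left1 order.not_eq_order_implies_strict linorder_not_le)
    \<comment> \<open>The grid fills a box of side 1/2, and the two approximations contribute at
      most \<open>2 * \<beta> \<le> 1/8\<close>. Entries this small contradict the minimality of
      \<open>v\<close>.\<close>
    have "\<bar>reco v d $ k\<bar> \<le> 3/4" for k
    proof -
      have "reco v d $ k = reco v (l g) $ k - reco v (l h) $ k" unfolding d_def by (simp only: reco_diff) simp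
      then show ?thesis using re[of g k] re[of h k] ptd[of k] \<beta>(2) by linarith
    qed
    then have "norm_Kbar (cvec (reco v d)) \<le> (\<Prod>k\<in>(UNIV::'s set). (3/4)\<^sup>2)"
      unfolding norm_Kbar_def by (intro prod_mono conjI power_mono) (auto simp del: reco_nth)
    also have "\<dots> = ((3/4)\<^sup>2) ^ CARD('s)" by simp
    also have "\<dots> < 1" by (intro power_less_one_iff[THEN iffD2]) (auto simp: power2_eq_square)
    finally show False using 1 by simp
  qed
  moreover have "\<bar>imco v d $ k\<bar> \<le> 32 * \<beta>\<^sup>2" for k
  proof -
    let ?s = "imco v (l g) $ k" and ?t = "imco v (l h) $ k"
    have "nat \<lfloor>?c g k\<rfloor> = nat \<lfloor>?c h k\<rfloor>"
      using fun_cong[OF gh(4), of k] by (simp add: cell_def)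
    then have "\<bar>?c g k - ?c h k\<bar> < 1"
      using bound(1)[of g k] bound(1)[of h k] by linarith
    also have "?c g k - ?c h k = (?s - ?t) * ((real m - 1) / (4 * \<beta>))"
      by (simp add: diff_divide_distrib[symmetric] left_diff_distrib[symmetric])
    finally have 1: "\<bar>?s - ?t\<bar> * ((real m - 1) / (4 * \<beta>)) < 1" using m(3) \<beta>(1) by (simp add: abs_mult)
    \<comment> \<open>A cell has width \<open>4 * \<beta> / (m - 1)\<close>, and
      \<open>m - 1 \<ge> M - 2 \<ge> M / 2 = 1 / (8 * \<beta>)\<close>.\<close>
    have "1 / (32 * \<beta>\<^sup>2) = (M / 2) / (4 * \<beta>)" using \<beta>(1) by (simp add: M_def power2_eq_square)
    also have "\<dots> \<le> (real m - 1) / (4 * \<beta>)" using m(2) M \<beta>(1) by (intro divide_right_mono) auto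
    finally have "\<bar>?s - ?t\<bar> * (1 / (32 * \<beta>\<^sup>2)) \<le> \<bar>?s - ?t\<bar> * ((real m - 1) / (4 * \<beta>))" by (intro mult_left_mono) auto
    then have "\<bar>?s - ?t\<bar> * (1 / (32 * \<beta>\<^sup>2)) < 1" using 1 by linarith
    then have "\<bar>?s - ?t\<bar> < 32 * \<beta>\<^sup>2" using \<beta>(1) by (simp add: divide_less_eq)
    moreover have "imco v d $ k = ?s - ?t" unfolding d_def by (simp only: imco_diff) simp
    ultimately show ?thesis by simp
  qed
  ultimately show ?thesis using dL unfolding quotient_def by blast
qed

text \<open>Let \<open>\<rho>\<close> be the size of a balanced minimal generator. For large
  \<open>\<rho>\<close>, \<open>short_transversal\<close> with \<open>\<beta>\<close> of order
  \<open>1 / \<rho>\<close> yields a transversal vector of order \<open>1 / \<rho>\<close> squared,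
  and its integer unit combinations approximate any transversal coordinate equally well. Multiplied
  by the generator, this leaves entries of order \<open>1 / \<rho>\<close>, so the flat has points
  of norm below \<open>e\<close>.\<close>

lemma level_flat_generator_bounded:
  assumes e: "e > 0"
  shows "\<exists>B. \<forall>r v. v \<in> L \<longrightarrow> v \<noteq> 0 \<longrightarrow> (\<forall>p. r + frame v p 0 \<in> level e) \<longrightarrow>
    (\<exists>w. (\<forall>k. w $ k \<noteq> 0) \<and> frame v w 0 \<in> L \<and> frame v w 0 \<noteq> 0 \<and> norm (frame v w 0) \<le> B)"
proof -
  obtain C0 where C0: "C0 > 0" "\<And>x. \<exists>a\<in>L. norm (x - a) \<le> C0" using radius by metis
  obtain R where R: "R > 0" "\<And>x::complex^'s. (\<forall>i. x $ i \<noteq> 0) \<Longrightarrow>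
     (\<exists>u\<in>G. \<forall>i. \<bar>ln (cmod ((cvec u * x) $ i)) - ln (norm_Kbar x) / (2 * real CARD('s))\<bar> \<le> R)"
    using balance by blast
  obtain B0 Cu where B0: "finite B0" "B0 \<subseteq> G" "Cu > 0" "\<And>x. \<exists>k :: real^'s \<Rightarrow> int. norm (x - (\<Sum>b\<in>B0. real_of_int (k b) *\<^sub>R b)) \<le> Cu"
    using unit_rounding by blast
  \<comment> \<open>The remaining transversal entries will be at most \<open>C5 / \<rho>\<close>.
    For \<open>\<rho> > C5 / \<theta>\<close> they are at most \<open>\<theta>\<close>, and since
    \<open>\<theta> < 1\<close> the norm is at most \<open>\<theta> < e\<close>.\<close>
  define C5 where "C5 = exp R * (32 * (C0 * exp R)\<^sup>2 * Cu)"
  have C5: "C5 > 0" using C0(1) B0(3) by (simp add: C5_def)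
  define \<theta> where "\<theta> = min e 1 / 2"
  have \<theta>: "\<theta> > 0" "\<theta> < 1" "\<theta> < e" using e by (auto simp: \<theta>_def)
  define \<rho>0 where "\<rho>0 = max (16 * C0 * exp R) (C5 / \<theta>)"
  define B where "B = real CARD('s) * (exp R * \<rho>0)"
  have "\<exists>w. (\<forall>k. w $ k \<noteq> 0) \<and> frame v w 0 \<in> L \<and> frame v w 0 \<noteq> 0 \<and> norm (frame v w 0) \<le> B"
    if v: "v \<in> L" "v \<noteq> 0" and fl: "\<And>p. r + frame v p 0 \<in> level e" for r v
  proof -
    obtain w0 where w0: "\<And>k. w0 $ k \<noteq> 0" "minimal (frame v w0 0)" using minimal_generator[OF v] by blast
    have m0: "frame v w0 0 \<in> L" "frame v w0 0 \<noteq> 0" using w0(2) by (auto simp: minimal_def)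
    obtain u where u: "u \<in> G" "\<And>i. \<bar>ln (cmod ((cvec u * frame v w0 0) $ i)) - ln (norm_Kbar (frame v w0 0)) / (2 * real CARD('s))\<bar> \<le> R"
      using R(2)[of "frame v w0 0"] coordinate_nonzero[OF m0] by blast
    define w where "w = u * w0"
    have wk: "w $ k \<noteq> 0" for k using w0(1) nonzero[OF u(1)] by (simp add: w_def)
    let ?v = "frame v w 0"
    have v': "?v = cvec u * frame v w0 0" by (simp add: w_def frame_cvec)
    have min: "minimal ?v" unfolding v' by (rule minimal_act[OF w0(2) u(1)])
    have vL: "?v \<in> L" "?v \<noteq> 0" using min by (auto simp: minimal_def)
    note nz = coordinate_nonzero[OF vL]
    define \<rho> where "\<rho> = exp (ln (norm_Kbar (frame v w0 0)) / (2 * real CARD('s)))"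
    have \<rho>: "\<rho> > 0" by (simp add: \<rho>_def)
    have vb: "cmod (?v $ k) \<le> exp R * \<rho>" "\<rho> \<le> exp R * cmod (?v $ k)" for k
    proof -
      have p: "cmod (?v $ k) > 0" using nz[of k] by simp
      have "ln (cmod (?v $ k)) \<le> R + ln \<rho>" "ln \<rho> \<le> R + ln (cmod (?v $ k))"
        using u(2)[of k] unfolding v'[symmetric] \<rho>_def ln_exp by linarith+
      then have "exp (ln (cmod (?v $ k))) \<le> exp (R + ln \<rho>)" "exp (ln \<rho>) \<le> exp (R + ln (cmod (?v $ k)))" by simp_all
      then show "cmod (?v $ k) \<le> exp R * \<rho>" "\<rho> \<le> exp R * cmod (?v $ k)" using p \<rho> by (simp_all add: exp_add)
    qed
    have "\<rho> \<le> \<rho>0"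
    proof (rule ccontr)
      assume "\<not> \<rho> \<le> \<rho>0"
      then have big: "\<rho> > 16 * C0 * exp R" "\<rho> > C5 / \<theta>" by (auto simp: \<rho>0_def)
      define \<beta> where "\<beta> = C0 * exp R / \<rho>"
      have \<beta>: "0 < \<beta>" "\<beta> \<le> 1/16" using C0(1) \<rho> big(1) by (auto simp: \<beta>_def field_simps)
      have \<beta>3: "C0 \<le> \<beta> * cmod (?v $ k)" for k
        using vb(2)[of k] C0(1) \<rho> by (simp add: \<beta>_def field_simps)
      obtain y0 where y0: "y0 \<in> quotient ?v" "y0 \<noteq> 0" "\<And>k. \<bar>y0 $ k\<bar> \<le> 32 * \<beta>\<^sup>2"
        using short_transversal[OF C0 min \<beta> \<beta>3] by blast
      interpret quot: unit_lattice G "quotient ?v" by (rule quotient_lattice[OF vL])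
      have y0k: "y0 $ k \<noteq> 0" for k using quot.coordinate_nonzero[OF y0(1)] y0(2) by blast
      define y where "y = imco ?v r"
      \<comment> \<open>The entrywise quotient of \<open>y\<close> by \<open>y0\<close> is rounded
        to an integer combination of units; multiplied back by \<open>y0\<close>, the error has the
        size of \<open>y0\<close>.\<close>
      obtain c :: "real^'s \<Rightarrow> int" where c: "norm (vinv y0 * y - (\<Sum>b\<in>B0. real_of_int (c b) *\<^sub>R b)) \<le> Cu" using B0(4) by blast
      define z where "z = y0 * (\<Sum>b\<in>B0. real_of_int (c b) *\<^sub>R b)"
      have "z = (\<Sum>b\<in>B0. real_of_int (c b) *\<^sub>R (b * y0))" by (simp add: z_def sum_distrib_left mult.commute)
      also have "\<dots> \<in> quotient ?v" using B0(2) y0(1) by (intro quot.sum_mem quot.scaleR_int quot.act) auto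
      finally obtain a where a: "a \<in> L" "z = imco ?v a" unfolding quotient_def by blast
      have "y0 * vinv y0 = 1" using y0k by (simp add: vec_eq_iff)
      then have yz: "y - z = y0 * (vinv y0 * y - (\<Sum>b\<in>B0. real_of_int (c b) *\<^sub>R b))"
        by (simp only: z_def right_diff_distrib mult.assoc[symmetric] mult_1_left)
      have yzk: "\<bar>(y - z) $ k\<bar> \<le> 32 * \<beta>\<^sup>2 * Cu" for k
      proof -
        have "\<bar>(y - z) $ k\<bar> = \<bar>y0 $ k\<bar> * \<bar>(vinv y0 * y - (\<Sum>b\<in>B0. real_of_int (c b) *\<^sub>R b)) $ k\<bar>"
          unfolding yz by (simp only: vector_mult_component abs_mult)
        also have "\<dots> \<le> 32 * \<beta>\<^sup>2 * Cu"
          using y0(3)[of k] component_le_norm_cart[of "vinv y0 * y - (\<Sum>b\<in>B0. real_of_int (c b) *\<^sub>R b)" k] c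
          by (intro mult_mono) auto
        finally show ?thesis .
      qed
      define p where "p = - reco ?v (r - a)"
      have "r + frame ?v p 0 \<in> level e" using fl by (simp add: frame_frame)
      then have "e \<le> norm_Kbar (r + frame ?v p 0 + - a)" using uminus[OF a(1)] by (auto simp: level_def)
      also have "r + frame ?v p 0 + - a = frame ?v 0 (y - z)"
      proof -
        have "r - a = frame ?v (reco ?v (r - a)) (y - z)"
          using frame_coordinates[of ?v "r - a", OF nz] by (simp only: y_def a(2) imco_diff)
        then have "r - a + frame ?v p 0 = frame ?v 0 (y - z)" by (metis frame_add p_def add.right_inverse add.right_neutral)
        then show ?thesis by (simp add: algebra_simps)
      qed
      also have "norm_Kbar (frame ?v 0 (y - z)) \<le> (\<Prod>k\<in>(UNIV::'s set). \<theta>\<^sup>2)"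
        unfolding norm_Kbar_def
      proof (intro prod_mono conjI power_mono)
        fix k
        have "cmod (frame ?v 0 (y - z) $ k) = cmod (?v $ k) * \<bar>(y - z) $ k\<bar>"
          by (simp only: frame_nth[of ?v] norm_mult) (simp add: cmod_def)
        also have "\<dots> \<le> (exp R * \<rho>) * (32 * \<beta>\<^sup>2 * Cu)" using vb(1) yzk by (intro mult_mono) (auto simp: less_imp_le[OF \<rho>])
        also have "\<dots> = C5 / \<rho>" using \<rho> by (simp add: C5_def \<beta>_def power2_eq_square field_simps)
        also have "\<dots> \<le> \<theta>" using big(2) \<theta>(1) \<rho> by (simp add: field_simps)
        finally show "cmod (frame ?v 0 (y - z) $ k) \<le> \<theta>" .
      qed auto
      also have "\<dots> = \<theta> ^ (2 * CARD('s))" by (simp add: power_mult)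
      also have "\<dots> \<le> \<theta> ^ 1" using \<theta> card4 by (intro power_decreasing) auto
      finally show False using \<theta>(3) by simp
    qed
    have "norm ?v \<le> (\<Sum>i\<in>UNIV. norm (?v $ i))" unfolding norm_vec_def by (intro L2_set_le_sum) auto
    also have "\<dots> \<le> B"
    proof -
      have "norm (?v $ k) \<le> exp R * \<rho>0" for k using vb(1)[of k] \<open>\<rho> \<le> \<rho>0\<close> by (meson exp_ge_zero mult_left_mono order_trans)
      then show ?thesis unfolding B_def by (intro order.trans[OF sum_bounded_above]) auto
    qed
    finally show ?thesis using vL wk by blast
  qed
  then show ?thesis by blast
qed

lemma flatset_frame:
  assumes w: "\<And>k. w $ k \<noteq> 0"
  shows "flatset (frame v w 0) r = flatset v r"
proof -
  have ex: "\<exists>p'. frame v (w * p') 0 = frame v p 0" for p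
    using w by (intro exI[of _ "vinv w * p"]) (simp add: vec_eq_iff complex_eq_iff)
  have eq: "frame (frame v w 0) p 0 = frame v (w * p) 0" for p by (simp add: frame_frame)
  show ?thesis
    unfolding flatset_def eq
  proof safe
    fix p a assume "a \<in> L"
    obtain p' where "frame v (w * p') 0 = frame v p 0" using ex by blast
    then show "\<exists>p' a'. r + frame v p 0 + a = r + frame v (w * p') 0 + a' \<and> a' \<in> L"
      using \<open>a \<in> L\<close> by (intro exI[of _ p'] exI[of _ a]) simp
  qed blast
qed

lemma flatset_shift:
  assumes v: "v \<in> L" "v \<noteq> 0" and d: "imco v r - imco v r' \<in> quotient v"
  shows "flatset v r = flatset v r'"
proof -
  note nz = coordinate_nonzero[OF v]
  have sub: "flatset v r \<subseteq> flatset v r'" if d: "imco v r - imco v r' \<in> quotient v" for r r'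
  proof
    fix x assume "x \<in> flatset v r"
    then obtain p a where x: "a \<in> L" "x = r + frame v p 0 + a" unfolding flatset_def by blast
    obtain b where b: "b \<in> L" "imco v r - imco v r' = imco v b" using d unfolding quotient_def by blast
    have "imco v (r - r' - b) = 0" using b(2) by (simp only: imco_diff) simp
    then obtain D where "r - r' - b = frame v D 0" using frame_coordinates[of v "r - r' - b", OF nz] by metis
    then have "r = r' + frame v D 0 + b" by (simp add: algebra_simps)
    moreover have "frame v (D + p) 0 = frame v D 0 + frame v p 0" by (simp add: frame_add)
    ultimately have "x = r' + frame v (D + p) 0 + (b + a)" unfolding x(2) by (simp add: add_ac)
    then show "x \<in> flatset v r'" unfolding flatset_def using add[OF b(1) x(1)] by blast
  qed
  interpret quot: unit_lattice G "quotient v" by (rule quotient_lattice[OF v])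
  show ?thesis using sub[OF d] sub[of r' r] quot.uminus[OF d] by auto
qed

text \<open>Bounded generators leave finitely many directions. For each of them the admissible
  transversal coordinates form a closed invariant set omitting 0, which is finite modulo
  \<open>quotient v\<close> by rigidity.\<close>

theorem finite_flatsets:
  assumes e: "e > 0"
  shows "finite {flatset v r |v r. v \<in> L \<and> v \<noteq> 0 \<and> (\<forall>p. r + frame v p 0 \<in> level e)}"
proof -
  obtain B where B: "\<And>r v. v \<in> L \<Longrightarrow> v \<noteq> 0 \<Longrightarrow> (\<forall>p. r + frame v p 0 \<in> level e) \<Longrightarrow>
    (\<exists>w. (\<forall>k. w $ k \<noteq> 0) \<and> frame v w 0 \<in> L \<and> frame v w 0 \<noteq> 0 \<and> norm (frame v w 0) \<le> B)"
    using level_flat_generator_bounded[OF e] by blast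
  define Vs where "Vs = {v\<in>L. norm v \<le> B} - {0}"
  have Vs: "finite Vs" unfolding Vs_def using finite_bounded0 by blast
  define Y where "Y v = {y. \<forall>p. frame v p y \<in> level e}" for v
  have "\<exists>F. finite F \<and> (\<forall>y\<in>Y v. \<exists>z\<in>F. y - z \<in> quotient v)" if v: "v \<in> Vs" for v
  proof -
    have vL: "v \<in> L" "v \<noteq> 0" using v by (auto simp: Vs_def)
    note nz = coordinate_nonzero[OF vL]
    interpret quot: unit_lattice G "quotient v" by (rule quotient_lattice[OF vL])
    have "real_invariant G (quotient v) (Y v)"
      unfolding real_invariant_def
    proof (intro conjI ballI)
      have "Y v = (\<Inter>p. (\<lambda>y. frame v p y) -` level e)" by (auto simp: Y_def)
      moreover have "closed ((\<lambda>y. frame v p y) -` level e)" for p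
        by (intro closed_vimage invariantD(1)[OF level_invariant] continuous_intros)
      ultimately show "closed (Y v)" by auto
    next
      fix y a assume y: "y \<in> Y v" and "a \<in> quotient v"
      then obtain m where m: "m \<in> L" "a = imco v m" by (auto simp: quotient_def)
      have "frame v p (y + a) \<in> level e" for p
      proof -
        have "frame v (p - reco v m) y + m \<in> level e"
          using y m(1) by (intro invariantD(2)[OF level_invariant]) (auto simp: Y_def)
        moreover have "frame v (p - reco v m) y + m = frame v p (y + a)"
          using frame_coordinates[of v m, OF nz] frame_add[of v "p - reco v m" y "reco v m" "imco v m"] m(2) by simp
        ultimately show ?thesis by simp
      qed
      then show "y + a \<in> Y v" by (simp add: Y_def)
    next
      fix y u assume y: "y \<in> Y v" and u: "u \<in> G"
      have "frame v p (u * y) \<in> level e" for p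
      proof -
        have "frame v (vinv u * p) y \<in> level e" using y by (simp add: Y_def)
        from invariantD(3)[OF level_invariant this u] show ?thesis
          using mult_vinv[OF u] by (simp add: frame_cvec mult.assoc[symmetric])
      qed
      then show "u * y \<in> Y v" by (simp add: Y_def)
    qed
    moreover have "0 \<notin> Y v"
    proof
      assume "0 \<in> Y v"
      then have "frame v 0 0 \<in> level e" by (simp only: Y_def mem_Collect_eq)
      then show False using zero_notin_level[OF e] by simp
    qed
    ultimately show ?thesis using quot.real_invariant_finite by meson
  qed
  then obtain F where F: "\<And>v. v \<in> Vs \<Longrightarrow> finite (F v)" "\<And>v y. v \<in> Vs \<Longrightarrow> y \<in> Y v \<Longrightarrow> \<exists>z\<in>F v. y - z \<in> quotient v" by metis
  have "{flatset v r |v r. v \<in> L \<and> v \<noteq> 0 \<and> (\<forall>p. r + frame v p 0 \<in> level e)} \<subseteq> (\<Union>v\<in>Vs. (\<lambda>z. flatset v (frame v 0 z)) ` F v)"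
  proof safe
    fix v r assume v: "v \<in> L" "v \<noteq> 0" and fl: "\<forall>p. r + frame v p 0 \<in> level e"
    obtain w where w: "\<And>k. w $ k \<noteq> 0" "frame v w 0 \<in> L" "frame v w 0 \<noteq> 0" "norm (frame v w 0) \<le> B"
      using B[OF v fl] by blast
    let ?v = "frame v w 0"
    have vV: "?v \<in> Vs" using w by (simp add: Vs_def)
    have nz: "?v $ k \<noteq> 0" for k using coordinate_nonzero[OF w(2,3)] .
    have "imco ?v r \<in> Y ?v"
      unfolding Y_def
    proof (intro CollectI allI)
      fix p
      have "frame ?v p (imco ?v r) = r + frame ?v (p - reco ?v r) 0"
        using frame_coordinates[of ?v r, OF nz] frame_add[of ?v "reco ?v r" "imco ?v r" "p - reco ?v r" 0] by simp
      then show "frame ?v p (imco ?v r) \<in> level e" using fl by (simp add: frame_frame)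
    qed
    then obtain z where z: "z \<in> F ?v" "imco ?v r - z \<in> quotient ?v" using F(2)[OF vV] by blast
    have "flatset ?v r = flatset ?v (frame ?v 0 z)"
      using z(2) by (intro flatset_shift[OF w(2,3)]) (simp only: imco_frame[OF nz])
    then have "flatset v r = flatset ?v (frame ?v 0 z)" using flatset_frame[OF w(1)] by simp
    then show "flatset v r \<in> (\<Union>v\<in>Vs. (\<lambda>z. flatset v (frame v 0 z)) ` F v)" using vV z(1) by blast
  qed
  moreover have "finite (\<Union>v\<in>Vs. (\<lambda>z. flatset v (frame v 0 z)) ` F v)" using Vs F(1) by blast
  ultimately show ?thesis by (rule finite_subset)
qed

end


section \<open>Minima on flats\<close>

text \<open>Besides providing the real units, conjugation on K gives this property: \<open>v\<close>
  times the real part of \<open>a / v\<close> lies in K again. It is the reason why the lowest value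
  on a flat is attained at a torsion point.\<close>

locale cm_lattice = complex_lattice G L for G :: "(real ^ 's::finite) set" and L :: "(complex^'s) set" +
  assumes real_part_torsion: "a \<in> L \<Longrightarrow> v \<in> L \<Longrightarrow> v \<noteq> 0 \<Longrightarrow> torsion (frame v (reco v a) 0)"
begin

lemma reco_scaleR: "reco v (c *\<^sub>R x) = c *\<^sub>R reco v x"
proof -
  have "Re (c *\<^sub>R (z::complex) / w) = c * Re (z / w)" for z w
    by (simp only: divide_inverse mult_scaleR_left scaleR_complex.sel)
  then show ?thesis by (simp add: vec_eq_iff)
qed

lemma torsion_scaleR_cancel:
  assumes "n > 0" "torsion (real n *\<^sub>R x)"
  shows "torsion x"
proof -
  obtain m :: nat where "m > 0" "real m *\<^sub>R (real n *\<^sub>R x) \<in> L" using assms(2) unfolding torsion_def by blast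
  then show ?thesis using assms(1) unfolding torsion_def by (intro exI[of _ "m * n"]) simp
qed

lemma torsion_real_part:
  assumes x: "torsion x" and v: "v \<in> L" "v \<noteq> 0"
  shows "torsion (frame v (reco v x) 0)"
proof -
  obtain n :: nat where n: "n > 0" "real n *\<^sub>R x \<in> L" using x unfolding torsion_def by blast
  have "torsion (real n *\<^sub>R frame v (reco v x) 0)"
    using real_part_torsion[OF n(2) v] by (simp add: reco_scaleR frame_scaleR)
  then show ?thesis by (rule torsion_scaleR_cancel[OF n(1)])
qed

text \<open>For each lattice translate of the flat the component along \<open>v\<close> can be
  chosen to be 0, and the norm of the transversal component remains.\<close>

definition nu :: "complex^'s \<Rightarrow> complex^'s \<Rightarrow> real" where
  "nu v r = (INF a\<in>L. norm_Kbar (frame v 0 (imco v (r + a))))"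

lemma transversal_torsion:
  "real q *\<^sub>R r \<in> L \<Longrightarrow> a \<in> L \<Longrightarrow> real q *\<^sub>R imco v (r + a) \<in> quotient v"
  unfolding quotient_def imco_scaleR[symmetric] by (intro imageI) (simp add: scaleR_right_distrib add scaleR_nat)

text \<open>The transversal coordinates of the translates of \<open>r\<close> have a common
  denominator, so finitely many values lie below any bound.\<close>

lemma nu_attained:
  assumes v: "v \<in> L" "v \<noteq> 0" and r: "torsion r"
  shows "\<exists>a\<in>L. nu v r = norm_Kbar (frame v 0 (imco v (r + a)))"
    and "\<And>a. a \<in> L \<Longrightarrow> nu v r \<le> norm_Kbar (frame v 0 (imco v (r + a)))"
proof -
  note nz = coordinate_nonzero[OF v]
  have Nv: "norm_Kbar v > 0" using nz norm_Kbar_eq_0_iff[of v] norm_Kbar_nonneg[of v] by force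
  interpret quot: unit_lattice G "quotient v" by (rule quotient_lattice[OF v])
  obtain q :: nat where q: "q > 0" "real q *\<^sub>R r \<in> L" using r unfolding torsion_def by blast
  let ?S = "(\<lambda>a. norm_Kbar (frame v 0 (imco v (r + a)))) ` L"
  let ?T = "\<lambda>B. {norm_Kbar (cvec y) |y. real q *\<^sub>R y \<in> quotient v \<and> norm_Kbar (cvec y) \<le> B / norm_Kbar v}"
  have "finite {t\<in>?S. t \<le> B}" for B
  proof (rule finite_subset)
    show "{t\<in>?S. t \<le> B} \<subseteq> (\<lambda>t. norm_Kbar v * t) ` ?T B"
    proof
      fix t assume "t \<in> {t\<in>?S. t \<le> B}"
      then obtain a where a: "a \<in> L" "t = norm_Kbar v * norm_Kbar (cvec (imco v (r + a)))" "t \<le> B"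
        by (auto simp: norm_Kbar_frame_imag)
      have "norm_Kbar (cvec (imco v (r + a))) \<le> B / norm_Kbar v" using a(2,3) Nv by (simp add: pos_le_divide_eq mult.commute)
      then show "t \<in> (\<lambda>t. norm_Kbar v * t) ` ?T B"
        using a(2) transversal_torsion[OF q(2) a(1), of v] by blast
    qed
    show "finite ((\<lambda>t. norm_Kbar v * t) ` ?T B)"
      using quot.finite_real_values[OF q(1)] by blast
  qed
  then have S: "Inf ?S \<in> ?S" "\<And>x. x \<in> ?S \<Longrightarrow> Inf ?S \<le> x" using zero by (intro cInf_attained; auto)+
  then show "\<exists>a\<in>L. nu v r = norm_Kbar (frame v 0 (imco v (r + a)))" unfolding nu_def by blast
  show "\<And>a. a \<in> L \<Longrightarrow> nu v r \<le> norm_Kbar (frame v 0 (imco v (r + a)))" unfolding nu_def using S(2) by blast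
qed

lemma flat_emin_ge:
  assumes v: "v \<in> L" "v \<noteq> 0" and r: "torsion r"
  shows "nu v r \<le> emin (r + frame v p 0)"
proof -
  note nz = coordinate_nonzero[OF v]
  have "r + frame v p 0 \<in> level (nu v r)"
    unfolding level_def
  proof (intro CollectI ballI)
    fix a assume a: "a \<in> L"
    have "r + frame v p 0 + a = frame v (reco v (r + a) + p) (imco v (r + a))"
      using frame_coordinates[of v "r + a", OF nz] frame_add[of v "reco v (r + a)" "imco v (r + a)" p 0] by (simp add: add_ac)
    then show "nu v r \<le> norm_Kbar (r + frame v p 0 + a)"
      using nu_attained(2)[OF v r a] norm_Kbar_frame_le order.trans by metis
  qed
  then show ?thesis by (simp add: level_iff)
qed

text \<open>The point is the one at which the real part of a minimizing translate is cancelled; it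
  is torsion by \<open>torsion_real_part\<close>.\<close>

lemma flat_emin_attained:
  assumes v: "v \<in> L" "v \<noteq> 0" and r: "torsion r"
  shows "\<exists>p. torsion (r + frame v p 0) \<and> emin (r + frame v p 0) = nu v r"
proof -
  note nz = coordinate_nonzero[OF v]
  obtain a where a: "a \<in> L" "nu v r = norm_Kbar (frame v 0 (imco v (r + a)))" using nu_attained(1)[OF v r] by blast
  define p where "p = - reco v (r + a)"
  have "frame v p 0 = - frame v (reco v (r + a)) 0" by (simp add: p_def vec_eq_iff complex_eq_iff)
  then have t: "torsion (r + frame v p 0)"
    using torsion_diff[OF r torsion_real_part[OF _ v, of "r + a"]] torsion_add[OF r torsion_lattice[OF a(1)]] by simp
  have "r + frame v p 0 + a = frame v (reco v (r + a) + p) (imco v (r + a))"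
    using frame_coordinates[of v "r + a", OF nz] frame_add[of v "reco v (r + a)" "imco v (r + a)" p 0] by (simp add: add_ac)
  then have "r + frame v p 0 + a = frame v 0 (imco v (r + a))" by (simp add: p_def)
  then have "emin (r + frame v p 0) \<le> nu v r" using emin_le[OF a(1), of "r + frame v p 0"] a(2) by simp
  then show ?thesis using t flat_emin_ge[OF v r, of p] by (intro exI[of _ p]) simp
qed

lemma level_flat_iff:
  assumes v: "v \<in> L" "v \<noteq> 0" and r: "torsion r"
  shows "(\<forall>p. r + frame v p 0 \<in> level e) \<longleftrightarrow> e \<le> nu v r"
  using flat_emin_ge[OF v r] flat_emin_attained[OF v r] by (metis level_iff order.trans)

text \<open>The parameters with value at least \<open>e\<close> form a closed set, invariant under
  the powers of units that fix \<open>r\<close>, and proper since a lowest point is missing.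
  Rigidity makes it finite modulo the lattice, and points with finite orbit are torsion.\<close>

lemma flat_level_finite:
  assumes v: "v \<in> L" "v \<noteq> 0" and r: "torsion r" and e: "nu v r < e"
  shows "\<exists>F. finite F \<and> (\<forall>p. e \<le> emin (r + frame v p 0) \<longrightarrow> torsion (r + frame v p 0) \<and> (\<exists>y\<in>F. r + frame v p 0 - y \<in> L))"
proof -
  interpret flat: unit_lattice G "flat v" by (rule flat_lattice[OF v])
  obtain n0 :: nat where n0: "n0 > 0" "real n0 *\<^sub>R r \<in> L" using r unfolding torsion_def by blast
  obtain N where N: "N > 0" "\<And>u x. u \<in> G \<Longrightarrow> real n0 *\<^sub>R x \<in> L \<Longrightarrow> cvec (u ^ N) * x - x \<in> L"
    using unit_power_fixes_torsion[OF n0(1)] by blast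
  let ?G = "(\<lambda>u. u ^ N) ` G"
  interpret C': complex_lattice ?G L by (rule powers_lattice[OF N(1)])
  interpret F': unit_lattice ?G "flat v" by (rule flat.powers_lattice[OF N(1)])
  define Q where "Q = {p. e \<le> emin (r + frame v p 0)}"
  have Ql: "p \<in> Q \<longleftrightarrow> r + frame v p 0 \<in> level e" for p by (simp add: Q_def level_iff)
  have shift: "cvec u * r - r \<in> L" if "u \<in> ?G" for u using that N(2)[OF _ n0(2)] by blast
  have Qinv: "real_invariant ?G (flat v) Q"
    unfolding real_invariant_def
  proof (intro conjI ballI)
    have "closed ((\<lambda>p. r + frame v p 0) -` level e)" by (intro closed_vimage invariantD(1)[OF level_invariant] continuous_intros)
    then show "closed Q" by (simp add: Ql[abs_def] vimage_def Q_def level_iff)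
  next
    fix p a assume "p \<in> Q" "a \<in> flat v"
    then have "r + frame v p 0 + frame v a 0 \<in> level e" using invariantD(2)[OF level_invariant] by (simp add: flat_iff Ql)
    then show "p + a \<in> Q" by (simp add: Ql add.assoc frame_add)
  next
    fix p u assume p: "p \<in> Q" and u: "u \<in> ?G"
    have "u \<in> G" using u powers_subset by blast
    then have "cvec u * (r + frame v p 0) \<in> level e" using invariantD(3)[OF level_invariant] p by (simp add: Ql)
    from invariantD(2)[OF level_invariant this uminus[OF shift[OF u]]]
    show "u * p \<in> Q" by (simp add: Ql algebra_simps frame_cvec)
  qed
  obtain p0 where "emin (r + frame v p0 0) = nu v r" using flat_emin_attained[OF v r] by blast
  then have "p0 \<notin> Q" using e by (simp add: Q_def)
  then obtain F where F: "finite F" "\<And>p. p \<in> Q \<Longrightarrow> \<exists>y\<in>F. p - y \<in> flat v"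
    using F'.real_invariant_finite[OF Qinv] by meson
  let ?F = "(\<lambda>y. r + frame v y 0) ` F"
  have near: "\<exists>y\<in>?F. r + frame v p 0 - y \<in> L" if pQ: "p \<in> Q" for p
  proof -
    obtain y where "y \<in> F" "p - y \<in> flat v" using F(2)[OF pQ] by blast
    then show ?thesis by (intro bexI[of _ "r + frame v y 0"]) (auto simp: flat_iff frame_diff)
  qed
  have "torsion (r + frame v p 0)" if p: "p \<in> Q" for p
  proof (rule C'.finite_orbit_torsion[of ?F])
    show "finite ?F" using F(1) by blast
    fix u assume u: "u \<in> ?G"
    have "u * p \<in> Q" by (rule real_invariantD(3)[OF Qinv p u])
    then obtain y where y: "y \<in> ?F" "r + frame v (u * p) 0 - y \<in> L" using near by blast
    have "cvec u * (r + frame v p 0) - y = (cvec u * r - r) + (r + frame v (u * p) 0 - y)"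
      by (simp add: algebra_simps frame_cvec)
    then have "cvec u * (r + frame v p 0) - y \<in> L" using add[OF shift[OF u] y(2)] by (simp only:)
    then show "\<exists>y\<in>?F. cvec u * (r + frame v p 0) - y \<in> L" using y(1) by blast
  qed
  then show ?thesis using near F(1) by (intro exI[of _ ?F]) (auto simp: Q_def)
qed

lemma flat_emin_nontorsion:
  assumes v: "v \<in> L" "v \<noteq> 0" and r: "torsion r" and nt: "\<not> torsion (r + frame v p 0)"
  shows "emin (r + frame v p 0) = nu v r"
proof (rule ccontr)
  assume "emin (r + frame v p 0) \<noteq> nu v r"
  then have "nu v r < emin (r + frame v p 0)" using flat_emin_ge[OF v r, of p] by simp
  from flat_level_finite[OF v r this] nt show False by blast
qed

lemma finite_orbit:
  assumes "torsion x"
  shows "\<exists>F. finite F \<and> (\<forall>u\<in>G. \<exists>y\<in>F. cvec u * x - y \<in> L)"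
proof -
  obtain q :: nat where q: "q > 0" "real q *\<^sub>R x \<in> L" using assms unfolding torsion_def by blast
  obtain S where S: "finite S" "\<And>x. real q *\<^sub>R x \<in> L \<Longrightarrow> \<exists>s\<in>S. real q *\<^sub>R s \<in> L \<and> x - s \<in> L"
    using finite_torsion_classes[OF q(1)] by blast
  have "\<exists>y\<in>S. cvec u * x - y \<in> L" if "u \<in> G" for u
    using S(2)[of "cvec u * x"] act[OF that q(2)] by auto
  then show ?thesis using S(1) by blast
qed

text \<open>
  On a flat, the infimum of the norm is attained only at points with vanishing real part; modulo
  units there are finitely many of those.
\<close>

lemma flat_minimum_finite:
  assumes v: "v \<in> L" "v \<noteq> 0" and r: "torsion r" and pos: "nu v r > 0"
  shows "\<exists>F. finite F \<and> (\<forall>p. torsion (r + frame v p 0) \<longrightarrow> emin (r + frame v p 0) = nu v r \<longrightarrow> (\<exists>y\<in>F. r + frame v p 0 - y \<in> L))"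
proof -
  note nz = coordinate_nonzero[OF v]
  interpret quot: unit_lattice G "quotient v" by (rule quotient_lattice[OF v])
  obtain q :: nat where q: "q > 0" "real q *\<^sub>R r \<in> L" using r unfolding torsion_def by blast
  obtain K where K: "K > 0" "\<And>x::complex^'s. norm_Kbar x \<le> nu v r \<Longrightarrow> (\<forall>i. x $ i \<noteq> 0) \<Longrightarrow> (\<exists>u\<in>G. norm (cvec u * x) \<le> K)"
    using bounded_representative[of "nu v r"] by blast
  \<comment> \<open>Candidates for balanced minimizing points: purely transversal, bounded, and with
    denominator \<open>q\<close>. The set \<open>E\<close> then adds representatives of their
    orbits, because the balancing unit has to be undone.\<close>
  define W where "W = (\<lambda>y. frame v 0 (y /\<^sub>R real q)) ` {y\<in>quotient v. norm y \<le> real q * (K * norm (\<chi> k. inverse (v $ k)))}"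
  have "finite W" unfolding W_def using quot.finite_bounded0 by blast
  have "\<exists>F. \<forall>x. torsion x \<longrightarrow> finite (F x) \<and> (\<forall>u\<in>G. \<exists>y\<in>F x. cvec u * x - y \<in> L)"
    using finite_orbit by (intro choice) blast
  then obtain F where F: "\<And>x. torsion x \<Longrightarrow> finite (F x)" "\<And>x u. torsion x \<Longrightarrow> u \<in> G \<Longrightarrow> \<exists>y\<in>F x. cvec u * x - y \<in> L" by blast
  define E where "E = (\<Union>x\<in>{x\<in>W. torsion x}. F x)"
  have "finite E" unfolding E_def using \<open>finite W\<close> F(1) by auto
  moreover have "\<exists>y\<in>E. r + frame v p 0 - y \<in> L" if t: "torsion (r + frame v p 0)" and m: "emin (r + frame v p 0) = nu v r" for p
  proof -
    define x where "x = r + frame v p 0"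
    obtain a where a: "a \<in> L" "nu v r = norm_Kbar (x + a)" using emin_attained[OF t] m by (auto simp: x_def)
    define P where "P = reco v (r + a) + p"
    define Q where "Q = imco v (r + a)"
    have xa: "x + a = frame v P Q"
      using frame_coordinates[of v "r + a", OF nz] frame_add[of v "reco v (r + a)" "imco v (r + a)" p 0] by (simp add: add_ac x_def P_def Q_def)
    have ge: "nu v r \<le> norm_Kbar (frame v 0 Q)" unfolding Q_def by (rule nu_attained(2)[OF v r a(1)])
    then have eqN: "norm_Kbar (frame v 0 Q) = norm_Kbar (frame v P Q)"
      using norm_Kbar_frame_le[of v Q P] a(2) xa by simp
    have Qk: "Q $ k \<noteq> 0" for k
    proof
      assume "Q $ k = 0"
      then have "frame v 0 Q $ k = 0" by (simp add: complex_eq_iff)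
      then have "norm_Kbar (frame v 0 Q) = 0" using norm_Kbar_eq_0_iff by blast
      then show False using ge pos by simp
    qed
    have "P $ k = 0" for k
    proof (rule ccontr)
      assume Pk: "P $ k \<noteq> 0"
      have lt: "(cmod (Complex 0 (Q $ k)))\<^sup>2 < (cmod (Complex (P $ k) (Q $ k)))\<^sup>2"
        using Pk by (simp add: cmod_def)
      have "(cmod (frame v 0 Q $ k))\<^sup>2 < (cmod (frame v P Q $ k))\<^sup>2"
        using lt nz[of k] by (simp add: norm_mult power_mult_distrib)
      moreover have "(\<Prod>i\<in>UNIV - {k}. (cmod (frame v 0 Q $ i))\<^sup>2) \<le> (\<Prod>i\<in>UNIV - {k}. (cmod (frame v P Q $ i))\<^sup>2)"
      proof (intro prod_mono conjI power_mono)
        fix i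
        have "cmod (Complex 0 (Q $ i)) \<le> cmod (Complex (P $ i) (Q $ i))" by (simp add: cmod_def)
        then show "cmod (frame v 0 Q $ i) \<le> cmod (frame v P Q $ i)" by (simp add: norm_mult mult_left_mono)
      qed auto
      moreover have "(\<Prod>i\<in>UNIV - {k}. (cmod (frame v 0 Q $ i))\<^sup>2) > 0"
      proof (intro prod_pos ballI)
        fix i
        have "Complex 0 (Q $ i) \<noteq> 0" using Qk[of i] by (simp add: complex_eq_iff)
        then show "0 < (cmod (frame v 0 Q $ i))\<^sup>2" using nz[of i] by simp
      qed
      ultimately have "(cmod (frame v 0 Q $ k))\<^sup>2 * (\<Prod>i\<in>UNIV - {k}. (cmod (frame v 0 Q $ i))\<^sup>2)
          < (cmod (frame v P Q $ k))\<^sup>2 * (\<Prod>i\<in>UNIV - {k}. (cmod (frame v P Q $ i))\<^sup>2)"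
        by (intro mult_less_le_imp_less) auto
      then show False using eqN by (simp add: norm_Kbar_def prod.remove[of UNIV k])
    qed
    then have "P = 0" by (simp add: vec_eq_iff)
    then have xQ: "x + a = frame v 0 Q" using xa by simp
    have "\<forall>i. (x + a) $ i \<noteq> 0"
      using norm_Kbar_eq_0_iff[of "x + a"] a(2) pos by auto
    from K(2)[OF _ this] a(2) obtain u where u: "u \<in> G" "norm (cvec u * (x + a)) \<le> K" by auto
    let ?y = "real q *\<^sub>R (u * Q)"
    have "?y \<in> quotient v"
      using quot.act[OF u(1) transversal_torsion[OF q(2) a(1), of v]] by (simp add: Q_def)
    moreover have "norm ?y \<le> real q * (K * norm (\<chi> k. inverse (v $ k)))"
    proof -
      have "u * Q = imco v (cvec u * (x + a))" using imco_frame[OF nz] by (simp add: xQ frame_cvec)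
      then have "norm (u * Q) \<le> norm (cvec u * (x + a)) * norm (\<chi> k. inverse (v $ k))" using norm_imco_le by metis
      also have "\<dots> \<le> K * norm (\<chi> k. inverse (v $ k))" using u(2) by (intro mult_right_mono) auto
      finally show ?thesis by (simp add: mult_left_mono)
    qed
    ultimately have "frame v 0 (?y /\<^sub>R real q) \<in> W" unfolding W_def by blast
    moreover have yu: "frame v 0 (?y /\<^sub>R real q) = cvec u * (x + a)" using q(1) by (simp add: xQ frame_cvec)
    moreover have tu: "torsion (cvec u * (x + a))"
      using torsion_cvec[OF _ u(1)] torsion_add[OF t torsion_lattice[OF a(1)]] by (simp add: x_def)
    ultimately have W: "cvec u * (x + a) \<in> {x\<in>W. torsion x}" by simp
    obtain z where z: "z \<in> F (cvec u * (x + a))" "cvec (vinv u) * (cvec u * (x + a)) - z \<in> L"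
      using F(2)[OF tu inv[OF u(1)]] by blast
    have "x + a - z \<in> L" using z(2) cvec_vinv[OF u(1)] by simp
    then have "x - z \<in> L" using diff[of "x + a - z" a] a(1) by (simp add: algebra_simps)
    moreover have "z \<in> E" using z(1) W unfolding E_def by blast
    ultimately show ?thesis unfolding x_def by blast
  qed
  ultimately show ?thesis by blast
qed

section \<open>The collection of all flats and their minima\<close>

definition flats :: "(complex^'s) set set" where
  "flats = {flatset v r |v r. v \<in> L \<and> v \<noteq> 0 \<and> torsion r}"

text \<open>Defined from the set alone, since different pairs \<open>v\<close>, \<open>r\<close>
  describe the same flat; \<open>flat_min_flatset\<close> identifies it with
  \<open>nu\<close>.\<close>

definition flat_min :: "(complex^'s) set \<Rightarrow> real" where
  "flat_min S = Inf (emin ` S)"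

lemma flat_min_flatset:
  assumes v: "v \<in> L" "v \<noteq> 0" and r: "torsion r"
  shows "flat_min (flatset v r) = nu v r"
proof -
  obtain p where p: "emin (r + frame v p 0) = nu v r" using flat_emin_attained[OF v r] by blast
  have "r + frame v p 0 + 0 \<in> flatset v r" unfolding flatset_def using zero by blast
  then have "nu v r \<in> emin ` flatset v r" using p by (metis add_0_right image_eqI)
  moreover have "nu v r \<le> t" if "t \<in> emin ` flatset v r" for t
    using that flat_emin_ge[OF v r] by (auto simp: flatset_def emin_periodic)
  ultimately show ?thesis unfolding flat_min_def by (rule cInf_eq_minimum)
qed

lemma flatE:
  assumes "S \<in> flats"
  obtains v r where "v \<in> L" "v \<noteq> 0" "torsion r" "S = flatset v r" "flat_min S = nu v r"
  using assms flat_min_flatset unfolding flats_def by blast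

lemma flatset_mem: "r + frame v p 0 \<in> flatset v r"
  unfolding flatset_def using zero by force

lemma flatset_cases:
  assumes "x \<in> flatset v r"
  obtains p a where "a \<in> L" "x = r + frame v p 0 + a" "emin x = emin (r + frame v p 0)"
    "torsion x \<longleftrightarrow> torsion (r + frame v p 0)"
  using assms emin_periodic torsion_add_iff unfolding flatset_def by blast

lemma finite_flats_above:
  assumes "e > 0"
  shows "finite {S\<in>flats. flat_min S \<ge> e}"
proof (rule finite_subset[OF _ finite_flatsets[OF assms]])
  show "{S\<in>flats. flat_min S \<ge> e} \<subseteq> {flatset v r |v r. v \<in> L \<and> v \<noteq> 0 \<and> (\<forall>p. r + frame v p 0 \<in> level e)}"
  proof safe
    fix S assume "S \<in> flats" "e \<le> flat_min S"
    then show "\<exists>v r. S = flatset v r \<and> v \<in> L \<and> v \<noteq> 0 \<and> (\<forall>p. r + frame v p 0 \<in> level e)"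
      using level_flat_iff by (elim flatE) metis
  qed
qed

lemma level_cases:
  assumes e: "e > 0"
  shows "\<exists>F. finite F \<and> (\<forall>x. emin x \<ge> e \<longrightarrow> (\<exists>S\<in>flats. x \<in> S \<and> flat_min S \<ge> e) \<or> (torsion x \<and> (\<exists>y\<in>F. x - y \<in> L)))"
proof -
  obtain F where F: "finite F" "\<And>x. x \<in> level e - flat_points (level e) \<Longrightarrow> torsion x \<and> (\<exists>y\<in>F. x - y \<in> L)"
    using finite_outside_flats[OF level_invariant zero_notin_level[OF e]] by blast
  have "\<exists>S\<in>flats. x \<in> S \<and> flat_min S \<ge> e" if x: "x \<in> flat_points (level e)" for x
  proof -
    obtain r v p where r: "torsion r" "v \<in> L" "v \<noteq> 0" "x = r + frame v p 0" "\<forall>p. r + frame v p 0 \<in> level e"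
      using x unfolding flat_points_def by blast
    then have "e \<le> nu v r" using level_flat_iff by blast
    then have "flat_min (flatset v r) \<ge> e" using flat_min_flatset r by simp
    moreover have "flatset v r \<in> flats" unfolding flats_def using r by blast
    ultimately show ?thesis using flatset_mem r(4) by blast
  qed
  then show ?thesis using F by (intro exI[of _ F]) (auto simp: level_iff)
qed

lemma flat_min_le: "S \<in> flats \<Longrightarrow> x \<in> S \<Longrightarrow> flat_min S \<le> emin x"
  by (elim flatE) (metis flat_emin_ge flatset_cases)

lemma flat_min_nontorsion: "S \<in> flats \<Longrightarrow> x \<in> S \<Longrightarrow> \<not> torsion x \<Longrightarrow> emin x = flat_min S"
  by (elim flatE) (metis flat_emin_nontorsion flatset_cases)

lemma flat_above_finite:
  assumes S: "S \<in> flats" "flat_min S < e"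
  shows "\<exists>F. finite F \<and> (\<forall>x\<in>S. emin x \<ge> e \<longrightarrow> (\<exists>y\<in>F. x - y \<in> L))"
proof -
  obtain v r where v: "v \<in> L" "v \<noteq> 0" "torsion r" "S = flatset v r" "flat_min S = nu v r" using S(1) by (rule flatE)
  obtain F where F: "finite F" "\<And>p. e \<le> emin (r + frame v p 0) \<Longrightarrow> \<exists>y\<in>F. r + frame v p 0 - y \<in> L"
    using flat_level_finite[OF v(1-3)] S(2) v(5) by metis
  have "\<exists>y\<in>F. x - y \<in> L" if x: "x \<in> S" "emin x \<ge> e" for x
  proof -
    obtain p a where p: "a \<in> L" "x = r + frame v p 0 + a" "emin x = emin (r + frame v p 0)"
      using x(1) unfolding v(4) by (rule flatset_cases)
    obtain y where "y \<in> F" "r + frame v p 0 - y \<in> L" using F(2)[of p] x(2) p(3) by auto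
    then show ?thesis using add[OF _ p(1), of "r + frame v p 0 - y"] p(2) by (intro bexI[of _ y]) (auto simp: algebra_simps)
  qed
  then show ?thesis using F(1) by blast
qed

lemma flat_minimum:
  assumes S: "S \<in> flats"
  shows "\<exists>x\<in>S. torsion x \<and> emin x = flat_min S"
    and "flat_min S > 0 \<Longrightarrow> \<exists>F. finite F \<and> (\<forall>x\<in>S. torsion x \<longrightarrow> emin x = flat_min S \<longrightarrow> (\<exists>y\<in>F. x - y \<in> L))"
proof -
  obtain v r where v: "v \<in> L" "v \<noteq> 0" "torsion r" "S = flatset v r" "flat_min S = nu v r" using S(1) by (rule flatE)
  show "\<exists>x\<in>S. torsion x \<and> emin x = flat_min S"
    using flat_emin_attained[OF v(1-3)] v(4,5) flatset_mem by metis
  assume "flat_min S > 0"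
  then obtain F where F: "finite F" "\<And>p. torsion (r + frame v p 0) \<Longrightarrow> emin (r + frame v p 0) = nu v r \<Longrightarrow> \<exists>y\<in>F. r + frame v p 0 - y \<in> L"
    using flat_minimum_finite[OF v(1-3)] v(5) by metis
  have "\<exists>y\<in>F. x - y \<in> L" if x: "x \<in> S" "torsion x" "emin x = flat_min S" for x
  proof -
    obtain p a where p: "a \<in> L" "x = r + frame v p 0 + a" "emin x = emin (r + frame v p 0)" "torsion x \<longleftrightarrow> torsion (r + frame v p 0)"
      using x(1) unfolding v(4) by (rule flatset_cases)
    obtain y where "y \<in> F" "r + frame v p 0 - y \<in> L" using F(2)[of p] x(2,3) p(3,4) v(5) by auto
    then show ?thesis using add[OF _ p(1), of "r + frame v p 0 - y"] p(2) by (intro bexI[of _ y]) (auto simp: algebra_simps)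
  qed
  then show "\<exists>F. finite F \<and> (\<forall>x\<in>S. torsion x \<longrightarrow> emin x = flat_min S \<longrightarrow> (\<exists>y\<in>F. x - y \<in> L))" using F(1) by blast
qed

text \<open>The torsion points \<open>r + v / n\<close> of the flat are pairwise incongruent for
  large n. Without a value in between, each of them would have the minimal value or one at least
  \<open>e\<close> above it, and both kinds fill finitely many classes.\<close>

lemma flat_approached:
  assumes S: "S \<in> flats" "flat_min S > 0" and e: "e > 0"
  shows "\<exists>x. torsion x \<and> flat_min S < emin x \<and> emin x < flat_min S + e"
proof (rule ccontr)
  assume neg: "\<not> ?thesis"
  obtain v r where v: "v \<in> L" "v \<noteq> 0" "torsion r" "S = flatset v r" "flat_min S = nu v r" using S(1) by (rule flatE)
  obtain F1 where F1: "finite F1" "\<And>x. x \<in> S \<Longrightarrow> emin x \<ge> flat_min S + e \<Longrightarrow> \<exists>y\<in>F1. x - y \<in> L"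
    using flat_above_finite[OF S(1), of "flat_min S + e"] e by auto
  obtain F2 where F2: "finite F2" "\<And>x. x \<in> S \<Longrightarrow> torsion x \<Longrightarrow> emin x = flat_min S \<Longrightarrow> \<exists>y\<in>F2. x - y \<in> L"
    using flat_minimum(2)[OF S] by blast
  obtain d where d: "d > 0" "\<forall>a\<in>L. norm a < d \<longrightarrow> a = 0" using discrete by blast
  \<comment> \<open>Large enough for the differences of the points \<open>x n\<close> to be shorter
    than every nonzero lattice vector.\<close>
  obtain n0 :: nat where n0: "norm v / d < real n0" using reals_Archimedean2 by blast
  define x where "x n = r + (1 / real (n + n0 + 1)) *\<^sub>R v" for n :: nat
  have xS: "x n \<in> S" for n
  proof -
    have "(1 / real (n + n0 + 1)) *\<^sub>R v = frame v ((1 / real (n + n0 + 1)) *\<^sub>R 1) 0"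
      by (simp add: vec_eq_iff complex_eq_iff)
    then show ?thesis unfolding x_def v(4) using flatset_mem by metis
  qed
  have xt: "torsion (x n)" for n
  proof -
    have "torsion ((1 / real (n + n0 + 1)) *\<^sub>R v)"
      by (rule torsion_scaleR_cancel[of "n + n0 + 1"]) (use torsion_lattice[OF v(1)] in auto)
    then show ?thesis unfolding x_def by (rule torsion_add[OF v(3)])
  qed
  have "\<exists>y\<in>F1 \<union> F2. x n - y \<in> L" for n
    using neg xt[of n] flat_min_le[OF S(1) xS[of n]] F1(2)[OF xS[of n]] F2(2)[OF xS[of n] xt[of n]]
    by (cases "emin (x n) = flat_min S"; cases "emin (x n) < flat_min S + e") force+
  then obtain y where y: "\<And>n. y n \<in> F1 \<union> F2" "\<And>n. x n - y n \<in> L" by metis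
  have "\<not> inj y"
  proof
    assume "inj y"
    moreover have "finite (range y)" by (rule finite_subset[of _ "F1 \<union> F2"]) (use y(1) F1(1) F2(1) in auto)
    ultimately show False using finite_imageD by blast
  qed
  then obtain m n where mn: "m \<noteq> n" "y m = y n" unfolding inj_def by blast
  have "x m - x n \<in> L" using diff[OF y(2)[of m] y(2)[of n]] mn(2) by simp
  moreover have xd: "x m - x n = (1 / real (m + n0 + 1) - 1 / real (n + n0 + 1)) *\<^sub>R v"
    by (simp add: x_def scaleR_left_diff_distrib)
  moreover have "norm (x m - x n) < d"
  proof -
    have b: "0 < 1 / real (k + n0 + 1)" "1 / real (k + n0 + 1) \<le> 1 / (real n0 + 1)" for k
      by (auto simp: divide_simps)
    have "\<bar>1 / real (m + n0 + 1) - 1 / real (n + n0 + 1)\<bar> \<le> 1 / (real n0 + 1)" using b[of m] b[of n] by linarith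
    then have "norm (x m - x n) \<le> 1 / (real n0 + 1) * norm v" unfolding xd norm_scaleR by (intro mult_right_mono) auto
    also have "\<dots> < d" using n0 d(1) by (simp add: field_simps)
    finally show ?thesis .
  qed
  ultimately have "(1 / real (m + n0 + 1) - 1 / real (n + n0 + 1)) *\<^sub>R v = 0" using d(2) by metis
  then show False using v(2) mn(1) by simp
qed

text \<open>The torsion points \<open>x n\<close> tend to 0 transversally to \<open>v\<close>. Their
  flats have positive minimum because small nonzero multiples of \<open>y\<close> are not in
  \<open>quotient v\<close>. If no positive minimum were below \<open>e\<close>, all
  \<open>x n\<close> and hence their limit 0 would lie in the closed set
  \<open>level e\<close>.\<close>

lemma flat_small:
  assumes e: "e > 0"
  shows "\<exists>S\<in>flats. 0 < flat_min S \<and> flat_min S < e"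
proof (rule ccontr)
  assume neg: "\<not> ?thesis"
  obtain v where v: "v \<in> L" "v \<noteq> 0" using nonzero_element by blast
  note nz = coordinate_nonzero[OF v]
  interpret quot: unit_lattice G "quotient v" by (rule quotient_lattice[OF v])
  obtain C where C: "C > 0" "\<And>x. \<exists>a\<in>quotient v. norm (x - a) \<le> C" using quot.radius by metis
  obtain b :: "real^'s" where b: "b \<in> Basis" using nonempty_Basis by blast
  obtain y where y: "y \<in> quotient v" "norm ((C + 1) *\<^sub>R b - y) \<le> C" using C(2) by blast
  have "norm ((C + 1) *\<^sub>R b) = C + 1" using b C(1) by simp
  then have y0: "y \<noteq> 0" using y(2) by auto
  obtain a where a: "a \<in> L" "y = imco v a" using y(1) unfolding quotient_def by blast
  obtain d where d: "d > 0" "\<forall>a\<in>quotient v. norm a < d \<longrightarrow> a = 0" using quot.discrete by blast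
  obtain n0 :: nat where n0: "norm y / d < real n0" using reals_Archimedean2 by blast
  define x where "x n = (1 / real (n + n0 + 1)) *\<^sub>R a" for n :: nat
  have xt: "torsion (x n)" for n
    unfolding x_def by (rule torsion_scaleR_cancel[of "n + n0 + 1"]) (use torsion_lattice[OF a(1)] in auto)
  have "x n \<in> level e" for n
  proof -
    let ?S = "flatset v (x n)"
    have S: "?S \<in> flats" unfolding flats_def using v xt by blast
    have fm: "flat_min ?S = nu v (x n)" by (rule flat_min_flatset[OF v xt])
    obtain c where c: "c \<in> L" "nu v (x n) = norm_Kbar (frame v 0 (imco v (x n + c)))"
      using nu_attained(1)[OF v xt] by blast
    have "flat_min ?S \<noteq> 0"
    proof
      assume "flat_min ?S = 0"
      then obtain k where k: "frame v 0 (imco v (x n + c)) $ k = 0" using fm c(2) norm_Kbar_eq_0_iff by metis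
      then have "Complex 0 (imco v (x n + c) $ k) = 0"
        using nz[of k] by (simp only: frame_nth[of v] zero_index mult_eq_0_iff) blast
      then have "imco v (x n + c) $ k = 0" by (simp add: complex_eq_iff del: imco_nth)
      then have "(real (n + n0 + 1) *\<^sub>R imco v (x n + c)) $ k = 0" by simp
      moreover have "real (n + n0 + 1) *\<^sub>R imco v (x n + c) \<in> quotient v"
        by (rule transversal_torsion[OF _ c(1)]) (simp add: x_def a(1) del: of_nat_add)
      ultimately have "real (n + n0 + 1) *\<^sub>R imco v (x n + c) = 0" using quot.coordinate_nonzero by blast
      then have "imco v (x n) = - imco v c" by (simp add: imco_add eq_neg_iff_add_eq_0)
      moreover have "imco v c \<in> quotient v" unfolding quotient_def using c(1) by blast
      ultimately have "imco v (x n) \<in> quotient v" using quot.uminus by simp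
      moreover have "imco v (x n) = (1 / real (n + n0 + 1)) *\<^sub>R y" unfolding x_def imco_scaleR a(2) ..
      moreover have "norm ((1 / real (n + n0 + 1)) *\<^sub>R y) < d"
      proof -
        have "norm y < d * real n0" using n0 d(1) by (simp add: field_simps)
        also have "\<dots> \<le> d * real (n + n0 + 1)" using d(1) by (intro mult_left_mono) auto
        finally show ?thesis by (simp add: field_simps)
      qed
      ultimately have "(1 / real (n + n0 + 1)) *\<^sub>R y = 0" using d(2) by metis
      then show False using y0 by simp
    qed
    then have "flat_min ?S > 0" using fm c(2) norm_Kbar_nonneg by (metis order_le_less)
    then have "e \<le> flat_min ?S" using neg S by force
    moreover have "x n \<in> ?S" using flatset_mem[of "x n" v 0] by simp
    ultimately show ?thesis using flat_min_le[OF S] by (simp add: level_iff) (meson order_trans)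
  qed
  moreover have "x \<longlonglongrightarrow> 0"
  proof -
    have "(\<lambda>n. 1 / real (n + n0 + 1)) \<longlonglongrightarrow> 0"
      using LIMSEQ_ignore_initial_segment[OF LIMSEQ_inverse_real_of_nat, of n0] by (simp add: inverse_eq_divide add.commute add.left_commute)
    from tendsto_scaleR[OF this tendsto_const[of a]] show ?thesis by (simp add: x_def[abs_def])
  qed
  ultimately have "0 \<in> level e" using closed_sequentially[OF invariantD(1)[OF level_invariant]] by blast
  then show False using zero_notin_level[OF e] by blast
qed

end


section \<open>The order type of the spectrum\<close>

text \<open>Every nonempty subset of \<open>A\<close> has a maximum, so taking the largest remaining
  element again and again lists a decreasing sequence. It must tend to \<open>c\<close>, and
  therefore misses nothing. The indices start at 1.\<close>

lemma decreasing_enumeration: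
  fixes A :: "real set" and c :: real
  assumes lb: "\<And>a. a \<in> A \<Longrightarrow> c < a" and fin: "\<And>d. d > 0 \<Longrightarrow> finite {a\<in>A. c + d \<le> a}"
    and app: "\<And>d. d > 0 \<Longrightarrow> \<exists>a\<in>A. a < c + d"
  shows "\<exists>f::nat \<Rightarrow> real. (\<forall>k\<ge>1. f k > f (Suc k)) \<and> f \<longlonglongrightarrow> c \<and> f ` {1..} = A"
proof -
  have mx: "\<exists>m\<in>B. \<forall>b\<in>B. b \<le> m" if B: "B \<subseteq> A" "B \<noteq> {}" for B
  proof -
    obtain b where b: "b \<in> B" using B(2) by blast
    let ?T = "{x\<in>B. b \<le> x}"
    have "b - c > 0" using lb b B(1) by force
    then have "finite {a\<in>A. b \<le> a}" using fin[of "b - c"] by simp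
    then have T: "finite ?T" using B(1) by (elim finite_subset[rotated]) auto
    have m: "Max ?T \<in> ?T" using T b by (intro Max_in) auto
    have "x \<le> Max ?T" if "x \<in> B" for x
      using Max_ge[OF T, of x] m that by (cases "b \<le> x") auto
    then show ?thesis using m by blast
  qed
  define M where "M B = (SOME m. m \<in> B \<and> (\<forall>b\<in>B. b \<le> m))" for B :: "real set"
  have M: "M B \<in> B \<and> (\<forall>b\<in>B. b \<le> M B)" if "B \<subseteq> A" "B \<noteq> {}" for B
    unfolding M_def by (rule someI_ex) (use mx[OF that] in blast)
  define g where "g = rec_nat (M A) (\<lambda>_ x. M {a\<in>A. a < x})"
  have g0: "g 0 = M A" and gS: "g (Suc n) = M {a\<in>A. a < g n}" for n by (simp_all add: g_def)
  have A: "A \<noteq> {}" using app[of 1] by auto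
  have below: "{a\<in>A. a < x} \<noteq> {}" if "x \<in> A" for x
    using app[of "x - c"] lb[OF that] by force
  have gA: "g n \<in> A" for n
  proof (induction n)
    case 0 then show ?case using M[of A] A g0 by simp
  next
    case (Suc n) then show ?case using M[of "{a\<in>A. a < g n}"] below gS by auto
  qed
  have dec: "g (Suc n) < g n" and nxt: "a \<in> A \<Longrightarrow> a < g n \<Longrightarrow> a \<le> g (Suc n)" for n a
    using M[of "{a\<in>A. a < g n}"] below[OF gA] gS[of n] by auto
  have lt: "g n < g m" if "m < n" for m n
    using lift_Suc_mono_less[of "\<lambda>n. - g n" m n] dec that by simp
  have le: "g n \<le> g m" if "m \<le> n" for m n using lt[of m n] that by (cases "m = n") auto
  have inj: "inj g" by (rule injI) (metis lt linorder_neqE_nat less_irrefl)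
  have small: "\<exists>n. g n < c + d" if d: "d > 0" for d
  proof (rule ccontr)
    assume "\<not> ?thesis"
    then have "range g \<subseteq> {a\<in>A. c + d \<le> a}" using gA by (auto simp: not_less)
    then have "finite (range g)" using fin[OF d] finite_subset by blast
    then show False using inj finite_imageD by blast
  qed
  have lim: "g \<longlonglongrightarrow> c"
  proof (rule LIMSEQ_I)
    fix d :: real assume "d > 0"
    then obtain n0 where "g n0 < c + d" using small by blast
    then have "norm (g n - c) < d" if "n \<ge> n0" for n using le[OF that] lb[OF gA[of n]] by simp
    then show "\<exists>n0. \<forall>n\<ge>n0. norm (g n - c) < d" by blast
  qed
  have onto: "a \<in> range g" if a: "a \<in> A" for a
  proof (rule ccontr)
    assume na: "a \<notin> range g"
    have "a < g n" for n
    proof (induction n)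
      case 0
      have "a \<le> g 0" using M[of A] A a g0 by simp
      then show ?case using na by (metis order_le_less rangeI)
    next
      case (Suc n)
      then show ?case using nxt[OF a Suc] na by (metis order_le_less rangeI)
    qed
    moreover obtain n where "g n < c + (a - c)" using small[of "a - c"] lb[OF a] by auto
    ultimately show False by (metis add.commute diff_add_cancel less_asym)
  qed
  let ?f = "\<lambda>k. g (k - 1)"
  have "?f ` {1..} = A"
  proof
    show "?f ` {1..} \<subseteq> A" using gA by auto
    show "A \<subseteq> ?f ` {1..}"
    proof
      fix a assume "a \<in> A"
      then obtain n where "a = g n" using onto by blast
      then show "a \<in> ?f ` {1..}" by (intro image_eqI[of _ _ "Suc n"]) auto
    qed
  qed
  moreover have "?f \<longlonglongrightarrow> c"
    by (rule LIMSEQ_offset[of _ 1]) (use lim in simp)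
  moreover have "?f k > ?f (Suc k)" if "k \<ge> 1" for k using dec[of "k - 1"] that by simp
  ultimately show ?thesis by (intro exI[of _ ?f]) blast
qed

context cm_lattice
begin

text \<open>A point with positive value that is not torsion lies on a flat whose minimum is that
  value, and the minimum is attained at a torsion point. This gives the equality of the two
  spectra.\<close>

lemma emin_torsion_values: "\<exists>y. torsion y \<and> emin y = emin x"
proof (cases "torsion x \<or> emin x = 0")
  case True
  then show ?thesis using emin_0 torsion_lattice[OF zero] by metis
next
  case False
  then have "emin x > 0" using emin_nonneg[of x] by simp
  from level_cases[OF this] False obtain S where S: "S \<in> flats" "x \<in> S" "flat_min S \<ge> emin x" by blast
  have "flat_min S = emin x" using flat_min_le[OF S(1,2)] S(3) by simp
  then show ?thesis using flat_minimum(1)[OF S(1)] by metis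
qed

text \<open>The \<open>\<nu> n\<close> enumerate the positive minima of flats. Values in the gap
  between two consecutive ones come from finitely many classes as long as they stay away from the
  lower end (\<open>level_cases\<close>), and they accumulate there
  (\<open>flat_approached\<close>). So every gap is again listed by a decreasing sequence.\<close>

theorem spectrum_structure:
  "\<exists>(S :: nat \<Rightarrow> real set) (\<nu> :: nat \<Rightarrow> real) (\<mu> :: nat \<Rightarrow> nat \<Rightarrow> real).
      range emin = {0} \<union> (\<Union>n\<in>{1..}. S n) \<and>
      (\<forall>n\<ge>1. 0 \<notin> S n) \<and>
      disjoint_family_on S {1..} \<and>
      (\<forall>n\<ge>1. S n = {\<nu> n} \<union> \<mu> n ` {1..}) \<and>
      (\<forall>n\<ge>1. \<forall>k\<ge>1. \<mu> n k > \<mu> n (Suc k)) \<and>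
      (\<forall>n\<ge>1. \<mu> n \<longlonglongrightarrow> \<nu> n) \<and>
      \<nu> \<longlonglongrightarrow> 0 \<and>
      (\<forall>n\<ge>1. \<nu> n > \<mu> (Suc n) 1) \<and>
      (\<forall>n\<ge>1. \<forall>k\<ge>1. \<exists>F. finite F \<and> (\<forall>x. emin x = \<mu> n k \<longrightarrow> torsion x \<and> (\<exists>y\<in>F. x - y \<in> L))) \<and>
      (\<forall>n\<ge>1. (\<exists>F. finite F \<and> (\<forall>x. torsion x \<longrightarrow> emin x = \<nu> n \<longrightarrow> (\<exists>y\<in>F. x - y \<in> L))) \<and>
        (\<exists>x. torsion x \<and> emin x = \<nu> n) \<and>
        (\<exists>\<S>. finite \<S> \<and> \<S> \<subseteq> flats \<and> (\<forall>x. \<not> torsion x \<longrightarrow> (emin x = \<nu> n \<longleftrightarrow> x \<in> \<Union>\<S>))))"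
proof -
  define N where "N = {t \<in> flat_min ` flats. t > 0}"
  have "\<exists>\<nu>::nat \<Rightarrow> real. (\<forall>k\<ge>1. \<nu> k > \<nu> (Suc k)) \<and> \<nu> \<longlonglongrightarrow> 0 \<and> \<nu> ` {1..} = N"
  proof (rule decreasing_enumeration)
    show "0 < a" if "a \<in> N" for a using that by (simp add: N_def)
    show "finite {a\<in>N. 0 + d \<le> a}" if d: "d > 0" for d
      by (rule finite_subset[OF _ finite_imageI[OF finite_flats_above[OF d], of flat_min]]) (auto simp: N_def)
    show "\<exists>a\<in>N. a < 0 + d" if d: "d > 0" for d
      using flat_small[OF d] by (auto simp: N_def)
  qed
  then obtain \<nu> :: "nat \<Rightarrow> real" where \<nu>: "\<And>k. k \<ge> 1 \<Longrightarrow> \<nu> k > \<nu> (Suc k)" "\<nu> \<longlonglongrightarrow> 0" "\<nu> ` {1..} = N" by blast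
  have \<nu>N: "\<nu> n \<in> N" if "n \<ge> 1" for n using \<nu>(3) that by auto
  have \<nu>pos: "\<nu> n > 0" if "n \<ge> 1" for n using \<nu>N[OF that] by (simp add: N_def)
  have \<nu>le: "\<nu> n \<le> \<nu> m" if "1 \<le> m" "m \<le> n" for m n
    using that(2)
  proof (induction n rule: dec_induct)
    case (step n)
    then show ?case using \<nu>(1)[of n] that(1) by simp
  qed simp
  \<comment> \<open>The values in the open gap above \<open>\<nu> n\<close>; the topmost gap,
    \<open>n = 1\<close>, has no upper end.\<close>
  define A where "A n = {t \<in> range emin. \<nu> n < t \<and> (n = 1 \<or> t < \<nu> (n - 1))}" for n
  have gap: "\<nu> m \<le> \<nu> n \<or> (n \<noteq> 1 \<and> \<nu> (n - 1) \<le> \<nu> m)" if mn: "m \<ge> 1" "n \<ge> 1" for m n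
  proof (cases "n \<le> m")
    case True then show ?thesis using \<nu>le[OF mn(2)] by blast
  next
    case False
    then have "\<nu> (n - 1) \<le> \<nu> m" using \<nu>le[OF mn(1), of "n - 1"] by simp
    then show ?thesis using False mn by auto
  qed
  have "\<exists>f::nat \<Rightarrow> real. (\<forall>k\<ge>1. f k > f (Suc k)) \<and> f \<longlonglongrightarrow> \<nu> n \<and> f ` {1..} = A n" if n: "n \<ge> 1" for n
  proof (rule decreasing_enumeration)
    show "\<nu> n < a" if "a \<in> A n" for a using that by (simp add: A_def)
  next
    fix d :: real assume d: "d > 0"
    have e: "\<nu> n + d > 0" using \<nu>pos[OF n] d by simp
    obtain F where F: "finite F" "\<And>x. emin x \<ge> \<nu> n + d \<Longrightarrow> (\<exists>S\<in>flats. x \<in> S \<and> flat_min S \<ge> \<nu> n + d) \<or> (torsion x \<and> (\<exists>y\<in>F. x - y \<in> L))"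
      using level_cases[OF e] by blast
    have "{a\<in>A n. \<nu> n + d \<le> a} \<subseteq> emin ` F"
    proof
      fix a assume "a \<in> {a\<in>A n. \<nu> n + d \<le> a}"
      then obtain x where x: "a = emin x" "\<nu> n + d \<le> emin x" "n = 1 \<or> emin x < \<nu> (n - 1)" by (auto simp: A_def)
      have "\<not> (\<exists>S\<in>flats. x \<in> S \<and> flat_min S \<ge> \<nu> n + d)"
      proof
        assume "\<exists>S\<in>flats. x \<in> S \<and> flat_min S \<ge> \<nu> n + d"
        then obtain S where S: "S \<in> flats" "x \<in> S" "flat_min S \<ge> \<nu> n + d" by blast
        then have "flat_min S \<in> N" using e by (auto simp: N_def)
        then obtain m where m: "m \<ge> 1" "flat_min S = \<nu> m" using \<nu>(3) by (metis atLeast_iff imageE)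
        then have "n \<noteq> 1 \<and> \<nu> (n - 1) \<le> flat_min S" using gap[OF m(1) n] S(3) d by auto
        then show False using x(3) flat_min_le[OF S(1,2)] by auto
      qed
      then obtain y where y: "y \<in> F" "x - y \<in> L" using F(2)[OF x(2)] by blast
      have "emin x = emin y" using emin_periodic[OF y(2), of y] by simp
      then show "a \<in> emin ` F" using x(1) y(1) by blast
    qed
    then show "finite {a\<in>A n. \<nu> n + d \<le> a}" using F(1) finite_subset by blast
  next
    fix d :: real assume d: "d > 0"
    obtain S where S: "S \<in> flats" "flat_min S = \<nu> n" using \<nu>N[OF n] by (auto simp: N_def)
    \<comment> \<open>The distance is capped so that the value found does not leave the gap.\<close>
    define d' where "d' = (if n = 1 then d else min d (\<nu> (n - 1) - \<nu> n))"
    have "d' > 0" using d \<nu>(1)[of "n - 1"] n by (auto simp: d'_def)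
    from flat_approached[OF S(1) _ this] S(2) \<nu>pos[OF n] obtain x where x: "\<nu> n < emin x" "emin x < \<nu> n + d'" by auto
    have "emin x < \<nu> n + d" "n = 1 \<or> emin x < \<nu> (n - 1)" using x(2) by (auto simp: d'_def split: if_splits)
    then show "\<exists>a\<in>A n. a < \<nu> n + d" using x(1) by (intro bexI[of _ "emin x"]) (auto simp: A_def)
  qed
  then have "\<forall>n. \<exists>f::nat \<Rightarrow> real. n \<ge> 1 \<longrightarrow> (\<forall>k\<ge>1. f k > f (Suc k)) \<and> f \<longlonglongrightarrow> \<nu> n \<and> f ` {1..} = A n" by blast
  from choice[OF this] obtain \<mu> :: "nat \<Rightarrow> nat \<Rightarrow> real" where
    \<mu>: "\<And>n. n \<ge> 1 \<Longrightarrow> (\<forall>k\<ge>1. \<mu> n k > \<mu> n (Suc k)) \<and> \<mu> n \<longlonglongrightarrow> \<nu> n \<and> \<mu> n ` {1..} = A n" by blast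
  have \<mu>A: "\<mu> n k \<in> A n" if "n \<ge> 1" "k \<ge> 1" for n k using \<mu>[OF that(1)] that(2) by auto
  define S where "S n = {\<nu> n} \<union> \<mu> n ` {1..}" for n
  have SA: "S n = {\<nu> n} \<union> A n" if "n \<ge> 1" for n using \<mu>[OF that] by (simp add: S_def)
  have lowS: "\<nu> n \<le> t" if "n \<ge> 1" "t \<in> S n" for n t using that by (auto simp: SA A_def)
  have highS: "t < \<nu> m" if "1 \<le> m" "m < n" "t \<in> S n" for m n t
  proof -
    have n: "n \<ge> 1" "n \<noteq> 1" using that by auto
    have "t < \<nu> (n - 1)" using that(3) \<nu>(1)[of "n - 1"] n by (auto simp: SA A_def)
    also have "\<dots> \<le> \<nu> m" using \<nu>le[OF that(1), of "n - 1"] that(2) by simp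
    finally show ?thesis .
  qed
  have "range emin = {0} \<union> (\<Union>n\<in>{1..}. S n)"
  proof
    show "range emin \<subseteq> {0} \<union> (\<Union>n\<in>{1..}. S n)"
    proof
      fix t assume t: "t \<in> range emin"
      show "t \<in> {0} \<union> (\<Union>n\<in>{1..}. S n)"
      proof (cases "t = 0")
        case False
        then have tp: "t > 0" using t emin_nonneg by (metis imageE order_le_less)
        have "\<exists>n\<ge>1. \<nu> n \<le> t"
        proof -
          obtain n0 where "\<And>n. n \<ge> n0 \<Longrightarrow> \<bar>\<nu> n\<bar> < t" using LIMSEQ_D[OF \<nu>(2) tp] by auto
          from this[of "n0 + 1"] show ?thesis by (intro exI[of _ "n0 + 1"]) auto
        qed
        then obtain n where n: "n \<ge> 1 \<and> \<nu> n \<le> t" "\<And>m. m < n \<Longrightarrow> \<not> (m \<ge> 1 \<and> \<nu> m \<le> t)"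
          using exists_least_iff[of "\<lambda>n. n \<ge> 1 \<and> \<nu> n \<le> t"] by blast
        have "t \<in> S n" using n(1) n(2)[of "n - 1"] t by (auto simp: SA A_def)
        then show ?thesis using n(1) by auto
      qed simp
    qed
    have "0 \<in> range emin" using emin_0 by (metis rangeI)
    moreover have "\<nu> n \<in> range emin" if n: "n \<ge> 1" for n
    proof -
      obtain T where "T \<in> flats" "flat_min T = \<nu> n" using \<nu>N[OF n] by (auto simp: N_def)
      then show ?thesis using flat_minimum(1)[of T] by (metis rangeI)
    qed
    ultimately show "{0} \<union> (\<Union>n\<in>{1..}. S n) \<subseteq> range emin" by (auto simp: SA A_def)
  qed
  moreover have "0 \<notin> S n" if "n \<ge> 1" for n using lowS[OF that, of 0] \<nu>pos[OF that] by auto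
  moreover have "disjoint_family_on S {1..}"
    unfolding disjoint_family_on_def
  proof (intro ballI impI)
    have *: "S m \<inter> S n = {}" if "1 \<le> m" "m < n" for m n
      using highS[OF that] lowS[OF that(1)] by force
    fix m n :: nat assume "m \<in> {1..}" "n \<in> {1..}" "m \<noteq> n"
    then show "S m \<inter> S n = {}" using *[of m n] *[of n m] by (cases "m < n") auto
  qed
  moreover have "\<nu> n > \<mu> (Suc n) 1" if "n \<ge> 1" for n
    using \<mu>A[of "Suc n" 1] that by (simp add: A_def)
  moreover have "\<exists>F. finite F \<and> (\<forall>x. emin x = \<mu> n k \<longrightarrow> torsion x \<and> (\<exists>y\<in>F. x - y \<in> L))" if nk: "n \<ge> 1" "k \<ge> 1" for n k
  proof -
    let ?t = "\<mu> n k"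
    have t: "\<nu> n < ?t" "n = 1 \<or> ?t < \<nu> (n - 1)" using \<mu>A[OF nk] by (auto simp: A_def)
    then have tp: "?t > 0" using \<nu>pos[OF nk(1)] by linarith
    obtain F where F: "finite F" "\<And>x. emin x \<ge> ?t \<Longrightarrow> (\<exists>S\<in>flats. x \<in> S \<and> flat_min S \<ge> ?t) \<or> (torsion x \<and> (\<exists>y\<in>F. x - y \<in> L))"
      using level_cases[OF tp] by blast
    have none: "\<not> (\<exists>S\<in>flats. x \<in> S \<and> flat_min S \<ge> ?t)" if x: "emin x = ?t" for x
    proof
      assume "\<exists>S\<in>flats. x \<in> S \<and> flat_min S \<ge> ?t"
      then obtain T where T: "T \<in> flats" "x \<in> T" "flat_min T \<ge> ?t" by blast
      then have "flat_min T = ?t" using flat_min_le[OF T(1,2)] x by simp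
      then have "?t \<in> N" using T(1) tp by (force simp: N_def)
      then obtain m where m: "m \<ge> 1" "?t = \<nu> m" using \<nu>(3) by (metis atLeast_iff imageE)
      then show False using gap[OF m(1) nk(1)] t by auto
    qed
    then have "torsion x \<and> (\<exists>y\<in>F. x - y \<in> L)" if "emin x = ?t" for x
      using F(2)[of x] none[OF that] that by (metis order_refl)
    then show ?thesis using F(1) by blast
  qed
  moreover have "(\<exists>F. finite F \<and> (\<forall>x. torsion x \<longrightarrow> emin x = \<nu> n \<longrightarrow> (\<exists>y\<in>F. x - y \<in> L))) \<and>
        (\<exists>x. torsion x \<and> emin x = \<nu> n) \<and>
        (\<exists>\<S>. finite \<S> \<and> \<S> \<subseteq> flats \<and> (\<forall>x. \<not> torsion x \<longrightarrow> (emin x = \<nu> n \<longleftrightarrow> x \<in> \<Union>\<S>)))" if n: "n \<ge> 1" for n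
  proof -
    define \<S> where "\<S> = {S\<in>flats. flat_min S = \<nu> n}"
    have fin: "finite \<S>" by (rule finite_subset[OF _ finite_flats_above[OF \<nu>pos[OF n]]]) (auto simp: \<S>_def)
    obtain F where F: "finite F" "\<And>x. emin x \<ge> \<nu> n \<Longrightarrow> (\<exists>S\<in>flats. x \<in> S \<and> flat_min S \<ge> \<nu> n) \<or> (torsion x \<and> (\<exists>y\<in>F. x - y \<in> L))"
      using level_cases[OF \<nu>pos[OF n]] by blast
    have cases: "x \<in> \<Union>\<S> \<or> (torsion x \<and> (\<exists>y\<in>F. x - y \<in> L))" if x: "emin x = \<nu> n" for x
    proof -
      have "S \<in> \<S>" if S: "S \<in> flats" "x \<in> S" "flat_min S \<ge> \<nu> n" for S
        using flat_min_le[OF S(1,2)] x S by (simp add: \<S>_def)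
      then show ?thesis using F(2)[of x] x by auto
    qed
    have "\<forall>S. \<exists>E. S \<in> \<S> \<longrightarrow> finite E \<and> (\<forall>x\<in>S. torsion x \<longrightarrow> emin x = \<nu> n \<longrightarrow> (\<exists>y\<in>E. x - y \<in> L))"
      using flat_minimum(2) \<nu>pos[OF n] unfolding \<S>_def mem_Collect_eq by metis
    from choice[OF this] obtain E where E: "\<And>S. S \<in> \<S> \<Longrightarrow> finite (E S)" "\<And>S x. S \<in> \<S> \<Longrightarrow> x \<in> S \<Longrightarrow> torsion x \<Longrightarrow> emin x = \<nu> n \<Longrightarrow> \<exists>y\<in>E S. x - y \<in> L"
      by blast
    have "finite (F \<union> (\<Union>S\<in>\<S>. E S))" using F(1) fin E(1) by blast
    moreover have "\<exists>y\<in>F \<union> (\<Union>S\<in>\<S>. E S). x - y \<in> L" if "torsion x" "emin x = \<nu> n" for x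
      using cases[OF that(2)] E(2) that by blast
    moreover have "\<exists>x. torsion x \<and> emin x = \<nu> n"
    proof -
      obtain T where "T \<in> flats" "flat_min T = \<nu> n" using \<nu>N[OF n] by (auto simp: N_def)
      then show ?thesis using flat_minimum(1)[of T] by metis
    qed
    moreover have "emin x = \<nu> n \<longleftrightarrow> x \<in> \<Union>\<S>" if "\<not> torsion x" for x
      using cases[of x] that flat_min_nontorsion by (auto simp: \<S>_def)
    moreover have "\<S> \<subseteq> flats" by (auto simp: \<S>_def)
    ultimately show ?thesis using fin by blast
  qed
  ultimately show ?thesis using \<mu> \<nu>(2)
    by (intro exI[of _ S] exI[of _ \<nu>] exI[of _ \<mu>] conjI allI impI) (auto simp: S_def)
qed

end


section \<open>Algebraic integers\<close>

interpretation int_mod: module "\<lambda>(k::int) (x::'a::field_char_0). of_int k * x"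
  by unfold_locales (auto simp: algebra_simps)

abbreviation int_span :: "'a::field_char_0 set \<Rightarrow> 'a set" where
  "int_span \<equiv> int_mod.span"

text \<open>The coefficients of the new generator \<open>g\<close> that occur in \<open>S\<close>
  form an ideal of the integers. An element of \<open>S\<close> realizing its positive generator,
  together with generators of the part of \<open>S\<close> without \<open>g\<close>,
  suffices.\<close>

lemma int_subgroup_generated:
  assumes "finite B" "int_mod.subspace S" "S \<subseteq> int_span B"
  shows "\<exists>H. finite H \<and> H \<subseteq> S \<and> S \<subseteq> int_span H"
  using assms
proof (induction B arbitrary: S rule: finite_induct)
  case empty
  then show ?case by (intro exI[of _ "{}"]) auto
next
  case (insert g B)
  note S = insert.prems(1)
  let ?S0 = "S \<inter> int_span B"
  have "int_mod.subspace ?S0" using S int_mod.subspace_inter int_mod.subspace_span by blast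
  then obtain H0 where H0: "finite H0" "H0 \<subseteq> ?S0" "?S0 \<subseteq> int_span H0" using insert.IH[of ?S0] by blast
  define T where "T = {k::int. \<exists>s\<in>S. s - of_int k * g \<in> int_span B}"
  have rep: "\<exists>k\<in>T. s - of_int k * g \<in> int_span B" if sS: "s \<in> S" for s
  proof -
    obtain k where "s - of_int k * g \<in> int_span B"
      using subsetD[OF insert.prems(2) sS] unfolding int_mod.span_insert by blast
    then show ?thesis using sS unfolding T_def by blast
  qed
  show ?case
  proof (cases "T \<subseteq> {0}")
    case True
    have "S \<subseteq> int_span B" using rep True by fastforce
    then show ?thesis using H0 by (intro exI[of _ H0]) auto
  next
    case False
    then obtain k0 where k0: "k0 \<in> T" "k0 \<noteq> 0" by blast
    have neg: "- k \<in> T" if kT: "k \<in> T" for k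
    proof -
      obtain s where s: "s \<in> S" "s - of_int k * g \<in> int_span B" using kT unfolding T_def by blast
      have "- s - of_int (- k) * g \<in> int_span B" using int_mod.span_neg[OF s(2)] by simp
      then show ?thesis using int_mod.subspace_neg[OF S s(1)] unfolding T_def by blast
    qed
    have "\<exists>n::nat. n > 0 \<and> int n \<in> T"
    proof (cases "k0 > 0")
      case True then show ?thesis using k0 by (intro exI[of _ "nat k0"]) auto
    next
      case False then show ?thesis using k0 neg[OF k0(1)] by (intro exI[of _ "nat (- k0)"]) auto
    qed
    then obtain n :: nat where n: "n > 0 \<and> int n \<in> T" "\<And>m. m < n \<Longrightarrow> \<not> (m > 0 \<and> int m \<in> T)"
      using exists_least_iff[of "\<lambda>n::nat. n > 0 \<and> int n \<in> T"] by blast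
    obtain h where h: "h \<in> S" "h - of_int (int n) * g \<in> int_span B" using n(1) unfolding T_def by blast
    have "s \<in> int_span (insert h H0)" if s: "s \<in> S" for s
    proof -
      obtain k where k: "s - of_int k * g \<in> int_span B" using rep[OF s] by blast
      define m where "m = k div int n"
      let ?s = "s - of_int m * h"
      have sS: "?s \<in> S" using int_mod.subspace_diff[OF S s int_mod.subspace_scale[OF S h(1)]] by simp
      have "?s - of_int (k mod int n) * g = (s - of_int k * g) - of_int m * (h - of_int (int n) * g)"
      proof -
        have "k = m * int n + k mod int n" by (simp add: m_def)
        then have "of_int k = (of_int m * of_int (int n) + of_int (k mod int n) :: 'a)"
          by (metis of_int_add of_int_mult)
        then show ?thesis by (simp add: algebra_simps)
      qed
      then have B: "?s - of_int (k mod int n) * g \<in> int_span B"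
        using int_mod.span_diff[OF k int_mod.span_scale[OF h(2)], of m] by (simp only:)
      then have "k mod int n \<in> T" unfolding T_def using sS by blast
      moreover have "\<not> (0 < k mod int n \<and> k mod int n \<in> T \<and> k mod int n < int n)"
        using n(2)[of "nat (k mod int n)"] by (auto simp: nat_less_iff)
      ultimately have "k mod int n = 0"
        using n(1) pos_mod_bound[of "int n" k] pos_mod_sign[of "int n" k] by linarith
      then have "?s \<in> ?S0" using B sS by simp
      then have "?s \<in> int_span H0" using H0(3) by blast
      then show ?thesis by (auto simp: int_mod.span_insert)
    qed
    then show ?thesis using H0 h(1) by (intro exI[of _ "insert h H0"]) auto
  qed
qed

lemma poly_of_int_add: "poly (map_poly of_int (p + q)) x = poly (map_poly of_int p) x + poly (map_poly of_int q) (x::'a::field_char_0)"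
proof -
  have "map_poly of_int (p + q) = map_poly of_int p + (map_poly of_int q :: 'a poly)"
    by (rule poly_eqI) (simp add: coeff_map_poly)
  then show ?thesis by simp
qed

lemma poly_of_int_monom: "poly (map_poly of_int (monom c k)) x = of_int c * (x::'a::field_char_0) ^ k"
  by (simp add: map_poly_monom poly_monom)

lemma int_span_powers:
  assumes "y \<in> int_span ((\<lambda>k. x ^ k) ` {..<D})"
  shows "\<exists>p. (p = 0 \<or> degree p < D) \<and> y = poly (map_poly of_int p) x"
  using assms
proof (induction rule: int_mod.span_induct_alt)
  case base
  show ?case by (intro exI[of _ 0]) auto
next
  case (step c z y)
  then obtain k p where k: "k < D" "z = x ^ k" and p: "p = 0 \<or> degree p < D" "y = poly (map_poly of_int p) x" by blast
  let ?p = "monom c k + p"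
  have "?p = 0 \<or> degree ?p < D"
    using degree_add_le_max[of "monom c k" p] degree_monom_le[of c k] k(1) p(1) by fastforce
  moreover have "of_int c * z + y = poly (map_poly of_int ?p) x"
    by (simp add: k(2) p(2) poly_of_int_add poly_of_int_monom)
  ultimately show ?case by blast
qed

lemma int_span_mult:
  assumes x: "\<And>b. b \<in> B \<Longrightarrow> x * b \<in> int_span B" and "y \<in> int_span B"
  shows "x * y \<in> int_span B"
  using assms(2)
proof (induction rule: int_mod.span_induct_alt)
  case base then show ?case by (simp add: int_mod.span_zero)
next
  case (step c b y)
  have "of_int c * (x * b) + x * y \<in> int_span B"
    by (intro int_mod.span_add int_mod.span_scale x step)
  then show ?case by (simp add: algebra_simps)
qed

lemma int_span_powers_mult:
  assumes a: "a ^ d \<in> int_span ((\<lambda>k. a ^ k) ` {..<d})" and x: "x \<in> {a ^ i * y |i y. i < d \<and> y \<in> Y}"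
  shows "a * x \<in> int_span {a ^ i * y |i y. i < d \<and> y \<in> Y}" (is "_ \<in> int_span ?B")
proof -
  have B: "z * y \<in> int_span ?B" if "z \<in> int_span ((\<lambda>k. a ^ k) ` {..<d})" "y \<in> Y" for z y
    using that(1)
  proof (induction rule: int_mod.span_induct_alt)
    case base then show ?case by (simp add: int_mod.span_zero)
  next
    case (step c z w)
    then have "of_int c * (z * y) + w * y \<in> int_span ?B"
      using that(2) by (intro int_mod.span_add int_mod.span_scale) (auto intro: int_mod.span_base)
    then show ?case by (simp add: algebra_simps)
  qed
  obtain i y where iy: "i < d" "y \<in> Y" "x = a ^ i * y" using x by blast
  have "a ^ Suc i \<in> int_span ((\<lambda>k. a ^ k) ` {..<d})"
  proof (cases "Suc i = d")
    case True show ?thesis unfolding True by (rule a)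
  next
    case False then show ?thesis using iy(1) by (intro int_mod.span_base imageI) auto
  qed
  from B[OF this iy(2)] show ?thesis by (simp add: iy(3) mult.assoc)
qed

text \<open>The ring generated by \<open>x\<close> is a subgroup of a finitely generated group,
  hence spanned by finitely many polynomials in \<open>x\<close>. If their degrees are below
  \<open>M\<close>, then \<open>x ^ M\<close> is an integer combination of lower powers, which is a
  monic equation.\<close>

lemma algebraic_int_finite_module:
  assumes B: "finite B" "1 \<in> int_span B" and x: "\<And>b. b \<in> B \<Longrightarrow> x * b \<in> int_span B"
  shows "algebraic_int x"
proof -
  have pow: "x ^ k \<in> int_span B" for k by (induction k) (auto simp: B(2) int_span_mult[OF x])
  let ?S = "int_span (range (\<lambda>k. x ^ k))"
  have "?S \<subseteq> int_span B" using pow by (intro int_mod.span_minimal int_mod.subspace_span) auto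
  then obtain H where H: "finite H" "H \<subseteq> ?S" "?S \<subseteq> int_span H"
    using int_subgroup_generated[OF B(1) int_mod.subspace_span \<open>?S \<subseteq> int_span B\<close>] by blast
  have mono: "int_span ((\<lambda>k. x ^ k) ` {..<m}) \<subseteq> int_span ((\<lambda>k. x ^ k) ` {..<n})" if "m \<le> n" for m n
    using that by (intro int_mod.span_mono) auto
  have "\<exists>D. h \<in> int_span ((\<lambda>k. x ^ k) ` {..<D})" if "h \<in> ?S" for h
    using that
  proof (induction rule: int_mod.span_induct_alt)
    case base then show ?case by (auto intro: int_mod.span_zero)
  next
    case (step c z y)
    then obtain k D where k: "z = x ^ k" "y \<in> int_span ((\<lambda>k. x ^ k) ` {..<D})" by blast
    have "z \<in> int_span ((\<lambda>k. x ^ k) ` {..<max D (Suc k)})" unfolding k(1) by (rule int_mod.span_base) auto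
    moreover have "y \<in> int_span ((\<lambda>k. x ^ k) ` {..<max D (Suc k)})" using k(2) mono[of D "max D (Suc k)"] by auto
    ultimately show ?case using int_mod.span_add int_mod.span_scale by blast
  qed
  then have "\<forall>h. \<exists>D. h \<in> H \<longrightarrow> h \<in> int_span ((\<lambda>k. x ^ k) ` {..<D})" using H(2) by blast
  from choice[OF this] obtain D where D: "\<And>h. h \<in> H \<Longrightarrow> h \<in> int_span ((\<lambda>k. x ^ k) ` {..<D h})" by blast
  define M where "M = Max (insert 0 (D ` H))"
  have "h \<in> int_span ((\<lambda>k. x ^ k) ` {..<M})" if "h \<in> H" for h
    using D[OF that] mono[of "D h" M] that H(1) by (auto simp: M_def)
  then have "int_span H \<subseteq> int_span ((\<lambda>k. x ^ k) ` {..<M})"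
    by (intro int_mod.span_minimal int_mod.subspace_span) auto
  moreover have "x ^ M \<in> ?S" by (intro int_mod.span_base) auto
  ultimately have "x ^ M \<in> int_span ((\<lambda>k. x ^ k) ` {..<M})" using H(3) by blast
  then obtain p where p: "p = 0 \<or> degree p < M" "x ^ M = poly (map_poly of_int p) x" using int_span_powers by blast
  let ?q = "monom 1 M - p"
  have "coeff ?q M = 1" using p(1) by (auto simp: coeff_eq_0)
  moreover have "degree ?q \<le> M" using degree_diff_le[of "monom 1 M" M p] p(1) by (auto simp: degree_monom_le)
  ultimately have "degree ?q = M" using le_degree[of ?q M] by simp
  then have "lead_coeff ?q = 1" using \<open>coeff ?q M = 1\<close> by simp
  moreover have "poly (map_poly of_int ?q) x = 0" using p(2) poly_of_int_add[of ?q p x]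
    by (simp add: poly_of_int_monom)
  ultimately show ?thesis unfolding algebraic_int_altdef_ipoly by blast
qed

lemma algebraic_int_power_span:
  assumes "algebraic_int a"
  obtains d where "d > 0" "a ^ d \<in> int_span ((\<lambda>k. a ^ k) ` {..<d})"
proof -
  obtain p where p: "poly (map_poly of_int p) a = 0" "lead_coeff p = 1"
    using assms unfolding algebraic_int_altdef_ipoly by blast
  let ?d = "degree p"
  have "?d > 0"
  proof (rule ccontr)
    assume "\<not> ?d > 0"
    then obtain c where "p = [:c:]" using degree_eq_zeroE by blast
    then show False using p by (simp add: map_poly_pCons)
  qed
  have "0 = (\<Sum>k\<le>?d. of_int (coeff p k) * a ^ k)"
    using p(1) by (simp add: poly_altdef degree_map_poly coeff_map_poly)
  also have "\<dots> = (\<Sum>k<?d. of_int (coeff p k) * a ^ k) + a ^ ?d"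
    using p(2) by (simp add: lessThan_Suc_atMost[symmetric])
  finally have "a ^ ?d = - (\<Sum>k<?d. of_int (coeff p k) * a ^ k)" by (simp add: eq_neg_iff_add_eq_0 add.commute)
  also have "\<dots> \<in> int_span ((\<lambda>k. a ^ k) ` {..<?d})"
    by (intro int_mod.span_neg int_mod.span_sum int_mod.span_scale int_mod.span_base) auto
  finally show ?thesis using that \<open>?d > 0\<close> by blast
qed

text \<open>The products \<open>a ^ i * b ^ j\<close> below the degrees of the integral equations
  span a group that multiplication by \<open>a\<close> and by \<open>b\<close> preserves, and so do
  their sum and product.\<close>

lemma algebraic_int_closed:
  fixes a b :: "'a::field_char_0"
  assumes a: "algebraic_int a" and b: "algebraic_int b"
  shows "algebraic_int (a + b)" "algebraic_int (a * b)"
proof -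
  obtain d where d: "d > 0" "a ^ d \<in> int_span ((\<lambda>k. a ^ k) ` {..<d})" using algebraic_int_power_span[OF a] .
  obtain e where e: "e > 0" "b ^ e \<in> int_span ((\<lambda>k. b ^ k) ` {..<e})" using algebraic_int_power_span[OF b] .
  define B where "B = {a ^ i * y |i y. i < d \<and> y \<in> (\<lambda>j. b ^ j) ` {..<e}}"
  have B': "B = {b ^ j * y |j y. j < e \<and> y \<in> (\<lambda>i. a ^ i) ` {..<d}}"
    unfolding B_def using mult.commute by blast
  have "B = (\<lambda>(i, j). a ^ i * b ^ j) ` ({..<d} \<times> {..<e})" by (auto simp: B_def)
  then have fin: "finite B" by simp
  have "a ^ 0 * b ^ 0 \<in> B" using d(1) e(1) unfolding B_def by blast
  then have one: "1 \<in> int_span B" by (intro int_mod.span_base) simp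
  have ma: "a * x \<in> int_span B" if "x \<in> B" for x
    using that unfolding B_def by (rule int_span_powers_mult[OF d(2)])
  have mb: "b * x \<in> int_span B" if "x \<in> B" for x
    using that unfolding B' by (rule int_span_powers_mult[OF e(2)])
  show "algebraic_int (a + b)"
    by (rule algebraic_int_finite_module[OF fin one]) (simp add: distrib_right ma mb int_mod.span_add)
  show "algebraic_int (a * b)"
    by (rule algebraic_int_finite_module[OF fin one]) (simp add: mult.assoc int_span_mult[OF ma] mb)
qed

lemma algebraic_int_diff: "algebraic_int a \<Longrightarrow> algebraic_int b \<Longrightarrow> algebraic_int (a - b)"
  for a b :: "'a::field_char_0"
  using algebraic_int_closed(1)[of a "- b"] by simp

lemma algebraic_int_prod:
  fixes f :: "'b \<Rightarrow> 'a::field_char_0"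
  shows "(\<And>i. i \<in> A \<Longrightarrow> algebraic_int (f i)) \<Longrightarrow> algebraic_int (prod f A)"
  by (induction A rule: infinite_finite_induct) (auto intro: algebraic_int_closed(2) int_imp_algebraic_int)

lemma algebraic_int_power: "algebraic_int a \<Longrightarrow> algebraic_int (a ^ n)" for a :: "'a::field_char_0"
  by (induction n) (auto intro: algebraic_int_closed(2) int_imp_algebraic_int)

lemma algebraic_int_of_int: "algebraic_int (of_int k :: 'a::field_char_0)"
  by (rule int_imp_algebraic_int) auto

text \<open>An integer equation of degree n with leading coefficient \<open>D\<close>, multiplied by
  \<open>D ^ (n - 1)\<close>, becomes an integral equation for \<open>D * x\<close>. A negative
  \<open>D\<close> is replaced by \<open>- D\<close> at the end.\<close>

lemma algebraic_multiple_int: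
  fixes x :: "'a::field_char_0"
  assumes "poly (map_poly of_rat p) x = 0" "p \<noteq> (0 :: rat poly)"
  shows "\<exists>D::int. D > 0 \<and> algebraic_int (of_int D * x)"
proof -
  have "algebraic x"
    using assms by (intro algebraicI'[of "map_poly of_rat p"]) (auto simp: coeff_map_poly poly_eq_iff)
  then obtain q :: "int poly" where q: "q \<noteq> 0" "poly (map_poly of_int q) x = 0" using algebraicE' by blast
  let ?n = "degree q"
  define c where "c = coeff q"
  define D where "D = c ?n"
  have D0: "D \<noteq> 0" using q(1) by (simp add: D_def c_def)
  have n: "?n > 0"
  proof (rule ccontr)
    assume "\<not> ?n > 0"
    then obtain d where "q = [:d:]" using degree_eq_zeroE by blast
    then show False using q by (simp add: map_poly_pCons)
  qed
  have rel: "(\<Sum>i\<le>?n. of_int (c i) * x ^ i) = 0"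
    using q(2) by (simp add: poly_altdef degree_map_poly coeff_map_poly c_def)
  let ?z = "of_int D * x"
  have "algebraic_int ?z"
  proof (rule algebraic_int_finite_module)
    let ?B = "(\<lambda>k. ?z ^ k) ` {..<?n}"
    show "finite ?B" by simp
    show "1 \<in> int_span ?B" using n by (intro int_mod.span_base image_eqI[of _ _ 0]) auto
    fix b assume "b \<in> ?B"
    then obtain i where i: "i < ?n" "b = ?z ^ i" by blast
    have top: "?z ^ ?n \<in> int_span ?B"
    proof -
      have "of_int (c ?n) * x ^ ?n = - (\<Sum>i<?n. of_int (c i) * x ^ i)"
        using rel by (simp add: lessThan_Suc_atMost[symmetric] eq_neg_iff_add_eq_0 add.commute)
      then have "of_int D ^ (?n - 1) * (of_int (c ?n) * x ^ ?n) = - (\<Sum>i<?n. of_int D ^ (?n - 1) * (of_int (c i) * x ^ i))"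
        by (simp add: sum_distrib_left)
      moreover have "of_int D ^ (?n - 1) * (of_int (c ?n) * x ^ ?n) = ?z ^ ?n"
        using power_minus_mult[OF n, of "of_int D :: 'a"] by (simp add: D_def power_mult_distrib mult.assoc[symmetric])
      moreover have "of_int D ^ (?n - 1) * (of_int (c i) * x ^ i) = of_int (c i * D ^ (?n - 1 - i)) * ?z ^ i" if "i < ?n" for i
      proof -
        have "of_int D ^ (?n - 1) = (of_int D ^ (?n - 1 - i) * of_int D ^ i :: 'a)"
          using that by (simp flip: power_add)
        then show ?thesis by (simp add: power_mult_distrib mult_ac)
      qed
      ultimately have "?z ^ ?n = - (\<Sum>i<?n. of_int (c i * D ^ (?n - 1 - i)) * ?z ^ i)"
        by (smt (verit, ccfv_SIG) lessThan_iff sum.cong)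
      also have "\<dots> \<in> int_span ?B"
        by (intro int_mod.span_neg int_mod.span_sum int_mod.span_scale int_mod.span_base) auto
      finally show ?thesis .
    qed
    have "?z * b = ?z ^ Suc i" by (simp only: i(2) power_Suc)
    moreover have "?z ^ Suc i \<in> int_span ?B"
    proof (cases "Suc i = ?n")
      case True
      show ?thesis unfolding True by (rule top)
    next
      case False
      then show ?thesis using i(1) by (intro int_mod.span_base image_eqI[of _ _ "Suc i"]) auto
    qed
    ultimately show "?z * b \<in> int_span ?B" by (simp only:)
  qed
  then have "algebraic_int (of_int (- D) * x)" by (simp add: algebraic_int_minus_iff)
  then show ?thesis using \<open>algebraic_int ?z\<close> D0
    by (cases "D > 0") (auto intro: exI[of _ D] exI[of _ "- D"])
qed


section \<open>Rational polynomials and primitive elements\<close>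

lemma (in vector_space) independent_family:
  fixes n :: nat
  assumes "\<forall>c. (\<Sum>k<n. scale (c k) (v k)) = 0 \<longrightarrow> (\<forall>k<n. c k = 0)"
  shows "inj_on v {..<n}" "independent (v ` {..<n})"
proof -
  have indep: "c k = 0" if "(\<Sum>k<n. scale (c k) (v k)) = 0" "k < n" for c k using assms that by blast
  show inj: "inj_on v {..<n}"
  proof (rule inj_onI, rule ccontr)
    fix i j assume ij: "i \<in> {..<n}" "j \<in> {..<n}" "v i = v j" "i \<noteq> j"
    let ?c = "\<lambda>k. if k = i then 1 else if k = j then - 1 else (0 :: 'a)"
    have "(\<Sum>k<n. scale (?c k) (v k)) = (\<Sum>k\<in>{i, j}. scale (?c k) (v k))"
      using ij(1,2) by (intro sum.mono_neutral_right) auto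
    also have "\<dots> = 0" using ij(3,4) by simp
    finally have "?c i = 0" using ij(1) by (intro indep[of ?c i]) simp_all
    then show False by simp
  qed
  show "independent (v ` {..<n})"
  proof (rule independent_if_scalars_zero)
    fix g x assume "(\<Sum>x\<in>v ` {..<n}. scale (g x) x) = 0" "x \<in> v ` {..<n}"
    then show "g x = 0" using indep[of "\<lambda>k. g (v k)"] by (auto simp: sum.reindex[OF inj])
  qed simp
qed

lemma coeff_sum_monom: "coeff (\<Sum>k<n. monom (c k) k) j = (if j < n then c j else 0)"
  by (simp add: coeff_sum)

lemma degree_sum_monom: "n > 0 \<Longrightarrow> degree (\<Sum>k<n. monom (c k) k) < n"
  by (intro degree_sum_less) (auto intro: le_less_trans[OF degree_monom_le])

definition rpoly :: "rat poly \<Rightarrow> 'a::field_char_0 \<Rightarrow> 'a" where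
  "rpoly p x = poly (map_poly of_rat p) x"

lemma rpoly_pCons: "rpoly (pCons a p) x = of_rat a + x * rpoly p x"
  by (simp add: rpoly_def map_poly_pCons)

lemma rpoly_0 [simp]: "rpoly 0 x = 0"
  by (simp add: rpoly_def)

lemma rpoly_add: "rpoly (p + q) x = rpoly p x + rpoly q x"
proof -
  have "map_poly of_rat (p + q) = map_poly of_rat p + (map_poly of_rat q :: 'a poly)"
    by (rule poly_eqI) (simp add: coeff_map_poly of_rat_add)
  then show ?thesis by (simp add: rpoly_def)
qed

lemma rpoly_smult: "rpoly (smult a p) x = of_rat a * rpoly p x"
proof -
  have "map_poly of_rat (smult a p) = smult (of_rat a) (map_poly of_rat p :: 'a poly)"
    by (rule poly_eqI) (simp add: coeff_map_poly of_rat_mult)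
  then show ?thesis by (simp add: rpoly_def)
qed

lemma rpoly_uminus: "rpoly (- p) x = - rpoly p x"
  using rpoly_smult[of "- 1" p x] by simp

lemma rpoly_diff: "rpoly (p - q) x = rpoly p x - rpoly q x"
  using rpoly_add[of p "- q" x] by (simp add: rpoly_uminus)

lemma rpoly_mult: "rpoly (p * q) x = rpoly p x * rpoly q x"
proof (induction p)
  case 0 show ?case by simp
next
  case (pCons a p)
  then show ?case by (simp add: mult_pCons_left rpoly_add rpoly_smult rpoly_pCons algebra_simps)
qed

lemma rpoly_1 [simp]: "rpoly 1 x = 1"
  by (simp add: one_pCons rpoly_pCons)

lemma rpoly_monom: "rpoly (monom c k) x = of_rat c * x ^ k"
  by (simp add: rpoly_def map_poly_monom poly_monom)

lemma rpoly_sum: "rpoly (sum p A) x = (\<Sum>i\<in>A. rpoly (p i) x)"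
  by (induction A rule: infinite_finite_induct) (simp_all add: rpoly_add)

lemma degree_map_of_rat: "degree (map_poly of_rat p :: 'a::field_char_0 poly) = degree p"
  by (rule degree_map_poly) simp

lemma map_of_rat_eq_0: "map_poly of_rat p = (0 :: 'a::field_char_0 poly) \<longleftrightarrow> p = 0"
  by (auto simp: poly_eq_iff coeff_map_poly)

lemma rpoly_altdef:
  assumes "p = 0 \<or> degree p < n"
  shows "rpoly p x = (\<Sum>k<n. of_rat (coeff p k) * x ^ k)"
proof -
  have "rpoly p x = (\<Sum>k\<le>degree p. of_rat (coeff p k) * x ^ k)"
    by (simp add: rpoly_def poly_altdef degree_map_of_rat coeff_map_poly)
  also have "\<dots> = (\<Sum>k<n. of_rat (coeff p k) * x ^ k)"
  proof (cases "p = 0")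
    case True then show ?thesis by simp
  next
    case False
    then have "degree p < n" using assms by simp
    then show ?thesis by (intro sum.mono_neutral_left) (auto simp: coeff_eq_0)
  qed
  finally show ?thesis .
qed

definition algebraic_elt :: "'a::field_char_0 \<Rightarrow> bool" where
  "algebraic_elt x \<longleftrightarrow> (\<exists>p. p \<noteq> 0 \<and> rpoly p x = 0)"

text \<open>Any generator of the ideal of annihilating polynomials, not normalized to be
  monic.\<close>

definition minimal_poly :: "rat poly \<Rightarrow> 'a::field_char_0 \<Rightarrow> bool" where
  "minimal_poly f x \<longleftrightarrow> f \<noteq> 0 \<and> (\<forall>q. rpoly q x = 0 \<longleftrightarrow> f dvd q)"

lemma minimal_poly_exists:
  assumes "algebraic_elt x"
  obtains f where "minimal_poly f x"
proof -
  let ?P = "\<lambda>n. \<exists>p. p \<noteq> 0 \<and> rpoly p x = 0 \<and> degree p = n"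
  obtain n where n: "?P n" "\<And>m. m < n \<Longrightarrow> \<not> ?P m"
    using assms exists_least_iff[of ?P] unfolding algebraic_elt_def by blast
  then obtain f where f: "f \<noteq> 0" "rpoly f x = 0" "degree f = n" by blast
  have "rpoly q x = 0 \<longleftrightarrow> f dvd q" for q
  proof
    assume "f dvd q" then show "rpoly q x = 0" using f by (auto simp: rpoly_mult elim!: dvdE)
  next
    assume q: "rpoly q x = 0"
    have "rpoly (q mod f) x = 0"
    proof -
      have "rpoly q x = rpoly (q div f) x * rpoly f x + rpoly (q mod f) x"
        by (simp flip: rpoly_mult rpoly_add)
      then show ?thesis using q f(2) by simp
    qed
    then have "q mod f = 0" using n(2)[of "degree (q mod f)"] degree_mod_less'[OF f(1), of q] f(3) by auto
    then show "f dvd q" by auto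
  qed
  then show ?thesis using that f(1) unfolding minimal_poly_def by blast
qed

text \<open>Irreducibility in the form needed: the gcd does not vanish at \<open>x\<close>, so the
  cofactor \<open>e\<close> does and is a multiple of \<open>f\<close>, which makes the gcd a
  unit.\<close>

lemma minimal_poly_coprime:
  assumes f: "minimal_poly f x" and p: "\<not> f dvd p"
  obtains u v where "u * f + v * p = 1"
proof -
  have f0: "f \<noteq> 0" using f by (simp add: minimal_poly_def)
  obtain e where e: "f = gcd f p * e" using gcd_dvd1 by (metis dvdE)
  have "rpoly f x = 0" using f by (simp add: minimal_poly_def)
  then have "rpoly (gcd f p) x * rpoly e x = 0" using e by (metis rpoly_mult)
  moreover have "rpoly (gcd f p) x \<noteq> 0"
    using f p unfolding minimal_poly_def by (metis dvd_trans gcd_dvd2)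
  ultimately have "f dvd e" using f by (simp add: minimal_poly_def)
  then obtain d where "e = f * d" by blast
  then have "f * 1 = f * (gcd f p * d)" using e by (metis mult.left_commute mult_1_right)
  then have "1 = gcd f p * d" using f0 by (metis mult_cancel_left)
  then have "is_unit (gcd f p)" by (metis dvd_triv_left)
  then have "gcd f p = 1" by (simp add: is_unit_gcd)
  moreover obtain u v where "bezout_coefficients f p = (u, v)" by fastforce
  ultimately show ?thesis using that bezout_coefficients[of f p u v] by simp
qed

lemma minimal_poly_degree: "minimal_poly f x \<Longrightarrow> degree f > 0"
proof (rule ccontr)
  assume f: "minimal_poly f x" "\<not> degree f > 0"
  then obtain c where c: "f = [:c:]" using degree_eq_zeroE by blast
  have "rpoly f x = 0" "f \<noteq> 0" using f by (auto simp: minimal_poly_def)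
  then show False by (simp add: c rpoly_pCons)
qed

lemma minimal_poly_separable:
  assumes f: "minimal_poly f x"
  shows "rsquarefree (map_poly of_rat f :: 'a::field_char_0 poly)"
proof -
  have d: "degree f > 0" by (rule minimal_poly_degree[OF f])
  have "pderiv f \<noteq> 0" using d by (simp add: pderiv_eq_0_iff)
  then have "\<not> f dvd pderiv f" using d dvd_imp_degree_le[of f "pderiv f"] by (auto simp: degree_pderiv)
  from minimal_poly_coprime[OF f this] obtain u v where uv: "u * f + v * pderiv f = 1" .
  have "pderiv (map_poly of_rat f) = (map_poly of_rat (pderiv f) :: 'a poly)"
    by (rule poly_eqI) (simp add: coeff_map_poly coeff_pderiv of_rat_mult del: of_nat_Suc)
  then have "\<not> (poly (map_poly of_rat f) a = 0 \<and> poly (pderiv (map_poly of_rat f)) a = 0)" for a :: 'a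
    using arg_cong[OF uv, of "\<lambda>p. rpoly p a"] unfolding rpoly_add rpoly_mult rpoly_1 by (auto simp: rpoly_def)
  then show ?thesis by (simp add: rsquarefree_roots)
qed

lemma minimal_poly_roots:
  assumes f: "minimal_poly f x"
  shows "card {z::complex. rpoly f z = 0} = degree f" "finite {z::complex. rpoly f z = 0}"
proof -
  let ?f = "map_poly of_rat f :: complex poly"
  have f0: "?f \<noteq> 0" using f by (simp add: minimal_poly_def map_of_rat_eq_0)
  then show fin: "finite {z::complex. rpoly f z = 0}" unfolding rpoly_def by (rule poly_roots_finite)
  have "?f = smult (lead_coeff ?f) (\<Prod>z | poly ?f z = 0. [:- z, 1:])"
    using complex_poly_decompose_rsquarefree[OF minimal_poly_separable[OF f]] by simp
  then have "degree ?f = degree (smult (lead_coeff ?f) (\<Prod>z | poly ?f z = 0. [:- z, 1:]))" by (rule arg_cong)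
  also have "\<dots> = (\<Sum>z | poly ?f z = 0. degree [:- z, 1:])"
    using f0 by (simp add: degree_prod_eq_sum_degree)
  finally show "card {z::complex. rpoly f z = 0} = degree f" by (simp add: degree_map_of_rat rpoly_def)
qed

definition ratfield :: "'a::field_char_0 \<Rightarrow> 'a set" where
  "ratfield x = range (\<lambda>p. rpoly p x)"

lemma ratfield_self: "x \<in> ratfield x"
  unfolding ratfield_def by (rule range_eqI[of _ _ "[:0, 1:]"]) (simp add: rpoly_pCons)

lemma ratfield_subfield:
  assumes "algebraic_elt x"
  shows "subfield_set (ratfield x)"
proof -
  obtain f where f: "minimal_poly f x" using minimal_poly_exists[OF assms] .
  have "inverse (rpoly p x) \<in> ratfield x" for p
  proof (cases "rpoly p x = 0")
    case True
    then show ?thesis unfolding ratfield_def by (auto intro!: range_eqI[of _ _ 0])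
  next
    case False
    then have "\<not> f dvd p" using f by (simp add: minimal_poly_def)
    from minimal_poly_coprime[OF f this] obtain u v where uv: "u * f + v * p = 1" .
    have "rpoly f x = 0" using f by (simp add: minimal_poly_def)
    then have "rpoly v x * rpoly p x = 1"
      using arg_cong[OF uv, of "\<lambda>p. rpoly p x"] by (simp add: rpoly_add rpoly_mult)
    then have "inverse (rpoly p x) = rpoly v x" using False by (simp add: field_simps)
    then show ?thesis by (simp add: ratfield_def)
  qed
  moreover have "1 \<in> ratfield x" unfolding ratfield_def by (rule range_eqI[of _ _ 1]) simp
  moreover have "rpoly p x - rpoly q x \<in> ratfield x \<and> rpoly p x * rpoly q x \<in> ratfield x" for p q
    by (simp add: ratfield_def flip: rpoly_diff rpoly_mult)
  ultimately show ?thesis unfolding subfield_set_def ratfield_def by blast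
qed

lemma subfield_setD:
  assumes "subfield_set K"
  shows "0 \<in> K" "1 \<in> K" "x \<in> K \<Longrightarrow> y \<in> K \<Longrightarrow> x - y \<in> K" "x \<in> K \<Longrightarrow> y \<in> K \<Longrightarrow> x + y \<in> K"
    "x \<in> K \<Longrightarrow> y \<in> K \<Longrightarrow> x * y \<in> K" "x \<in> K \<Longrightarrow> - x \<in> K" "x \<in> K \<Longrightarrow> inverse x \<in> K"
    "x \<in> K \<Longrightarrow> y \<in> K \<Longrightarrow> x / y \<in> K"
proof -
  show 1: "1 \<in> K" and d: "\<And>x y. x \<in> K \<Longrightarrow> y \<in> K \<Longrightarrow> x - y \<in> K"
    and m: "\<And>x y. x \<in> K \<Longrightarrow> y \<in> K \<Longrightarrow> x * y \<in> K" and i: "\<And>x. x \<in> K \<Longrightarrow> inverse x \<in> K"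
    using assms by (auto simp: subfield_set_def)
  show 0: "0 \<in> K" using d[OF 1 1] by simp
  show n: "\<And>x. x \<in> K \<Longrightarrow> - x \<in> K" using d[OF 0] by simp
  show "x \<in> K \<Longrightarrow> y \<in> K \<Longrightarrow> x + y \<in> K" using d[OF _ n, of x y] by simp
  show "x \<in> K \<Longrightarrow> y \<in> K \<Longrightarrow> x / y \<in> K" using m[OF _ i, of x y] by (simp add: field_simps)
qed

lemma subfield_set_of_nat: "subfield_set K \<Longrightarrow> of_nat n \<in> K"
  by (induction n) (auto intro: subfield_setD)

lemma subfield_set_of_int: "subfield_set K \<Longrightarrow> of_int n \<in> K"
  using subfield_set_of_nat[of K "nat n"] subfield_setD(6)[OF _ subfield_set_of_nat, of K "nat (- n)"]
  by (cases "n \<ge> 0") auto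

lemma subfield_set_of_rat: "subfield_set K \<Longrightarrow> of_rat q \<in> K"
  by (cases q) (auto simp: of_rat_rat intro!: subfield_setD subfield_set_of_int)

lemma subfield_set_sum: "subfield_set K \<Longrightarrow> (\<And>i. i \<in> A \<Longrightarrow> f i \<in> K) \<Longrightarrow> sum f A \<in> K"
  by (induction A rule: infinite_finite_induct) (auto intro: subfield_setD)

lemma subfield_set_power: "subfield_set K \<Longrightarrow> x \<in> K \<Longrightarrow> x ^ n \<in> K"
  by (induction n) (auto intro: subfield_setD)

lemma subfield_set_rpoly: "subfield_set K \<Longrightarrow> x \<in> K \<Longrightarrow> rpoly p x \<in> K"
  by (induction p) (auto simp: rpoly_pCons intro!: subfield_setD subfield_set_of_rat)

lemma ratfield_subset: "subfield_set K \<Longrightarrow> x \<in> K \<Longrightarrow> ratfield x \<subseteq> K"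
  by (auto simp: ratfield_def intro: subfield_set_rpoly)

definition coeffs_in :: "'a::field_char_0 set \<Rightarrow> 'a poly \<Rightarrow> bool" where
  "coeffs_in S p \<longleftrightarrow> (\<forall>i. coeff p i \<in> S)"

lemma coeffs_in_pCons: "subfield_set S \<Longrightarrow> coeffs_in S (pCons a p) \<longleftrightarrow> a \<in> S \<and> coeffs_in S p"
  unfolding coeffs_in_def by (auto simp: coeff_pCons split: nat.splits)

lemma coeffs_in_diff: "subfield_set S \<Longrightarrow> coeffs_in S p \<Longrightarrow> coeffs_in S q \<Longrightarrow> coeffs_in S (p - q)"
  unfolding coeffs_in_def by (auto intro: subfield_setD)

lemma coeffs_in_add: "subfield_set S \<Longrightarrow> coeffs_in S p \<Longrightarrow> coeffs_in S q \<Longrightarrow> coeffs_in S (p + q)"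
  unfolding coeffs_in_def by (auto intro: subfield_setD)

lemma coeffs_in_smult: "subfield_set S \<Longrightarrow> a \<in> S \<Longrightarrow> coeffs_in S p \<Longrightarrow> coeffs_in S (smult a p)"
  unfolding coeffs_in_def by (auto intro: subfield_setD)

lemma coeffs_in_mult: "subfield_set S \<Longrightarrow> coeffs_in S p \<Longrightarrow> coeffs_in S q \<Longrightarrow> coeffs_in S (p * q)"
  unfolding coeffs_in_def by (auto simp: coeff_mult intro!: subfield_setD subfield_set_sum)

lemma coeffs_in_0: "subfield_set S \<Longrightarrow> coeffs_in S 0"
  unfolding coeffs_in_def by (auto intro: subfield_setD)

lemma coeffs_in_mod:
  assumes S: "subfield_set S" and m: "coeffs_in S m" "m \<noteq> 0"
  shows "coeffs_in S p \<Longrightarrow> coeffs_in S (p mod m)"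
proof (induction p)
  case 0 show ?case using coeffs_in_0[OF S] by simp
next
  case (pCons a p)
  then have "coeffs_in S (pCons a (p mod m))" using coeffs_in_pCons[OF S] by blast
  then show ?case unfolding mod_pCons[OF m(2)]
    using m(1) by (intro coeffs_in_diff coeffs_in_smult S subfield_setD(8)) (auto simp: coeffs_in_def)
qed

lemma coeffs_in_pcompose:
  assumes S: "subfield_set S" and q: "coeffs_in S q"
  shows "coeffs_in S p \<Longrightarrow> coeffs_in S (pcompose p q)"
proof (induction p)
  case 0 show ?case using coeffs_in_0[OF S] by simp
next
  case (pCons a p)
  then show ?case using q S
    by (auto simp: pcompose_pCons coeffs_in_pCons intro!: coeffs_in_add coeffs_in_mult coeffs_in_0)
qed

lemma coeffs_in_of_rat: "subfield_set S \<Longrightarrow> coeffs_in S (map_poly of_rat p)"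
  unfolding coeffs_in_def by (simp add: coeff_map_poly subfield_set_of_rat)

text \<open>The number \<open>c\<close> avoids finitely many quotients, so that
  \<open>\<beta>\<close> is the only common root of \<open>?g\<close> and of \<open>?h\<close>,
  which is \<open>?f\<close> at \<open>\<theta> - c X\<close>. The polynomial \<open>m\<close> of
  least degree over the field of \<open>\<theta>\<close> vanishing at \<open>\<beta>\<close> divides
  both. Since \<open>?g\<close> is separable, \<open>\<beta>\<close> is its only and a simple root,
  so it is linear and its coefficients yield \<open>\<beta>\<close>.\<close>

lemma primitive_element_step:
  fixes \<alpha> \<beta> :: complex
  assumes K: "subfield_set K" "\<And>x. x \<in> K \<Longrightarrow> algebraic_elt x" and ab: "\<alpha> \<in> K" "\<beta> \<in> K"
  obtains \<theta> where "\<theta> \<in> K" "\<alpha> \<in> ratfield \<theta>" "\<beta> \<in> ratfield \<theta>"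
proof -
  obtain f where f: "minimal_poly f \<alpha>" using minimal_poly_exists[OF K(2)[OF ab(1)]] .
  obtain g where g: "minimal_poly g \<beta>" using minimal_poly_exists[OF K(2)[OF ab(2)]] .
  let ?f = "map_poly of_rat f :: complex poly" and ?g = "map_poly of_rat g :: complex poly"
  let ?E = "(\<lambda>(a, b). (a - \<alpha>) / (\<beta> - b)) ` ({z. rpoly f z = 0} \<times> {z. rpoly g z = 0})"
  have "finite ?E" using minimal_poly_roots(2)[OF f] minimal_poly_roots(2)[OF g] by blast
  then have "finite ((of_nat :: nat \<Rightarrow> complex) -` ?E)" by (rule finite_vimageI) (rule inj_of_nat)
  from ex_new_if_finite[OF infinite_UNIV_nat this] obtain c :: nat where c: "of_nat c \<notin> ?E" by (auto simp only: vimage_eq)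
  define \<theta> where "\<theta> = \<alpha> + of_nat c * \<beta>"
  have \<theta>: "\<theta> \<in> K" unfolding \<theta>_def using K(1) ab by (intro subfield_setD subfield_set_of_nat)
  define L where "L = ratfield \<theta>"
  have L: "subfield_set L" unfolding L_def by (rule ratfield_subfield[OF K(2)[OF \<theta>]])
  let ?h = "pcompose ?f [:\<theta>, - of_nat c:]"
  have gL: "coeffs_in L ?g" by (rule coeffs_in_of_rat[OF L])
  have "coeffs_in L [:\<theta>, - of_nat c:]"
    using ratfield_self[of \<theta>] subfield_setD(6)[OF L subfield_set_of_nat[OF L]]
    by (simp add: coeffs_in_pCons[OF L] coeffs_in_0[OF L] flip: L_def)
  then have hL: "coeffs_in L ?h"
    by (intro coeffs_in_pcompose L coeffs_in_of_rat)
  let ?P = "\<lambda>n. \<exists>p. p \<noteq> 0 \<and> coeffs_in L p \<and> poly p \<beta> = 0 \<and> degree p = n"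
  have g0: "?g \<noteq> 0" "poly ?g \<beta> = 0" using g by (auto simp: minimal_poly_def map_of_rat_eq_0 rpoly_def)
  have h0: "poly ?h \<beta> = 0" using f by (auto simp: minimal_poly_def rpoly_def poly_pcompose \<theta>_def)
  have "?P (degree ?g)" using g0 gL by blast
  then obtain n where n: "?P n" "\<And>k. k < n \<Longrightarrow> \<not> ?P k" using exists_least_iff[of ?P] by blast
  then obtain m where m: "m \<noteq> 0" "coeffs_in L m" "poly m \<beta> = 0" "degree m = n" by blast
  have dvd: "m dvd p" if p: "coeffs_in L p" "poly p \<beta> = 0" for p
  proof -
    have "poly (p div m * m + p mod m) \<beta> = 0" using p(2) by (simp only: div_mult_mod_eq)
    then have "poly (p mod m) \<beta> = 0" using m(3) unfolding poly_add poly_mult by simp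
    then have "p mod m = 0"
      using n(2)[of "degree (p mod m)"] degree_mod_less'[OF m(1), of p] m(4) coeffs_in_mod[OF L m(2,1) p(1)] by auto
    then show ?thesis by auto
  qed
  have only: "z = \<beta>" if z: "poly m z = 0" for z
  proof (rule ccontr)
    assume "z \<noteq> \<beta>"
    have "poly ?g z = 0" "poly ?h z = 0"
      using dvd[OF gL g0(2)] dvd[OF hL h0] z by (auto elim!: dvdE)
    then have "rpoly g z = 0" "rpoly f (\<theta> - of_nat c * z) = 0"
      by (auto simp: rpoly_def poly_pcompose mult.commute)
    moreover have "of_nat c = ((\<theta> - of_nat c * z) - \<alpha>) / (\<beta> - z)"
      using \<open>z \<noteq> \<beta>\<close> by (simp add: \<theta>_def field_simps)
    ultimately have "of_nat c \<in> ?E" by (intro image_eqI[of _ _ "(\<theta> - of_nat c * z, z)"]) auto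
    then show False using c by blast
  qed
  obtain m' where m': "m = [:- \<beta>, 1:] * m'" using m(3) by (auto simp: poly_eq_0_iff_dvd elim: dvdE)
  obtain k where k: "?g = m * k" using dvd[OF gL g0(2)] by (rule dvdE)
  have "poly m' \<beta> \<noteq> 0"
  proof
    assume z: "poly m' \<beta> = 0"
    have "?g = [:- \<beta>, 1:] * (m' * k)" using k m' by (simp only: mult.assoc)
    then have "pderiv ?g = pderiv ([:- \<beta>, 1:] * (m' * k))" by (rule arg_cong)
    then have "poly (pderiv ?g) \<beta> = 0" using z by (simp only: pderiv_mult) simp
    then show False using minimal_poly_separable[OF g] g0(2) unfolding rsquarefree_roots by blast
  qed
  then have "\<And>z. poly m' z \<noteq> 0" using only m' by (metis mult_zero_right poly_mult)
  then have "degree m' = 0"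
    using fundamental_theorem_of_algebra[of m'] constant_degree[of m'] by blast
  then obtain d where d: "m' = [:d:]" using degree_eq_zeroE by blast
  have "d \<noteq> 0" using m(1) m' d by auto
  have "m = [:- \<beta> * d, d:]" using m' d by simp
  then have "coeff m 0 = - \<beta> * d" "coeff m 1 = d" by (simp_all add: coeff_pCons)
  then have "\<beta> = - (coeff m 0 / coeff m 1)" using \<open>d \<noteq> 0\<close> by simp
  moreover have "- (coeff m 0 / coeff m 1) \<in> L"
    using m(2) L unfolding coeffs_in_def by (intro subfield_setD) auto
  ultimately have \<beta>: "\<beta> \<in> L" by simp
  have "\<theta> - of_nat c * \<beta> \<in> L"
    using \<beta> L ratfield_self[of \<theta>] by (intro subfield_setD subfield_set_of_nat) (auto simp: L_def)
  then have "\<alpha> \<in> L" by (simp add: \<theta>_def)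
  then show ?thesis using that \<theta> \<beta> by (simp add: L_def)
qed

lemma primitive_element:
  fixes K :: "complex set"
  assumes K: "subfield_set K" "\<And>x. x \<in> K \<Longrightarrow> algebraic_elt x" and "finite B" "B \<subseteq> K"
  shows "\<exists>\<theta>\<in>K. B \<subseteq> ratfield \<theta>"
  using assms(3,4)
proof (induction B rule: finite_induct)
  case empty
  then show ?case using subfield_setD(1)[OF K(1)] by auto
next
  case (insert b B)
  then obtain \<theta> where \<theta>: "\<theta> \<in> K" "B \<subseteq> ratfield \<theta>" by auto
  obtain \<eta> where \<eta>: "\<eta> \<in> K" "\<theta> \<in> ratfield \<eta>" "b \<in> ratfield \<eta>"
    using primitive_element_step[OF K \<theta>(1), of b] insert.prems by blast
  have "ratfield \<theta> \<subseteq> ratfield \<eta>" by (rule ratfield_subset[OF ratfield_subfield[OF K(2)[OF \<eta>(1)]] \<eta>(2)])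
  then show ?case using \<theta> \<eta> by blast
qed


section \<open>Number fields and their embeddings\<close>

interpretation rat_vs: vector_space "\<lambda>(q::rat) (x::'a::field_char_0). of_rat q * x"
  by unfold_locales (auto simp: algebra_simps of_rat_add of_rat_mult)

lemma field_basis_Rats:
  assumes K: "subfield_set K" and B: "field_basis \<rat> K B"
  shows "finite B" "rat_vs.span B = K" "rat_vs.independent B"
proof -
  show fin: "finite B" using B by (simp add: field_basis_def)
  have BK: "B \<subseteq> K" using B by (simp add: field_basis_def)
  have "rat_vs.subspace K"
    using K by (intro rat_vs.subspaceI) (auto intro: subfield_setD subfield_set_of_rat)
  moreover have "x \<in> rat_vs.span B" if x: "x \<in> K" for x
  proof -
    obtain c where c: "c \<in> B \<rightarrow>\<^sub>E \<rat>" "x = (\<Sum>b\<in>B. c b * b)"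
      using B x unfolding field_basis_def by blast
    have "\<exists>q. b \<in> B \<longrightarrow> c b = of_rat q" for b using c(1) by (metis PiE_mem Rats_cases)
    then obtain q where "\<And>b. b \<in> B \<Longrightarrow> c b = of_rat (q b)" by metis
    then have "x = (\<Sum>b\<in>B. of_rat (q b) * b)" using c(2) by simp
    then show ?thesis by (auto intro: rat_vs.span_sum rat_vs.span_scale rat_vs.span_base)
  qed
  ultimately show "rat_vs.span B = K" using rat_vs.span_minimal[OF BK] by blast
  show "rat_vs.independent B"
  proof (rule rat_vs.independent_if_scalars_zero[OF fin])
    fix u b assume u: "(\<Sum>b\<in>B. of_rat (u b) * b) = 0" and b: "b \<in> B"
    let ?c = "restrict (\<lambda>b. of_rat (u b) :: 'a) B" and ?d = "restrict (\<lambda>b. 0 :: 'a) B"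
    have "\<exists>!c. c \<in> B \<rightarrow>\<^sub>E \<rat> \<and> 0 = (\<Sum>b\<in>B. c b * b)"
      using B subfield_setD(1)[OF K] unfolding field_basis_def by blast
    then obtain e where e: "\<And>c. c \<in> B \<rightarrow>\<^sub>E \<rat> \<Longrightarrow> 0 = (\<Sum>b\<in>B. c b * b) \<Longrightarrow> c = e" by blast
    have "?c = ?d" by (rule trans[OF e sym[OF e]]) (use u in auto)
    then have "?c b = ?d b" by (rule fun_cong)
    then show "u b = 0" using b by simp
  qed
qed

lemma field_degree_Rats:
  assumes "number_field K"
  shows "field_degree \<rat> K = rat_vs.dim K"
proof -
  have K: "subfield_set K" using assms by (simp add: number_field_def)
  have "card B = rat_vs.dim K" if B: "field_basis \<rat> K B" for B
    using field_basis_Rats[OF K B] rat_vs.dim_eq_card[of B K] rat_vs.span_span[of B] by metis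
  moreover obtain B where "field_basis \<rat> K B" using assms by (auto simp: number_field_def)
  ultimately show ?thesis unfolding field_degree_def by (intro the_equality) blast+
qed

lemma number_field_algebraic:
  assumes K: "number_field K" and x: "x \<in> K"
  shows "algebraic_elt x"
proof -
  have K': "subfield_set K" using K by (simp add: number_field_def)
  obtain B where "field_basis \<rat> K B" using K by (auto simp: number_field_def)
  note B = field_basis_Rats[OF K' this]
  let ?n = "Suc (card B)"
  show ?thesis
  proof (rule ccontr)
    assume neg: "\<not> ?thesis"
    have indep: "\<forall>c. (\<Sum>k<?n. of_rat (c k) * x ^ k) = 0 \<longrightarrow> (\<forall>k<?n. c k = 0)"
    proof (intro allI impI)
      fix c k assume c: "(\<Sum>k<?n. of_rat (c k) * x ^ k) = 0" and k: "k < ?n"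
      let ?p = "\<Sum>k<?n. monom (c k) k"
      have "rpoly ?p x = 0" using c by (simp only: rpoly_sum rpoly_monom)
      then have "?p = 0" using neg unfolding algebraic_elt_def by blast
      then show "c k = 0" using coeff_sum_monom[of c ?n k] k by (metis coeff_0)
    qed
    let ?S = "(\<lambda>k. x ^ k) ` {..<?n}"
    note family = rat_vs.independent_family[where v = "\<lambda>k. x ^ k", OF indep]
    have "card ?S = ?n" using card_image[OF family(1)] by simp
    moreover have "?S \<subseteq> rat_vs.span B" using B(2) subfield_set_power[OF K' x] by auto
    ultimately show False
      using rat_vs.independent_span_bound[OF B(1) family(2)] by fastforce
  qed
qed

locale field_embedding =
  fixes K :: "'a::field_char_0 set" and \<tau> :: "'a \<Rightarrow> complex"
  assumes K: "subfield_set K" and \<tau>: "complex_embedding K \<tau>"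
begin

lemma emb_1 [simp]: "\<tau> 1 = 1" using \<tau> by (simp add: complex_embedding_def)
lemma emb_add: "x \<in> K \<Longrightarrow> y \<in> K \<Longrightarrow> \<tau> (x + y) = \<tau> x + \<tau> y" using \<tau> by (simp add: complex_embedding_def)
lemma emb_mult: "x \<in> K \<Longrightarrow> y \<in> K \<Longrightarrow> \<tau> (x * y) = \<tau> x * \<tau> y" using \<tau> by (simp add: complex_embedding_def)

lemma emb_0 [simp]: "\<tau> 0 = 0"
  using emb_add[of 0 0] subfield_setD(1)[OF K] by simp

lemma emb_uminus: "x \<in> K \<Longrightarrow> \<tau> (- x) = - \<tau> x"
  using emb_add[of x "- x"] subfield_setD(6)[OF K, of x] by (simp add: eq_neg_iff_add_eq_0 add.commute)

lemma emb_diff: "x \<in> K \<Longrightarrow> y \<in> K \<Longrightarrow> \<tau> (x - y) = \<tau> x - \<tau> y"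
  using emb_add[of x "- y"] subfield_setD(6)[OF K, of y] by (simp add: emb_uminus)

lemma emb_inverse: "x \<in> K \<Longrightarrow> \<tau> (inverse x) = inverse (\<tau> x)"
proof (cases "x = 0")
  case False
  assume x: "x \<in> K"
  have "\<tau> x * \<tau> (inverse x) = 1" using emb_mult[OF x subfield_setD(7)[OF K x]] False by simp
  then show ?thesis by (metis inverse_unique)
qed simp

lemma emb_divide: "x \<in> K \<Longrightarrow> y \<in> K \<Longrightarrow> \<tau> (x / y) = \<tau> x / \<tau> y"
  by (simp add: divide_inverse emb_mult emb_inverse subfield_setD(7)[OF K])

lemma emb_eq_0_iff: "x \<in> K \<Longrightarrow> \<tau> x = 0 \<longleftrightarrow> x = 0"
proof (cases "x = 0")
  case False
  assume x: "x \<in> K"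
  have "\<tau> x * \<tau> (inverse x) = 1" using emb_mult[OF x subfield_setD(7)[OF K x]] False by simp
  then show ?thesis using False by auto
qed simp

lemma emb_eq_iff: "x \<in> K \<Longrightarrow> y \<in> K \<Longrightarrow> \<tau> x = \<tau> y \<longleftrightarrow> x = y"
  using emb_eq_0_iff[of "x - y"] subfield_setD(3)[OF K, of x y] by (simp add: emb_diff)

lemma emb_of_nat: "\<tau> (of_nat n) = of_nat n"
  by (induction n) (auto simp: emb_add K subfield_set_of_nat subfield_setD)

lemma emb_of_int: "\<tau> (of_int n) = of_int n"
  using emb_of_nat[of "nat n"] emb_of_nat[of "nat (- n)"] emb_uminus[OF subfield_set_of_nat[OF K], of "nat (- n)"]
  by (cases "n \<ge> 0") auto

lemma emb_of_rat: "\<tau> (of_rat q) = of_rat q"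
  by (cases q) (simp add: of_rat_rat emb_divide emb_of_int subfield_set_of_int K)

lemma emb_power: "x \<in> K \<Longrightarrow> \<tau> (x ^ n) = \<tau> x ^ n"
  by (induction n) (auto simp: emb_mult subfield_set_power K)

lemma emb_rpoly: "x \<in> K \<Longrightarrow> \<tau> (rpoly p x) = rpoly p (\<tau> x)"
  by (induction p)
    (auto simp: rpoly_pCons emb_add emb_mult emb_of_rat subfield_set_rpoly subfield_set_of_rat subfield_setD(5) K)

lemma algebraic_int_emb: "x \<in> K \<Longrightarrow> algebraic_int (\<tau> x) \<longleftrightarrow> algebraic_int x"
proof -
  assume x: "x \<in> K"
  have *: "poly (map_poly of_int p) y = rpoly (map_poly of_int p) y" for p and y :: "'b::field_char_0"
  proof -
    have "map_poly of_rat (map_poly of_int p) = (map_poly of_int p :: 'b poly)"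
      by (rule poly_eqI) (simp add: coeff_map_poly)
    then show ?thesis by (simp add: rpoly_def)
  qed
  show ?thesis unfolding algebraic_int_altdef_ipoly *
    using emb_rpoly[OF x] emb_eq_0_iff[OF subfield_set_rpoly[OF K x]] by metis
qed

lemma algebraic_elt_emb: "x \<in> K \<Longrightarrow> algebraic_elt x \<Longrightarrow> algebraic_elt (\<tau> x)"
  unfolding algebraic_elt_def by (metis emb_rpoly emb_0)

lemma subfield_emb: "subfield_set (\<tau> ` K)"
  unfolding subfield_set_def
proof (intro conjI ballI)
  show "1 \<in> \<tau> ` K" by (rule image_eqI[of _ _ 1]) (auto intro: subfield_setD(2)[OF K])
  fix x assume "x \<in> \<tau> ` K"
  then obtain a where a: "a \<in> K" "x = \<tau> a" by blast
  show "inverse x \<in> \<tau> ` K" using a by (auto simp: emb_inverse[symmetric] intro: subfield_setD(7)[OF K])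
  fix y assume "y \<in> \<tau> ` K"
  then obtain b where b: "b \<in> K" "y = \<tau> b" by blast
  show "x - y \<in> \<tau> ` K" "x * y \<in> \<tau> ` K"
    using a b by (auto simp: emb_diff[symmetric] emb_mult[symmetric] intro: subfield_setD(3,5)[OF K])
qed

text \<open>The argument for \<open>primitive_element\<close> takes place in the complex numbers,
  where polynomials have roots. It is applied to the image under \<open>\<tau>\<close> and pulled
  back by injectivity.\<close>

lemma number_field_primitive:
  assumes nf: "number_field K"
  obtains \<theta> where "\<theta> \<in> K" "K = ratfield \<theta>"
proof -
  obtain B where "field_basis \<rat> K B" using nf by (auto simp: number_field_def)
  note B = field_basis_Rats[OF K this]
  have BK: "B \<subseteq> K" using B(2) rat_vs.span_superset by blast
  have "\<exists>\<eta>\<in>\<tau> ` K. \<tau> ` B \<subseteq> ratfield \<eta>"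
    using BK B(1) number_field_algebraic[OF nf] algebraic_elt_emb
    by (intro primitive_element subfield_emb) auto
  then obtain \<theta> where \<theta>: "\<theta> \<in> K" "\<tau> ` B \<subseteq> ratfield (\<tau> \<theta>)" by blast
  have "B \<subseteq> ratfield \<theta>"
  proof
    fix b assume b: "b \<in> B"
    then obtain p where "\<tau> b = rpoly p (\<tau> \<theta>)" using \<theta>(2) unfolding ratfield_def by blast
    then have "\<tau> b = \<tau> (rpoly p \<theta>)" using emb_rpoly[OF \<theta>(1)] by simp
    then have "b = rpoly p \<theta>" using emb_eq_iff b BK subfield_set_rpoly[OF K \<theta>(1)] by blast
    then show "b \<in> ratfield \<theta>" by (simp add: ratfield_def)
  qed
  moreover have F: "subfield_set (ratfield \<theta>)"
    by (rule ratfield_subfield[OF number_field_algebraic[OF nf \<theta>(1)]])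
  then have "rat_vs.subspace (ratfield \<theta>)"
    by (intro rat_vs.subspaceI) (auto intro: subfield_setD subfield_set_of_rat)
  ultimately have "K \<subseteq> ratfield \<theta>" using rat_vs.span_minimal[of B "ratfield \<theta>"] B(2) by blast
  then show ?thesis using that[OF \<theta>(1)] ratfield_subset[OF K \<theta>(1)] by blast
qed

end

text \<open>Evaluation at \<open>z\<close> in place of \<open>\<theta>\<close>. The choice of the
  polynomial representing an element is immaterial because two choices differ by a multiple of
  \<open>f\<close>.\<close>

lemma root_embedding:
  fixes \<theta> :: "'a::field_char_0"
  assumes f: "minimal_poly f \<theta>" and z: "rpoly f z = 0"
  obtains \<tau> where "complex_embedding (ratfield \<theta>) \<tau>" "\<tau> \<theta> = z"
proof -
  define \<tau> where "\<tau> x = rpoly (SOME p. rpoly p \<theta> = x) z" for x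
  have eq: "rpoly p z = rpoly q z" if "rpoly p \<theta> = rpoly q \<theta>" for p q
  proof -
    have "rpoly (p - q) \<theta> = 0" using that by (simp add: rpoly_diff)
    then have "f dvd p - q" using f by (simp add: minimal_poly_def)
    then have "rpoly (p - q) z = 0" using z by (auto simp: rpoly_mult elim!: dvdE)
    then show ?thesis by (simp add: rpoly_diff)
  qed
  have \<tau>: "\<tau> (rpoly p \<theta>) = rpoly p z" for p
    unfolding \<tau>_def by (rule eq) (rule someI[of "\<lambda>q. rpoly q \<theta> = rpoly p \<theta>" p], rule refl)
  have "\<tau> 1 = 1" using \<tau>[of 1] by simp
  moreover have "\<tau> (rpoly p \<theta> + rpoly q \<theta>) = \<tau> (rpoly p \<theta>) + \<tau> (rpoly q \<theta>) \<and>
      \<tau> (rpoly p \<theta> * rpoly q \<theta>) = \<tau> (rpoly p \<theta>) * \<tau> (rpoly q \<theta>)" for p q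
    using \<tau>[of "p + q"] \<tau>[of "p * q"] by (simp add: \<tau> rpoly_add rpoly_mult)
  ultimately have "complex_embedding (ratfield \<theta>) \<tau>"
    unfolding complex_embedding_def ratfield_def by blast
  moreover have "\<tau> \<theta> = z" using \<tau>[of "[:0, 1:]"] by (simp add: rpoly_pCons)
  ultimately show ?thesis using that by blast
qed

lemma dim_ratfield:
  assumes f: "minimal_poly f \<theta>"
  shows "rat_vs.dim (ratfield \<theta>) = degree f"
proof -
  let ?n = "degree f"
  let ?S = "(\<lambda>k. \<theta> ^ k) ` {..<?n}"
  have small: "p = 0" if p: "p = 0 \<or> degree p < ?n" "rpoly p \<theta> = 0" for p
    using p f dvd_imp_degree_le[of f p] unfolding minimal_poly_def by fastforce
  have indep: "\<forall>c. (\<Sum>k<?n. of_rat (c k) * \<theta> ^ k) = 0 \<longrightarrow> (\<forall>k<?n. c k = 0)"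
  proof (intro allI impI)
    fix c k assume c: "(\<Sum>k<?n. of_rat (c k) * \<theta> ^ k) = 0" and k: "k < ?n"
    let ?p = "\<Sum>k<?n. monom (c k) k"
    have "rpoly ?p \<theta> = 0" using c by (simp only: rpoly_sum rpoly_monom)
    then have "?p = 0" using small degree_sum_monom[OF minimal_poly_degree[OF f]] by blast
    then show "c k = 0" using coeff_sum_monom[of c ?n k] k by (metis coeff_0)
  qed
  note family = rat_vs.independent_family[where v = "\<lambda>k. \<theta> ^ k", OF indep]
  have "rat_vs.independent ?S" by (rule family(2))
  moreover have "ratfield \<theta> \<subseteq> rat_vs.span ?S"
  proof
    fix x assume "x \<in> ratfield \<theta>"
    then obtain p where p: "x = rpoly p \<theta>" by (auto simp: ratfield_def)
    have f0: "f \<noteq> 0" "rpoly f \<theta> = 0" using f by (auto simp: minimal_poly_def)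
    have "rpoly p \<theta> = rpoly (p div f) \<theta> * rpoly f \<theta> + rpoly (p mod f) \<theta>"
      by (simp flip: rpoly_mult rpoly_add)
    then have "x = rpoly (p mod f) \<theta>" using p f0 by simp
    also have "\<dots> = (\<Sum>k<?n. of_rat (coeff (p mod f) k) * \<theta> ^ k)"
      by (rule rpoly_altdef) (use degree_mod_less[OF f0(1)] in blast)
    also have "\<dots> \<in> rat_vs.span ?S" by (intro rat_vs.span_sum rat_vs.span_scale rat_vs.span_base) auto
    finally show "x \<in> rat_vs.span ?S" .
  qed
  moreover have "algebraic_elt \<theta>" using f dvd_refl[of f] unfolding algebraic_elt_def minimal_poly_def by blast
  then have "?S \<subseteq> ratfield \<theta>"
    using subfield_set_power[OF ratfield_subfield ratfield_self] by blast
  moreover have "card ?S = ?n" using card_image[OF family(1)] by simp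
  ultimately show ?thesis by (metis rat_vs.dim_unique)
qed

locale complex_number_field =
  fixes K :: "'a::field_char_0 set" and \<sigma> :: "'s::finite \<Rightarrow> 'a \<Rightarrow> complex"
  assumes nf: "number_field K" and tc: "totally_complex K" and rep: "embedding_representatives K \<sigma>"
begin

text \<open>Indexes all embeddings by a place and the choice between its representative and the
  conjugate, so sums and products over the type \<open>'s \<times> bool\<close> run over each
  embedding once.\<close>

definition emb :: "'s \<times> bool \<Rightarrow> 'a \<Rightarrow> complex" where
  "emb a x = (if snd a then \<sigma> (fst a) x else cnj (\<sigma> (fst a) x))"

lemma subfield_K: "subfield_set K" using nf by (simp add: number_field_def)

lemma embedding_\<sigma>: "complex_embedding K (\<sigma> i)" using rep by (simp add: embedding_representatives_def)

sublocale S: field_embedding K "\<sigma> i" for i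
  by unfold_locales (rule subfield_K, rule embedding_\<sigma>)

lemma embedding_emb: "complex_embedding K (emb a)"
  by (simp add: complex_embedding_def emb_def S.emb_add S.emb_mult)

sublocale E: field_embedding K "emb a" for a
  by unfold_locales (rule subfield_K, rule embedding_emb)

text \<open>The representatives determine the place, and the two embeddings of one place differ
  because none is real.\<close>

lemma emb_distinct:
  assumes "\<And>x. x \<in> K \<Longrightarrow> emb a x = emb b x"
  shows "a = b"
proof -
  have "\<exists>!i. (\<forall>x\<in>K. emb a x = \<sigma> i x) \<or> (\<forall>x\<in>K. emb a x = cnj (\<sigma> i x))"
    using rep embedding_emb[of a] unfolding embedding_representatives_def by blast
  moreover have "(\<forall>x\<in>K. emb a x = \<sigma> (fst a) x) \<or> (\<forall>x\<in>K. emb a x = cnj (\<sigma> (fst a) x))" by (simp add: emb_def)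
  moreover have "(\<forall>x\<in>K. emb a x = \<sigma> (fst b) x) \<or> (\<forall>x\<in>K. emb a x = cnj (\<sigma> (fst b) x))"
    using assms by (simp add: emb_def[of b])
  ultimately have 1: "fst a = fst b" by blast
  have "snd a = snd b"
  proof (rule ccontr)
    assume "snd a \<noteq> snd b"
    then have "\<sigma> (fst a) x = cnj (\<sigma> (fst a) x)" if "x \<in> K" for x
      using assms[OF that] 1 by (auto simp: emb_def split: if_splits)
    then have "\<sigma> (fst a) ` K \<subseteq> \<real>" by (auto simp: Reals_cnj_iff)
    then show False using tc embedding_\<sigma> unfolding totally_complex_def by blast
  qed
  then show ?thesis using 1 by (simp add: prod_eq_iff)
qed

lemma emb_surj:
  assumes "complex_embedding K \<tau>"
  shows "\<exists>a. \<forall>x\<in>K. \<tau> x = emb a x"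
proof -
  obtain i where "(\<forall>x\<in>K. \<tau> x = \<sigma> i x) \<or> (\<forall>x\<in>K. \<tau> x = cnj (\<sigma> i x))"
    using rep assms unfolding embedding_representatives_def by blast
  then show ?thesis
  proof
    assume "\<forall>x\<in>K. \<tau> x = \<sigma> i x" then show ?thesis by (intro exI[of _ "(i, True)"]) (simp add: emb_def)
  next
    assume "\<forall>x\<in>K. \<tau> x = cnj (\<sigma> i x)" then show ?thesis by (intro exI[of _ "(i, False)"]) (simp add: emb_def)
  qed
qed

text \<open>The values \<open>emb a \<theta>\<close> are exactly the roots of \<open>f\<close>:
  every root defines an embedding, and an embedding is determined by its value at
  \<open>\<theta>\<close>. Separability counts the roots by the degree.\<close>

lemma generator:
  obtains \<theta> f where "\<theta> \<in> K" "K = ratfield \<theta>" "minimal_poly f \<theta>" "inj (\<lambda>a. emb a \<theta>)"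
    "degree f = CARD('s \<times> bool)"
proof -
  obtain \<theta> where \<theta>: "\<theta> \<in> K" "K = ratfield \<theta>" using S.number_field_primitive[OF nf] .
  obtain f where f: "minimal_poly f \<theta>" using minimal_poly_exists[OF number_field_algebraic[OF nf \<theta>(1)]] .
  have inj: "inj (\<lambda>a. emb a \<theta>)"
  proof (rule injI)
    fix a b assume ab: "emb a \<theta> = emb b \<theta>"
    have "emb a x = emb b x" if "x \<in> K" for x
    proof -
      obtain p where "x = rpoly p \<theta>" using \<open>x \<in> K\<close> \<theta>(2) by (auto simp: ratfield_def)
      then show ?thesis using ab by (simp add: E.emb_rpoly[OF \<theta>(1)])
    qed
    then show "a = b" by (rule emb_distinct)
  qed
  have "{z. rpoly f z = 0} = range (\<lambda>a. emb a \<theta>)"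
  proof (intro equalityI subsetI)
    fix z :: complex assume "z \<in> {z. rpoly f z = 0}"
    then have z: "rpoly f z = 0" by simp
    obtain \<tau> where \<tau>: "complex_embedding (ratfield \<theta>) \<tau>" "\<tau> \<theta> = z" using root_embedding[OF f z] .
    then obtain a where "\<forall>x\<in>K. \<tau> x = emb a x" using emb_surj \<theta>(2) by blast
    then show "z \<in> range (\<lambda>a. emb a \<theta>)" using \<tau>(2) \<theta>(1) by auto
  next
    fix z assume "z \<in> range (\<lambda>a. emb a \<theta>)"
    then obtain a where "z = emb a \<theta>" by blast
    moreover have "rpoly f \<theta> = 0" using f by (simp add: minimal_poly_def)
    ultimately show "z \<in> {z. rpoly f z = 0}" using E.emb_rpoly[OF \<theta>(1), of a f] by simp
  qed
  then have "degree f = CARD('s \<times> bool)" using minimal_poly_roots(1)[OF f] card_image[OF inj] by simp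
  then show ?thesis using that \<theta> f inj by blast
qed

lemma degree_K: "field_degree \<rat> K = 2 * CARD('s)"
proof -
  obtain \<theta> f where "K = ratfield \<theta>" "minimal_poly f \<theta>" "degree f = CARD('s \<times> bool)" using generator by metis
  then show ?thesis using field_degree_Rats[OF nf] dim_ratfield[of f \<theta>] by simp
qed

end


section \<open>The lattice of integers\<close>

lemma ring_of_integersD: "x \<in> ring_of_integers K \<Longrightarrow> x \<in> K" "x \<in> ring_of_integers K \<Longrightarrow> algebraic_int x"
  by (auto simp: ring_of_integers_def)

lemma ring_of_integers_closed:
  assumes "subfield_set K"
  shows "0 \<in> ring_of_integers K" "1 \<in> ring_of_integers K"
    "x \<in> ring_of_integers K \<Longrightarrow> y \<in> ring_of_integers K \<Longrightarrow> x + y \<in> ring_of_integers K"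
    "x \<in> ring_of_integers K \<Longrightarrow> y \<in> ring_of_integers K \<Longrightarrow> x - y \<in> ring_of_integers K"
    "x \<in> ring_of_integers K \<Longrightarrow> y \<in> ring_of_integers K \<Longrightarrow> x * y \<in> ring_of_integers K"
    "x \<in> ring_of_integers K \<Longrightarrow> x ^ n \<in> ring_of_integers K"
    "of_int k \<in> ring_of_integers K"
  using assms by (auto simp: ring_of_integers_def algebraic_int_of_int subfield_set_power subfield_set_of_int
      intro: subfield_setD algebraic_int_closed algebraic_int_diff algebraic_int_power)

text \<open>Keeps the number of embeddings \<open>CARD('s \<times> bool)\<close> in one piece
  instead of rewriting it to a product.\<close>

declare card_prod [simp del]

lemma scaleR_nth_complex: "(r *\<^sub>R x) $ i = complex_of_real r * (x :: complex ^ 's) $ i"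
  by (simp add: scaleR_conv_of_real[of r "x $ i"])

context complex_number_field
begin

abbreviation \<OO> :: "'a set" where "\<OO> \<equiv> ring_of_integers K"
abbreviation \<iota> :: "'a \<Rightarrow> complex ^ 's" where "\<iota> \<equiv> canonical_embedding \<sigma>"
abbreviation \<Lambda> :: "(complex ^ 's) set" where "\<Lambda> \<equiv> \<iota> ` \<OO>"

lemmas \<OO>_closed = ring_of_integers_closed[OF subfield_K]

lemma \<iota>_nth [simp]: "\<iota> x $ i = \<sigma> i x" by (simp add: canonical_embedding_def)

lemma \<iota>_add: "x \<in> K \<Longrightarrow> y \<in> K \<Longrightarrow> \<iota> (x + y) = \<iota> x + \<iota> y" by (simp add: vec_eq_iff S.emb_add)
lemma \<iota>_diff: "x \<in> K \<Longrightarrow> y \<in> K \<Longrightarrow> \<iota> (x - y) = \<iota> x - \<iota> y" by (simp add: vec_eq_iff S.emb_diff)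
lemma \<iota>_mult: "x \<in> K \<Longrightarrow> y \<in> K \<Longrightarrow> \<iota> (x * y) = \<iota> x * \<iota> y" by (simp add: vec_eq_iff S.emb_mult)
lemma \<iota>_0 [simp]: "\<iota> 0 = 0" by (simp add: vec_eq_iff)
lemma \<iota>_eq_iff: "x \<in> K \<Longrightarrow> y \<in> K \<Longrightarrow> \<iota> x = \<iota> y \<longleftrightarrow> x = y" by (auto simp: vec_eq_iff S.emb_eq_iff)

text \<open>The field norm, grouped by places: an embedding and its conjugate contribute the square
  of an absolute value.\<close>

lemma prod_emb: "(\<Prod>a\<in>UNIV. emb a x) = complex_of_real (norm_Kbar (\<iota> x))"
proof -
  have "(\<Prod>a\<in>UNIV. emb a x) = (\<Prod>i\<in>UNIV. \<Prod>b\<in>UNIV. emb (i, b) x)"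
    by (simp add: prod.cartesian_product)
  also have "\<dots> = (\<Prod>i\<in>UNIV. complex_of_real ((cmod (\<sigma> i x))\<^sup>2))"
    by (rule prod.cong) (simp_all add: UNIV_bool emb_def complex_norm_square mult.commute del: of_real_power)
  finally show ?thesis by (simp add: norm_Kbar_def)
qed

text \<open>The coefficients belong to a polynomial with more roots, the distinct values
  \<open>emb a \<theta>\<close>, than its degree allows.\<close>

lemma vandermonde:
  assumes inj: "inj (\<lambda>a. emb a \<theta>)" and 0: "\<And>a. (\<Sum>k<CARD('s \<times> bool). c k * emb a \<theta> ^ k) = 0"
    and k: "k < CARD('s \<times> bool)"
  shows "c k = 0"
proof -
  let ?p = "\<Sum>k<CARD('s \<times> bool). monom (c k) k"
  have "?p = 0"
  proof (rule ccontr)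
    assume p: "?p \<noteq> 0"
    have "card (range (\<lambda>a. emb a \<theta>)) \<le> card {z. poly ?p z = 0}"
      using 0 p by (intro card_mono poly_roots_finite) (auto simp: poly_sum poly_monom)
    also have "\<dots> \<le> degree ?p" by (rule card_poly_roots_bound[OF p])
    also have "\<dots> < CARD('s \<times> bool)" by (rule degree_sum_monom) simp
    finally show False using card_image[OF inj] by simp
  qed
  then show ?thesis using coeff_sum_monom[of c "CARD('s \<times> bool)" k] k by (metis coeff_0)
qed

text \<open>The norm is the determinant of multiplication by \<open>x\<close>, which is rational in a power basis.\<close>

lemma norm_rational:
  assumes x: "x \<in> K"
  shows "norm_Kbar (\<iota> x) \<in> \<rat>"
proof -
  obtain \<theta> f where \<theta>: "\<theta> \<in> K" "K = ratfield \<theta>" "minimal_poly f \<theta>" "inj (\<lambda>a. emb a \<theta>)"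
    "degree f = CARD('s \<times> bool)" using generator .
  let ?n = "CARD('s \<times> bool)"
  obtain e :: "'s \<times> bool \<Rightarrow> nat" where "bij_betw e UNIV {0..<?n}"
    using ex_bij_betw_finite_nat[of "UNIV :: ('s \<times> bool) set"] by auto
  then have e: "bij_betw e UNIV {..<?n}" by (simp add: atLeast0LessThan)
  have sum_e: "(\<Sum>a\<in>UNIV. g (e a)) = sum g {..<?n}" for g :: "nat \<Rightarrow> complex"
    by (rule sum.reindex_bij_betw[OF e])
  have "\<exists>q. (q = 0 \<or> degree q < ?n) \<and> x * \<theta> ^ k = rpoly q \<theta>" for k
  proof -
    have "x * \<theta> ^ k \<in> K" using x \<theta>(1) subfield_K by (intro subfield_setD subfield_set_power)
    then obtain p where p: "x * \<theta> ^ k = rpoly p \<theta>" using \<theta>(2) by (auto simp: ratfield_def)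
    have f0: "f \<noteq> 0" "rpoly f \<theta> = 0" using \<theta>(3) by (auto simp: minimal_poly_def)
    have "rpoly p \<theta> = rpoly (p div f) \<theta> * rpoly f \<theta> + rpoly (p mod f) \<theta>"
      by (simp flip: rpoly_mult rpoly_add)
    then have "x * \<theta> ^ k = rpoly (p mod f) \<theta>" using p f0 by simp
    then show ?thesis using degree_mod_less[OF f0(1), of p] \<theta>(5) by auto
  qed
  then obtain q where q: "\<And>k. q k = 0 \<or> degree (q k) < ?n" "\<And>k. x * \<theta> ^ k = rpoly (q k) \<theta>" by metis
  \<comment> \<open>\<open>S\<close> is the Vandermonde matrix of the conjugates of
    \<open>\<theta>\<close>, \<open>M\<close> the rational matrix of multiplication by
    \<open>x\<close> on the powers of \<open>\<theta>\<close>, and \<open>D\<close> its diagonal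
    form under the embeddings.\<close>
  define S :: "complex ^ ('s \<times> bool) ^ ('s \<times> bool)" where "S = (\<chi> a b. emb a \<theta> ^ e b)"
  define M :: "complex ^ ('s \<times> bool) ^ ('s \<times> bool)" where "M = (\<chi> c b. of_rat (coeff (q (e b)) (e c)))"
  define D :: "complex ^ ('s \<times> bool) ^ ('s \<times> bool)" where "D = (\<chi> a b. if a = b then emb a x else 0)"
  have "D ** S = S ** M"
  proof -
    have "(D ** S) $ a $ b = (S ** M) $ a $ b" for a b
    proof -
      have "(D ** S) $ a $ b = emb a x * emb a \<theta> ^ e b"
        by (simp add: matrix_matrix_mult_def D_def S_def if_distrib[of "\<lambda>z. z * _"] cong: if_cong)
      also have "\<dots> = emb a (x * \<theta> ^ e b)"
        using x \<theta>(1) by (simp add: E.emb_mult E.emb_power subfield_set_power subfield_K)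
      also have "\<dots> = rpoly (q (e b)) (emb a \<theta>)" by (simp add: q(2) E.emb_rpoly[OF \<theta>(1)])
      also have "\<dots> = (\<Sum>k<?n. of_rat (coeff (q (e b)) k) * emb a \<theta> ^ k)" by (rule rpoly_altdef[OF q(1)])
      also have "\<dots> = (\<Sum>c\<in>UNIV. of_rat (coeff (q (e b)) (e c)) * emb a \<theta> ^ e c)" by (rule sum_e[symmetric])
      also have "\<dots> = (S ** M) $ a $ b" by (simp add: matrix_matrix_mult_def S_def M_def mult.commute)
      finally show ?thesis .
    qed
    then show ?thesis by (simp add: vec_eq_iff)
  qed
  then have "det D * det S = det S * det M" by (metis det_mul)
  moreover have "det S \<noteq> 0"
  proof -
    have "w = 0" if w: "S *v w = 0" for w
    proof -
      define c where "c k = w $ (inv e k)" for k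
      have ce: "c (e a) = w $ a" for a using e by (simp add: c_def bij_betw_def)
      have "(\<Sum>k<?n. c k * emb a \<theta> ^ k) = 0" for a
      proof -
        have "(\<Sum>k<?n. c k * emb a \<theta> ^ k) = (\<Sum>b\<in>UNIV. c (e b) * emb a \<theta> ^ e b)" by (rule sum_e[symmetric])
        also have "\<dots> = (S *v w) $ a" by (simp add: matrix_vector_mult_def S_def ce mult.commute)
        finally show ?thesis by (simp add: w)
      qed
      from vandermonde[OF \<theta>(4) this] have "c (e a) = 0" for a using bij_betwE[OF e] by blast
      then show ?thesis by (simp add: ce vec_eq_iff)
    qed
    then show ?thesis using matrix_left_invertible_ker invertible_left_inverse invertible_det_nz by metis
  qed
  ultimately have "det D = det M" by simp
  moreover have "det M \<in> \<rat>" unfolding det_def by (intro Rats_sum Rats_mult Rats_prod) (auto simp: M_def)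
  moreover have "det D = (\<Prod>a\<in>UNIV. emb a x)" by (subst det_diagonal) (auto simp: D_def)
  ultimately have "complex_of_real (norm_Kbar (\<iota> x)) \<in> \<rat>" by (simp add: prod_emb)
  then obtain r where "complex_of_real (norm_Kbar (\<iota> x)) = of_rat r" by (rule Rats_cases)
  then have "complex_of_real (norm_Kbar (\<iota> x)) = complex_of_real (of_rat r)"
    by (cases r) (simp add: of_rat_rat)
  then have "norm_Kbar (\<iota> x) = of_rat r" by (simp only: of_real_eq_iff)
  then show ?thesis by simp
qed

lemma norm_integer:
  assumes x: "x \<in> \<OO>"
  shows "norm_Kbar (\<iota> x) \<in> \<int>"
proof -
  have "algebraic_int (emb a x)" for a using x by (simp add: E.algebraic_int_emb ring_of_integers_def)
  then have "algebraic_int (\<Prod>a\<in>UNIV. emb a x)" by (rule algebraic_int_prod)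
  then have "algebraic_int (norm_Kbar (\<iota> x))" by (simp add: prod_emb)
  then show ?thesis using norm_rational[OF ring_of_integersD(1)[OF x]] by (rule rational_algebraic_int_is_int)
qed

lemma norm_ge_1:
  assumes x: "x \<in> \<OO>" "x \<noteq> 0"
  shows "norm_Kbar (\<iota> x) \<ge> 1"
proof -
  have "norm_Kbar (\<iota> x) > 0"
    using x S.emb_eq_0_iff[of x] ring_of_integersD(1)[OF x(1)] unfolding norm_Kbar_def by (intro prod_pos) simp
  moreover obtain k where "norm_Kbar (\<iota> x) = of_int k" using norm_integer[OF x(1)] by (rule Ints_cases)
  ultimately show ?thesis by simp
qed

text \<open>The vectors are the powers of an integral generator \<open>\<omega>\<close> of K. They
  are a real basis of the space made of lattice vectors and generate a sublattice that may be
  smaller than the lattice of integers; this gives cocompactness.\<close>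

lemma integral_basis:
  obtains v :: "nat \<Rightarrow> complex ^ 's" where "\<And>k. v k \<in> \<Lambda>"
    "\<And>x. \<exists>r. x = (\<Sum>k<CARD('s \<times> bool). r k *\<^sub>R v k)"
    "\<And>r k. (\<Sum>k<CARD('s \<times> bool). r k *\<^sub>R v k) = 0 \<Longrightarrow> k < CARD('s \<times> bool) \<Longrightarrow> r k = 0"
proof -
  obtain \<theta> f where \<theta>: "\<theta> \<in> K" "minimal_poly f \<theta>" "inj (\<lambda>a. emb a \<theta>)" using generator by metis
  have "f \<noteq> 0" "poly (map_poly of_rat f) \<theta> = 0" using \<theta>(2) by (auto simp: minimal_poly_def rpoly_def)
  then obtain D :: int where D: "D > 0" "algebraic_int (of_int D * \<theta>)" using algebraic_multiple_int by blast
  define \<omega> where "\<omega> = of_int D * \<theta>"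
  have \<omega>: "\<omega> \<in> \<OO>" using D(2) \<theta>(1) subfield_K
    by (auto simp: ring_of_integers_def \<omega>_def intro: subfield_setD subfield_set_of_int)
  have "emb a \<omega> = of_int D * emb a \<theta>" for a
    using \<theta>(1) by (simp add: \<omega>_def E.emb_mult E.emb_of_int subfield_set_of_int subfield_K)
  then have inj: "inj (\<lambda>a. emb a \<omega>)" using \<theta>(3) D(1) by (auto simp: inj_def)
  define v where "v k = \<iota> (\<omega> ^ k)" for k
  let ?n = "CARD('s \<times> bool)"
  have indep: "r k = 0" if r: "(\<Sum>k<?n. r k *\<^sub>R v k) = 0" and k: "k < ?n" for r k
  proof -
    have s: "(\<Sum>k<?n. complex_of_real (r k) * \<sigma> i \<omega> ^ k) = 0" for i
      using arg_cong[OF r, of "\<lambda>x. x $ i"] ring_of_integersD(1)[OF \<omega>]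
      by (simp add: v_def S.emb_power scaleR_nth_complex del: vector_scaleR_component)
    have "(\<Sum>k<?n. complex_of_real (r k) * cnj (\<sigma> i \<omega>) ^ k) = 0" for i
      using arg_cong[OF s[of i], of cnj] by (simp del: complex_cnj_zero_iff)
    then have "(\<Sum>k<?n. complex_of_real (r k) * emb a \<omega> ^ k) = 0" for a
      using s by (simp add: emb_def)
    from vandermonde[OF inj this k] show ?thesis by simp
  qed
  have "\<forall>r. (\<Sum>k<?n. r k *\<^sub>R v k) = 0 \<longrightarrow> (\<forall>k<?n. r k = 0)" using indep by blast
  note injv = real_vector.independent_family(1)[OF this] and real_vector.independent_family(2)[OF this]
  moreover have "card (v ` {..<?n}) = ?n" using card_image[OF injv] by simp
  ultimately have "span (v ` {..<?n}) = UNIV"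
    using card_ge_dim_independent[of "v ` {..<?n}" UNIV] by (auto simp: card_prod)
  then have "\<exists>r. x = (\<Sum>k<?n. r k *\<^sub>R v k)" for x
  proof -
    have "x \<in> range (\<lambda>u. \<Sum>y\<in>v ` {..<?n}. u y *\<^sub>R y)"
      using span_finite[of "v ` {..<?n}"] \<open>span (v ` {..<?n}) = UNIV\<close> by auto
    then obtain u where "x = (\<Sum>y\<in>v ` {..<?n}. u y *\<^sub>R y)" by blast
    then have "x = (\<Sum>k<?n. u (v k) *\<^sub>R v k)" by (simp add: sum.reindex[OF injv])
    then show ?thesis by (rule exI[of _ "\<lambda>k. u (v k)"])
  qed
  moreover have "v k \<in> \<Lambda>" for k unfolding v_def using \<OO>_closed(6)[OF \<omega>] by blast
  ultimately show ?thesis using that indep by blast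
qed

sublocale L: lattice_in \<Lambda>
proof
  show "0 \<in> \<Lambda>" by (rule image_eqI[of _ _ 0]) (auto simp: \<OO>_closed)
  show diff: "a - b \<in> \<Lambda>" if "a \<in> \<Lambda>" "b \<in> \<Lambda>" for a b
    using that by (auto simp: \<iota>_diff[symmetric] ring_of_integersD \<OO>_closed)
  have zero: "0 \<in> \<Lambda>" by (rule image_eqI[of _ _ 0]) (auto simp: \<OO>_closed)
  have add: "a + b \<in> \<Lambda>" if "a \<in> \<Lambda>" "b \<in> \<Lambda>" for a b
    using that by (auto simp: \<iota>_add[symmetric] ring_of_integersD \<OO>_closed)
  have scale: "of_int k *\<^sub>R a \<in> \<Lambda>" if a: "a \<in> \<Lambda>" for a k
  proof -
    obtain x where x: "x \<in> \<OO>" "a = \<iota> x" using a by blast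
    have "of_int k *\<^sub>R a = \<iota> (of_int k * x)"
      using x ring_of_integersD(1)[OF x(1)]
      by (simp add: vec_eq_iff S.emb_mult S.emb_of_int subfield_set_of_int subfield_K scaleR_nth_complex del: vector_scaleR_component)
    then show ?thesis using \<OO>_closed(5,7) x(1) by blast
  qed
  obtain v :: "nat \<Rightarrow> complex ^ 's" where v: "\<And>k. v k \<in> \<Lambda>"
    "\<And>x. \<exists>r. x = (\<Sum>k<CARD('s \<times> bool). r k *\<^sub>R v k)"
    "\<And>r k. (\<Sum>k<CARD('s \<times> bool). r k *\<^sub>R v k) = 0 \<Longrightarrow> k < CARD('s \<times> bool) \<Longrightarrow> r k = 0"
    by (rule integral_basis) blast
  let ?n = "CARD('s \<times> bool)"
  have "\<exists>a\<in>\<Lambda>. norm (x - a) \<le> (\<Sum>k<?n. norm (v k))" for x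
  proof -
    obtain r where r: "x = (\<Sum>k<?n. r k *\<^sub>R v k)" using v(2) by blast
    let ?a = "\<Sum>k<?n. real_of_int \<lfloor>r k\<rfloor> *\<^sub>R v k"
    have "(\<Sum>k\<in>A. real_of_int \<lfloor>r k\<rfloor> *\<^sub>R v k) \<in> \<Lambda>" if "finite A" for A
      using that by (induction A rule: finite_induct) (auto intro: zero add scale v)
    then have "?a \<in> \<Lambda>" by blast
    moreover have "x - ?a = (\<Sum>k<?n. frac (r k) *\<^sub>R v k)"
      by (simp add: r frac_def scaleR_left_diff_distrib sum_subtractf)
    then have "norm (x - ?a) \<le> (\<Sum>k<?n. norm (frac (r k) *\<^sub>R v k))" by (simp only: norm_sum)
    moreover have "norm (frac (r k) *\<^sub>R v k) \<le> norm (v k)" for k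
      using frac_lt_1[of "r k"] by (simp add: mult_left_le_one_le less_imp_le)
    then have "(\<Sum>k<?n. norm (frac (r k) *\<^sub>R v k)) \<le> (\<Sum>k<?n. norm (v k))" by (intro sum_mono)
    ultimately show ?thesis by force
  qed
  then show "\<exists>C. \<forall>x. \<exists>a\<in>\<Lambda>. norm (x - a) \<le> C" by blast
  \<comment> \<open>The norm of a nonzero integer is at least 1, so its entries cannot all be less
    than 1 in absolute value.\<close>
  have "a = 0" if a: "a \<in> \<Lambda>" "norm a < 1" for a
  proof (rule ccontr)
    assume "a \<noteq> 0"
    then obtain x where x: "x \<in> \<OO>" "a = \<iota> x" "x \<noteq> 0" using a by fastforce
    have "cmod (a $ i) < 1" for i using a(2) Finite_Cartesian_Product.norm_nth_le[of a i] by simp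
    then have "(cmod (a $ i))\<^sup>2 < 1" for i by (simp add: power_less_one_iff abs_square_less_1)
    moreover have "cmod (a $ i) > 0" for i using x S.emb_eq_0_iff[of x] ring_of_integersD(1)[OF x(1)] by simp
    then have "(cmod (a $ i))\<^sup>2 > 0" for i by simp
    ultimately have "norm_Kbar a < (\<Prod>i\<in>(UNIV :: 's set). 1)" unfolding norm_Kbar_def
      by (intro prod_mono_strict) (auto intro: less_imp_le)
    then show False using norm_ge_1[OF x(1,3)] x(2) by simp
  qed
  then show "\<exists>e>0. \<forall>a\<in>\<Lambda>. norm a < e \<longrightarrow> a = 0" by (intro exI[of _ 1]) auto
qed

text \<open>Translates rationality into the group-theoretic notion used so far: every element of K
  has a positive integer multiple that is an algebraic integer.\<close>

lemma torsion_iff: "L.torsion x \<longleftrightarrow> x \<in> \<iota> ` K"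
proof
  assume "L.torsion x"
  then obtain n :: nat where n: "n > 0" "real n *\<^sub>R x \<in> \<Lambda>" by (auto simp: L.torsion_def)
  then obtain y where y: "y \<in> \<OO>" "real n *\<^sub>R x = \<iota> y" by blast
  have "y / of_nat n \<in> K" using ring_of_integersD(1)[OF y(1)] subfield_K
    by (intro subfield_setD subfield_set_of_nat)
  moreover have "x $ i = \<sigma> i (y / of_nat n)" for i
    using arg_cong[OF y(2), of "\<lambda>x. x $ i"] n(1) ring_of_integersD(1)[OF y(1)]
    by (simp add: S.emb_divide S.emb_of_nat subfield_set_of_nat subfield_K scaleR_nth_complex field_simps del: vector_scaleR_component)
  then have "x = \<iota> (y / of_nat n)" by (simp add: vec_eq_iff)
  ultimately show "x \<in> \<iota> ` K" by blast
next
  assume "x \<in> \<iota> ` K"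
  then obtain y where y: "y \<in> K" "x = \<iota> y" by blast
  obtain p where "p \<noteq> 0" "rpoly p y = 0" using number_field_algebraic[OF nf y(1)] by (auto simp: algebraic_elt_def)
  then obtain D :: int where D: "D > 0" "algebraic_int (of_int D * y)"
    using algebraic_multiple_int[of p y] by (auto simp: rpoly_def)
  have "real (nat D) *\<^sub>R x = \<iota> (of_int D * y)"
    using D(1) y by (simp add: vec_eq_iff S.emb_mult S.emb_of_int subfield_set_of_int subfield_K scaleR_nth_complex del: vector_scaleR_component)
  moreover have "of_int D * y \<in> \<OO>"
    using D(2) y(1) subfield_K by (auto simp: ring_of_integers_def intro: subfield_setD subfield_set_of_int)
  ultimately show "L.torsion x" using D(1) by (auto simp: L.torsion_def intro!: exI[of _ "nat D"])
qed

text \<open>Minkowski's argument by counting. With n embeddings, \<open>(N + 1) ^ n\<close> integer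
  combinations of the basis fall into at most \<open>N ^ n\<close> cells, the entries of
  \<open>x\<close> having product 1; the difference of two combinations in one cell is the integer
  sought.\<close>

lemma small_integer:
  obtains C where "\<And>x :: real ^ 's. (\<And>i. x $ i > 0) \<Longrightarrow> (\<Prod>i\<in>UNIV. x $ i) = 1 \<Longrightarrow>
    \<exists>a\<in>\<OO>. a \<noteq> 0 \<and> (\<forall>i. x $ i * cmod (\<sigma> i a) \<le> C)"
proof -
  let ?n = "CARD('s \<times> bool)"
  obtain v :: "nat \<Rightarrow> complex ^ 's" where v: "\<And>k. v k \<in> \<Lambda>"
    "\<And>x. \<exists>r. x = (\<Sum>k<?n. r k *\<^sub>R v k)"
    "\<And>r k. (\<Sum>k<?n. r k *\<^sub>R v k) = 0 \<Longrightarrow> k < ?n \<Longrightarrow> r k = 0" by (rule integral_basis) blast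
  define V where "V = 1 + (\<Sum>k<?n. norm (v k))"
  have V: "V > 0" unfolding V_def by (intro add_pos_nonneg sum_nonneg) auto
  have "\<exists>a\<in>\<OO>. a \<noteq> 0 \<and> (\<forall>i. x $ i * cmod (\<sigma> i a) \<le> 8 * V)"
    if x: "\<And>i. x $ i > 0" "(\<Prod>i\<in>UNIV. x $ i) = 1" for x :: "real ^ 's"
  proof -
    \<comment> \<open>Ensures \<open>N * x $ i \<ge> 2\<close> for all \<open>i\<close>, so that
      rounding up the number of cells \<open>N * x $ i / 2\<close> costs at most a factor 2.\<close>
    define N where "N = nat \<lceil>\<Sum>i\<in>UNIV. 2 / x $ i\<rceil>"
    have Nx: "real N * x $ i \<ge> 2" for i
    proof -
      have "2 / x $ i \<le> (\<Sum>i\<in>UNIV. 2 / x $ i)" using x(1) by (intro member_le_sum) (auto intro: less_imp_le)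
      also have "\<dots> \<le> real N" unfolding N_def by linarith
      finally show ?thesis using x(1)[of i] by (simp add: field_simps)
    qed
    define pt where "pt m = (\<Sum>k<?n. real (m k) *\<^sub>R v k)" for m :: "nat \<Rightarrow> nat"
    define part where "part b z = (if b then Re z else Im z)" for b z
    define cell where "cell m = (\<lambda>(i, b). nat \<lfloor>(x $ i * part b (pt m $ i) + real N * V * x $ i) / (4 * V)\<rfloor>)" for m
    let ?A = "{..<?n} \<rightarrow>\<^sub>E {..N}"
    let ?B = "PiE UNIV (\<lambda>(i, b :: bool). {..nat \<lfloor>real N * x $ i / 2\<rfloor>})"
    have bd: "\<bar>x $ i * part b (pt m $ i)\<bar> \<le> real N * V * x $ i" if m: "m \<in> ?A" for m i b
    proof -
      have "\<bar>part b (pt m $ i)\<bar> \<le> cmod (pt m $ i)" by (simp add: part_def abs_Re_le_cmod abs_Im_le_cmod)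
      also have "\<dots> \<le> norm (pt m)" by (rule Finite_Cartesian_Product.norm_nth_le)
      also have "\<dots> \<le> (\<Sum>k<?n. norm (real (m k) *\<^sub>R v k))" unfolding pt_def by (rule norm_sum)
      also have "\<dots> \<le> (\<Sum>k<?n. real N * norm (v k))"
      proof (rule sum_mono)
        fix k assume "k \<in> {..<?n}"
        then have "m k \<le> N" using PiE_mem[OF m] by blast
        then show "norm (real (m k) *\<^sub>R v k) \<le> real N * norm (v k)" by (simp add: mult_right_mono)
      qed
      also have "\<dots> \<le> real N * V" unfolding V_def sum_distrib_left[symmetric] by (intro mult_left_mono) auto
      finally have "x $ i * \<bar>part b (pt m $ i)\<bar> \<le> x $ i * (real N * V)"
        using x(1)[of i] by (intro mult_left_mono) auto
      then show ?thesis using x(1)[of i] by (simp add: abs_mult mult_ac)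
    qed
    have "cell m \<in> ?B" if m: "m \<in> ?A" for m
    proof -
      have "cell m (i, b) \<le> nat \<lfloor>real N * x $ i / 2\<rfloor>" for i b
      proof -
        have "(x $ i * part b (pt m $ i) + real N * V * x $ i) / (4 * V) \<le> (2 * (real N * V * x $ i)) / (4 * V)"
          using bd[OF m, of i b] V by (intro divide_right_mono) linarith+
        also have "\<dots> = real N * x $ i / 2" using V by simp
        finally show ?thesis unfolding cell_def by (auto intro!: nat_mono floor_mono)
      qed
      then show ?thesis by auto
    qed
    then have "card (cell ` ?A) \<le> card ?B" by (intro card_mono finite_PiE) auto
    moreover have "real (card ?B) < real (card ?A)"
    proof -
      have "real (card ?B) = (\<Prod>(i, b :: bool)\<in>UNIV. real (Suc (nat \<lfloor>real N * x $ i / 2\<rfloor>)))"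
        by (simp add: card_PiE case_prod_beta)
      also have "\<dots> \<le> (\<Prod>(i, b :: bool)\<in>UNIV. real N * x $ i)"
      proof (rule prod_mono)
        fix a :: "'s \<times> bool"
        obtain i b where a: "a = (i, b)" by fastforce
        have "real (Suc (nat \<lfloor>real N * x $ i / 2\<rfloor>)) \<le> real N * x $ i" using Nx[of i] by linarith
        then show "0 \<le> (case a of (i, b) \<Rightarrow> real (Suc (nat \<lfloor>real N * x $ i / 2\<rfloor>))) \<and>
          (case a of (i, b) \<Rightarrow> real (Suc (nat \<lfloor>real N * x $ i / 2\<rfloor>))) \<le> (case a of (i, b) \<Rightarrow> real N * x $ i)"
          by (simp add: a)
      qed
      also have "\<dots> = (\<Prod>i\<in>UNIV. \<Prod>b\<in>(UNIV :: bool set). real N * x $ i)" by (simp only: prod.cartesian_product UNIV_Times_UNIV)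
      also have "\<dots> = (\<Prod>i\<in>UNIV. (real N)\<^sup>2 * (x $ i)\<^sup>2)" by (simp add: power_mult_distrib)
      also have "\<dots> = (real N)\<^sup>2 ^ CARD('s) * (\<Prod>i\<in>UNIV. x $ i)\<^sup>2"
        by (simp add: prod.distrib prod_power_distrib)
      also have "\<dots> = real N ^ ?n" using x(2) by (simp flip: power_mult) (simp add: mult.commute card_prod)
      also have "\<dots> < real (Suc N) ^ ?n" by (intro power_strict_mono) auto
      also have "\<dots> = real (card ?A)" by (simp add: card_PiE)
      finally show ?thesis .
    qed
    ultimately have "card (cell ` ?A) < card ?A" by linarith
    then have "\<not> inj_on cell ?A" by (rule pigeonhole)
    then obtain m m' where m: "m \<in> ?A" "m' \<in> ?A" "m \<noteq> m'" "cell m = cell m'" by (auto simp: inj_on_def)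
    have "pt m - pt m' = (\<Sum>k<?n. (real (m k) - real (m' k)) *\<^sub>R v k)"
      by (simp add: pt_def scaleR_left_diff_distrib sum_subtractf)
    moreover obtain k where k: "k < ?n" "m k \<noteq> m' k" using PiE_ext[OF m(1,2)] m(3) by blast
    ultimately have ne: "pt m - pt m' \<noteq> 0" using v(3)[of "\<lambda>k. real (m k) - real (m' k)" k] by auto
    have "pt m - pt m' \<in> \<Lambda>" unfolding pt_def by (intro L.diff L.sum_mem L.scaleR_nat v)
    then obtain a where a: "a \<in> \<OO>" "pt m - pt m' = \<iota> a" by blast
    have "x $ i * cmod (\<sigma> i a) \<le> 8 * V" for i
    proof -
      have p: "\<bar>x $ i * part b (pt m $ i) - x $ i * part b (pt m' $ i)\<bar> \<le> 4 * V" for b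
      proof -
        let ?t = "\<lambda>m. (x $ i * part b (pt m $ i) + real N * V * x $ i) / (4 * V)"
        have "?t m \<ge> 0" "?t m' \<ge> 0"
          using bd[OF m(1), of i b] bd[OF m(2), of i b] V by (auto intro!: divide_nonneg_nonneg)
        moreover have "nat \<lfloor>?t m\<rfloor> = nat \<lfloor>?t m'\<rfloor>" using fun_cong[OF m(4), of "(i, b)"] by (simp add: cell_def)
        ultimately have "\<bar>?t m - ?t m'\<bar> \<le> 1" by linarith
        moreover have "?t m - ?t m' = (x $ i * part b (pt m $ i) - x $ i * part b (pt m' $ i)) / (4 * V)"
          by (simp add: diff_divide_distrib add_divide_distrib)
        ultimately show ?thesis using V by (simp add: abs_divide divide_le_eq)
      qed
      have "\<sigma> i a = pt m $ i - pt m' $ i" using arg_cong[OF a(2), of "\<lambda>x. x $ i"] by simp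
      then have "x $ i * cmod (\<sigma> i a) \<le> x $ i * (\<bar>Re (pt m $ i) - Re (pt m' $ i)\<bar> + \<bar>Im (pt m $ i) - Im (pt m' $ i)\<bar>)"
        using x(1)[of i] cmod_le[of "\<sigma> i a"] by (intro mult_left_mono) auto
      also have "\<dots> = \<bar>x $ i * part True (pt m $ i) - x $ i * part True (pt m' $ i)\<bar> +
          \<bar>x $ i * part False (pt m $ i) - x $ i * part False (pt m' $ i)\<bar>"
        using x(1)[of i] by (simp add: part_def distrib_left abs_mult flip: right_diff_distrib)
      also have "\<dots> \<le> 8 * V" using p[of True] p[of False] by simp
      finally show ?thesis .
    qed
    moreover have "a \<noteq> 0" using ne a(2) by auto
    ultimately show ?thesis using a(1) by blast
  qed
  then show ?thesis using that by blast
qed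

end


section \<open>Units\<close>

context complex_number_field
begin

abbreviation unitgroup :: "'a set" where "unitgroup \<equiv> integer_units K"

lemma unitsD: "u \<in> unitgroup \<Longrightarrow> u \<in> \<OO>" "u \<in> unitgroup \<Longrightarrow> u \<in> K" "u \<in> unitgroup \<Longrightarrow> u \<noteq> 0"
  "u \<in> unitgroup \<Longrightarrow> inverse u \<in> unitgroup"
proof -
  assume u: "u \<in> unitgroup"
  then obtain v where v: "u \<in> \<OO>" "v \<in> \<OO>" "u * v = 1" by (auto simp: integer_units_def)
  then show "u \<in> \<OO>" "u \<in> K" "u \<noteq> 0" by (auto dest: ring_of_integersD)
  have "inverse u = v" using v(3) by (rule inverse_unique)
  then show "inverse u \<in> unitgroup" using v by (auto simp: integer_units_def mult.commute)
qed

lemma units_mult: "u \<in> unitgroup \<Longrightarrow> w \<in> unitgroup \<Longrightarrow> u * w \<in> unitgroup"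
proof -
  assume "u \<in> unitgroup" "w \<in> unitgroup"
  then obtain v x where "u \<in> \<OO>" "v \<in> \<OO>" "u * v = 1" "w \<in> \<OO>" "x \<in> \<OO>" "w * x = 1" by (auto simp: integer_units_def)
  moreover from this have "(u * w) * (v * x) = 1" by (metis mult.assoc mult.commute mult_1)
  ultimately show ?thesis using \<OO>_closed(5) unfolding integer_units_def by blast
qed

lemma units_1: "1 \<in> unitgroup"
  using \<OO>_closed(2) by (auto simp: integer_units_def)

lemma units_power: "u \<in> unitgroup \<Longrightarrow> u ^ n \<in> unitgroup"
  by (induction n) (auto intro: units_1 units_mult)

lemma units_prod: "(\<And>b. b \<in> B \<Longrightarrow> f b \<in> unitgroup) \<Longrightarrow> prod f B \<in> unitgroup"
  by (induction B rule: infinite_finite_induct) (auto intro: units_1 units_mult)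

lemma norm_\<iota>_mult: "x \<in> K \<Longrightarrow> y \<in> K \<Longrightarrow> norm_Kbar (\<iota> (x * y)) = norm_Kbar (\<iota> x) * norm_Kbar (\<iota> y)"
  by (simp add: \<iota>_mult norm_Kbar_mult)

lemma norm_unit: "u \<in> unitgroup \<Longrightarrow> norm_Kbar (\<iota> u) = 1"
proof -
  assume u: "u \<in> unitgroup"
  note v = unitsD(4)[OF u]
  have "norm_Kbar (\<iota> u) * norm_Kbar (\<iota> (inverse u)) = norm_Kbar (\<iota> (u * inverse u))"
    by (rule norm_\<iota>_mult[OF unitsD(2)[OF u] unitsD(2)[OF v], symmetric])
  also have "\<dots> = 1" using unitsD(3)[OF u] by (simp add: norm_Kbar_def)
  finally have e: "norm_Kbar (\<iota> u) * norm_Kbar (\<iota> (inverse u)) = 1" .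
  have "norm_Kbar (\<iota> u) \<ge> 1" "norm_Kbar (\<iota> (inverse u)) \<ge> 1"
    using norm_ge_1 unitsD[OF u] unitsD[OF v] by blast+
  then show ?thesis using e mult_left_mono[of 1 "norm_Kbar (\<iota> (inverse u))" "norm_Kbar (\<iota> u)"] by linarith
qed

text \<open>Under an embedding \<open>m / b\<close> becomes the product of the other conjugates of
  \<open>b\<close>, hence it is integral.\<close>

lemma norm_over_element:
  assumes b: "b \<in> \<OO>" "b \<noteq> 0" and m: "norm_Kbar (\<iota> b) = real m"
  shows "of_nat m / b \<in> \<OO>"
proof -
  have bK: "b \<in> K" by (rule ring_of_integersD(1)[OF b(1)])
  have mb: "of_nat m / b \<in> K" using bK subfield_K by (intro subfield_setD subfield_set_of_nat)
  fix a :: "'s \<times> bool"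
  have "of_nat m = emb a b * (\<Prod>c\<in>UNIV - {a}. emb c b)"
    using prod_emb[of b] m by (simp add: prod.remove[of UNIV a])
  moreover have "emb a b \<noteq> 0" using E.emb_eq_0_iff[OF bK] b(2) by simp
  ultimately have "emb a (of_nat m / b) = (\<Prod>c\<in>UNIV - {a}. emb c b)"
    using bK by (simp add: E.emb_divide E.emb_of_nat subfield_set_of_nat subfield_K)
  moreover have "algebraic_int (\<Prod>c\<in>UNIV - {a}. emb c b)"
    using b(1) by (intro algebraic_int_prod) (simp add: E.algebraic_int_emb ring_of_integers_def)
  ultimately have "algebraic_int (of_nat m / b)" using E.algebraic_int_emb[OF mb, of a] by simp
  then show ?thesis using mb by (simp add: ring_of_integers_def)
qed

text \<open>\<open>a / b = 1 + c * (m / b)\<close> with \<open>m / b\<close> integral, and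
  symmetrically for \<open>b / a\<close>.\<close>

lemma unit_quotient:
  assumes a: "a \<in> \<OO>" "a \<noteq> 0" "norm_Kbar (\<iota> a) = real m" and b: "b \<in> \<OO>" "b \<noteq> 0" "norm_Kbar (\<iota> b) = real m"
    and c: "c \<in> \<OO>" "a - b = of_nat m * c"
  shows "a / b \<in> unitgroup"
proof -
  have "a / b = 1 + c * (of_nat m / b)" using b(2) c(2) by (simp add: field_simps)
  then have 1: "a / b \<in> \<OO>" using \<OO>_closed(3)[OF \<OO>_closed(2) \<OO>_closed(5)[OF c(1) norm_over_element[OF b]]] by (simp only:)
  have "b / a = 1 - c * (of_nat m / a)" using a(2) c(2) by (simp add: field_simps)
  then have 2: "b / a \<in> \<OO>" using \<OO>_closed(4)[OF \<OO>_closed(2) \<OO>_closed(5)[OF c(1) norm_over_element[OF a]]] by (simp only:)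
  have "(a / b) * (b / a) = 1" using a(2) b(2) by simp
  then show ?thesis using 1 2 unfolding integer_units_def by blast
qed

text \<open>Integers of equal norm k that are congruent modulo k differ by a unit factor. The
  factorial \<open>Q\<close> is a common multiple of all norms up to \<open>M\<close>, so one
  congruence serves for all of them; residues modulo \<open>Q\<close> are read off as torsion
  classes of \<open>\<iota> a\<close> divided by \<open>Q\<close>.\<close>

lemma finite_norm_modulo_units:
  "\<exists>A. finite A \<and> (\<forall>b\<in>A. b \<in> \<OO> \<and> b \<noteq> 0) \<and>
    (\<forall>a\<in>\<OO>. a \<noteq> 0 \<longrightarrow> norm_Kbar (\<iota> a) \<le> M \<longrightarrow> (\<exists>b\<in>A. a / b \<in> unitgroup))"
proof -
  define Q :: nat where "Q = fact (nat \<lfloor>M\<rfloor>)"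
  have Q: "Q > 0" by (simp add: Q_def)
  obtain S where S: "finite S" "\<And>x. real Q *\<^sub>R x \<in> \<Lambda> \<Longrightarrow> \<exists>s\<in>S. real Q *\<^sub>R s \<in> \<Lambda> \<and> x - s \<in> \<Lambda>"
    using L.finite_torsion_classes[OF Q] by blast
  have "\<exists>s\<in>S. \<iota> a /\<^sub>R real Q - s \<in> \<Lambda>" if "a \<in> \<OO>" for a
    using S(2)[of "\<iota> a /\<^sub>R real Q"] that Q by auto
  then obtain s where s: "\<And>a. a \<in> \<OO> \<Longrightarrow> s a \<in> S" "\<And>a. a \<in> \<OO> \<Longrightarrow> \<iota> a /\<^sub>R real Q - s a \<in> \<Lambda>" by metis
  define X where "X = {a \<in> \<OO>. a \<noteq> 0 \<and> norm_Kbar (\<iota> a) \<le> M}"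
  define \<kappa> where "\<kappa> a = (norm_Kbar (\<iota> a), s a)" for a
  have norm: "\<exists>k\<le>nat \<lfloor>M\<rfloor>. k > 0 \<and> norm_Kbar (\<iota> a) = real k" if a: "a \<in> X" for a
  proof -
    obtain k where k: "norm_Kbar (\<iota> a) = of_int k" using norm_integer[of a] a by (auto simp: X_def elim: Ints_cases)
    have "k \<ge> 1" "k \<le> \<lfloor>M\<rfloor>" using norm_ge_1[of a] a k by (auto simp: X_def le_floor_iff)
    then show ?thesis using k by (intro exI[of _ "nat k"]) auto
  qed
  then have "\<kappa> ` X \<subseteq> real ` {..nat \<lfloor>M\<rfloor>} \<times> S" using s(1) by (force simp: \<kappa>_def X_def)
  then have fin: "finite (\<kappa> ` X)" by (rule finite_subset) (use S(1) in blast)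
  have unit: "a / inv_into X \<kappa> (\<kappa> a) \<in> unitgroup" if a: "a \<in> X" for a
  proof -
    define b where "b = inv_into X \<kappa> (\<kappa> a)"
    have b: "b \<in> X" "\<kappa> b = \<kappa> a" unfolding b_def using a by (auto intro: inv_into_into f_inv_into_f)
    have O: "a \<in> \<OO>" "b \<in> \<OO>" "a \<noteq> 0" "b \<noteq> 0" using a b by (auto simp: X_def)
    obtain k where k: "k \<le> nat \<lfloor>M\<rfloor>" "k > 0" "norm_Kbar (\<iota> a) = real k" using norm[OF a] by blast
    then obtain j where j: "Q = k * j" unfolding Q_def using dvd_fact[of k "nat \<lfloor>M\<rfloor>"] by auto
    have "(\<iota> a /\<^sub>R real Q - s a) - (\<iota> b /\<^sub>R real Q - s b) \<in> \<Lambda>" by (intro L.diff s(2) O)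
    then have "(\<iota> a - \<iota> b) /\<^sub>R real Q \<in> \<Lambda>" using b(2) by (simp add: \<kappa>_def scaleR_right_diff_distrib)
    then obtain c where c: "c \<in> \<OO>" "(\<iota> a - \<iota> b) /\<^sub>R real Q = \<iota> c" by blast
    have K: "a \<in> K" "b \<in> K" "c \<in> K" using O c(1) ring_of_integersD(1) by blast+
    have "\<iota> a - \<iota> b = real Q *\<^sub>R \<iota> c" using Q by (simp flip: c(2))
    moreover have "real Q *\<^sub>R \<iota> c = \<iota> (of_nat Q * c)"
      using K(3) by (simp add: vec_eq_iff scaleR_nth_complex S.emb_mult S.emb_of_nat subfield_set_of_nat subfield_K del: vector_scaleR_component)
    moreover have "a - b \<in> K" "of_nat Q * c \<in> K" using K subfield_K by (auto intro!: subfield_setD subfield_set_of_nat)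
    ultimately have "a - b = of_nat Q * c" using K \<iota>_eq_iff by (simp flip: \<iota>_diff)
    then have "a - b = of_nat k * (of_int (int j) * c)" by (simp add: j mult.assoc)
    moreover have "norm_Kbar (\<iota> b) = real k" using b(2) k(3) by (simp add: \<kappa>_def)
    ultimately show ?thesis
      using unit_quotient[OF O(1,3) k(3) O(2,4) _ \<OO>_closed(5)[OF \<OO>_closed(7) c(1)]] by (simp only: b_def)
  qed
  let ?A = "inv_into X \<kappa> ` \<kappa> ` X"
  show ?thesis
  proof (intro exI conjI ballI impI)
    show "finite ?A" using fin by (rule finite_imageI)
    fix b assume "b \<in> ?A"
    then have "b \<in> X" by (auto intro: inv_into_into)
    then show "b \<in> \<OO>" "b \<noteq> 0" by (simp_all add: X_def)
  next
    fix a assume "a \<in> \<OO>" "a \<noteq> 0" "norm_Kbar (\<iota> a) \<le> M"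
    then have "a \<in> X" by (simp add: X_def)
    then show "\<exists>b\<in>?A. a / b \<in> unitgroup" using unit by blast
  qed
qed

text \<open>A lattice point of the box \<open>\<bar>x\<^sub>i\<bar> \<le> C exp (h\<^sub>i / 2)\<close> has bounded norm, hence is a unit up to finitely many factors.\<close>

lemma units_log_cocompact:
  "\<exists>R. \<forall>h::real^'s. (\<Sum>i\<in>UNIV. h $ i) = 0 \<longrightarrow> (\<exists>u\<in>unitgroup. \<forall>i. \<bar>ln ((cmod (\<sigma> i u))\<^sup>2) - h $ i\<bar> \<le> R)"
proof -
  obtain C0 where C0: "\<And>x :: real ^ 's. (\<And>i. x $ i > 0) \<Longrightarrow> (\<Prod>i\<in>UNIV. x $ i) = 1 \<Longrightarrow>
    \<exists>a\<in>\<OO>. a \<noteq> 0 \<and> (\<forall>i. x $ i * cmod (\<sigma> i a) \<le> C0)" by (rule small_integer) blast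
  define C where "C = max 1 C0"
  have C: "C \<ge> 1" by (simp add: C_def)
  define M where "M = (C\<^sup>2) ^ CARD('s)"
  have C2: "C\<^sup>2 \<ge> 1" using C by simp
  have M: "M \<ge> 1" "M \<ge> C\<^sup>2" unfolding M_def using C2 self_le_power[OF C2, of "CARD('s)"] by (auto intro: one_le_power)
  from finite_norm_modulo_units[of M] obtain A where A: "finite A" "\<forall>b\<in>A. b \<in> \<OO> \<and> b \<noteq> 0"
    "\<forall>a\<in>\<OO>. a \<noteq> 0 \<longrightarrow> norm_Kbar (\<iota> a) \<le> M \<longrightarrow> (\<exists>b\<in>A. a / b \<in> unitgroup)"
    by (elim exE conjE)
  define R where "R = ln M + (\<Sum>b\<in>A. \<Sum>i\<in>UNIV. \<bar>ln ((cmod (\<sigma> i b))\<^sup>2)\<bar>)"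
  have "\<exists>u\<in>unitgroup. \<forall>i. \<bar>ln ((cmod (\<sigma> i u))\<^sup>2) - h $ i\<bar> \<le> R" if h: "(\<Sum>i\<in>UNIV. h $ i) = 0" for h :: "real ^ 's"
  proof -
    \<comment> \<open>With this \<open>x\<close>, the logarithm of \<open>y i\<close> below is
      exactly the deviation of the squared absolute value of \<open>a\<close> from
      \<open>h $ i\<close>. The \<open>y i\<close> are bounded above and have product at least 1, so
      they are bounded below as well.\<close>
    define x :: "real ^ 's" where "x = (\<chi> i. exp (- h $ i / 2))"
    have "(\<Prod>i\<in>UNIV. x $ i) = exp (\<Sum>i\<in>UNIV. - h $ i / 2)" by (simp add: x_def exp_sum)
    also have "(\<Sum>i\<in>UNIV. - h $ i / 2) = - (\<Sum>i\<in>UNIV. h $ i) / 2" by (simp add: sum_negf sum_divide_distrib)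
    finally have x1: "(\<Prod>i\<in>UNIV. x $ i) = 1" using h by simp
    obtain a where a: "a \<in> \<OO>" "a \<noteq> 0" "\<And>i. x $ i * cmod (\<sigma> i a) \<le> C0" using C0[of x] x1 by (auto simp: x_def)
    have aK: "a \<in> K" by (rule ring_of_integersD(1)[OF a(1)])
    define y where "y i = (x $ i * cmod (\<sigma> i a))\<^sup>2" for i
    have ypos: "y i > 0" for i unfolding y_def using a(2) aK by (simp add: x_def S.emb_eq_0_iff)
    have yC: "y i \<le> C\<^sup>2" for i unfolding y_def using a(3)[of i]
      by (intro power_mono) (auto simp: C_def x_def)
    have "(\<Prod>i\<in>UNIV. y i) = (\<Prod>i\<in>UNIV. x $ i)\<^sup>2 * norm_Kbar (\<iota> a)"
      by (simp add: y_def norm_Kbar_def power_mult_distrib prod.distrib prod_power_distrib)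
    then have yn: "(\<Prod>i\<in>UNIV. y i) = norm_Kbar (\<iota> a)" by (simp add: x1)
    have "norm_Kbar (\<iota> a) \<le> (\<Prod>i\<in>(UNIV :: 's set). C\<^sup>2)"
      unfolding yn[symmetric] using ypos yC by (intro prod_mono) (auto intro: less_imp_le)
    then have "norm_Kbar (\<iota> a) \<le> M" by (simp add: M_def)
    then obtain b where b: "b \<in> A" "a / b \<in> unitgroup" using A(3) a(1,2) by blast
    have bO: "b \<in> \<OO>" "b \<noteq> 0" and bK: "b \<in> K" using A(2) b(1) ring_of_integersD(1) by blast+
    have "\<bar>ln ((cmod (\<sigma> i (a / b)))\<^sup>2) - h $ i\<bar> \<le> R" for i
    proof -
      have "1 \<le> y i * (\<Prod>j\<in>UNIV - {i}. y j)"
        using norm_ge_1[OF a(1,2)] yn by (simp add: prod.remove[of UNIV i])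
      also have "(\<Prod>j\<in>UNIV - {i}. y j) \<le> (\<Prod>j\<in>UNIV - {i}. C\<^sup>2)"
        using ypos yC by (intro prod_mono) (auto intro: less_imp_le)
      then have "y i * (\<Prod>j\<in>UNIV - {i}. y j) \<le> y i * (C\<^sup>2) ^ (CARD('s) - 1)"
        using ypos[of i] by (intro mult_left_mono) auto
      also have "\<dots> \<le> y i * M" unfolding M_def using ypos[of i] C2
        by (intro mult_left_mono power_increasing) auto
      finally have "1 \<le> y i * M" .
      then have "ln 1 \<le> ln (y i * M)" by (subst ln_le_cancel_iff) (use ypos M(1) in auto)
      then have "- ln M \<le> ln (y i)" using ypos[of i] M(1) by (simp add: ln_mult)
      moreover have "ln (y i) \<le> ln M" using ypos[of i] yC[of i] M by simp
      moreover have "ln (y i) = ln ((cmod (\<sigma> i a))\<^sup>2) - h $ i"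
        using a(2) aK by (simp add: y_def x_def power_mult_distrib ln_mult S.emb_eq_0_iff ln_realpow)
      ultimately have 1: "\<bar>ln ((cmod (\<sigma> i a))\<^sup>2) - h $ i\<bar> \<le> ln M" by linarith
      have 2: "ln ((cmod (\<sigma> i (a / b)))\<^sup>2) = ln ((cmod (\<sigma> i a))\<^sup>2) - ln ((cmod (\<sigma> i b))\<^sup>2)"
        using aK bK a(2) bO(2) by (simp add: S.emb_divide norm_divide power_divide ln_div S.emb_eq_0_iff)
      have "\<bar>ln ((cmod (\<sigma> i b))\<^sup>2)\<bar> \<le> (\<Sum>i\<in>UNIV. \<bar>ln ((cmod (\<sigma> i b))\<^sup>2)\<bar>)"
        by (rule member_le_sum) auto
      also have "\<dots> \<le> (\<Sum>b\<in>A. \<Sum>i\<in>UNIV. \<bar>ln ((cmod (\<sigma> i b))\<^sup>2)\<bar>)"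
        by (rule member_le_sum[OF b(1)]) (auto intro: sum_nonneg A(1))
      finally show ?thesis using 1 2 by (simp add: R_def)
    qed
    then show ?thesis using b(2) by blast
  qed
  then show ?thesis by blast
qed

lemma unit_log_sum: "u \<in> unitgroup \<Longrightarrow> (\<Sum>i\<in>UNIV. ln ((cmod (\<sigma> i u))\<^sup>2)) = 0"
  using norm_unit[of u] unitsD(2,3)[of u] S.emb_eq_0_iff[of u]
  by (simp add: norm_Kbar_def flip: ln_prod)

lemma finite_bounded_units: "finite {u \<in> unitgroup. \<forall>i. ln ((cmod (\<sigma> i u))\<^sup>2) \<le> r}"
proof -
  let ?U = "{u \<in> unitgroup. \<forall>i. ln ((cmod (\<sigma> i u))\<^sup>2) \<le> r}"
  define c where "c = sqrt (exp r)"
  have "cmod (\<sigma> i u) \<le> c" if u: "u \<in> ?U" for u i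
  proof -
    have "cmod (\<sigma> i u) > 0" using u unitsD(2,3) S.emb_eq_0_iff by auto
    then have "(cmod (\<sigma> i u))\<^sup>2 = exp (ln ((cmod (\<sigma> i u))\<^sup>2))" by simp
    also have "\<dots> \<le> exp r" using u by auto
    finally show ?thesis unfolding c_def by (rule real_le_rsqrt)
  qed
  then have "norm (\<iota> u) \<le> (\<Sum>i\<in>(UNIV::'s set). c)" if "u \<in> ?U" for u
    using that unfolding norm_vec_def by (intro order_trans[OF L2_set_le_sum] sum_mono) auto
  then have "\<iota> ` ?U \<subseteq> {a \<in> \<Lambda>. norm a \<le> (\<Sum>i\<in>(UNIV::'s set). c)}" using unitsD(1) by blast
  then have "finite (\<iota> ` ?U)" using finite_subset L.finite_bounded0 by blast
  moreover have "inj_on \<iota> ?U" using \<iota>_eq_iff unitsD(2) by (auto simp: inj_on_def)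
  ultimately show ?thesis using finite_imageD by blast
qed

text \<open>The upper bound in the unit theorem: with at most three places the logarithms of units
  lie in a space of dimension at most 2. At least \<open>(N + 1) ^ 3\<close> products of powers of
  independent units would fall into a number of cells quadratic in \<open>N\<close>, each with
  boundedly many units.\<close>

lemma card_ge_4:
  assumes "unit_rank K \<ge> 3"
  shows "CARD('s) \<ge> 4"
proof (rule ccontr)
  assume small: "\<not> ?thesis"
  have "\<exists>B. finite B \<and> B \<subseteq> unitgroup \<and> mult_independent B \<and> card B \<ge> 3"
  proof (rule ccontr)
    assume none: "\<not> ?thesis"
    have "unit_rank K \<le> enat 2" unfolding unit_rank_def
    proof (rule SUP_least)
      fix B assume "B \<in> {B. finite B \<and> B \<subseteq> unitgroup \<and> mult_independent B}"
      then have "\<not> card B \<ge> 3" using none by blast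
      then show "enat (card B) \<le> enat 2" by simp
    qed
    then have "(3::enat) \<le> enat 2" using assms by (rule order_trans[rotated])
    then show False by (simp add: numeral_eq_enat)
  qed
  then obtain B where B: "finite B" "B \<subseteq> unitgroup" "mult_independent B" "card B \<ge> 3" by blast
  define lg where "lg i u = ln ((cmod (\<sigma> i u))\<^sup>2)" for i u
  have lg_mult: "lg i (u * w) = lg i u + lg i w" if "u \<in> unitgroup" "w \<in> unitgroup" for i u w
    using unitsD(2,3)[OF that(1)] unitsD(2,3)[OF that(2)]
    by (simp add: lg_def S.emb_mult norm_mult power_mult_distrib ln_mult S.emb_eq_0_iff)
  have lg_1: "lg i 1 = 0" for i by (simp add: lg_def)
  have lg_power: "lg i (u ^ n) = real n * lg i u" if u: "u \<in> unitgroup" for i u n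
    by (induction n) (auto simp: lg_1 lg_mult u units_power algebra_simps)
  have lg_prod: "lg i (prod f C) = (\<Sum>b\<in>C. lg i (f b))" if "\<And>b. b \<in> C \<Longrightarrow> f b \<in> unitgroup" for i f and C :: "'a set"
    using that by (induction C rule: infinite_finite_induct) (auto simp: lg_1 lg_mult units_prod)
  have lg_divide: "lg i (u * inverse w) = lg i u - lg i w" if "u \<in> unitgroup" "w \<in> unitgroup" for i u w
    using lg_mult[OF that(1) unitsD(4)[OF that(2)], of i] lg_mult[OF that(2) unitsD(4)[OF that(2)], of i]
      lg_1[of i] unitsD(3)[OF that(2)] by simp
  define V where "V = nat \<lceil>\<Sum>b\<in>B. \<Sum>i\<in>UNIV. \<bar>lg i b\<bar>\<rceil>"
  obtain i0 :: 's where True by blast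
  let ?I = "UNIV - {i0}"
  have I: "card ?I \<le> 2" using small by simp
  let ?F = "{u \<in> unitgroup. \<forall>i. lg i u \<le> 2}"
  have F: "finite ?F" using finite_bounded_units[of 2] by (simp add: lg_def)
  \<comment> \<open>With this choice at most \<open>N * (N + 1)\<^sup>2\<close> products fit into
    the cells, fewer than the \<open>(N + 1) ^ 3\<close> available.\<close>
  define N where "N = card ?F * (2 * V + 1)\<^sup>2"
  let ?A = "B \<rightarrow>\<^sub>E {..N}"
  let ?C = "?I \<rightarrow>\<^sub>E {..2 * V * N}"
  define w where "w m = (\<Prod>b\<in>B. b ^ m b)" for m :: "'a \<Rightarrow> nat"
  have wu: "w m \<in> unitgroup" for m unfolding w_def using B(2) by (intro units_prod units_power) auto
  have wlg: "\<bar>lg i (w m)\<bar> \<le> real (V * N)" if m: "m \<in> ?A" for i m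
  proof -
    have "lg i (w m) = (\<Sum>b\<in>B. real (m b) * lg i b)"
      unfolding w_def using B(2) by (subst lg_prod) (auto simp: units_power lg_power subset_iff)
    then have "\<bar>lg i (w m)\<bar> \<le> (\<Sum>b\<in>B. \<bar>real (m b) * lg i b\<bar>)" by simp
    also have "\<dots> \<le> (\<Sum>b\<in>B. real N * \<bar>lg i b\<bar>)"
    proof (rule sum_mono)
      fix b assume "b \<in> B"
      then have "m b \<le> N" using PiE_mem[OF m] by blast
      then show "\<bar>real (m b) * lg i b\<bar> \<le> real N * \<bar>lg i b\<bar>" by (simp add: abs_mult mult_right_mono)
    qed
    also have "\<dots> \<le> (\<Sum>b\<in>B. real N * (\<Sum>i\<in>UNIV. \<bar>lg i b\<bar>))"
      by (intro sum_mono mult_left_mono member_le_sum) auto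
    also have "\<dots> = real N * (\<Sum>b\<in>B. \<Sum>i\<in>UNIV. \<bar>lg i b\<bar>)" by (simp only: sum_distrib_left)
    also have "\<dots> \<le> real N * real V" unfolding V_def by (intro mult_left_mono) linarith+
    finally show ?thesis by (simp add: mult.commute)
  qed
  have inj: "inj_on w ?A"
  proof (rule inj_onI)
    fix m m' assume m: "m \<in> ?A" "m' \<in> ?A" "w m = w m'"
    have "(\<Prod>b\<in>B. b powi (int (m b) - int (m' b))) = (\<Prod>b\<in>B. b ^ m b / b ^ m' b)"
      using B(2) unitsD(3) by (intro prod.cong refl) (auto simp: power_int_diff)
    also have "\<dots> = w m / w m'" by (simp add: w_def prod_dividef)
    also have "\<dots> = 1" using m(3) unitsD(3)[OF wu[of m']] by simp
    finally have "\<forall>b\<in>B. int (m b) - int (m' b) = 0"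
      using B(3)[unfolded mult_independent_def, rule_format, of "\<lambda>b. int (m b) - int (m' b)"] by blast
    then show "m = m'" using m(1,2) by (intro PiE_ext[of m B "\<lambda>_. {..N}"]) auto
  qed
  define cell where "cell m = restrict (\<lambda>i. nat \<lfloor>lg i (w m) + real (V * N)\<rfloor>) ?I" for m
  have "cell \<in> ?A \<rightarrow> ?C"
  proof
    fix m assume m: "m \<in> ?A"
    have "nat \<lfloor>lg i (w m) + real (V * N)\<rfloor> \<le> 2 * V * N" for i
      using wlg[OF m, of i] by linarith
    then show "cell m \<in> ?C" unfolding cell_def by auto
  qed
  moreover have "finite ?A" "finite ?C" using B(1) by (auto intro: finite_PiE)
  moreover have "?C \<noteq> {}" by (simp add: PiE_eq_empty_iff)
  ultimately obtain y where y: "y \<in> ?C" "card ?A \<le> card (cell -` {y} \<inter> ?A) * card ?C"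
    using pigeonhole_card by metis
  have "card (cell -` {y} \<inter> ?A) \<le> card ?F"
  proof (cases "cell -` {y} \<inter> ?A = {}")
    case False
    then obtain m0 where m0: "m0 \<in> ?A" "cell m0 = y" by blast
    let ?g = "\<lambda>m. w m * inverse (w m0)"
    show ?thesis
    proof (rule card_inj_on_le[of ?g])
      show "inj_on ?g (cell -` {y} \<inter> ?A)"
        using inj unitsD(3)[OF wu[of m0]] by (auto simp: inj_on_def)
      show "?g ` (cell -` {y} \<inter> ?A) \<subseteq> ?F"
      proof
        fix u assume "u \<in> ?g ` (cell -` {y} \<inter> ?A)"
        then obtain m where m: "m \<in> ?A" "cell m = y" "u = ?g m" by blast
        have u: "u \<in> unitgroup" unfolding m(3) by (intro units_mult wu unitsD(4))
        have 1: "\<bar>lg i u\<bar> \<le> 1" if i: "i \<noteq> i0" for i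
        proof -
          have "cell m i = cell m0 i" using m(2) m0(2) by simp
          then have "nat \<lfloor>lg i (w m) + real (V * N)\<rfloor> = nat \<lfloor>lg i (w m0) + real (V * N)\<rfloor>" using i by (simp add: cell_def)
          moreover have "lg i (w m) + real (V * N) \<ge> 0" "lg i (w m0) + real (V * N) \<ge> 0"
            using wlg[OF m(1), of i] wlg[OF m0(1), of i] by linarith+
          ultimately have "\<bar>lg i (w m) - lg i (w m0)\<bar> \<le> 1" by linarith
          then show ?thesis using lg_divide[OF wu wu, of i m m0] m(3) by simp
        qed
        \<comment> \<open>The cells ignore the place \<open>i0\<close>; there the logarithm is
          controlled by the vanishing of the sum.\<close>
        have "(\<Sum>i\<in>UNIV. lg i u) = 0" using unit_log_sum[OF u] by (simp add: lg_def)
        then have "lg i0 u = - (\<Sum>i\<in>?I. lg i u)" by (simp add: sum.remove[of UNIV i0])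
        also have "\<dots> \<le> (\<Sum>i\<in>?I. \<bar>lg i u\<bar>)" using sum_abs[of "\<lambda>i. lg i u" ?I] by linarith
        also have "\<dots> \<le> (\<Sum>i\<in>?I. 1)" using 1 by (intro sum_mono) auto
        also have "\<dots> \<le> 2" using I by simp
        finally have 2: "lg i0 u \<le> 2" .
        have "lg i u \<le> 2" for i using 1[of i] 2 by (cases "i = i0") auto
        then show "u \<in> ?F" using u by blast
      qed
      show "finite ?F" by (rule F)
    qed
  qed simp
  then have "card ?A \<le> card ?F * card ?C" using y(2) by (meson mult_le_mono1 order_trans)
  moreover have "card ?A = (N + 1) ^ card B" using B(1) by (simp add: card_PiE)
  moreover have "card ?C = (2 * V * N + 1) ^ card ?I" by (simp add: card_PiE)
  ultimately have "(N + 1) ^ card B \<le> card ?F * (2 * V * N + 1) ^ card ?I" by simp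
  moreover have "(N + 1) ^ 3 \<le> (N + 1) ^ card B" using B(4) by (intro power_increasing) auto
  moreover have "(2 * V * N + 1) ^ card ?I \<le> (2 * V * N + 1)\<^sup>2" using I by (intro power_increasing) auto
  moreover have "(2 * V * N + 1)\<^sup>2 \<le> ((2 * V + 1) * (N + 1))\<^sup>2" by (intro power_mono) auto
  ultimately have "(N + 1) ^ 3 \<le> card ?F * ((2 * V + 1) * (N + 1))\<^sup>2"
    by (meson mult_le_mono2 order_trans)
  moreover have "card ?F * ((2 * V + 1) * (N + 1))\<^sup>2 = N * (N + 1)\<^sup>2"
    unfolding N_def power_mult_distrib by (simp only: mult.assoc)
  moreover have "(N + 1) ^ 3 = (N + 1) * (N + 1)\<^sup>2" by (simp only: power3_eq_cube power2_eq_square mult.assoc)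
  ultimately show False by simp
qed

end


section \<open>CM fields\<close>

locale cm_number_field =
  fixes K :: "'a::field_char_0 set" and \<sigma> :: "'s::finite \<Rightarrow> 'a \<Rightarrow> complex"
  assumes cm: "CM_field K" and rank: "unit_rank K \<ge> 3" and representatives: "embedding_representatives K \<sigma>"

sublocale cm_number_field \<subseteq> complex_number_field K \<sigma>
  by unfold_locales (use cm representatives in \<open>auto simp: CM_field_def\<close>)

context cm_number_field
begin

text \<open>For \<open>x\<close> outside the totally real subfield, 1 and \<open>x\<close> span K
  over it, so \<open>x\<close> satisfies a quadratic equation over that subfield. The second root
  \<open>q - x\<close> is the conjugate of \<open>x\<close> at all places simultaneously.\<close>

lemma conjugate_exists:
  assumes x: "x \<in> K"
  shows "\<exists>y\<in>K. \<forall>i. \<sigma> i y = cnj (\<sigma> i x)"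
proof -
  obtain F B where F: "number_field F" "totally_real F" "F \<subseteq> K" "field_basis F K B" "card B = 2"
    using cm by (auto simp: CM_field_def)
  have Fs: "subfield_set F" using F(1) by (simp add: number_field_def)
  have "complex_embedding F (\<sigma> i)" for i
    using embedding_\<sigma>[of i] F(3) unfolding complex_embedding_def by blast
  then have real: "\<sigma> i a \<in> \<real>" if "a \<in> F" for i a using F(2) that unfolding totally_real_def by blast
  show ?thesis
  proof (cases "x \<in> F")
    case True
    then show ?thesis using x real[of x] by (intro bexI[of _ x]) (auto simp: Reals_cnj_iff)
  next
    case False
    obtain b1 b2 where b: "B = {b1, b2}" "b1 \<noteq> b2" using F(5) by (auto simp: card_2_iff)
    have expand: "\<exists>p\<in>F. \<exists>q\<in>F. z = p * b1 + q * b2" if z: "z \<in> K" for z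
    proof -
      obtain c where "c \<in> B \<rightarrow>\<^sub>E F" "z = (\<Sum>b\<in>B. c b * b)" using F(4) z unfolding field_basis_def by blast
      then have "c b1 \<in> F" "c b2 \<in> F" "z = c b1 * b1 + c b2 * b2" using b by auto
      then show ?thesis by blast
    qed
    obtain \<alpha>1 \<alpha>2 where \<alpha>: "\<alpha>1 \<in> F" "\<alpha>2 \<in> F" "1 = \<alpha>1 * b1 + \<alpha>2 * b2" using expand[OF subfield_setD(2)[OF subfield_K]] by blast
    obtain \<beta>1 \<beta>2 where \<beta>: "\<beta>1 \<in> F" "\<beta>2 \<in> F" "x = \<beta>1 * b1 + \<beta>2 * b2" using expand[OF x] by blast
    \<comment> \<open>The determinant of the coordinates of 1 and \<open>x\<close> with respect to
      \<open>b1\<close> and \<open>b2\<close>.\<close>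
    define \<Delta> where "\<Delta> = \<alpha>1 * \<beta>2 - \<alpha>2 * \<beta>1"
    have \<Delta>F: "\<Delta> \<in> F" unfolding \<Delta>_def by (intro subfield_setD Fs \<alpha> \<beta>)
    have e: "\<Delta> * b2 = \<alpha>1 * x - \<beta>1" "\<Delta> * b1 = \<beta>2 - \<alpha>2 * x"
    proof -
      have "\<alpha>1 * x - \<beta>1 * 1 = \<Delta> * b2" unfolding \<beta>(3) \<alpha>(3) by (simp add: \<Delta>_def algebra_simps)
      moreover have "\<beta>2 * 1 - \<alpha>2 * x = \<Delta> * b1" unfolding \<beta>(3) \<alpha>(3) by (simp add: \<Delta>_def algebra_simps)
      ultimately show "\<Delta> * b2 = \<alpha>1 * x - \<beta>1" "\<Delta> * b1 = \<beta>2 - \<alpha>2 * x" by simp_all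
    qed
    have "\<Delta> \<noteq> 0"
    proof
      assume "\<Delta> = 0"
      then have "\<alpha>1 * x = \<beta>1" "\<alpha>2 * x = \<beta>2" using e by simp_all
      moreover have "\<alpha>1 \<noteq> 0 \<or> \<alpha>2 \<noteq> 0" using \<alpha>(3) by auto
      ultimately have "x = \<beta>1 / \<alpha>1 \<or> x = \<beta>2 / \<alpha>2" by (auto simp: field_simps)
      then show False using False subfield_setD(8)[OF Fs] \<alpha> \<beta> by blast
    qed
    have expand': "\<exists>p\<in>F. \<exists>q\<in>F. z = p + q * x" if z: "z \<in> K" for z
    proof -
      obtain p q where pq: "p \<in> F" "q \<in> F" "z = p * b1 + q * b2" using expand[OF z] by blast
      have "\<Delta> * z = p * (\<Delta> * b1) + q * (\<Delta> * b2)" by (simp add: pq(3) algebra_simps)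
      also have "\<dots> = (p * \<beta>2 - q * \<beta>1) + (q * \<alpha>1 - p * \<alpha>2) * x" unfolding e by (simp add: algebra_simps)
      finally have "z = (p * \<beta>2 - q * \<beta>1) / \<Delta> + ((q * \<alpha>1 - p * \<alpha>2) / \<Delta>) * x"
        using \<open>\<Delta> \<noteq> 0\<close> nonzero_mult_div_cancel_left[of \<Delta> z] by (simp add: add_divide_distrib)
      moreover have "(p * \<beta>2 - q * \<beta>1) / \<Delta> \<in> F" "(q * \<alpha>1 - p * \<alpha>2) / \<Delta> \<in> F"
        by (intro subfield_setD Fs pq \<alpha> \<beta> \<Delta>F)+
      ultimately show ?thesis by blast
    qed
    have nonreal: "\<sigma> i x \<notin> \<real>" for i
    proof
      assume "\<sigma> i x \<in> \<real>"
      have "\<sigma> i z \<in> \<real>" if z: "z \<in> K" for z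
      proof -
        obtain p q where pq: "p \<in> F" "q \<in> F" "z = p + q * x" using expand'[OF z] by blast
        have "\<sigma> i z = \<sigma> i p + \<sigma> i q * \<sigma> i x"
          unfolding pq(3) using pq(1,2) F(3) x subfield_K
          by (subst S.emb_add S.emb_mult; auto intro: subfield_setD)+
        then show ?thesis using real pq(1,2) \<open>\<sigma> i x \<in> \<real>\<close> by simp
      qed
      then show False using tc embedding_\<sigma>[of i] unfolding totally_complex_def by blast
    qed
    have "x * x \<in> K" using x subfield_K by (intro subfield_setD)
    then obtain p q where pq: "p \<in> F" "q \<in> F" "x * x = p + q * x" using expand' by blast
    have K: "p \<in> K" "q \<in> K" using pq F(3) by auto
    text \<open>\<open>\<sigma>\<^sub>i x\<close> is a nonreal root of a real quadratic polynomial, so its conjugate is the other root.\<close>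
    have "\<sigma> i (q - x) = cnj (\<sigma> i x)" for i
    proof -
      let ?z = "\<sigma> i x"
      have "\<sigma> i (x * x) = \<sigma> i (p + q * x)" using pq(3) by simp
      then have z: "?z * ?z = \<sigma> i p + \<sigma> i q * ?z"
        using K x subfield_K by (simp add: S.emb_add S.emb_mult subfield_setD)
      have "cnj ?z * cnj ?z = \<sigma> i p + \<sigma> i q * cnj ?z"
        using arg_cong[OF z, of cnj] real[OF pq(1), of i] real[OF pq(2), of i] by (simp add: Reals_cnj_iff)
      then have "(?z - cnj ?z) * (?z + cnj ?z - \<sigma> i q) = 0" using z by (simp add: algebra_simps)
      moreover have "?z \<noteq> cnj ?z" using nonreal[of i] by (auto simp: Reals_cnj_iff)
      ultimately have "?z + cnj ?z - \<sigma> i q = 0" by simp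
      then have "\<sigma> i q - ?z = cnj ?z" by (simp add: algebra_simps)
      then show ?thesis using K x by (simp add: S.emb_diff)
    qed
    moreover have "q - x \<in> K" using K x subfield_K by (intro subfield_setD)
    ultimately show ?thesis by blast
  qed
qed

definition conjugate :: "'a \<Rightarrow> 'a" where
  "conjugate x = (SOME y. y \<in> K \<and> (\<forall>i. \<sigma> i y = cnj (\<sigma> i x)))"

lemma conjugate: "x \<in> K \<Longrightarrow> conjugate x \<in> K" "x \<in> K \<Longrightarrow> \<sigma> i (conjugate x) = cnj (\<sigma> i x)"
proof -
  assume "x \<in> K"
  then have "\<exists>y. y \<in> K \<and> (\<forall>i. \<sigma> i y = cnj (\<sigma> i x))" using conjugate_exists by blast
  from someI_ex[OF this] show "conjugate x \<in> K" "\<sigma> i (conjugate x) = cnj (\<sigma> i x)" by (auto simp: conjugate_def)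
qed

lemma conjugate_integer: "x \<in> \<OO> \<Longrightarrow> conjugate x \<in> \<OO>"
  using conjugate[of x] S.algebraic_int_emb[of "conjugate x" undefined] S.algebraic_int_emb[of x undefined]
  by (auto simp: ring_of_integers_def)

definition \<Gamma> :: "(real ^ 's) set" where
  "\<Gamma> = (\<lambda>a. \<chi> i. (cmod (\<sigma> i a))\<^sup>2) ` unitgroup"

lemma \<Gamma>E:
  assumes "u \<in> \<Gamma>"
  obtains a where "a \<in> unitgroup" "\<And>i. u $ i = (cmod (\<sigma> i a))\<^sup>2" "cvec u = \<iota> (a * conjugate a)"
proof -
  obtain a where a: "a \<in> unitgroup" "u = (\<chi> i. (cmod (\<sigma> i a))\<^sup>2)" using assms by (auto simp: \<Gamma>_def)
  note K = unitsD(2)[OF a(1)]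
  have "cvec u = \<iota> (a * conjugate a)"
    using conjugate[OF K] K by (simp add: vec_eq_iff a(2) S.emb_mult complex_norm_square del: of_real_power)
  then show ?thesis using that a by simp
qed

lemma unit_group_\<Gamma>: "unit_group \<Gamma>"
proof
  show "1 \<in> \<Gamma>" unfolding \<Gamma>_def by (rule image_eqI[OF _ units_1]) (simp add: vec_eq_iff)
next
  fix u w assume "u \<in> \<Gamma>" "w \<in> \<Gamma>"
  then obtain a b where ab: "a \<in> unitgroup" "\<And>i. u $ i = (cmod (\<sigma> i a))\<^sup>2" "b \<in> unitgroup" "\<And>i. w $ i = (cmod (\<sigma> i b))\<^sup>2"
    by (auto elim!: \<Gamma>E)
  show "u * w \<in> \<Gamma>" unfolding \<Gamma>_def
    using unitsD(2)[OF ab(1)] unitsD(2)[OF ab(3)]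
    by (intro image_eqI[OF _ units_mult[OF ab(1,3)]]) (simp add: vec_eq_iff ab S.emb_mult norm_mult power_mult_distrib)
next
  fix u assume "u \<in> \<Gamma>"
  then obtain a where a: "a \<in> unitgroup" "\<And>i. u $ i = (cmod (\<sigma> i a))\<^sup>2" by (auto elim!: \<Gamma>E)
  show "vinv u \<in> \<Gamma>" unfolding \<Gamma>_def
    using unitsD(2)[OF a(1)]
    by (intro image_eqI[OF _ unitsD(4)[OF a(1)]]) (simp add: vec_eq_iff a S.emb_inverse norm_inverse power_inverse)
  show "u $ i > 0" for i using a unitsD(2,3)[OF a(1)] by (simp add: S.emb_eq_0_iff)
  show "(\<Prod>i\<in>UNIV. u $ i) = 1" using norm_unit[OF a(1)] by (simp add: a(2) norm_Kbar_def)
next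
  \<comment> \<open>The vector is the image of the element \<open>a * conjugate a\<close> of K,
    which is determined by its value under a single embedding.\<close>
  fix u i assume u: "u \<in> \<Gamma>" "u $ i = 1"
  then obtain a where a: "a \<in> unitgroup" "cvec u = \<iota> (a * conjugate a)" by (auto elim!: \<Gamma>E)
  have K: "a * conjugate a \<in> K" using conjugate unitsD(2)[OF a(1)] subfield_K by (intro subfield_setD)
  have "\<sigma> i (a * conjugate a) = \<sigma> i 1" using arg_cong[OF a(2), of "\<lambda>x. x $ i"] u(2) by simp
  then have "a * conjugate a = 1" using S.emb_eq_iff[OF K subfield_setD(2)[OF subfield_K]] by blast
  then have "cvec u = cvec 1" using a(2) by (simp add: vec_eq_iff)
  then show "u = 1" by (simp add: vec_eq_iff)
next
  show "\<exists>R. \<forall>h::real^'s. (\<Sum>i\<in>UNIV. h $ i) = 0 \<longrightarrow> (\<exists>u\<in>\<Gamma>. \<forall>i. \<bar>ln (u $ i) - h $ i\<bar> \<le> R)"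
    using units_log_cocompact by (simp add: \<Gamma>_def)
  show "CARD('s) \<ge> 4" by (rule card_ge_4[OF rank])
qed

sublocale cm_lattice \<Gamma> \<Lambda>
proof -
  interpret \<Gamma>: unit_group \<Gamma> by (rule unit_group_\<Gamma>)
  have act: "cvec u * a \<in> \<Lambda>" if "u \<in> \<Gamma>" "a \<in> \<Lambda>" for u a
  proof -
    obtain e where e: "e \<in> unitgroup" "cvec u = \<iota> (e * conjugate e)" using \<open>u \<in> \<Gamma>\<close> by (auto elim!: \<Gamma>E)
    obtain x where x: "x \<in> \<OO>" "a = \<iota> x" using \<open>a \<in> \<Lambda>\<close> by blast
    have "e * conjugate e \<in> \<OO>" using \<OO>_closed(5) unitsD(1)[OF e(1)] conjugate_integer by blast
    then have *: "e * conjugate e * x \<in> \<OO>" "e * conjugate e \<in> K" using x \<OO>_closed(5) ring_of_integersD(1) by blast+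
    have "cvec u * a = \<iota> (e * conjugate e * x)"
      unfolding e(2) x(2) by (rule \<iota>_mult[symmetric]) (use *(2) x(1) ring_of_integersD(1) in blast)+
    then show ?thesis using *(1) by (simp only: imageI)
  qed
  have re: "L.torsion (frame v (reco v a) 0)" if "a \<in> \<Lambda>" "v \<in> \<Lambda>" "v \<noteq> 0" for a v
  proof -
    obtain x where x: "x \<in> \<OO>" "a = \<iota> x" using \<open>a \<in> \<Lambda>\<close> by blast
    obtain y where y: "y \<in> \<OO>" "v = \<iota> y" using \<open>v \<in> \<Lambda>\<close> by blast
    have K: "x \<in> K" "y \<in> K" "y \<noteq> 0" using x y \<open>v \<noteq> 0\<close> ring_of_integersD(1) by auto
    let ?q = "x / y"
    have qK: "?q \<in> K" using K subfield_K by (intro subfield_setD)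
    \<comment> \<open>\<open>y\<close> times the real part of \<open>x / y\<close>, expressed by the
      conjugate so that it is visibly an element of K.\<close>
    let ?w = "y * (?q + conjugate ?q) / of_nat 2"
    have wK: "y * (?q + conjugate ?q) \<in> K" "?q + conjugate ?q \<in> K" "of_nat 2 \<in> K"
      using K qK conjugate(1)[OF qK] subfield_K by (auto intro!: subfield_setD subfield_set_of_nat simp del: of_nat_numeral)
    have "frame v (reco v a) 0 $ i = \<sigma> i ?w" for i
    proof -
      have "\<sigma> i ?w = \<sigma> i y * (\<sigma> i ?q + cnj (\<sigma> i ?q)) / of_nat 2"
        using K wK qK conjugate[OF qK]
        by (simp only: S.emb_divide[OF wK(1,3)] S.emb_mult S.emb_add S.emb_of_nat)
      also have "\<sigma> i ?q + cnj (\<sigma> i ?q) = complex_of_real (2 * Re (\<sigma> i x / \<sigma> i y))"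
        using K by (simp only: complex_add_cnj S.emb_divide)
      finally show ?thesis by (simp add: x(2) y(2) complex_eq_iff)
    qed
    then have "frame v (reco v a) 0 = \<iota> ?w" by (simp add: vec_eq_iff)
    moreover have "?w \<in> K" by (rule subfield_setD(8)[OF subfield_K wK(1,3)])
    ultimately show ?thesis using torsion_iff by blast
  qed
  show "cm_lattice \<Gamma> \<Lambda>" by unfold_locales (rule act re; assumption)+
qed

section \<open>The torus\<close>

definition coset :: "complex ^ 's \<Rightarrow> (complex ^ 's) set" where
  "coset x = (\<lambda>a. x + a) ` \<Lambda>"

lemma lattice_rel_Image: "lattice_rel K \<sigma> `` {x} = coset x"
proof (intro equalityI subsetI)
  fix y assume "y \<in> lattice_rel K \<sigma> `` {x}"
  then have "x - y \<in> \<Lambda>" by (simp add: lattice_rel_def)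
  then have "y - x \<in> \<Lambda>" using L.uminus[of "x - y"] by simp
  then show "y \<in> coset x" unfolding coset_def by (rule image_eqI[rotated]) simp
next
  fix y assume "y \<in> coset x"
  then obtain a where a: "a \<in> \<Lambda>" "y = x + a" by (auto simp: coset_def)
  then have "x - y \<in> \<Lambda>" using L.uminus[of a] by simp
  then show "y \<in> lattice_rel K \<sigma> `` {x}" by (simp add: lattice_rel_def)
qed

lemma quotient_coset: "X // lattice_rel K \<sigma> = coset ` X"
  unfolding Equiv_Relations.quotient_def lattice_rel_Image by blast

lemma coset_self: "x \<in> coset x"
  unfolding coset_def by (rule image_eqI[OF _ L.zero]) simp

lemma coset_eq_iff: "coset x = coset y \<longleftrightarrow> x - y \<in> \<Lambda>"
proof
  assume "coset x = coset y"
  then have "x \<in> coset y" using coset_self by blast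
  then show "x - y \<in> \<Lambda>" by (auto simp: coset_def)
next
  assume xy: "x - y \<in> \<Lambda>"
  have "coset x \<subseteq> coset y" if "x - y \<in> \<Lambda>" for x y
  proof
    fix z assume "z \<in> coset x"
    then obtain a where "a \<in> \<Lambda>" "z = x + a" by (auto simp: coset_def)
    then show "z \<in> coset y" unfolding coset_def
      using L.add[OF that, of a] by (intro image_eqI[of _ _ "x - y + a"]) auto
  qed
  moreover have "y - x \<in> \<Lambda>" using L.uminus[OF xy] by simp
  ultimately show "coset x = coset y" using xy by blast
qed

lemma torus_coset: "torus K \<sigma> = range coset"
  by (simp add: torus_def quotient_coset)

lemma rational_coset: "rational_points K \<sigma> = coset ` {x. L.torsion x}"
  by (simp add: rational_points_def quotient_coset torsion_iff)

lemma coset_rational_iff: "coset x \<in> rational_points K \<sigma> \<longleftrightarrow> L.torsion x"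
proof
  assume "coset x \<in> rational_points K \<sigma>"
  then obtain y where y: "L.torsion y" "x - y \<in> \<Lambda>" by (auto simp: rational_coset coset_eq_iff)
  then have "L.torsion (y + (x - y))" using L.torsion_add L.torsion_lattice by blast
  then show "L.torsion x" by simp
qed (auto simp: rational_coset)

lemma euclidean_min_coset: "euclidean_min (coset x) = emin x"
  by (simp add: euclidean_min_def coset_def emin_def image_image norm_Kbar_nonneg)

text \<open>The preimage of the subtorus consists of the points whose transversal coordinates lie in
  the discrete group \<open>quotient v\<close>, hence it is closed.\<close>

lemma flatset_affine_subtorus:
  assumes v: "v \<in> \<Lambda>" "v \<noteq> 0"
  shows "affine_subtorus K \<sigma> CARD('s) (coset ` flatset v r)"
proof -
  let ?f = "\<lambda>p. frame v p 0"
  let ?W = "range ?f"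
  have nz: "v $ k \<noteq> 0" for k using coordinate_nonzero[OF v] .
  have lin: "linear ?f" by (rule linearI) (simp_all add: frame_add frame_scaleR)
  have inj: "inj ?f"
  proof (rule injI)
    fix p q assume "frame v p 0 = frame v q 0"
    then have "reco v (frame v p 0) = reco v (frame v q 0)" by simp
    then show "p = q" by (simp only: reco_frame[OF nz])
  qed
  have "subspace ?W" by (rule linear_subspace_image[OF lin subspace_UNIV])
  moreover have "dim ?W = CARD('s)" using dim_image_eq[OF lin, of UNIV] inj by simp
  moreover have "closed (\<Union>(?W // lattice_rel K \<sigma>))"
  proof -
    have "\<Union>(?W // lattice_rel K \<sigma>) = imco v -` quotient v"
    proof (intro equalityI subsetI)
      fix x assume "x \<in> \<Union>(?W // lattice_rel K \<sigma>)"
      then obtain p a where "x = frame v p 0 + a" "a \<in> \<Lambda>" by (auto simp: quotient_coset coset_def)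
      then show "x \<in> imco v -` quotient v" using nz by (simp add: imco_add quotient_def)
    next
      fix x assume "x \<in> imco v -` quotient v"
      then obtain a where a: "a \<in> \<Lambda>" "imco v x = imco v a" by (auto simp: quotient_def)
      have "x - a = frame v (reco v (x - a)) (imco v (x - a))" using frame_coordinates[OF nz] by simp
      also have "imco v (x - a) = 0" using a(2) by (simp add: imco_diff)
      finally have "x = frame v (reco v (x - a)) 0 + a" by (simp add: algebra_simps)
      then show "x \<in> \<Union>(?W // lattice_rel K \<sigma>)" using a(1) unfolding quotient_coset coset_def by blast
    qed
    moreover interpret q: unit_lattice \<Gamma> "quotient v" by (rule quotient_lattice[OF v])
    have "continuous_on UNIV (imco v)"
      by (intro linear_continuous_on linear_linear[THEN iffD2] linearI) (simp_all add: imco_add imco_scaleR)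
    ultimately show ?thesis using q.closed by (simp add: continuous_on_closed_vimage)
  qed
  ultimately have "subtorus K \<sigma> CARD('s) (?W // lattice_rel K \<sigma>)" unfolding subtorus_def by blast
  moreover have "coset ` flatset v r = (\<lambda>z. (+) r ` z) ` (?W // lattice_rel K \<sigma>)"
  proof -
    have shift: "(+) r ` coset x = coset (r + x)" for x by (simp add: coset_def image_image add.assoc)
    have "coset ` flatset v r = (\<lambda>p. coset (r + frame v p 0)) ` UNIV"
    proof (intro equalityI subsetI)
      fix z assume "z \<in> coset ` flatset v r"
      then obtain p a where "a \<in> \<Lambda>" "z = coset (r + frame v p 0 + a)" by (auto simp: flatset_def)
      then have "z = coset (r + frame v p 0)" by (simp add: coset_eq_iff)
      then show "z \<in> (\<lambda>p. coset (r + frame v p 0)) ` UNIV" by blast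
    next
      fix z assume "z \<in> (\<lambda>p. coset (r + frame v p 0)) ` UNIV"
      then obtain p where "z = coset (r + frame v p 0)" by blast
      moreover have "r + frame v p 0 \<in> flatset v r"
        unfolding flatset_def using L.zero by (force intro: exI[of _ p] exI[of _ 0])
      ultimately show "z \<in> coset ` flatset v r" by blast
    qed
    then show ?thesis by (simp add: quotient_coset image_image shift)
  qed
  ultimately show ?thesis unfolding affine_subtorus_def by blast
qed

end

theorem theorem4p9:
  fixes K :: "'a::field_char_0 set"
    and \<sigma> :: "'s::finite \<Rightarrow> 'a \<Rightarrow> complex"
  assumes "CM_field K"
    and "unit_rank K \<ge> 3"
    and "embedding_representatives K \<sigma>"
  shows "inhomogeneous_spectrum K \<sigma> = euclidean_spectrum K \<sigma> \<and>
    countable (euclidean_spectrum K \<sigma>) \<and>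
    euclidean_spectrum K \<sigma> \<subseteq> \<rat> \<and>
    (\<exists>(S :: nat \<Rightarrow> real set) (\<nu> :: nat \<Rightarrow> real) (\<mu> :: nat \<Rightarrow> nat \<Rightarrow> real).
      euclidean_spectrum K \<sigma> = {0} \<union> (\<Union>n\<in>{1..}. S n) \<and>
      (\<forall>n\<ge>1. 0 \<notin> S n) \<and>
      disjoint_family_on S {1..} \<and>
      (\<forall>n\<ge>1. S n = {\<nu> n} \<union> \<mu> n ` {1..}) \<and>
      (\<forall>n\<ge>1. \<forall>k\<ge>1. \<mu> n k > \<mu> n (Suc k)) \<and>
      (\<forall>n\<ge>1. \<mu> n \<longlonglongrightarrow> \<nu> n) \<and>
      \<nu> \<longlonglongrightarrow> 0 \<and>
      (\<forall>n\<ge>1. \<nu> n > \<mu> (Suc n) 1) \<and>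
      (\<forall>n\<ge>1. \<forall>k\<ge>1.
        finite {z \<in> torus K \<sigma>. euclidean_min z = \<mu> n k} \<and>
        {z \<in> torus K \<sigma>. euclidean_min z = \<mu> n k} \<subseteq> rational_points K \<sigma>) \<and>
      (\<forall>n\<ge>1.
        finite {z \<in> rational_points K \<sigma>. euclidean_min z = \<nu> n} \<and>
        {z \<in> rational_points K \<sigma>. euclidean_min z = \<nu> n} \<noteq> {} \<and>
        (\<exists>\<T>. finite \<T> \<and>
          (\<forall>T\<in>\<T>. affine_subtorus K \<sigma> (field_degree \<rat> K div 2) T) \<and>
          {z \<in> irrational_points K \<sigma>. euclidean_min z = \<nu> n} = \<Union>\<T> \<inter> irrational_points K \<sigma>)))"
  proof -
  interpret cm_number_field K \<sigma> using assms by unfold_locales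
  have degree: "field_degree \<rat> K div 2 = CARD('s)" by (simp add: degree_K)
  have inhomogeneous: "inhomogeneous_spectrum K \<sigma> = range emin"
    by (simp add: inhomogeneous_spectrum_def torus_coset image_image euclidean_min_coset)
  have "euclidean_spectrum K \<sigma> = emin ` {x. L.torsion x}"
    by (simp add: euclidean_spectrum_def rational_coset image_image euclidean_min_coset)
  also have "\<dots> = range emin"
  proof (intro equalityI subsetI)
    fix t assume "t \<in> range emin"
    then obtain x where x: "t = emin x" by blast
    obtain y where "L.torsion y" "emin y = emin x" using emin_torsion_values[of x] by blast
    then show "t \<in> emin ` {x. L.torsion x}" unfolding x by (intro image_eqI[of _ _ y]) simp_all
  qed blast
  finally have euclidean: "euclidean_spectrum K \<sigma> = range emin" .
  \<comment> \<open>Every value is taken at a torsion point, where the infimum is attained; so it is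
    the norm of an element of K.\<close>
  have rational: "range emin \<subseteq> \<rat>"
  proof
    fix t assume "t \<in> range emin"
    then obtain w where w: "t = emin w" by blast
    obtain x where x: "L.torsion x" "emin x = t" unfolding w using emin_torsion_values[of w] by blast
    obtain a where a: "a \<in> \<Lambda>" "emin x = norm_Kbar (x + a)" using emin_attained[OF x(1)] by blast
    have "L.torsion (x + a)" using L.torsion_add[OF x(1) L.torsion_lattice[OF a(1)]] .
    then obtain y where "y \<in> K" "x + a = \<iota> y" using torsion_iff by blast
    then show "t \<in> \<rat>" using norm_rational a(2) x(2) by metis
  qed
  have "countable (range emin)" using rational countable_rat by (rule countable_subset)
  moreover obtain S \<nu> \<mu> where S: "range emin = {0} \<union> (\<Union>n\<in>{1..}. S n)"
    "\<forall>n\<ge>1. 0 \<notin> S n" "disjoint_family_on S {1..}" "\<forall>n\<ge>1. S n = {\<nu> n} \<union> \<mu> n ` {1..}"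
    "\<forall>n\<ge>1. \<forall>k\<ge>1. \<mu> n k > \<mu> n (Suc k)" "\<forall>n\<ge>1. \<mu> n \<longlonglongrightarrow> \<nu> n" "\<nu> \<longlonglongrightarrow> 0" "\<forall>n\<ge>1. \<nu> n > \<mu> (Suc n) 1"
    and \<mu>: "\<forall>n\<ge>1. \<forall>k\<ge>1. \<exists>F. finite F \<and> (\<forall>x. emin x = \<mu> n k \<longrightarrow> L.torsion x \<and> (\<exists>y\<in>F. x - y \<in> \<Lambda>))"
    and \<nu>: "\<forall>n\<ge>1. (\<exists>F. finite F \<and> (\<forall>x. L.torsion x \<longrightarrow> emin x = \<nu> n \<longrightarrow> (\<exists>y\<in>F. x - y \<in> \<Lambda>))) \<and>
        (\<exists>x. L.torsion x \<and> emin x = \<nu> n) \<and>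
        (\<exists>\<S>. finite \<S> \<and> \<S> \<subseteq> flats \<and> (\<forall>x. \<not> L.torsion x \<longrightarrow> (emin x = \<nu> n \<longleftrightarrow> x \<in> \<Union>\<S>)))"
    using spectrum_structure by (elim exE conjE)
  have "finite {z \<in> torus K \<sigma>. euclidean_min z = \<mu> n k} \<and>
      {z \<in> torus K \<sigma>. euclidean_min z = \<mu> n k} \<subseteq> rational_points K \<sigma>" if nk: "n \<ge> 1" "k \<ge> 1" for n k
  proof -
    from \<mu>[rule_format, OF nk] obtain F where F: "finite F"
      "\<forall>x. emin x = \<mu> n k \<longrightarrow> L.torsion x \<and> (\<exists>y\<in>F. x - y \<in> \<Lambda>)" by (elim exE conjE)
    have "z \<in> coset ` F \<and> z \<in> rational_points K \<sigma>" if z: "z \<in> torus K \<sigma>" "euclidean_min z = \<mu> n k" for z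
    proof -
      obtain x where x: "z = coset x" using z(1) by (auto simp: torus_coset)
      then have "emin x = \<mu> n k" using z(2) by (simp add: euclidean_min_coset)
      then obtain y where "L.torsion x" "y \<in> F" "coset x = coset y" using F(2) coset_eq_iff by blast
      then show ?thesis using x coset_rational_iff by blast
    qed
    then have sub: "{z \<in> torus K \<sigma>. euclidean_min z = \<mu> n k} \<subseteq> coset ` F"
      "{z \<in> torus K \<sigma>. euclidean_min z = \<mu> n k} \<subseteq> rational_points K \<sigma>" by blast+
    show ?thesis using finite_subset[OF sub(1) finite_imageI[OF F(1)]] sub(2) by (rule conjI)
  qed
  moreover have "finite {z \<in> rational_points K \<sigma>. euclidean_min z = \<nu> n} \<and>
      {z \<in> rational_points K \<sigma>. euclidean_min z = \<nu> n} \<noteq> {} \<and>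
      (\<exists>\<T>. finite \<T> \<and> (\<forall>T\<in>\<T>. affine_subtorus K \<sigma> (field_degree \<rat> K div 2) T) \<and>
        {z \<in> irrational_points K \<sigma>. euclidean_min z = \<nu> n} = \<Union>\<T> \<inter> irrational_points K \<sigma>)" if n: "n \<ge> 1" for n
  proof -
    from \<nu>[rule_format, OF n] obtain F x0 \<S> where F: "finite F"
      "\<forall>x. L.torsion x \<longrightarrow> emin x = \<nu> n \<longrightarrow> (\<exists>y\<in>F. x - y \<in> \<Lambda>)"
      and x0: "L.torsion x0" "emin x0 = \<nu> n"
      and \<S>: "finite \<S>" "\<S> \<subseteq> flats" "\<forall>x. \<not> L.torsion x \<longrightarrow> (emin x = \<nu> n \<longleftrightarrow> x \<in> \<Union>\<S>)"
      by (elim exE conjE)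
    have "z \<in> coset ` F" if z: "z \<in> rational_points K \<sigma>" "euclidean_min z = \<nu> n" for z
    proof -
      obtain x where x: "z = coset x" "L.torsion x" using z(1) by (auto simp: rational_coset)
      then have "emin x = \<nu> n" using z(2) by (simp add: euclidean_min_coset)
      then obtain y where "y \<in> F" "coset x = coset y" using F(2) x(2) coset_eq_iff by blast
      then show ?thesis using x(1) by blast
    qed
    then have "{z \<in> rational_points K \<sigma>. euclidean_min z = \<nu> n} \<subseteq> coset ` F" by blast
    then have 1: "finite {z \<in> rational_points K \<sigma>. euclidean_min z = \<nu> n}"
      by (rule finite_subset) (rule finite_imageI[OF F(1)])
    have "coset x0 \<in> {z \<in> rational_points K \<sigma>. euclidean_min z = \<nu> n}"
      using x0 by (simp add: coset_rational_iff euclidean_min_coset)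
    then have 2: "{z \<in> rational_points K \<sigma>. euclidean_min z = \<nu> n} \<noteq> {}" by blast
    let ?\<T> = "(\<lambda>X. coset ` X) ` \<S>"
    have irr: "z \<in> irrational_points K \<sigma> \<longleftrightarrow> (\<exists>x. z = coset x \<and> \<not> L.torsion x)" for z
      unfolding irrational_points_def torus_coset using coset_rational_iff by blast
    have tori: "\<forall>T\<in>?\<T>. affine_subtorus K \<sigma> (field_degree \<rat> K div 2) T"
      using \<S>(2) flatset_affine_subtorus unfolding flats_def degree by blast
    \<comment> \<open>Flats contain all lattice translates of their points, so a coset belongs to
      the image of a flat exactly if its points lie on the flat.\<close>
    have mem: "coset x \<in> \<Union>?\<T> \<longleftrightarrow> x \<in> \<Union>\<S>" for x
    proof
      assume "coset x \<in> \<Union>?\<T>"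
      then obtain X y where X: "X \<in> \<S>" "y \<in> X" "x - y \<in> \<Lambda>" by (auto simp: coset_eq_iff)
      then obtain v r where "X = flatset v r" using \<S>(2) by (auto simp: flats_def)
      then obtain p a where "a \<in> \<Lambda>" "y = r + frame v p 0 + a" "X = flatset v r" using X(2) by (auto simp: flatset_def)
      moreover from this have "x = r + frame v p 0 + (a + (x - y))" by simp
      moreover have "a + (x - y) \<in> \<Lambda>" using L.add \<open>a \<in> \<Lambda>\<close> X(3) by blast
      ultimately have "x \<in> X" unfolding flatset_def by blast
      then show "x \<in> \<Union>\<S>" using X(1) by blast
    qed blast
    have "{z \<in> irrational_points K \<sigma>. euclidean_min z = \<nu> n} = \<Union>?\<T> \<inter> irrational_points K \<sigma>"
    proof (intro equalityI subsetI)
      fix z assume "z \<in> {z \<in> irrational_points K \<sigma>. euclidean_min z = \<nu> n}"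
      then obtain x where "z = coset x" "\<not> L.torsion x" "emin x = \<nu> n" by (auto simp: irr euclidean_min_coset)
      then show "z \<in> \<Union>?\<T> \<inter> irrational_points K \<sigma>" using \<S>(3) mem irr by blast
    next
      fix z assume z: "z \<in> \<Union>?\<T> \<inter> irrational_points K \<sigma>"
      then obtain x where x: "z = coset x" "\<not> L.torsion x" using irr by blast
      then have "emin x = \<nu> n" using z \<S>(3) mem by blast
      then show "z \<in> {z \<in> irrational_points K \<sigma>. euclidean_min z = \<nu> n}" using z x by (simp add: euclidean_min_coset)
    qed
    then show ?thesis using 1 2 tori \<S>(1) by (intro conjI exI[of _ ?\<T>]) simp_all
  qed
  ultimately show ?thesis
    unfolding inhomogeneous euclidean using rational S
    by (intro conjI exI[of _ S] exI[of _ \<nu>] exI[of _ \<mu>] refl allI impI) simp_all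
qed

end
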